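(* Let $k$ be a field, let $R$ be a $k$-algebra and noetherian domain, and let $$A = R[x_1;\tau_1,\delta_1]\cdots[x_n;\tau_n,\delta_n],$$ where each $\tau_i$ is a $k$-linear automorphism of $R\langle x_1,\dots,x_{i-1}\rangle$ such that $\tau_i(x_j)=\lambda_{ij}x_j$ for all $i,j$ with $1\le j<i\le n$ and some $\lambda_{ij}\in k^\times$, and where each $\delta_i$ is a $k$-linear $\tau_i$-derivation. Assume that there exist elements $q_i\in k^\times$ with $q_i\neq 1$ such that $\delta_i\tau_i=q_i\tau_i\delta_i$, and that $\delta_i$ extends to a locally nilpotent, iterative higher $q_i$-skew $\tau_i$-derivation on $R\langle x_1,\dots,x_{i-1}\rangle$, for $i=1,\dots,n$. (1) Then there exists an Ore set $T\subseteq A$ generated by $n$ elements of $A$ such that $$AT^{-1}\cong R[y_1^{\pm1};\tau_1][y_2^{\pm1};\tau_2']\cdots[y_n^{\pm1};\tau_n'],$$ where $\tau_i'|_R=\tau_i$ (that is, $\tau_i'$ agrees with $\tau_i$ on $R$) and $\tau_i'(y_j)=\lambda_{ij}y_j$ for all $i,j$ with $1\le j<i\le n$. (2) There is PI degree parity between $A$ and $R[y_1;\tau_1][y_2;\tau_2']\cdots[y_n;\tau_n']$. Moreover, these algebras have isomorphic division rings of fractions.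
   Context: Conventions: $k$ is a field of arbitrary characteristic; rings are unital and associative. In a skew polynomial ring $R[x;\tau,\delta]$, $R$ is a $k$-algebra, $\tau$ is a $k$-algebra automorphism of $R$, $\delta$ is a $k$-linear $\tau$-derivation ($\delta(rs)=\tau(r)\delta(s)+\delta(r)s$), and $xr=\tau(r)x+\delta(r)$; $R[x;\tau]$ means $\delta=0$, and $R[x^{\pm1};\tau]$ is the skew Laurent ring. $R\langle x_1,\dots,x_{i-1}\rangle$ denotes the subalgebra $R[x_1;\tau_1,\delta_1]\cdots[x_{i-1};\tau_{i-1},\delta_{i-1}]$ of $A$ (equal to $R$ if $i=1$). An Ore set generated by given elements means generated by them as a multiplicative set. For an indeterminate $t$: $(m)_t=t^{m-1}+\cdots+t+1$, $(m)!_t=(m)_t\cdots(1)_t$, $(0)!_t=1$, $\binom{n}{m}_t=\frac{(n)!_t}{(m)!_t(n-m)!_t}$ (a polynomial in $t$), and $\binom{n}{m}_q$ is its value at $t=q$. A higher $q$-skew $\tau$-derivation on a $k$-algebra $R$ is a sequence $d_0,d_1,d_2,\dots$ of $k$-linear operators on $R$ with $d_0=\mathrm{id}$, $d_n(rs)=\sum_{i=0}^n\tau^{n-i}d_i(r)\,d_{n-i}(s)$ for all $r,s\in R$ and all $n$, and $d_i\tau=q^i\tau d_i$ for all $i$. It is locally nilpotent if for all $r\in R$ there exists an integer $n\ge0$ such that $d_i(r)=0$ for all $i\ge n$, and $d_p(r)\ne0$ for $p<n$. It is iterative if $d_id_j=\binom{i+j}{j}_qd_{i+j}$ for all $i,j$.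 A $\tau$-derivation $\delta$ with $\delta\tau=q\tau\delta$ extends to a higher $q$-skew $\tau$-derivation if there is such a sequence $\{d_i\}$ with $d_1=\delta$. Two rings exhibit PI degree parity when: one is a PI ring if and only if the other is, and their PI degrees are equal.
   Formalization: The formal theorem additionally assumes that each automorphism τ_i maps R into R; without this the conclusion that τ_i' agrees with τ_i on R is not defined (e.g. R=k[a], τ_2(a)=a+x_1, all δ_i=0). *)

theory Defs
  imports "HOL-Algebra.Subrings" "HOL-Algebra.Module" "HOL-Computational_Algebra.Polynomial"
begin

section \<open>Algebras over a field\<close>

text \<open>The library locale \<open>algebra\<close> demands that the algebra be commutative.\<close>

locale nc_algebra = K?: field K + A?: ring A + module K A
  for K :: "('k, 'm) ring_scheme" (structure) and A :: "('k, 'a, 'n) module_scheme" (structure) +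
  assumes smult_mult_left:
      "\<lbrakk>a \<in> carrier K; x \<in> carrier A; y \<in> carrier A\<rbrakk>
        \<Longrightarrow> (a \<odot>\<^bsub>A\<^esub> x) \<otimes>\<^bsub>A\<^esub> y = a \<odot>\<^bsub>A\<^esub> (x \<otimes>\<^bsub>A\<^esub> y)"
    and smult_mult_right:
      "\<lbrakk>a \<in> carrier K; x \<in> carrier A; y \<in> carrier A\<rbrakk>
        \<Longrightarrow> x \<otimes>\<^bsub>A\<^esub> (a \<odot>\<^bsub>A\<^esub> y) = a \<odot>\<^bsub>A\<^esub> (x \<otimes>\<^bsub>A\<^esub> y)"

definition subalg :: "('k, 'm) ring_scheme \<Rightarrow> ('k, 'a, 'n) module_scheme \<Rightarrow> 'a set \<Rightarrow> bool" where
  "subalg K A S \<longleftrightarrow> subring S A \<and> (\<forall>a\<in>carrier K. \<forall>s\<in>S. a \<odot>\<^bsub>A\<^esub> s \<in> S)"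

definition klinear ::
  "('k, 'm) ring_scheme \<Rightarrow> ('k, 'a, 'n) module_scheme \<Rightarrow> ('k, 'b, 'p) module_scheme \<Rightarrow> ('a \<Rightarrow> 'b) \<Rightarrow> bool"
  where
  "klinear K A B f \<longleftrightarrow>
     f \<in> carrier A \<rightarrow> carrier B \<and>
     (\<forall>x\<in>carrier A. \<forall>y\<in>carrier A. f (x \<oplus>\<^bsub>A\<^esub> y) = f x \<oplus>\<^bsub>B\<^esub> f y) \<and>
     (\<forall>a\<in>carrier K. \<forall>x\<in>carrier A. f (a \<odot>\<^bsub>A\<^esub> x) = a \<odot>\<^bsub>B\<^esub> f x)"

definition alg_hom ::
  "('k, 'm) ring_scheme \<Rightarrow> ('k, 'a, 'n) module_scheme \<Rightarrow> ('k, 'b, 'p) module_scheme \<Rightarrow> ('a \<Rightarrow> 'b) set"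
  where "alg_hom K A B = {f. f \<in> ring_hom A B \<and> klinear K A B f}"

definition alg_iso ::
  "('k, 'm) ring_scheme \<Rightarrow> ('k, 'a, 'n) module_scheme \<Rightarrow> ('k, 'b, 'p) module_scheme \<Rightarrow> ('a \<Rightarrow> 'b) set"
  where "alg_iso K A B = {f. f \<in> ring_iso A B \<and> klinear K A B f}"


section \<open>Noetherian domains and division rings, not necessarily commutative\<close>

text \<open>The library locales \<open>domain\<close> (commutative) and \<open>noetherian_ring\<close> (two-sided ideals only)
  do not apply.  Noetherian means left and right noetherian.\<close>

definition nc_domain :: "('a, 'm) ring_scheme \<Rightarrow> bool" where
  "nc_domain R \<longleftrightarrow> ring R \<and> \<one>\<^bsub>R\<^esub> \<noteq> \<zero>\<^bsub>R\<^esub> \<and>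
     (\<forall>a\<in>carrier R. \<forall>b\<in>carrier R. a \<otimes>\<^bsub>R\<^esub> b = \<zero>\<^bsub>R\<^esub> \<longrightarrow> a = \<zero>\<^bsub>R\<^esub> \<or> b = \<zero>\<^bsub>R\<^esub>)"

definition left_ideal :: "'a set \<Rightarrow> ('a, 'm) ring_scheme \<Rightarrow> bool" where
  "left_ideal I R \<longleftrightarrow> additive_subgroup I R \<and> (\<forall>r\<in>carrier R. \<forall>a\<in>I. r \<otimes>\<^bsub>R\<^esub> a \<in> I)"

definition right_ideal :: "'a set \<Rightarrow> ('a, 'm) ring_scheme \<Rightarrow> bool" where
  "right_ideal I R \<longleftrightarrow> additive_subgroup I R \<and> (\<forall>r\<in>carrier R. \<forall>a\<in>I. a \<otimes>\<^bsub>R\<^esub> r \<in> I)"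

definition nc_noetherian :: "('a, 'm) ring_scheme \<Rightarrow> bool" where
  "nc_noetherian R \<longleftrightarrow> ring R \<and>
     (\<forall>I. left_ideal I R \<longrightarrow>
        (\<exists>F \<subseteq> carrier R. finite F \<and> I = \<Inter>{J. left_ideal J R \<and> F \<subseteq> J})) \<and>
     (\<forall>I. right_ideal I R \<longrightarrow>
        (\<exists>F \<subseteq> carrier R. finite F \<and> I = \<Inter>{J. right_ideal J R \<and> F \<subseteq> J}))"

definition division_ring :: "('a, 'm) ring_scheme \<Rightarrow> bool" where
  "division_ring R \<longleftrightarrow> ring R \<and> \<one>\<^bsub>R\<^esub> \<noteq> \<zero>\<^bsub>R\<^esub> \<and> Units R = carrier R - {\<zero>\<^bsub>R\<^esub>}"


section \<open>Skew polynomial and skew Laurent rings\<close>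

definition skew_derivation ::
  "('k, 'm) ring_scheme \<Rightarrow> ('k, 'a, 'n) module_scheme \<Rightarrow> ('a \<Rightarrow> 'a) \<Rightarrow> ('a \<Rightarrow> 'a) \<Rightarrow> bool" where
  "skew_derivation K R \<tau> \<delta> \<longleftrightarrow> klinear K R R \<delta> \<and>
     (\<forall>r\<in>carrier R. \<forall>s\<in>carrier R. \<delta> (r \<otimes>\<^bsub>R\<^esub> s) = \<tau> r \<otimes>\<^bsub>R\<^esub> \<delta> s \<oplus>\<^bsub>R\<^esub> \<delta> r \<otimes>\<^bsub>R\<^esub> s)"

text \<open>\<open>A = S[x;\<tau>,\<delta>]\<close>, in the internal form: \<open>A\<close> contains \<open>S\<close> and \<open>x\<close>, satisfies the commutation
  rule, and is a free left \<open>S\<close>-module with basis \<open>1, x, x^2, \<dots>\<close>.  Only the values of \<open>\<tau>\<close> and \<open>\<delta>\<close>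
  on \<open>S\<close> matter.\<close>

definition skew_polynomial_ring ::
  "('k, 'm) ring_scheme \<Rightarrow> ('k, 'a, 'n) module_scheme \<Rightarrow> 'a set \<Rightarrow> 'a \<Rightarrow>
     ('a \<Rightarrow> 'a) \<Rightarrow> ('a \<Rightarrow> 'a) \<Rightarrow> bool" where
  "skew_polynomial_ring K A S x \<tau> \<delta> \<longleftrightarrow>
     nc_algebra K A \<and> subalg K A S \<and>
     \<tau> \<in> alg_iso K (A\<lparr>carrier := S\<rparr>) (A\<lparr>carrier := S\<rparr>) \<and>
     skew_derivation K (A\<lparr>carrier := S\<rparr>) \<tau> \<delta> \<and>
     x \<in> carrier A \<and>
     (\<forall>r\<in>S. x \<otimes>\<^bsub>A\<^esub> r = \<tau> r \<otimes>\<^bsub>A\<^esub> x \<oplus>\<^bsub>A\<^esub> \<delta> r) \<and>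
     (\<forall>a\<in>carrier A. \<exists>!c :: nat \<Rightarrow> 'a.
        (\<forall>i. c i \<in> S) \<and> finite {i. c i \<noteq> \<zero>\<^bsub>A\<^esub>} \<and>
        a = (\<Oplus>\<^bsub>A\<^esub> i \<in> {i. c i \<noteq> \<zero>\<^bsub>A\<^esub>}. c i \<otimes>\<^bsub>A\<^esub> (x [^]\<^bsub>A\<^esub> i)))"

definition skew_laurent_ring ::
  "('k, 'm) ring_scheme \<Rightarrow> ('k, 'a, 'n) module_scheme \<Rightarrow> 'a set \<Rightarrow> 'a \<Rightarrow> ('a \<Rightarrow> 'a) \<Rightarrow> bool" where
  "skew_laurent_ring K A S x \<tau> \<longleftrightarrow>
     nc_algebra K A \<and> subalg K A S \<and>
     \<tau> \<in> alg_iso K (A\<lparr>carrier := S\<rparr>) (A\<lparr>carrier := S\<rparr>) \<and>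
     x \<in> Units A \<and>
     (\<forall>r\<in>S. x \<otimes>\<^bsub>A\<^esub> r = \<tau> r \<otimes>\<^bsub>A\<^esub> x) \<and>
     (\<forall>a\<in>carrier A. \<exists>!c :: int \<Rightarrow> 'a.
        (\<forall>i. c i \<in> S) \<and> finite {i. c i \<noteq> \<zero>\<^bsub>A\<^esub>} \<and>
        a = (\<Oplus>\<^bsub>A\<^esub> i \<in> {i. c i \<noteq> \<zero>\<^bsub>A\<^esub>}. c i \<otimes>\<^bsub>A\<^esub> (x [^]\<^bsub>A\<^esub> i)))"

text \<open>\<open>A = R[x\<^sub>1;\<tau>\<^sub>1,\<delta>\<^sub>1]\<cdots>[x\<^sub>n;\<tau>\<^sub>n,\<delta>\<^sub>n]\<close> with \<open>S i = R\<langle>x\<^sub>1,\<dots>,x\<^sub>i\<rangle>\<close>; in particular the base ring is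
  \<open>R = S 0\<close>.  The sets \<open>S i\<close> are determined by \<open>S 0\<close> and the \<open>x\<^sub>i\<close>.  The index \<open>0\<close> of \<open>x\<close>, \<open>\<tau>\<close>
  and \<open>\<delta>\<close> is unused.\<close>

definition iterated_skew_polynomial_ring ::
  "('k, 'm) ring_scheme \<Rightarrow> ('k, 'a, 'n) module_scheme \<Rightarrow> (nat \<Rightarrow> 'a set) \<Rightarrow> nat \<Rightarrow> (nat \<Rightarrow> 'a) \<Rightarrow>
     (nat \<Rightarrow> 'a \<Rightarrow> 'a) \<Rightarrow> (nat \<Rightarrow> 'a \<Rightarrow> 'a) \<Rightarrow> bool" where
  "iterated_skew_polynomial_ring K A S n x \<tau> \<delta> \<longleftrightarrow>
     nc_algebra K A \<and> subalg K A (S 0) \<and> S n = carrier A \<and>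
     (\<forall>i\<in>{1..n}. skew_polynomial_ring K (A\<lparr>carrier := S i\<rparr>) (S (i - 1)) (x i) (\<tau> i) (\<delta> i))"

definition iterated_skew_laurent_ring ::
  "('k, 'm) ring_scheme \<Rightarrow> ('k, 'a, 'n) module_scheme \<Rightarrow> (nat \<Rightarrow> 'a set) \<Rightarrow> nat \<Rightarrow> (nat \<Rightarrow> 'a) \<Rightarrow>
     (nat \<Rightarrow> 'a \<Rightarrow> 'a) \<Rightarrow> bool" where
  "iterated_skew_laurent_ring K A S n y \<tau> \<longleftrightarrow>
     nc_algebra K A \<and> subalg K A (S 0) \<and> S n = carrier A \<and>
     (\<forall>i\<in>{1..n}. skew_laurent_ring K (A\<lparr>carrier := S i\<rparr>) (S (i - 1)) (y i) (\<tau> i))"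


section \<open>Higher q-skew derivations\<close>

definition qint :: "nat \<Rightarrow> int poly" where
  "qint m = (\<Sum>i<m. Polynomial.monom 1 i)"

definition qfact :: "nat \<Rightarrow> int poly" where
  "qfact m = (\<Prod>i\<in>{1..m}. qint i)"

text \<open>The division is exact (for \<open>m \<le> n\<close>).\<close>

definition qbinom :: "nat \<Rightarrow> nat \<Rightarrow> int poly" where
  "qbinom n m = qfact n div (qfact m * qfact (n - m))"

definition qbinom_at :: "('k, 'm) ring_scheme \<Rightarrow> nat \<Rightarrow> nat \<Rightarrow> 'k \<Rightarrow> 'k" where
  "qbinom_at K n m q =
     (\<Oplus>\<^bsub>K\<^esub> i \<in> {..Polynomial.degree (qbinom n m)}.
        [Polynomial.coeff (qbinom n m) i] \<cdot>\<^bsub>K\<^esub> (q [^]\<^bsub>K\<^esub> i))"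

definition higher_skew_derivation ::
  "('k, 'm) ring_scheme \<Rightarrow> ('k, 'a, 'n) module_scheme \<Rightarrow> 'k \<Rightarrow> ('a \<Rightarrow> 'a) \<Rightarrow> (nat \<Rightarrow> 'a \<Rightarrow> 'a) \<Rightarrow> bool"
  where
  "higher_skew_derivation K R q \<tau> d \<longleftrightarrow>
     (\<forall>i. klinear K R R (d i)) \<and>
     (\<forall>r\<in>carrier R. d 0 r = r) \<and>
     (\<forall>m. \<forall>r\<in>carrier R. \<forall>s\<in>carrier R.
        d m (r \<otimes>\<^bsub>R\<^esub> s) = (\<Oplus>\<^bsub>R\<^esub> i \<in> {..m}. (\<tau> ^^ (m - i)) (d i r) \<otimes>\<^bsub>R\<^esub> d (m - i) s)) \<and>
     (\<forall>i. \<forall>r\<in>carrier R. d i (\<tau> r) = (q [^]\<^bsub>K\<^esub> i) \<odot>\<^bsub>R\<^esub> \<tau> (d i r))"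

text \<open>The second conjunct is part of the notion: the components \<open>d\<^sub>0(r), d\<^sub>1(r), \<dots>\<close> are nonzero
  up to some point and zero from there on.\<close>

definition locally_nilpotent :: "('k, 'a, 'n) module_scheme \<Rightarrow> (nat \<Rightarrow> 'a \<Rightarrow> 'a) \<Rightarrow> bool" where
  "locally_nilpotent R d \<longleftrightarrow>
     (\<forall>r\<in>carrier R. \<exists>m::nat. (\<forall>i\<ge>m. d i r = \<zero>\<^bsub>R\<^esub>) \<and> (\<forall>p<m. d p r \<noteq> \<zero>\<^bsub>R\<^esub>))"

definition iterative ::
  "('k, 'm) ring_scheme \<Rightarrow> ('k, 'a, 'n) module_scheme \<Rightarrow> 'k \<Rightarrow> (nat \<Rightarrow> 'a \<Rightarrow> 'a) \<Rightarrow> bool" where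
  "iterative K R q d \<longleftrightarrow>
     (\<forall>i j. \<forall>r\<in>carrier R. d i (d j r) = qbinom_at K (i + j) j q \<odot>\<^bsub>R\<^esub> d (i + j) r)"


section \<open>Ore localization\<close>

definition mult_set_generated :: "('a, 'm) ring_scheme \<Rightarrow> 'a set \<Rightarrow> 'a set" where
  "mult_set_generated A G = \<Inter>{M. submonoid M A \<and> G \<subseteq> M}"

definition ore_set :: "('a, 'm) ring_scheme \<Rightarrow> 'a set \<Rightarrow> bool" where
  "ore_set A T \<longleftrightarrow> submonoid T A \<and>
     (\<forall>a\<in>carrier A. \<forall>t\<in>T. \<exists>b\<in>carrier A. \<exists>s\<in>T. a \<otimes>\<^bsub>A\<^esub> s = t \<otimes>\<^bsub>A\<^esub> b) \<and>
     (\<forall>a\<in>carrier A. \<forall>t\<in>T. \<exists>b\<in>carrier A. \<exists>s\<in>T. s \<otimes>\<^bsub>A\<^esub> a = b \<otimes>\<^bsub>A\<^esub> t)"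

text \<open>\<open>B\<close>, with the structure map \<open>\<phi>\<close>, is the ring of right fractions \<open>AT\<^sup>-\<^sup>1\<close>.\<close>

definition right_localization ::
  "('k, 'm) ring_scheme \<Rightarrow> ('k, 'a, 'n) module_scheme \<Rightarrow> 'a set \<Rightarrow> ('k, 'b, 'p) module_scheme \<Rightarrow>
     ('a \<Rightarrow> 'b) \<Rightarrow> bool" where
  "right_localization K A T B \<phi> \<longleftrightarrow>
     nc_algebra K A \<and> nc_algebra K B \<and> \<phi> \<in> alg_hom K A B \<and>
     (\<forall>t\<in>T. \<phi> t \<in> Units B) \<and>
     (\<forall>b\<in>carrier B. \<exists>a\<in>carrier A. \<exists>t\<in>T. b = \<phi> a \<otimes>\<^bsub>B\<^esub> inv\<^bsub>B\<^esub> (\<phi> t)) \<and>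
     (\<forall>a\<in>carrier A. \<phi> a = \<zero>\<^bsub>B\<^esub> \<longleftrightarrow> (\<exists>t\<in>T. a \<otimes>\<^bsub>A\<^esub> t = \<zero>\<^bsub>A\<^esub>))"

definition division_ring_of_fractions ::
  "('k, 'm) ring_scheme \<Rightarrow> ('k, 'a, 'n) module_scheme \<Rightarrow> ('k, 'b, 'p) module_scheme \<Rightarrow>
     ('a \<Rightarrow> 'b) \<Rightarrow> bool" where
  "division_ring_of_fractions K A Q \<phi> \<longleftrightarrow>
     division_ring Q \<and> ore_set A (carrier A - {\<zero>\<^bsub>A\<^esub>}) \<and>
     right_localization K A (carrier A - {\<zero>\<^bsub>A\<^esub>}) Q \<phi>"


section \<open>Polynomial identities\<close>

text \<open>A polynomial with integer coefficients in noncommuting indeterminates \<open>X\<^sub>0, X\<^sub>1, \<dots>\<close> is given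
  by its coefficient function on words (lists of indices).\<close>

definition word_value :: "('a, 'm) ring_scheme \<Rightarrow> (nat \<Rightarrow> 'a) \<Rightarrow> nat list \<Rightarrow> 'a" where
  "word_value R v w = foldr (\<lambda>i p. v i \<otimes>\<^bsub>R\<^esub> p) w \<one>\<^bsub>R\<^esub>"

text \<open>\<open>f\<close> is an identity of \<open>R\<close> of degree \<open>d\<close>, and monic: some monomial of the highest total
  degree \<open>d\<close> has coefficient \<open>1\<close>.\<close>

definition monic_identity :: "('a, 'm) ring_scheme \<Rightarrow> nat \<Rightarrow> (nat list \<Rightarrow> int) \<Rightarrow> bool" where
  "monic_identity R d f \<longleftrightarrow>
     finite {w. f w \<noteq> 0} \<and>
     (\<forall>w. f w \<noteq> 0 \<longrightarrow> length w \<le> d) \<and> (\<exists>w. length w = d \<and> f w = 1) \<and>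
     (\<forall>v. range v \<subseteq> carrier R \<longrightarrow>
        (\<Oplus>\<^bsub>R\<^esub> w \<in> {w. f w \<noteq> 0}. [f w] \<cdot>\<^bsub>R\<^esub> word_value R v w) = \<zero>\<^bsub>R\<^esub>)"

definition PI_ring :: "('a, 'm) ring_scheme \<Rightarrow> bool" where
  "PI_ring R \<longleftrightarrow> (\<exists>d f. monic_identity R d f)"

text \<open>The PI degree of a (prime) PI ring is half the minimal degree of a monic identity.\<close>

definition PI_degree :: "('a, 'm) ring_scheme \<Rightarrow> rat" where
  "PI_degree R = of_nat (LEAST d. \<exists>f. monic_identity R d f) / 2"

definition PI_degree_parity :: "('a, 'm) ring_scheme \<Rightarrow> ('b, 'p) ring_scheme \<Rightarrow> bool" where
  "PI_degree_parity R S \<longleftrightarrow>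
     (PI_ring R \<longleftrightarrow> PI_ring S) \<and> (PI_ring R \<longrightarrow> PI_degree R = PI_degree S)"

end

theory Submission
  imports Defs "HOL-Algebra.UnivPoly"
begin

text \<open>The derivations are deleted one variable at a time. Suppose that the subalgebra \<open>C\<close> generated by
  the first \<open>i\<close> variables is embedded by \<open>\<theta>\<close> into an iterated skew Laurent ring \<open>L\<close>, and let \<open>y\<close> be the
  variable of \<open>M = L[y\<^sup>\<plusminus>\<^sup>1;\<tau>]\<close>. With \<open>w = (1 - q)\<^sup>-\<^sup>1y\<^sup>-\<^sup>1\<close> the map \<open>g a = \<Sum>\<^sub>k w\<^sup>k \<theta> (d\<^sub>k a)\<close> is a homomorphism
  from \<open>C\<close> to \<open>M\<close> with \<open>y g(a) = g(\<tau> a) y + g(\<delta> a)\<close>, so it extends to an embedding of \<open>C[x;\<tau>,\<delta>]\<close> sending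
  \<open>x\<close> to \<open>y\<close>. Multiplying the old denominators by a power of \<open>y\<close> moves them into the image, which makes
  \<open>M\<close> a ring of fractions of \<open>C[x;\<tau>,\<delta>]\<close> with one more generating denominator.

  Ore's theorem then embeds \<open>L\<close>, and with it \<open>A\<close> and the skew polynomial ring inside \<open>L\<close>, into one
  division ring of fractions. A multilinear identity of a right Ore domain holds in its division ring of
  fractions: if it holds for all values \<open>at\<^sup>N\<close>, \<open>N \<ge> 0\<close>, of one variable, then also for \<open>at\<^sup>-\<^sup>1\<close>. So all these
  rings satisfy monic identities of the same degrees.\<close>

section \<open>Homomorphisms and subalgebras\<close>

text \<open>The obstacle is the passage to the next variable. Its automorphism is given on the
  polynomial side only, and it must extend to \<open>L\<close> compatibly with \<open>g\<close>. The
  induction therefore carries along every automorphism \<open>\<sigma>\<close> that preserves the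
  tower and scales the variables, and it needs
  \<open>\<sigma> d\<^sub>k = c\<^sup>k d\<^sub>k \<sigma>\<close> for all k. Applying
  \<open>\<sigma>\<close> to the commutation rule of the variable gives only k = 1. Iterativity
  reaches higher k by division by \<open>(k)\<^sub>q\<close>, which fails when q is a root of unity.
  There local nilpotence without gaps takes over: once some \<open>(k)\<^sub>q\<close> vanishes, all
  \<open>d\<^sub>k\<close> with k > 0 are zero.

  The factor \<open>(1 - q)\<^sup>-\<^sup>1\<close> in w is the solution u of
  \<open>u = u q\<^sup>k + (k)\<^sub>q\<close>. This is what equality of the coefficients of
  \<open>w\<^sup>k\<^sup>-\<^sup>1 \<theta> (d\<^sub>k a)\<close> in the relation for y g(a)
  demands, and one u serves all k because
  \<open>(1 - q) (k)\<^sub>q = 1 - q\<^sup>k\<close>.\<close>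

lemma nc_algebra_ring: "nc_algebra K A ==> ring A"
  by (simp add: nc_algebra_def)

lemma nc_algebra_module: "nc_algebra K A ==> module K A"
  by (simp add: nc_algebra_def)

lemma nc_algebraI:
  assumes "field K" "ring A"
    and "\<And>a x. [|a \<in> carrier K; x \<in> carrier A|] ==> a \<odot>\<^bsub>A\<^esub> x \<in> carrier A"
    and "\<And>a b x. [|a \<in> carrier K; b \<in> carrier K; x \<in> carrier A|] ==> (a \<oplus>\<^bsub>K\<^esub> b) \<odot>\<^bsub>A\<^esub> x = a \<odot>\<^bsub>A\<^esub> x \<oplus>\<^bsub>A\<^esub> b \<odot>\<^bsub>A\<^esub> x"
    and "\<And>a x y. [|a \<in> carrier K; x \<in> carrier A; y \<in> carrier A|] ==> a \<odot>\<^bsub>A\<^esub> (x \<oplus>\<^bsub>A\<^esub> y) = a \<odot>\<^bsub>A\<^esub> x \<oplus>\<^bsub>A\<^esub> a \<odot>\<^bsub>A\<^esub> y"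
    and "\<And>a b x. [|a \<in> carrier K; b \<in> carrier K; x \<in> carrier A|] ==> (a \<otimes>\<^bsub>K\<^esub> b) \<odot>\<^bsub>A\<^esub> x = a \<odot>\<^bsub>A\<^esub> (b \<odot>\<^bsub>A\<^esub> x)"
    and "\<And>x. x \<in> carrier A ==> \<one>\<^bsub>K\<^esub> \<odot>\<^bsub>A\<^esub> x = x"
    and "\<And>a x y. [|a \<in> carrier K; x \<in> carrier A; y \<in> carrier A|] ==> (a \<odot>\<^bsub>A\<^esub> x) \<otimes>\<^bsub>A\<^esub> y = a \<odot>\<^bsub>A\<^esub> (x \<otimes>\<^bsub>A\<^esub> y)"
    and "\<And>a x y. [|a \<in> carrier K; x \<in> carrier A; y \<in> carrier A|] ==> x \<otimes>\<^bsub>A\<^esub> (a \<odot>\<^bsub>A\<^esub> y) = a \<odot>\<^bsub>A\<^esub> (x \<otimes>\<^bsub>A\<^esub> y)"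
  shows "nc_algebra K A"
proof -
  interpret field K by fact
  interpret A: ring A by fact
  have "module K A"
    by (rule moduleI) (use assms is_cring A.is_abelian_group in auto)
  then show ?thesis
    by (intro nc_algebra.intro nc_algebra_axioms.intro) (use assms in auto)
qed

lemma subalgD:
  assumes "subalg K A S"
  shows "subring S A" "\<And>a s. a \<in> carrier K ==> s \<in> S ==> a \<odot>\<^bsub>A\<^esub> s \<in> S"
    "S \<subseteq> carrier A" "\<zero>\<^bsub>A\<^esub> \<in> S" "\<one>\<^bsub>A\<^esub> \<in> S" "\<And>h. h \<in> S ==> \<ominus>\<^bsub>A\<^esub> h \<in> S"
    "\<And>h1 h2. h1 \<in> S ==> h2 \<in> S ==> h1 \<otimes>\<^bsub>A\<^esub> h2 \<in> S"
    "\<And>h1 h2. h1 \<in> S ==> h2 \<in> S ==> h1 \<oplus>\<^bsub>A\<^esub> h2 \<in> S"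
  using assms subringE[of S A] unfolding subalg_def by auto

lemma subalg_nc_algebra:
  assumes "nc_algebra K A" "subalg K A S"
  shows "nc_algebra K (A\<lparr>carrier := S\<rparr>)"
proof -
  interpret nc_algebra K A by fact
  note S = subalgD[OF assms(2)]
  have sub: "s \<in> carrier A" if "s \<in> S" for s using that S(3) by blast
  show ?thesis
    by (rule nc_algebraI)
      (use S sub in \<open>auto simp: K.field_axioms A.subring_is_ring smult_l_distr smult_r_distr smult_assoc1
        smult_mult_left smult_mult_right\<close>)
qed

lemma subalg_carrier: "nc_algebra K A ==> subalg K A (carrier A)"
  unfolding subalg_def
  by (meson module.smult_closed nc_algebra_module nc_algebra_ring ring.carrier_is_subring)

lemma subring_sub:
  assumes "ring A" "subring S A" "T \<subseteq> S"
  shows "subring T (A\<lparr>carrier := S\<rparr>) \<longleftrightarrow> subring T A"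
proof -
  interpret ring A by fact
  interpret S: ring "A\<lparr>carrier := S\<rparr>" by (rule subring_is_ring) fact
  have "T \<subseteq> carrier A" using assms subringE(1) by blast
  then show ?thesis
    using S.subring_iff[of T] subring_iff[of T] assms(3) by auto
qed

lemma subalg_sub:
  assumes "nc_algebra K A" "subalg K A S" "T \<subseteq> S"
  shows "subalg K (A\<lparr>carrier := S\<rparr>) T \<longleftrightarrow> subalg K A T"
  using assms subring_sub[of A S T] nc_algebra_ring unfolding subalg_def by auto

lemma alg_homI:
  assumes "\<And>x. x \<in> carrier A ==> f x \<in> carrier B"
    "\<And>x y. [|x \<in> carrier A; y \<in> carrier A|] ==> f (x \<otimes>\<^bsub>A\<^esub> y) = f x \<otimes>\<^bsub>B\<^esub> f y"
    "\<And>x y. [|x \<in> carrier A; y \<in> carrier A|] ==> f (x \<oplus>\<^bsub>A\<^esub> y) = f x \<oplus>\<^bsub>B\<^esub> f y"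
    "f \<one>\<^bsub>A\<^esub> = \<one>\<^bsub>B\<^esub>"
    "\<And>a x. [|a \<in> carrier K; x \<in> carrier A|] ==> f (a \<odot>\<^bsub>A\<^esub> x) = a \<odot>\<^bsub>B\<^esub> f x"
  shows "f \<in> alg_hom K A B"
  using assms unfolding alg_hom_def klinear_def ring_hom_def by auto

lemma alg_homD:
  assumes "f \<in> alg_hom K A B"
  shows "\<And>x. x \<in> carrier A ==> f x \<in> carrier B"
    "\<And>x y. [|x \<in> carrier A; y \<in> carrier A|] ==> f (x \<otimes>\<^bsub>A\<^esub> y) = f x \<otimes>\<^bsub>B\<^esub> f y"
    "\<And>x y. [|x \<in> carrier A; y \<in> carrier A|] ==> f (x \<oplus>\<^bsub>A\<^esub> y) = f x \<oplus>\<^bsub>B\<^esub> f y"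
    "f \<one>\<^bsub>A\<^esub> = \<one>\<^bsub>B\<^esub>"
    "\<And>a x. [|a \<in> carrier K; x \<in> carrier A|] ==> f (a \<odot>\<^bsub>A\<^esub> x) = a \<odot>\<^bsub>B\<^esub> f x"
  using assms unfolding alg_hom_def klinear_def ring_hom_def by auto

lemma alg_iso_iff:
  "f \<in> alg_iso K A B \<longleftrightarrow> f \<in> alg_hom K A B \<and> bij_betw f (carrier A) (carrier B)"
  unfolding alg_iso_def alg_hom_def ring_iso_def by auto

lemma alg_isoD: "f \<in> alg_iso K A B ==> f \<in> alg_hom K A B"
  "f \<in> alg_iso K A B ==> inj_on f (carrier A)"
  "f \<in> alg_iso K A B ==> f ` carrier A = carrier B"
  by (auto simp: alg_iso_iff bij_betw_def)

lemma alg_isoI: "f \<in> alg_hom K A B ==> inj_on f (carrier A) ==> f ` carrier A = carrier B ==> f \<in> alg_iso K A B"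
  by (auto simp: alg_iso_iff bij_betw_def)

lemma alg_hom_comp:
  "f \<in> alg_hom K A B ==> g \<in> alg_hom K B C ==> (\<lambda>x. g (f x)) \<in> alg_hom K A C"
  by (rule alg_homI) (auto simp: alg_homD)

lemma alg_iso_comp:
  assumes "f \<in> alg_iso K A B" "g \<in> alg_iso K B C" shows "(\<lambda>x. g (f x)) \<in> alg_iso K A C"
  using assms bij_betw_trans[of f _ _ g] alg_hom_comp[of f K A B g C]
  unfolding alg_iso_iff by (auto simp: comp_def)

lemma alg_hom_zero:
  assumes "ring A" "ring B" "f \<in> alg_hom K A B" shows "f \<zero>\<^bsub>A\<^esub> = \<zero>\<^bsub>B\<^esub>"
proof -
  interpret A: ring A by fact
  interpret B: ring B by fact
  have "f \<zero>\<^bsub>A\<^esub> \<oplus>\<^bsub>B\<^esub> f \<zero>\<^bsub>A\<^esub> = f \<zero>\<^bsub>A\<^esub>" "f \<zero>\<^bsub>A\<^esub> \<in> carrier B"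
    using alg_homD(3)[OF assms(3), of "\<zero>\<^bsub>A\<^esub>" "\<zero>\<^bsub>A\<^esub>"] alg_homD(1)[OF assms(3)] by auto
  then show ?thesis by (simp add: B.add.l_cancel_one)
qed

lemma alg_hom_minus:
  assumes "ring A" "ring B" "f \<in> alg_hom K A B" "a \<in> carrier A" shows "f (\<ominus>\<^bsub>A\<^esub> a) = \<ominus>\<^bsub>B\<^esub> f a"
proof -
  interpret A: ring A by fact
  interpret B: ring B by fact
  have "f (\<ominus>\<^bsub>A\<^esub> a) \<oplus>\<^bsub>B\<^esub> f a = \<zero>\<^bsub>B\<^esub>"
    using alg_homD(3)[OF assms(3), of "\<ominus>\<^bsub>A\<^esub> a" a] assms alg_hom_zero[OF assms(1-3)]
    by (simp add: A.l_neg)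
  then show ?thesis
    using alg_homD(1)[OF assms(3)] assms(4) by (metis A.a_inv_closed B.minus_equality)
qed

text \<open>Asks for additivity only, because it is applied not just to homomorphisms but also to
  coefficient functionals, to evaluation of functions at a point and to integer multiples.\<close>

lemma additive_finsum:
  assumes "abelian_group A" "abelian_group B"
    and "\<And>x. x \<in> carrier A ==> f x \<in> carrier B"
    and "\<And>x y. [|x \<in> carrier A; y \<in> carrier A|] ==> f (x \<oplus>\<^bsub>A\<^esub> y) = f x \<oplus>\<^bsub>B\<^esub> f y"
    and "g \<in> F \<rightarrow> carrier A"
  shows "f (finsum A g F) = finsum B (\<lambda>i. f (g i)) F"
proof -
  interpret A: abelian_group A by fact
  interpret B: abelian_group B by fact
  have "f \<zero>\<^bsub>A\<^esub> \<oplus>\<^bsub>B\<^esub> f \<zero>\<^bsub>A\<^esub> = f \<zero>\<^bsub>A\<^esub>" "f \<zero>\<^bsub>A\<^esub> \<in> carrier B"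
    using assms(4)[of "\<zero>\<^bsub>A\<^esub>" "\<zero>\<^bsub>A\<^esub>"] assms(3) by auto
  then have z: "f \<zero>\<^bsub>A\<^esub> = \<zero>\<^bsub>B\<^esub>" by (simp add: B.add.l_cancel_one)
  show ?thesis
    using assms(5)
  proof (induction F rule: infinite_finite_induct)
    case (insert i F)
    then have "finsum A g F \<in> carrier A" by (intro A.finsum_closed) auto
    with insert show ?case by (auto simp: A.finsum_insert B.finsum_insert assms(3,4) Pi_def)
  qed (auto simp: z A.finsum_infinite B.finsum_infinite)
qed

lemma alg_hom_finsum:
  assumes "ring A" "ring B" "f \<in> alg_hom K A B" "g \<in> F \<rightarrow> carrier A"
  shows "f (finsum A g F) = finsum B (\<lambda>i. f (g i)) F"
  by (rule additive_finsum)
    (use assms alg_homD[OF assms(3)] in \<open>auto dest: ring.is_abelian_group\<close>)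

lemma alg_hom_pow:
  assumes "ring A" "ring B" "f \<in> alg_hom K A B" "a \<in> carrier A"
  shows "f (a [^]\<^bsub>A\<^esub> (n::nat)) = f a [^]\<^bsub>B\<^esub> n"
proof -
  interpret A: ring A by fact
  interpret B: ring B by fact
  show ?thesis
    using assms(4) by (induct n) (auto simp: alg_homD[OF assms(3)])
qed

lemma alg_hom_Units:
  assumes "ring A" "ring B" "f \<in> alg_hom K A B" "a \<in> Units A"
  shows "f a \<in> Units B" "f (inv\<^bsub>A\<^esub> a) = inv\<^bsub>B\<^esub> (f a)"
proof -
  interpret A: ring A by fact
  interpret B: ring B by fact
  have a: "a \<in> carrier A" "inv\<^bsub>A\<^esub> a \<in> carrier A" using assms(4) by auto
  have 1: "f a \<otimes>\<^bsub>B\<^esub> f (inv\<^bsub>A\<^esub> a) = \<one>\<^bsub>B\<^esub>" "f (inv\<^bsub>A\<^esub> a) \<otimes>\<^bsub>B\<^esub> f a = \<one>\<^bsub>B\<^esub>"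
    by (simp_all add: a assms(4) alg_homD(4)[OF assms(3)] flip: alg_homD(2)[OF assms(3)])
  have 2: "f a \<in> carrier B" "f (inv\<^bsub>A\<^esub> a) \<in> carrier B" using a alg_homD(1)[OF assms(3)] by auto
  show "f a \<in> Units B" using 1 2 unfolding Units_def by blast
  show "f (inv\<^bsub>A\<^esub> a) = inv\<^bsub>B\<^esub> (f a)" using 1 2 by (metis B.inv_unique')
qed

lemma alg_hom_int_pow:
  assumes "ring A" "ring B" "f \<in> alg_hom K A B" "a \<in> Units A"
  shows "f (a [^]\<^bsub>A\<^esub> (n::int)) = f a [^]\<^bsub>B\<^esub> n"
proof -
  interpret A: ring A by fact
  interpret B: ring B by fact
  have a: "a \<in> carrier A" using assms(4) by auto
  have "a [^]\<^bsub>A\<^esub> (m::nat) \<in> Units A" for m using assms(4) by (induct m) auto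
  then show ?thesis
    by (simp add: int_pow_def2 del: pow_nat add: alg_hom_pow[OF assms(1-3) a] alg_hom_Units[OF assms(1-3)])
qed

lemma alg_hom_restrict:
  assumes "f \<in> alg_hom K A B" "S \<subseteq> carrier A" "f ` S \<subseteq> T"
  shows "f \<in> alg_hom K (A\<lparr>carrier := S\<rparr>) (B\<lparr>carrier := T\<rparr>)"
  by (rule alg_homI) (use assms(2-) in \<open>auto simp: subset_iff image_subset_iff alg_homD[OF assms(1)]\<close>)

lemma alg_hom_inc:
  assumes "f \<in> alg_hom K A (B\<lparr>carrier := T\<rparr>)" "T \<subseteq> carrier B"
  shows "f \<in> alg_hom K A B"
  by (rule alg_homI) (use assms alg_homD[OF assms(1)] in auto)

lemma alg_iso_inv:
  assumes "nc_algebra K A" "f \<in> alg_iso K A B"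
  shows "inv_into (carrier A) f \<in> alg_iso K B A"
proof -
  let ?g = "inv_into (carrier A) f"
  interpret nc_algebra K A by fact
  note f = alg_homD[OF alg_isoD(1)[OF assms(2)]] and inj = alg_isoD(2)[OF assms(2)]
  have bij: "bij_betw f (carrier A) (carrier B)" using assms(2) by (simp add: alg_iso_iff)
  have g: "?g b \<in> carrier A" "f (?g b) = b" if "b \<in> carrier B" for b
    using that bij by (metis bij_betw_imp_surj_on inv_into_into, metis bij_betw_inv_into_right)
  have eq: "?g b = a" if "a \<in> carrier A" "f a = b" for a b
    using that inj by (simp add: inv_into_f_eq)
  have "?g \<in> alg_hom K B A"
  proof (rule alg_homI)
    fix x y assume xy: "x \<in> carrier B" "y \<in> carrier B"
    show "?g (x \<otimes>\<^bsub>B\<^esub> y) = ?g x \<otimes>\<^bsub>A\<^esub> ?g y" "?g (x \<oplus>\<^bsub>B\<^esub> y) = ?g x \<oplus>\<^bsub>A\<^esub> ?g y"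
      by (rule eq; use xy g f in simp)+
  next
    fix a x assume "a \<in> carrier K" "x \<in> carrier B"
    then show "?g (a \<odot>\<^bsub>B\<^esub> x) = a \<odot>\<^bsub>A\<^esub> ?g x" by (intro eq) (use g f in simp_all)
  next
    show "?g \<one>\<^bsub>B\<^esub> = \<one>\<^bsub>A\<^esub>" by (rule eq) (use f in simp_all)
  qed (use g in auto)
  then show ?thesis
    using bij_betw_inv_into[OF bij] by (simp add: alg_iso_iff)
qed

lemma alg_hom_image_subalg:
  assumes "nc_algebra K A" "nc_algebra K B" "f \<in> alg_hom K A B" "subalg K A S"
  shows "subalg K B (f ` S)"
proof -
  interpret A: nc_algebra K A by fact
  interpret B: nc_algebra K B by fact
  note f = alg_homD[OF assms(3)] and S = subalgD[OF assms(4)]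
  have sub: "s \<in> carrier A" if "s \<in> S" for s using that S(3) by blast
  have "subring (f ` S) B"
  proof (rule B.A.subringI)
    show "\<one>\<^bsub>B\<^esub> \<in> f ` S" using f(4) S(5) by (metis imageI)
  next
    fix h assume "h \<in> f ` S"
    then obtain s where "s \<in> S" "h = f s" by auto
    then show "\<ominus>\<^bsub>B\<^esub> h \<in> f ` S"
      using alg_hom_minus[OF A.A.ring_axioms B.A.ring_axioms assms(3)] S(6) sub by (metis imageI)
  next
    fix h1 h2 assume "h1 \<in> f ` S" "h2 \<in> f ` S"
    then obtain s t where "s \<in> S" "h1 = f s" "t \<in> S" "h2 = f t" by auto
    then show "h1 \<otimes>\<^bsub>B\<^esub> h2 \<in> f ` S" "h1 \<oplus>\<^bsub>B\<^esub> h2 \<in> f ` S"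
      using f(2,3)[OF sub sub] S(7,8) by (metis imageI)+
  qed (use f(1) sub in auto)
  moreover have "a \<odot>\<^bsub>B\<^esub> f s \<in> f ` S" if "a \<in> carrier K" "s \<in> S" for a s
    using that f(5) S(2) sub by (metis imageI)
  ultimately show ?thesis unfolding subalg_def by auto
qed

section \<open>Free left modules over a subring\<close>

definition fin_coeffs :: "('a, 'm) ring_scheme => 'a set => ('i => 'a) set" where
  "fin_coeffs M S = {c. (\<forall>i. c i \<in> S) \<and> finite {i. c i ~= \<zero>\<^bsub>M\<^esub>}}"

definition lcomb :: "('a, 'm) ring_scheme => ('i => 'a) => ('i => 'a) => 'a" where
  "lcomb M b c = (\<Oplus>\<^bsub>M\<^esub> i \<in> {i. c i ~= \<zero>\<^bsub>M\<^esub>}. c i \<otimes>\<^bsub>M\<^esub> b i)"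

text \<open>The freeness clause common to \<open>skew_polynomial_ring\<close> (index type
  \<open>nat\<close>) and \<open>skew_laurent_ring\<close> (index type \<open>int\<close>), isolated
  so that both kinds of ring share one theory of coefficients.\<close>

definition free_basis :: "('a, 'm) ring_scheme => 'a set => ('i => 'a) => bool" where
  "free_basis M S b \<longleftrightarrow> (\<forall>a \<in> carrier M. \<exists>!c. c \<in> fin_coeffs M S \<and> a = lcomb M b c)"

locale left_family = ring M for M (structure) +
  fixes S :: "'a set" and b :: "'i => 'a"
  assumes S: "subring S M" and b: "\<And>i. b i \<in> carrier M"
begin

lemmas SE = subringE[OF S]

lemma S_carrier: "s \<in> S ==> s \<in> carrier M"
  using SE(1) by blast

lemma fin_coeffsD: "c \<in> fin_coeffs M S ==> c i \<in> S" "c \<in> fin_coeffs M S ==> finite {i. c i ~= \<zero>}"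
  "c \<in> fin_coeffs M S ==> c i \<in> carrier M"
  using S_carrier unfolding fin_coeffs_def by auto

lemma lcomb_superset:
  assumes "c \<in> fin_coeffs M S" "finite F" "{i. c i ~= \<zero>} \<subseteq> F"
  shows "lcomb M b c = (\<Oplus>i\<in>F. c i \<otimes> b i)"
  unfolding lcomb_def
  by (rule add.finprod_mono_neutral_cong_left)
    (use assms fin_coeffsD(3)[OF assms(1)] b in auto)

lemma lcomb_closed: "c \<in> fin_coeffs M S ==> lcomb M b c \<in> carrier M"
  unfolding lcomb_def by (rule finsum_closed) (auto intro: b fin_coeffsD)

lemma zero_coeffs: "(\<lambda>_. \<zero>) \<in> fin_coeffs M S" "lcomb M b (\<lambda>_. \<zero>) = \<zero>"
  using SE(2) unfolding fin_coeffs_def lcomb_def by auto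

lemma add_coeffs:
  assumes "c \<in> fin_coeffs M S" "d \<in> fin_coeffs M S"
  shows "(\<lambda>i. c i \<oplus> d i) \<in> fin_coeffs M S"
    "lcomb M b (\<lambda>i. c i \<oplus> d i) = lcomb M b c \<oplus> lcomb M b d"
proof -
  let ?F = "{i. c i ~= \<zero>} \<union> {i. d i ~= \<zero>}"
  have F: "finite ?F" using fin_coeffsD(2)[OF assms(1)] fin_coeffsD(2)[OF assms(2)] by simp
  have sub: "{i. c i \<oplus> d i ~= \<zero>} \<subseteq> ?F" by auto
  show 1: "(\<lambda>i. c i \<oplus> d i) \<in> fin_coeffs M S"
    unfolding fin_coeffs_def
    using SE(7) fin_coeffsD(1)[OF assms(1)] fin_coeffsD(1)[OF assms(2)] finite_subset[OF sub F] by auto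
  have cl: "c i \<in> carrier M" "d i \<in> carrier M" "b i \<in> carrier M" for i
    using assms b by (auto intro: fin_coeffsD)
  have "lcomb M b (\<lambda>i. c i \<oplus> d i) = (\<Oplus>i\<in>?F. (c i \<oplus> d i) \<otimes> b i)"
    by (rule lcomb_superset[OF 1 F sub])
  also have "\<dots> = (\<Oplus>i\<in>?F. c i \<otimes> b i \<oplus> d i \<otimes> b i)"
    by (rule finsum_cong') (auto simp: cl l_distr)
  also have "\<dots> = (\<Oplus>i\<in>?F. c i \<otimes> b i) \<oplus> (\<Oplus>i\<in>?F. d i \<otimes> b i)"
    by (rule finsum_addf) (auto simp: cl)
  also have "\<dots> = lcomb M b c \<oplus> lcomb M b d"
    using lcomb_superset[OF assms(1) F] lcomb_superset[OF assms(2) F] by simp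
  finally show "lcomb M b (\<lambda>i. c i \<oplus> d i) = lcomb M b c \<oplus> lcomb M b d" .
qed

lemma single_coeffs:
  assumes "s \<in> S"
  shows "(\<lambda>j. if j = i then s else \<zero>) \<in> fin_coeffs M S"
    "lcomb M b (\<lambda>j. if j = i then s else \<zero>) = s \<otimes> b i"
proof -
  have sub: "{j. (if j = i then s else \<zero>) ~= \<zero>} \<subseteq> {i}" by auto
  show 1: "(\<lambda>j. if j = i then s else \<zero>) \<in> fin_coeffs M S"
    using finite_subset[OF sub] assms SE(2) unfolding fin_coeffs_def by auto
  show "lcomb M b (\<lambda>j. if j = i then s else \<zero>) = s \<otimes> b i"
    using lcomb_superset[OF 1 _ sub] S_carrier[OF assms] b by simp
qed

lemma smult_coeffs:
  assumes "c \<in> fin_coeffs M S" "s \<in> S"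
  shows "(\<lambda>i. s \<otimes> c i) \<in> fin_coeffs M S"
    "lcomb M b (\<lambda>i. s \<otimes> c i) = s \<otimes> lcomb M b c"
proof -
  let ?F = "{i. c i ~= \<zero>}"
  have F: "finite ?F" using fin_coeffsD(2)[OF assms(1)] .
  have s: "s \<in> carrier M" by (rule S_carrier[OF assms(2)])
  have sub: "{i. s \<otimes> c i ~= \<zero>} \<subseteq> ?F" using s by auto
  show 1: "(\<lambda>i. s \<otimes> c i) \<in> fin_coeffs M S"
    unfolding fin_coeffs_def
    using SE(6) assms(2) fin_coeffsD(1)[OF assms(1)] finite_subset[OF sub F] by auto
  have cl: "c i \<in> carrier M" "b i \<in> carrier M" for i
    using assms b by (auto intro: fin_coeffsD)
  have "lcomb M b (\<lambda>i. s \<otimes> c i) = (\<Oplus>i\<in>?F. s \<otimes> c i \<otimes> b i)"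
    by (rule lcomb_superset[OF 1 F sub])
  also have "\<dots> = (\<Oplus>i\<in>?F. s \<otimes> (c i \<otimes> b i))"
    by (rule finsum_cong') (auto simp: cl s m_assoc)
  also have "\<dots> = s \<otimes> lcomb M b c"
    unfolding lcomb_def by (rule finsum_rdistr[symmetric]) (auto simp: cl s F)
  finally show "lcomb M b (\<lambda>i. s \<otimes> c i) = s \<otimes> lcomb M b c" .
qed

lemma lcomb_induct:
  assumes "c \<in> fin_coeffs M S"
    and "\<And>s i. s \<in> S ==> P (s \<otimes> b i)"
    and "\<And>u v. [|u \<in> carrier M; v \<in> carrier M; P u; P v|] ==> P (u \<oplus> v)"
  shows "P (lcomb M b c)"
proof -
  have "P (\<Oplus>i\<in>F. c i \<otimes> b i) \<and> (\<Oplus>i\<in>F. c i \<otimes> b i) \<in> carrier M" if "finite F" for F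
    using that
  proof induction
    case empty
    \<comment> \<open>The empty sum is a monomial with coefficient zero, at any index whatsoever; so
      the rule gets by without a separate case for zero.\<close>
    show ?case using assms(2)[of \<zero> undefined] SE(2) b by simp
  next
    case (insert i F)
    have "c i \<otimes> b i \<in> carrier M" "c i \<in> S" for i using assms(1) b by (auto intro: fin_coeffsD)
    then show ?case using insert assms(2,3) by (auto simp: finsum_insert Pi_def)
  qed
  then show ?thesis using fin_coeffsD(2)[OF assms(1)] unfolding lcomb_def by blast
qed

lemma free_basisI:
  assumes span: "\<And>a. a \<in> carrier M ==> \<exists>c \<in> fin_coeffs M S. a = lcomb M b c"
    and indep: "\<And>c. c \<in> fin_coeffs M S ==> lcomb M b c = \<zero> ==> c = (\<lambda>_. \<zero>)"
  shows "free_basis M S b"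
  unfolding free_basis_def
proof (intro ballI ex_ex1I)
  fix a assume "a \<in> carrier M"
  then show "\<exists>c. c \<in> fin_coeffs M S \<and> a = lcomb M b c" using span by blast
next
  fix a c d assume "a \<in> carrier M" and c: "c \<in> fin_coeffs M S \<and> a = lcomb M b c"
    and d: "d \<in> fin_coeffs M S \<and> a = lcomb M b d"
  let ?m = "\<lambda>i. \<ominus> \<one> \<otimes> d i"
  have 1: "\<ominus> \<one> \<in> S" using SE(3,5) by blast
  have m: "?m \<in> fin_coeffs M S" "lcomb M b ?m = \<ominus> \<one> \<otimes> a"
    using smult_coeffs[OF conjunct1[OF d] 1] d by auto
  have "lcomb M b (\<lambda>i. c i \<oplus> ?m i) = a \<oplus> \<ominus> \<one> \<otimes> a"
    using add_coeffs(2)[OF conjunct1[OF c] m(1)] m(2) c by simp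
  also have "\<dots> = \<zero>" using \<open>a \<in> carrier M\<close> by (simp add: l_minus r_neg)
  finally have "(\<lambda>i. c i \<oplus> ?m i) = (\<lambda>_. \<zero>)"
    using indep[OF add_coeffs(1)[OF conjunct1[OF c] m(1)]] by blast
  then have "c i \<oplus> ?m i = \<zero>" for i by meson
  moreover have "c i \<in> carrier M" "d i \<in> carrier M" for i using c d by (auto intro: fin_coeffsD)
  ultimately show "c = d"
    by (intro ext) (metis a_minus_def l_minus l_one one_closed r_right_minus_eq)
qed

end

locale left_basis = left_family +
  assumes basis: "free_basis M S b"
begin

lemma coeffs_unique:
  "c \<in> fin_coeffs M S ==> d \<in> fin_coeffs M S ==> lcomb M b c = lcomb M b d ==> c = d"
  using basis lcomb_closed unfolding free_basis_def by (metis (no_types, lifting))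

lemma coeffs_ex: "a \<in> carrier M ==> \<exists>c \<in> fin_coeffs M S. a = lcomb M b c"
  using basis unfolding free_basis_def by blast

lemma coeffs_zero: "c \<in> fin_coeffs M S ==> lcomb M b c = \<zero> ==> c i = \<zero>"
  using coeffs_unique[OF _ zero_coeffs(1)] zero_coeffs(2) by metis

lemma basis_induct [consumes 1, case_names monom add]:
  assumes "a \<in> carrier M"
    and "\<And>s i. s \<in> S ==> P (s \<otimes> b i)"
    and "\<And>u v. [|u \<in> carrier M; v \<in> carrier M; P u; P v|] ==> P (u \<oplus> v)"
  shows "P a"
  using coeffs_ex[OF assms(1)] lcomb_induct[of _ P] assms(2,3) by blast

text \<open>Freeness as a mapping property. The target is only an abelian group, so the lemma yields
  both the maps of the universal properties, which are linear along a homomorphism of the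
  coefficients, and the functionals reading off one coefficient.\<close>

lemma basis_extend:
  fixes N :: "('z, 'x) ring_scheme"
  assumes N: "abelian_group N"
    and f: "\<And>i s. s \<in> S ==> f i s \<in> carrier N"
    and f_add: "\<And>i s t. s \<in> S ==> t \<in> S ==> f i (s \<oplus> t) = f i s \<oplus>\<^bsub>N\<^esub> f i t"
  shows "\<exists>F. (\<forall>a \<in> carrier M. F a \<in> carrier N) \<and>
    (\<forall>u \<in> carrier M. \<forall>v \<in> carrier M. F (u \<oplus> v) = F u \<oplus>\<^bsub>N\<^esub> F v) \<and>
    (\<forall>s \<in> S. \<forall>i. F (s \<otimes> b i) = f i s)"
proof -
  interpret N: abelian_group N by fact
  define C where "C a = (THE c. c \<in> fin_coeffs M S \<and> a = lcomb M b c)" for a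
  have C: "C (lcomb M b c) = c" if "c \<in> fin_coeffs M S" for c
    unfolding C_def using that coeffs_unique by (intro the_equality) auto
  define G where "G c = (\<Oplus>\<^bsub>N\<^esub>i\<in>{i. c i ~= \<zero>}. f i (c i))" for c
  have f0: "f i \<zero> = \<zero>\<^bsub>N\<^esub>" for i
  proof -
    have "f i \<zero> \<oplus>\<^bsub>N\<^esub> f i \<zero> = f i \<zero>" "f i \<zero> \<in> carrier N"
      using f_add[of \<zero> \<zero>] f SE(2) by auto
    then show ?thesis by (simp add: N.add.l_cancel_one)
  qed
  have G_sup: "G c = (\<Oplus>\<^bsub>N\<^esub>i\<in>F. f i (c i))"
    if "c \<in> fin_coeffs M S" "finite F" "{i. c i ~= \<zero>} \<subseteq> F" for c F
    unfolding G_def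
    by (rule N.add.finprod_mono_neutral_cong_left) (use that f0 f fin_coeffsD(1)[OF that(1)] in auto)
  have G_add: "G (\<lambda>i. c i \<oplus> d i) = G c \<oplus>\<^bsub>N\<^esub> G d"
    if c: "c \<in> fin_coeffs M S" and d: "d \<in> fin_coeffs M S" for c d
  proof -
    let ?F = "{i. c i ~= \<zero>} \<union> {i. d i ~= \<zero>}"
    have F: "finite ?F" using fin_coeffsD(2)[OF c] fin_coeffsD(2)[OF d] by simp
    have sub: "{i. c i \<oplus> d i ~= \<zero>} \<subseteq> ?F" by auto
    have "G (\<lambda>i. c i \<oplus> d i) = (\<Oplus>\<^bsub>N\<^esub>i\<in>?F. f i (c i \<oplus> d i))"
      by (rule G_sup[OF add_coeffs(1)[OF c d] F sub])
    also have "\<dots> = (\<Oplus>\<^bsub>N\<^esub>i\<in>?F. f i (c i) \<oplus>\<^bsub>N\<^esub> f i (d i))"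
      by (rule N.finsum_cong') (use f f_add fin_coeffsD(1)[OF c] fin_coeffsD(1)[OF d] in auto)
    also have "\<dots> = (\<Oplus>\<^bsub>N\<^esub>i\<in>?F. f i (c i)) \<oplus>\<^bsub>N\<^esub> (\<Oplus>\<^bsub>N\<^esub>i\<in>?F. f i (d i))"
      by (rule N.finsum_addf) (use f fin_coeffsD(1)[OF c] fin_coeffsD(1)[OF d] in auto)
    also have "\<dots> = G c \<oplus>\<^bsub>N\<^esub> G d" using G_sup[OF c F] G_sup[OF d F] by simp
    finally show ?thesis .
  qed
  have "G (C a) \<in> carrier N" if a: "a \<in> carrier M" for a
  proof -
    obtain c where c: "c \<in> fin_coeffs M S" "a = lcomb M b c" using coeffs_ex[OF a] by blast
    show ?thesis using c C f fin_coeffsD(1)[OF c(1)] unfolding G_def by (auto intro!: N.finsum_closed)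
  qed
  moreover have "G (C (u \<oplus> v)) = G (C u) \<oplus>\<^bsub>N\<^esub> G (C v)" if uv: "u \<in> carrier M" "v \<in> carrier M" for u v
  proof -
    obtain c d where c: "c \<in> fin_coeffs M S" "u = lcomb M b c" and d: "d \<in> fin_coeffs M S" "v = lcomb M b d"
      using coeffs_ex[OF uv(1)] coeffs_ex[OF uv(2)] by blast
    then have "u \<oplus> v = lcomb M b (\<lambda>i. c i \<oplus> d i)" using add_coeffs(2) by simp
    then show ?thesis using C add_coeffs(1) c d G_add by simp
  qed
  moreover have "G (C (s \<otimes> b i)) = f i s" if "s \<in> S" for s i
  proof -
    let ?c = "\<lambda>j. if j = i then s else \<zero>"
    have "G (C (s \<otimes> b i)) = G ?c"
      using C[OF single_coeffs(1)[OF that]] single_coeffs(2)[OF that] by metis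
    also have "\<dots> = (\<Oplus>\<^bsub>N\<^esub>j\<in>{i}. f j (?c j))"
      by (rule G_sup[OF single_coeffs(1)[OF that]]) auto
    also have "\<dots> = f i s" using f[OF that] by simp
    finally show ?thesis .
  qed
  ultimately show ?thesis by (intro exI[of _ "\<lambda>a. G (C a)"]) simp
qed

end

section \<open>Skew polynomial rings\<close>

lemma nc_domainD:
  assumes "nc_domain R"
  shows "ring R" "\<one>\<^bsub>R\<^esub> ~= \<zero>\<^bsub>R\<^esub>"
    "\<And>a b. [|a \<in> carrier R; b \<in> carrier R; a \<otimes>\<^bsub>R\<^esub> b = \<zero>\<^bsub>R\<^esub>|] ==> a = \<zero>\<^bsub>R\<^esub> \<or> b = \<zero>\<^bsub>R\<^esub>"
  using assms unfolding nc_domain_def by auto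

definition left_ore :: "('a, 'm) ring_scheme => bool" where
  "left_ore R \<longleftrightarrow> (\<forall>a \<in> carrier R - {\<zero>\<^bsub>R\<^esub>}. \<forall>b \<in> carrier R - {\<zero>\<^bsub>R\<^esub>}.
     \<exists>u \<in> carrier R. \<exists>v \<in> carrier R. u \<otimes>\<^bsub>R\<^esub> a = v \<otimes>\<^bsub>R\<^esub> b \<and> u \<otimes>\<^bsub>R\<^esub> a ~= \<zero>\<^bsub>R\<^esub>)"

definition right_ore :: "('a, 'm) ring_scheme => bool" where
  "right_ore R \<longleftrightarrow> (\<forall>a \<in> carrier R - {\<zero>\<^bsub>R\<^esub>}. \<forall>b \<in> carrier R - {\<zero>\<^bsub>R\<^esub>}.
     \<exists>u \<in> carrier R. \<exists>v \<in> carrier R. a \<otimes>\<^bsub>R\<^esub> u = b \<otimes>\<^bsub>R\<^esub> v \<and> a \<otimes>\<^bsub>R\<^esub> u ~= \<zero>\<^bsub>R\<^esub>)"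

text \<open>Cancels two equal leading terms in a difference of polynomials.\<close>

lemma (in ring) add_cancel_minus:
  assumes "a \<in> carrier R" "b \<in> carrier R" "c \<in> carrier R"
  shows "(a \<oplus> b) \<ominus> (a \<oplus> c) = b \<oplus> \<ominus> c"
proof -
  have "(a \<oplus> b) \<ominus> (a \<oplus> c) = (a \<oplus> \<ominus> a) \<oplus> (b \<oplus> \<ominus> c)"
    using assms by (simp only: a_minus_def minus_add a_closed a_inv_closed a_ac)
  then show ?thesis using assms by (simp add: r_neg)
qed

lemma left_oreD:
  "[|left_ore R; a \<in> carrier R; a ~= \<zero>\<^bsub>R\<^esub>; b \<in> carrier R; b ~= \<zero>\<^bsub>R\<^esub>|] ==>
    \<exists>u \<in> carrier R. \<exists>v \<in> carrier R. u \<otimes>\<^bsub>R\<^esub> a = v \<otimes>\<^bsub>R\<^esub> b \<and> u \<otimes>\<^bsub>R\<^esub> a ~= \<zero>\<^bsub>R\<^esub>"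
  unfolding left_ore_def by simp

lemma right_oreD:
  "[|right_ore R; a \<in> carrier R; a ~= \<zero>\<^bsub>R\<^esub>; b \<in> carrier R; b ~= \<zero>\<^bsub>R\<^esub>|] ==>
    \<exists>u \<in> carrier R. \<exists>v \<in> carrier R. a \<otimes>\<^bsub>R\<^esub> u = b \<otimes>\<^bsub>R\<^esub> v \<and> a \<otimes>\<^bsub>R\<^esub> u ~= \<zero>\<^bsub>R\<^esub>"
  unfolding right_ore_def by simp

locale skew_poly =
  fixes K :: "('k, 'm) ring_scheme" and M :: "('k, 'a, 'n) module_scheme" (structure)
    and S :: "'a set" and x :: 'a and \<tau> \<delta> :: "'a => 'a"
  assumes skew: "skew_polynomial_ring K M S x \<tau> \<delta>"
begin

lemma alg: "nc_algebra K M" and sub: "subalg K M S"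
  and tau_iso: "\<tau> \<in> alg_iso K (M\<lparr>carrier := S\<rparr>) (M\<lparr>carrier := S\<rparr>)"
  and deriv: "skew_derivation K (M\<lparr>carrier := S\<rparr>) \<tau> \<delta>"
  and x_closed [simp]: "x \<in> carrier M"
  and x_comm: "r \<in> S ==> x \<otimes> r = \<tau> r \<otimes> x \<oplus> \<delta> r"
  using skew unfolding skew_polynomial_ring_def by auto

lemma free: "free_basis M S (\<lambda>i::nat. x [^] i)"
  using skew unfolding skew_polynomial_ring_def free_basis_def fin_coeffs_def lcomb_def
  by (simp add: conj_assoc)

end

sublocale skew_poly \<subseteq> nc_algebra K M
  by (rule alg)

sublocale skew_poly \<subseteq> left_basis M S "\<lambda>i::nat. x [^] i"
proof -
  interpret nc_algebra K M by (rule alg)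
  show "left_basis M S (\<lambda>i::nat. x [^] i)"
    by (intro left_basis.intro left_family.intro left_family_axioms.intro left_basis_axioms.intro
        A.ring_axioms free A.nat_pow_closed x_closed) (use sub in \<open>auto simp: subalg_def\<close>)
qed

section \<open>Universal property, degrees and Ore conditions of
  \<open>S[x;\<tau>,\<delta>]\<close>\<close>

context skew_poly
begin

lemmas SD = subalgD[OF sub]

lemma tau_hom: "\<tau> \<in> alg_hom K (M\<lparr>carrier := S\<rparr>) (M\<lparr>carrier := S\<rparr>)"
  by (rule alg_isoD(1)[OF tau_iso])

lemma ringS: "ring (M\<lparr>carrier := S\<rparr>)"
  by (rule subring_is_ring[OF S])

lemma tau [simp]: "s \<in> S ==> \<tau> s \<in> S" "\<tau> \<one> = \<one>" "\<tau> \<zero> = \<zero>"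
  using alg_homD(1,4)[OF tau_hom] alg_hom_zero[OF ringS ringS tau_hom] by auto

lemma tau_inj: "r \<in> S ==> s \<in> S ==> \<tau> r = \<tau> s ==> r = s"
  using alg_isoD(2)[OF tau_iso] by (auto dest: inj_onD)

lemma tau_surj: "s \<in> S ==> \<exists>r \<in> S. \<tau> r = s"
  using alg_isoD(3)[OF tau_iso] by simp (metis imageE)

lemma tau_pow [simp]: "s \<in> S ==> (\<tau> ^^ n) s \<in> S"
  by (induct n) auto

lemma tau_pow_surj: "s \<in> S ==> \<exists>r \<in> S. (\<tau> ^^ n) r = s"
proof (induct n arbitrary: s)
  case (Suc n)
  then obtain r where "r \<in> S" "\<tau> r = s" using tau_surj by blast
  then show ?case using Suc(1)[of r] by auto
qed auto

lemma tau_pow_zero: "s \<in> S ==> (\<tau> ^^ n) s = \<zero> \<longleftrightarrow> s = \<zero>"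
proof (induct n)
  case (Suc n)
  then show ?case using tau_inj[of "(\<tau> ^^ n) s" \<zero>] SE(2) by auto
qed auto

lemma delta [simp]: "s \<in> S ==> \<delta> s \<in> S"
  using deriv unfolding skew_derivation_def klinear_def by auto

lemma S_carr [simp]: "s \<in> S ==> s \<in> carrier M"
  by (rule S_carrier)

text \<open>Freeness prescribes the additive map sending s x^i to \<open>\<phi> s\<close> times y^i.
  Multiplicativity is checked for left factors s in S, then for x (where \<open>comm\<close>
  enters), then for powers of x; these generate all left factors additively.\<close>

lemma skew_universal:
  fixes N :: "('k, 'c, 'y) module_scheme"
  assumes N: "nc_algebra K N" and phi: "\<phi> \<in> alg_hom K (M\<lparr>carrier := S\<rparr>) N"
    and y: "y \<in> carrier N" and comm: "\<And>r. r \<in> S ==> y \<otimes>\<^bsub>N\<^esub> \<phi> r = \<phi> (\<tau> r) \<otimes>\<^bsub>N\<^esub> y \<oplus>\<^bsub>N\<^esub> \<phi> (\<delta> r)"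
  shows "\<exists>\<Phi> \<in> alg_hom K M N. (\<forall>r \<in> S. \<Phi> r = \<phi> r) \<and> \<Phi> x = y"
proof -
  interpret N: nc_algebra K N by fact
  have ph: "\<And>s. s \<in> S ==> \<phi> s \<in> carrier N"
    "\<And>r s. r \<in> S ==> s \<in> S ==> \<phi> (r \<otimes> s) = \<phi> r \<otimes>\<^bsub>N\<^esub> \<phi> s"
    "\<And>r s. r \<in> S ==> s \<in> S ==> \<phi> (r \<oplus> s) = \<phi> r \<oplus>\<^bsub>N\<^esub> \<phi> s"
    "\<phi> \<one> = \<one>\<^bsub>N\<^esub>" "\<And>c s. c \<in> carrier K ==> s \<in> S ==> \<phi> (c \<odot> s) = c \<odot>\<^bsub>N\<^esub> \<phi> s"
    using alg_homD[OF phi] by auto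
  have yk: "y [^]\<^bsub>N\<^esub> k \<in> carrier N" for k :: nat using y by simp
  have "\<exists>F. (\<forall>a \<in> carrier M. F a \<in> carrier N) \<and>
    (\<forall>u \<in> carrier M. \<forall>v \<in> carrier M. F (u \<oplus> v) = F u \<oplus>\<^bsub>N\<^esub> F v) \<and>
    (\<forall>s \<in> S. \<forall>i::nat. F (s \<otimes> x [^] i) = \<phi> s \<otimes>\<^bsub>N\<^esub> y [^]\<^bsub>N\<^esub> i)"
    by (rule basis_extend[where f = "\<lambda>i s. \<phi> s \<otimes>\<^bsub>N\<^esub> y [^]\<^bsub>N\<^esub> i"])
      (auto simp: N.A.abelian_group_axioms ph yk N.A.l_distr)
  then obtain F where F: "\<And>a. a \<in> carrier M ==> F a \<in> carrier N"
    "\<And>u v. u \<in> carrier M ==> v \<in> carrier M ==> F (u \<oplus> v) = F u \<oplus>\<^bsub>N\<^esub> F v"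
    "\<And>s i. s \<in> S ==> F (s \<otimes> x [^] (i::nat)) = \<phi> s \<otimes>\<^bsub>N\<^esub> y [^]\<^bsub>N\<^esub> i" by blast
  have FS: "F s = \<phi> s" if "s \<in> S" for s using F(3)[OF that, of 0] that ph(1) by simp
  have "F (\<one> \<otimes> x [^] (1::nat)) = \<phi> \<one> \<otimes>\<^bsub>N\<^esub> y [^]\<^bsub>N\<^esub> (1::nat)" by (rule F(3)) (rule SE(3))
  then have Fx: "F x = y" using y ph(4) by simp
  have Fs: "F (s \<otimes> a) = \<phi> s \<otimes>\<^bsub>N\<^esub> F a" if s: "s \<in> S" and a: "a \<in> carrier M" for s a
    using a
  proof (induct rule: basis_induct)
    case (monom r i)
    then have "F (s \<otimes> (r \<otimes> x [^] i)) = F (s \<otimes> r \<otimes> x [^] i)" using s by (simp add: A.m_assoc)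
    also have "\<dots> = \<phi> s \<otimes>\<^bsub>N\<^esub> F (r \<otimes> x [^] i)"
      using monom s SE(6)[OF s monom] by (simp add: F ph yk N.A.m_assoc)
    finally show ?case .
  next
    case (add u v)
    then show ?case using s by (simp add: A.r_distr F ph N.A.r_distr)
  qed
  have Fxa: "F (x \<otimes> a) = y \<otimes>\<^bsub>N\<^esub> F a" if a: "a \<in> carrier M" for a
    using a
  proof (induct rule: basis_induct)
    case (monom r i)
    have pw: "x \<otimes> x [^] i = x [^] Suc i" "y \<otimes>\<^bsub>N\<^esub> y [^]\<^bsub>N\<^esub> i = y [^]\<^bsub>N\<^esub> Suc i"
      using y by (simp_all only: x_closed A.nat_pow_Suc2 N.A.nat_pow_Suc2)
    have "x \<otimes> (r \<otimes> x [^] i) = (\<tau> r \<otimes> x \<oplus> \<delta> r) \<otimes> x [^] i"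
      using monom by (simp add: x_comm flip: A.m_assoc)
    also have "\<dots> = \<tau> r \<otimes> x [^] Suc i \<oplus> \<delta> r \<otimes> x [^] i"
      using monom by (simp del: A.nat_pow_Suc Group.nat_pow_Suc add: A.l_distr A.m_assoc pw)
    finally have "F (x \<otimes> (r \<otimes> x [^] i)) = \<phi> (\<tau> r) \<otimes>\<^bsub>N\<^esub> y [^]\<^bsub>N\<^esub> Suc i \<oplus>\<^bsub>N\<^esub> \<phi> (\<delta> r) \<otimes>\<^bsub>N\<^esub> y [^]\<^bsub>N\<^esub> i"
      using monom by (simp add: F del: A.nat_pow_Suc Group.nat_pow_Suc N.A.nat_pow_Suc)
    also have "\<dots> = (y \<otimes>\<^bsub>N\<^esub> \<phi> r) \<otimes>\<^bsub>N\<^esub> y [^]\<^bsub>N\<^esub> i"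
      using monom y by (simp add: comm ph N.A.l_distr N.A.m_assoc flip: pw(2) del: A.nat_pow_Suc Group.nat_pow_Suc N.A.nat_pow_Suc)
    also have "\<dots> = y \<otimes>\<^bsub>N\<^esub> F (r \<otimes> x [^] i)"
      using monom y by (simp add: F ph N.A.m_assoc)
    finally show ?case .
  next
    case (add u v)
    then show ?case using y by (simp add: A.r_distr F N.A.r_distr)
  qed
  have Fxk: "F (x [^] k \<otimes> a) = y [^]\<^bsub>N\<^esub> k \<otimes>\<^bsub>N\<^esub> F a" if a: "a \<in> carrier M" for a and k :: nat
    using a
  proof (induct k arbitrary: a)
    case (Suc k)
    then show ?case using y F(1) Fxa by (simp add: A.m_assoc N.A.m_assoc)
  qed (use F in simp)
  have F1: "F \<one> = \<one>\<^bsub>N\<^esub>" using FS SE(3) ph(4) by simp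
  have Fxi: "F (x [^] i) = y [^]\<^bsub>N\<^esub> i" for i :: nat
    using Fxk[of \<one> i] F1 yk by simp
  have "F \<in> alg_hom K M N"
  proof (rule alg_homI)
    fix a b assume a: "a \<in> carrier M" and b: "b \<in> carrier M"
    show "F (a \<otimes> b) = F a \<otimes>\<^bsub>N\<^esub> F b"
      using a
    proof (induct rule: basis_induct)
      case (monom r i)
      then show ?case using b F(1) ph(1) yk by (simp add: A.m_assoc Fs Fxk Fxi N.A.m_assoc)
    next
      case (add u v)
      then show ?case using b by (simp add: A.l_distr F N.A.l_distr)
    qed
  next
    fix c a assume c: "c \<in> carrier K" and a: "a \<in> carrier M"
    show "F (c \<odot> a) = c \<odot>\<^bsub>N\<^esub> F a"
      using a
    proof (induct rule: basis_induct)
      case (monom r i)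
      have "c \<odot> (r \<otimes> x [^] i) = (c \<odot> r) \<otimes> x [^] i" using monom c by (simp add: smult_mult_left)
      then show ?case
        using F(3)[OF SD(2)[OF c monom], of i] F(3)[OF monom, of i] monom c ph yk by (simp add: N.smult_mult_left)
    next
      case (add u v)
      then show ?case using c by (simp add: smult_r_distr F N.smult_r_distr)
    qed
  next
    show "F \<one> = \<one>\<^bsub>N\<^esub>" by (rule F1)
  qed (use F in auto)
  then show ?thesis using FS Fx by blast
qed

text \<open>The polynomials of degree less than n. The strict bound gives the zero polynomial the
  level 0, without a convention for its degree.\<close>

definition low :: "nat => 'a set" where
  "low n = {lcomb M (\<lambda>i::nat. x [^] i) c |c. c \<in> fin_coeffs M S \<and> (\<forall>i\<ge>n. c i = \<zero>)}"

lemma lowI: "c \<in> fin_coeffs M S ==> (\<And>i. i \<ge> n ==> c i = \<zero>) ==> lcomb M (\<lambda>i::nat. x [^] i) c \<in> low n"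
  unfolding low_def by blast

lemma low_carrier [simp]: "a \<in> low n ==> a \<in> carrier M"
  unfolding low_def using lcomb_closed by auto

lemma low_zero [simp]: "\<zero> \<in> low n"
  using lowI[OF zero_coeffs(1)] zero_coeffs(2) by auto

lemma low_add:
  assumes "a \<in> low n" "b \<in> low n"
  shows "a \<oplus> b \<in> low n"
proof -
  obtain c d where c: "c \<in> fin_coeffs M S" "\<forall>i\<ge>n. c i = \<zero>" "a = lcomb M (\<lambda>i::nat. x [^] i) c"
    and d: "d \<in> fin_coeffs M S" "\<forall>i\<ge>n. d i = \<zero>" "b = lcomb M (\<lambda>i::nat. x [^] i) d"
    using assms unfolding low_def by auto
  show ?thesis
    unfolding c(3) d(3) add_coeffs(2)[OF c(1) d(1), symmetric]
    by (rule lowI[OF add_coeffs(1)[OF c(1) d(1)]]) (use c(2) d(2) in auto)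
qed

lemma low_smult:
  assumes "s \<in> S" "a \<in> low n" shows "s \<otimes> a \<in> low n"
proof -
  obtain c where c: "c \<in> fin_coeffs M S" "\<forall>i\<ge>n. c i = \<zero>" "a = lcomb M (\<lambda>i::nat. x [^] i) c"
    using assms unfolding low_def by auto
  show ?thesis
    unfolding c(3) smult_coeffs(2)[OF c(1) assms(1), symmetric]
    by (rule lowI[OF smult_coeffs(1)[OF c(1) assms(1)]]) (use c(2) assms(1) in auto)
qed

lemma low_minus: "a \<in> low n ==> \<ominus> a \<in> low n"
  using low_smult[of "\<ominus> \<one>" a n] SE(3,5) by (simp add: A.l_minus)

lemma low_mono: "a \<in> low n ==> n \<le> m ==> a \<in> low m"
  unfolding low_def by fastforce

lemma low_monom:
  assumes "s \<in> S" "k < n" shows "s \<otimes> x [^] k \<in> low n"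
  unfolding single_coeffs(2)[OF assms(1), symmetric]
  by (rule lowI[OF single_coeffs(1)[OF assms(1)]]) (use assms(2) in auto)

lemma low_0: "low 0 = {\<zero>}"
proof -
  have "a = \<zero>" if "a \<in> low 0" for a
  proof -
    obtain c where c: "c \<in> fin_coeffs M S" "\<forall>i. c i = \<zero>" "a = lcomb M (\<lambda>i::nat. x [^] i) c"
      using \<open>a \<in> low 0\<close> unfolding low_def by auto
    then have "c = (\<lambda>_. \<zero>)" by auto
    then show ?thesis using c zero_coeffs by auto
  qed
  then show ?thesis by auto
qed

lemma low_Suc:
  assumes "a \<in> low (Suc n)"
  shows "\<exists>r \<in> S. \<exists>v \<in> low n. a = r \<otimes> x [^] n \<oplus> v"
proof -
  obtain c where c: "c \<in> fin_coeffs M S" "\<forall>i\<ge>Suc n. c i = \<zero>" "a = lcomb M (\<lambda>i::nat. x [^] i) c"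
    using assms unfolding low_def by auto
  let ?s = "\<lambda>j. if j = n then c n else \<zero>" and ?d = "\<lambda>j. if j = n then \<zero> else c j"
  have cn: "c n \<in> S" using fin_coeffsD(1)[OF c(1)] .
  have "finite {i. ?d i ~= \<zero>}" by (rule finite_subset[OF _ fin_coeffsD(2)[OF c(1)]]) auto
  moreover have "?d i \<in> S" for i using SE(2) fin_coeffsD(1)[OF c(1)] by simp
  ultimately have d: "?d \<in> fin_coeffs M S" unfolding fin_coeffs_def by blast
  have "c = (\<lambda>i. ?s i \<oplus> ?d i)" using fin_coeffsD(3)[OF c(1)] by auto
  then have "a = lcomb M (\<lambda>i::nat. x [^] i) (\<lambda>i. ?s i \<oplus> ?d i)" using c(3) by simp
  also have "\<dots> = c n \<otimes> x [^] n \<oplus> lcomb M (\<lambda>i::nat. x [^] i) ?d"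
    using add_coeffs(2)[OF single_coeffs(1)[OF cn] d] single_coeffs(2)[OF cn] by simp
  finally have "a = c n \<otimes> x [^] n \<oplus> lcomb M (\<lambda>i::nat. x [^] i) ?d" .
  moreover have "lcomb M (\<lambda>i::nat. x [^] i) ?d \<in> low n"
  proof (rule lowI[OF d])
    fix i assume "i \<ge> n"
    then show "?d i = \<zero>" using c(2) by (cases "i = n") auto
  qed
  ultimately show ?thesis using cn by blast
qed

lemma low_induct [consumes 1, case_names zero monom add]:
  assumes "a \<in> low n" and "P \<zero>"
    and "\<And>s k. s \<in> S ==> k < n ==> P (s \<otimes> x [^] k)"
    and "\<And>u v. [|u \<in> low n; v \<in> low n; P u; P v|] ==> P (u \<oplus> v)"
  shows "P a"
proof -
  have "m \<le> n ==> b \<in> low m ==> P b" for m b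
  proof (induct m arbitrary: b)
    case 0
    then show ?case using low_0 assms(2) by auto
  next
    case (Suc m)
    obtain r v where "r \<in> S" "v \<in> low m" "b = r \<otimes> x [^] m \<oplus> v" using low_Suc[OF Suc(3)] by blast
    then show ?case
      using Suc(1)[of v] Suc(2) assms(3)[of r m] assms(4)[of "r \<otimes> x [^] m" v] low_monom[of r m n] low_mono[of v m n]
      by auto
  qed
  then show ?thesis using assms(1) by blast
qed

lemma low_lead_zero:
  assumes "r \<in> S" "r \<otimes> x [^] n \<in> low n"
  shows "r = \<zero>"
proof -
  obtain c where c: "c \<in> fin_coeffs M S" "\<forall>i\<ge>n. c i = \<zero>" "r \<otimes> x [^] n = lcomb M (\<lambda>i::nat. x [^] i) c"
    using assms unfolding low_def by auto
  have "(\<lambda>j. if j = n then r else \<zero>) = c"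
    using coeffs_unique[OF single_coeffs(1)[OF assms(1)] c(1)] single_coeffs(2)[OF assms(1)] c(3) by simp
  then have "c n = r" by auto
  then show ?thesis using c(2) by simp
qed

lemma in_low: "a \<in> carrier M ==> \<exists>n. a \<in> low n"
proof (induct rule: basis_induct)
  case (monom s i)
  then show ?case using low_monom[of s i "Suc i"] by auto
next
  case (add u v)
  then obtain n m where "u \<in> low n" "v \<in> low m" by auto
  then have "u \<in> low (max n m)" "v \<in> low (max n m)" using low_mono by auto
  then show ?case using low_add by blast
qed

text \<open>The last conclusion identifies n as the degree. The Ore reductions use it to see that
  the degree of a remainder has dropped.\<close>

lemma leading_term:
  assumes "a \<in> carrier M" "a ~= \<zero>"
  obtains n r v where "r \<in> S" "r ~= \<zero>" "v \<in> low n" "a = r \<otimes> x [^] n \<oplus> v" "\<And>k. a \<in> low k ==> n < k"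
proof -
  define m where "m = (LEAST m. a \<in> low m)"
  have m: "a \<in> low m" using in_low[OF assms(1)] unfolding m_def by (rule LeastI_ex)
  then obtain n where n: "m = Suc n" using low_0 assms(2) by (cases m) auto
  obtain r v where rv: "r \<in> S" "v \<in> low n" "a = r \<otimes> x [^] n \<oplus> v" using low_Suc m n by blast
  have "a \<notin> low n" using not_less_Least[of n "\<lambda>m. a \<in> low m"] n m_def by auto
  then have "r ~= \<zero>" using rv by auto
  moreover have "n < k" if "a \<in> low k" for k
    using Least_le[of "\<lambda>m. a \<in> low m" k] that n m_def by auto
  ultimately show ?thesis using rv that by blast
qed

lemma x_low: "a \<in> low n ==> x \<otimes> a \<in> low (Suc n)"
proof (induct rule: low_induct)
  case (monom s k)
  have "x \<otimes> (s \<otimes> x [^] k) = \<tau> s \<otimes> (x \<otimes> x [^] k) \<oplus> \<delta> s \<otimes> x [^] k"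
    using monom by (simp add: x_comm A.l_distr A.m_assoc flip: A.m_assoc[of x s])
  also have "x \<otimes> x [^] k = x [^] Suc k" by (rule A.nat_pow_Suc2[symmetric]) simp
  finally show ?case
    using monom low_monom[of "\<tau> s" "Suc k" "Suc n"] low_monom[of "\<delta> s" k "Suc n"] low_add
    by (simp del: A.nat_pow_Suc Group.nat_pow_Suc)
next
  case (add u v)
  then show ?case by (simp add: A.r_distr low_add)
qed simp

text \<open>Each application of \<open>\<delta>\<close> costs a power of x, so only the term in
  which \<open>\<tau>\<close> is applied every time keeps the full degree.\<close>

lemma xpow_comm:
  assumes "s \<in> S"
  shows "\<exists>v \<in> low k. x [^] k \<otimes> s = (\<tau> ^^ k) s \<otimes> x [^] k \<oplus> v"
proof (induct k)
  case 0
  then show ?case using assms by auto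
next
  case (Suc k)
  then obtain v where v: "v \<in> low k" "x [^] k \<otimes> s = (\<tau> ^^ k) s \<otimes> x [^] k \<oplus> v" by blast
  have "x [^] Suc k \<otimes> s = x \<otimes> (x [^] k \<otimes> s)"
    using assms by (subst A.nat_pow_Suc2) (simp_all add: A.m_assoc)
  also have "\<dots> = (x \<otimes> (\<tau> ^^ k) s) \<otimes> x [^] k \<oplus> x \<otimes> v"
    using v assms by (simp add: A.r_distr A.m_assoc)
  also have "\<dots> = \<tau> ((\<tau> ^^ k) s) \<otimes> (x \<otimes> x [^] k) \<oplus> (\<delta> ((\<tau> ^^ k) s) \<otimes> x [^] k \<oplus> x \<otimes> v)"
    using v assms by (simp add: x_comm A.l_distr A.m_assoc A.a_assoc)
  also have "x \<otimes> x [^] k = x [^] Suc k" by (rule A.nat_pow_Suc2[symmetric]) simp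
  finally have "x [^] Suc k \<otimes> s = (\<tau> ^^ Suc k) s \<otimes> x [^] Suc k \<oplus> (\<delta> ((\<tau> ^^ k) s) \<otimes> x [^] k \<oplus> x \<otimes> v)"
    by simp
  moreover have "\<delta> ((\<tau> ^^ k) s) \<otimes> x [^] k \<oplus> x \<otimes> v \<in> low (Suc k)"
    using assms v by (intro low_add low_monom x_low) auto
  ultimately show ?case by blast
qed

lemma low_rmult:
  assumes "a \<in> low n" "s \<in> S" shows "a \<otimes> s \<in> low n"
  using assms(1)
proof (induct rule: low_induct)
  case (monom r k)
  obtain v where v: "v \<in> low k" "x [^] k \<otimes> s = (\<tau> ^^ k) s \<otimes> x [^] k \<oplus> v" using xpow_comm[OF assms(2)] by blast
  have "r \<otimes> x [^] k \<otimes> s = r \<otimes> (\<tau> ^^ k) s \<otimes> x [^] k \<oplus> r \<otimes> v"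
    using monom v assms(2) by (simp add: A.m_assoc A.r_distr)
  then show ?case
    using monom v assms(2) low_monom[of "r \<otimes> (\<tau> ^^ k) s" k n] low_smult[of r v k] low_mono[of _ k n] SE(6) by (simp add: low_add)
next
  case (add u v)
  then show ?case using assms(2) by (simp add: A.l_distr low_add)
qed (use assms in simp)

lemma low_xpow: "a \<in> low n ==> a \<otimes> x [^] j \<in> low (n + j)"
proof (induct rule: low_induct)
  case (monom s k)
  then have "s \<otimes> x [^] k \<otimes> x [^] j = s \<otimes> x [^] (k + j)" by (simp add: A.m_assoc A.nat_pow_mult)
  then show ?case using low_monom monom by simp
next
  case (add u v)
  then show ?case by (simp add: A.l_distr low_add)
qed simp

text \<open>A degree below n plus a degree of at most m stays below n + m; this is why the second
  bound is \<open>Suc m\<close>.\<close>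

lemma low_mult:
  assumes "a \<in> low n" "b \<in> low (Suc m)" shows "a \<otimes> b \<in> low (n + m)"
  using assms(2)
proof (induct rule: low_induct)
  case (monom s k)
  have "a \<otimes> (s \<otimes> x [^] k) = (a \<otimes> s) \<otimes> x [^] k" using monom assms by (simp add: A.m_assoc)
  then show ?case using low_xpow[OF low_rmult[OF assms(1) monom(1)], of k] low_mono monom by simp
next
  case (add u v)
  then show ?case using assms by (simp add: A.r_distr low_add)
qed (use assms in simp)

text \<open>Moving x^n past the coefficient s twists it by \<open>\<tau> ^^ n\<close>; the three
  products involving v or w drop below degree n + m.\<close>

lemma lead_mult:
  assumes "r \<in> S" "v \<in> low n" "s \<in> S" "w \<in> low m"
  shows "\<exists>z \<in> low (n + m). (r \<otimes> x [^] n \<oplus> v) \<otimes> (s \<otimes> x [^] m \<oplus> w) = r \<otimes> (\<tau> ^^ n) s \<otimes> x [^] (n + m) \<oplus> z"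
proof -
  obtain u where u: "u \<in> low n" "x [^] n \<otimes> s = (\<tau> ^^ n) s \<otimes> x [^] n \<oplus> u" using xpow_comm[OF assms(3)] by blast
  have "r \<otimes> x [^] n \<otimes> (s \<otimes> x [^] m) = r \<otimes> (x [^] n \<otimes> s) \<otimes> x [^] m"
    using assms by (simp add: A.m_assoc)
  also have "\<dots> = r \<otimes> (\<tau> ^^ n) s \<otimes> x [^] (n + m) \<oplus> r \<otimes> u \<otimes> x [^] m"
    using assms u by (simp add: A.m_assoc A.r_distr A.l_distr A.nat_pow_mult)
  finally have 1: "r \<otimes> x [^] n \<otimes> (s \<otimes> x [^] m) = r \<otimes> (\<tau> ^^ n) s \<otimes> x [^] (n + m) \<oplus> r \<otimes> u \<otimes> x [^] m" .
  let ?z = "r \<otimes> u \<otimes> x [^] m \<oplus> (r \<otimes> x [^] n \<otimes> w \<oplus> v \<otimes> (s \<otimes> x [^] m \<oplus> w))"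
  have "(r \<otimes> x [^] n \<oplus> v) \<otimes> (s \<otimes> x [^] m \<oplus> w)
    = r \<otimes> x [^] n \<otimes> (s \<otimes> x [^] m) \<oplus> (r \<otimes> x [^] n \<otimes> w \<oplus> v \<otimes> (s \<otimes> x [^] m \<oplus> w))"
    using assms by (simp add: A.l_distr A.r_distr A.a_ac)
  also have "\<dots> = r \<otimes> (\<tau> ^^ n) s \<otimes> x [^] (n + m) \<oplus> ?z"
    unfolding 1 using assms u by (simp add: A.a_assoc)
  finally have "(r \<otimes> x [^] n \<oplus> v) \<otimes> (s \<otimes> x [^] m \<oplus> w) = r \<otimes> (\<tau> ^^ n) s \<otimes> x [^] (n + m) \<oplus> ?z" .
  moreover have "?z \<in> low (n + m)"
  proof (intro low_add)
    show "r \<otimes> u \<otimes> x [^] m \<in> low (n + m)" using u assms by (intro low_xpow low_smult) auto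
    show "v \<otimes> (s \<otimes> x [^] m \<oplus> w) \<in> low (n + m)"
      using assms by (intro low_mult low_add low_monom) (auto intro: low_mono)
    have "r \<otimes> x [^] n \<in> low (Suc n)" using assms by (intro low_monom) auto
    \<comment> \<open>\<open>low_mult\<close> wants the bound on w to be a successor. For m = 0 it
      is not, but then w is zero.\<close>
    then show "r \<otimes> x [^] n \<otimes> w \<in> low (n + m)"
      using low_mult[of "r \<otimes> x [^] n" "Suc n" w "m - 1"] assms low_0 by (cases m) auto
  qed
  ultimately show ?thesis by blast
qed

lemma lead_nonzero: "r \<in> S ==> r ~= \<zero> ==> v \<in> low n ==> r \<otimes> x [^] n \<oplus> v ~= \<zero>"
  using low_lead_zero[of r n] low_minus[of v n]
  by (metis A.add.inv_closed A.minus_equality A.minus_minus S_carr b A.m_closed low_carrier)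

text \<open>The leading coefficient of a product is r times the image of s under the injective
  \<open>\<tau> ^^ n\<close>, hence nonzero.\<close>

theorem skew_poly_domain:
  assumes "nc_domain (M\<lparr>carrier := S\<rparr>)"
  shows "nc_domain M"
  unfolding nc_domain_def
proof (intro conjI ballI impI)
  note D = nc_domainD[OF assms]
  show "ring M" by unfold_locales
  show "\<one> ~= \<zero>" using D(2) by simp
  fix a b assume ab: "a \<in> carrier M" "b \<in> carrier M" "a \<otimes> b = \<zero>"
  show "a = \<zero> \<or> b = \<zero>"
  proof (rule ccontr)
    assume neg: "\<not> (a = \<zero> \<or> b = \<zero>)"
    obtain n r v where a: "r \<in> S" "r ~= \<zero>" "v \<in> low n" "a = r \<otimes> x [^] n \<oplus> v"
      using leading_term ab neg by metis
    obtain m s w where b: "s \<in> S" "s ~= \<zero>" "w \<in> low m" "b = s \<otimes> x [^] m \<oplus> w"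
      using leading_term ab neg by metis
    obtain z where z: "z \<in> low (n + m)" "a \<otimes> b = r \<otimes> (\<tau> ^^ n) s \<otimes> x [^] (n + m) \<oplus> z"
      using lead_mult a b by blast
    have "r \<otimes> (\<tau> ^^ n) s ~= \<zero>" using D(3)[of r "(\<tau> ^^ n) s"] a b tau_pow_zero by auto
    moreover have "r \<otimes> (\<tau> ^^ n) s \<in> S" using a b SE(6) by auto
    ultimately show False using lead_nonzero z ab(3) by metis
  qed
qed

text \<open>Euclidean reduction by induction on the sum of the two degrees. A common left multiple
  of the leading coefficients, found in S, makes the leading terms of \<open>p \<otimes> a\<close>
  and of a left multiple of b equal. Their difference is either zero, which is a common multiple at
  once, or of smaller degree than a, and a common multiple for it and b can be rewritten as one for
  a and b.\<close>

theorem skew_poly_left_ore: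
  assumes dom: "nc_domain (M\<lparr>carrier := S\<rparr>)" and ore: "left_ore (M\<lparr>carrier := S\<rparr>)"
  shows "left_ore M"
proof -
  have domM: "a = \<zero> \<or> b = \<zero>" if "a \<in> carrier M" "b \<in> carrier M" "a \<otimes> b = \<zero>" for a b
    using nc_domainD(3)[OF skew_poly_domain[OF dom]] that by blast
  define C where "C a b \<longleftrightarrow> (\<exists>u \<in> carrier M. \<exists>v \<in> carrier M. u \<otimes> a = v \<otimes> b \<and> u \<otimes> a ~= \<zero>)" for a b
  have C_sym: "C a b ==> C b a" for a b unfolding C_def by metis
  have "C a b" if "n + m = N" "r \<in> S" "r ~= \<zero>" "v \<in> low n" "a = r \<otimes> x [^] n \<oplus> v"
    "s \<in> S" "s ~= \<zero>" "w \<in> low m" "b = s \<otimes> x [^] m \<oplus> w" for N n m r v a s w b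
    using that
  proof (induct N arbitrary: n m r v a s w b rule: less_induct)
    case (less N)
    have red: "C a b" if ab: "m \<le> n" "n + m = N" "r \<in> S" "r ~= \<zero>" "v \<in> low n" "a = r \<otimes> x [^] n \<oplus> v"
      "s \<in> S" "s ~= \<zero>" "w \<in> low m" "b = s \<otimes> x [^] m \<oplus> w" for n m r v a s w b
    proof -
      have cl: "a \<in> carrier M" "b \<in> carrier M" using ab by auto
      have a0: "a ~= \<zero>" using lead_nonzero ab by auto
      \<comment> \<open>The leading coefficient of \<open>x [^] (n - m) \<otimes> b\<close>, the
        multiple of b that has the degree of a.\<close>
      let ?t = "(\<tau> ^^ (n - m)) s"
      have t: "?t \<in> S" "?t ~= \<zero>" using ab tau_pow_zero by auto
      obtain p p' where p: "p \<in> S" "p' \<in> S" "p \<otimes> r = p' \<otimes> ?t" "p \<otimes> r ~= \<zero>"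
        using left_oreD[OF ore, of r ?t] ab t by auto
      have p0: "p ~= \<zero>" using p ab by auto
      obtain z where z: "z \<in> low n" "x [^] (n - m) \<otimes> b = ?t \<otimes> x [^] n \<oplus> z"
        using lead_mult[of \<one> \<zero> "n - m" s w m] ab SE(3) by auto
      let ?a = "p \<otimes> a \<ominus> p' \<otimes> (x [^] (n - m) \<otimes> b)"
      have "p \<otimes> a = (p \<otimes> r) \<otimes> x [^] n \<oplus> p \<otimes> v"
        using ab p(1,2) by (simp add: A.r_distr A.m_assoc)
      moreover have "p' \<otimes> (x [^] (n - m) \<otimes> b) = (p \<otimes> r) \<otimes> x [^] n \<oplus> p' \<otimes> z"
        unfolding z(2) p(3) using t z p by (simp add: A.r_distr A.m_assoc)
      ultimately have "?a = p \<otimes> v \<oplus> \<ominus> (p' \<otimes> z)"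
        by (simp only:) (rule A.add_cancel_minus; use p ab z in simp)
      then have low: "?a \<in> low n" using p ab z by (auto intro!: low_add low_minus low_smult)
      show "C a b"
      proof (cases "?a = \<zero>")
        case True
        then have "p \<otimes> a = (p' \<otimes> x [^] (n - m)) \<otimes> b"
          using p cl by (simp add: A.r_right_minus_eq A.m_assoc)
        moreover have "p \<otimes> a ~= \<zero>" using domM[of p a] p p0 cl a0 by auto
        ultimately show ?thesis using p cl unfolding C_def by (metis A.m_closed S_carr b)
      next
        case False
        have acl: "?a \<in> carrier M" using cl p by simp
        obtain n' r' v' where a': "r' \<in> S" "r' ~= \<zero>" "v' \<in> low n'" "?a = r' \<otimes> x [^] n' \<oplus> v'" "n' < n"
          using leading_term[OF acl False] low by metis
        have "C ?a b" using less(1)[of "n' + m" n' m r' v' ?a s w b] ab a' by auto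
        then obtain u u' where u: "u \<in> carrier M" "u' \<in> carrier M" "u \<otimes> ?a = u' \<otimes> b" "u \<otimes> ?a ~= \<zero>"
          unfolding C_def by blast
        let ?q = "p' \<otimes> x [^] (n - m)"
        have q: "?q \<in> carrier M" using p by simp
        \<comment> \<open>Undoes the reduction: the remainder is \<open>p \<otimes> a\<close> minus
          \<open>?q \<otimes> b\<close>, and u times the remainder is a left multiple of b.\<close>
        have "(u \<otimes> p) \<otimes> a = u \<otimes> ?a \<oplus> u \<otimes> (?q \<otimes> b)"
          using p(1,2) u(1,2) cl q by (simp add: a_minus_def A.r_distr A.m_assoc A.a_assoc A.r_minus A.l_neg)
        also have "\<dots> = (u' \<oplus> u \<otimes> ?q) \<otimes> b"
          unfolding u(3) using u q cl by (simp add: A.l_distr A.m_assoc)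
        finally have "(u \<otimes> p) \<otimes> a = (u' \<oplus> u \<otimes> ?q) \<otimes> b" .
        moreover have "u ~= \<zero>" using u acl by auto
        then have "(u \<otimes> p) \<otimes> a ~= \<zero>" using domM[of "u \<otimes> p" a] domM[of u p] p p0 u cl a0 by auto
        ultimately show ?thesis using p u q cl unfolding C_def by (metis A.m_closed S_carr A.a_closed)
      qed
    qed
    show "C a b"
    proof (cases "m \<le> n")
      case True
      then show ?thesis using red[of m n r v a s w b] less by blast
    next
      case False
      then show ?thesis using red[of n m s w b r v a] less C_sym[of b a] by (simp add: add.commute)
    qed
  qed
  then show ?thesis
    unfolding left_ore_def C_def
    by (metis Diff_iff insertI1 leading_term)
qed

text \<open>The mirror image of the previous reduction, except that the coefficients now multiply
  from the right and get twisted on their way past powers of x. Surjectivity of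
  \<open>\<tau>\<close> repairs this.\<close>

theorem skew_poly_right_ore:
  assumes dom: "nc_domain (M\<lparr>carrier := S\<rparr>)" and ore: "right_ore (M\<lparr>carrier := S\<rparr>)"
  shows "right_ore M"
proof -
  have domM: "a = \<zero> \<or> b = \<zero>" if "a \<in> carrier M" "b \<in> carrier M" "a \<otimes> b = \<zero>" for a b
    using nc_domainD(3)[OF skew_poly_domain[OF dom]] that by blast
  define C where "C a b \<longleftrightarrow> (\<exists>u \<in> carrier M. \<exists>v \<in> carrier M. a \<otimes> u = b \<otimes> v \<and> a \<otimes> u ~= \<zero>)" for a b
  have C_sym: "C a b ==> C b a" for a b unfolding C_def by metis
  have "C a b" if "n + m = N" "r \<in> S" "r ~= \<zero>" "v \<in> low n" "a = r \<otimes> x [^] n \<oplus> v"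
    "s \<in> S" "s ~= \<zero>" "w \<in> low m" "b = s \<otimes> x [^] m \<oplus> w" for N n m r v a s w b
    using that
  proof (induct N arbitrary: n m r v a s w b rule: less_induct)
    case (less N)
    have red: "C a b" if ab: "m \<le> n" "n + m = N" "r \<in> S" "r ~= \<zero>" "v \<in> low n" "a = r \<otimes> x [^] n \<oplus> v"
      "s \<in> S" "s ~= \<zero>" "w \<in> low m" "b = s \<otimes> x [^] m \<oplus> w" for n m r v a s w b
    proof -
      have cl: "a \<in> carrier M" "b \<in> carrier M" using ab by auto
      have a0: "a ~= \<zero>" using lead_nonzero ab by auto
      obtain e e' where e: "e \<in> S" "e' \<in> S" "r \<otimes> e = s \<otimes> e'" "r \<otimes> e ~= \<zero>"
        using right_oreD[OF ore, of r s] ab by auto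
      \<comment> \<open>\<open>a \<otimes> p\<close> has the leading coefficient r times
        \<open>(\<tau> ^^ n) p\<close>; so the Ore relation between r and s in S has to be pulled
        back along \<open>\<tau> ^^ n\<close>.\<close>
      obtain p p' where p: "p \<in> S" "p' \<in> S" "(\<tau> ^^ n) p = e" "(\<tau> ^^ n) p' = e'"
        using tau_pow_surj e by metis
      have p0: "p ~= \<zero>" using p e ab tau_pow_zero[of \<zero> n] SE(2) by auto
      let ?q = "x [^] (n - m) \<otimes> p'"
      have q: "?q \<in> carrier M" using p by simp
      obtain z where z: "z \<in> low n" "a \<otimes> p = (r \<otimes> e) \<otimes> x [^] n \<oplus> z"
        using lead_mult[of r v n p \<zero> 0] ab p by auto
      have "b \<otimes> x [^] (n - m) = s \<otimes> x [^] n \<oplus> w \<otimes> x [^] (n - m)"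
        using ab by (simp add: A.l_distr A.m_assoc A.nat_pow_mult)
      moreover have "w \<otimes> x [^] (n - m) \<in> low n" using low_xpow[of w m "n - m"] ab by simp
      ultimately obtain z' where z': "z' \<in> low n" "b \<otimes> x [^] (n - m) \<otimes> p' = (s \<otimes> e') \<otimes> x [^] n \<oplus> z'"
        using lead_mult[of s "w \<otimes> x [^] (n - m)" n p' \<zero> 0] ab p by auto
      let ?a = "a \<otimes> p \<ominus> b \<otimes> ?q"
      have "b \<otimes> ?q = (r \<otimes> e) \<otimes> x [^] n \<oplus> z'"
        using z'(2) e(3) cl p by (simp add: A.m_assoc)
      then have "?a = z \<oplus> \<ominus> z'"
        by (simp only: z(2)) (rule A.add_cancel_minus; use z z' ab e in simp)
      then have low: "?a \<in> low n" using z z' by (auto intro!: low_add low_minus)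
      show "C a b"
      proof (cases "?a = \<zero>")
        case True
        then have "a \<otimes> p = b \<otimes> ?q"
          using p cl by (simp add: A.r_right_minus_eq)
        moreover have "a \<otimes> p ~= \<zero>" using domM[of a p] p p0 cl a0 by auto
        ultimately show ?thesis using p q cl unfolding C_def by (metis S_carr)
      next
        case False
        have acl: "?a \<in> carrier M" using cl p by simp
        obtain n' r' v' where a': "r' \<in> S" "r' ~= \<zero>" "v' \<in> low n'" "?a = r' \<otimes> x [^] n' \<oplus> v'" "n' < n"
          using leading_term[OF acl False] low by metis
        have "C ?a b" using less(1)[of "n' + m" n' m r' v' ?a s w b] ab a' by auto
        then obtain u u' where u: "u \<in> carrier M" "u' \<in> carrier M" "?a \<otimes> u = b \<otimes> u'" "?a \<otimes> u ~= \<zero>"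
          unfolding C_def by blast
        have "a \<otimes> (p \<otimes> u) = ?a \<otimes> u \<oplus> b \<otimes> (?q \<otimes> u)"
          using p(1,2) u(1,2) cl q by (simp add: a_minus_def A.l_distr A.m_assoc A.a_assoc A.l_minus A.l_neg)
        also have "\<dots> = b \<otimes> (u' \<oplus> ?q \<otimes> u)"
          unfolding u(3) using u q cl by (simp add: A.r_distr A.m_assoc)
        finally have "a \<otimes> (p \<otimes> u) = b \<otimes> (u' \<oplus> ?q \<otimes> u)" .
        moreover have "u ~= \<zero>" using u acl by auto
        then have "a \<otimes> (p \<otimes> u) ~= \<zero>" using domM[of a "p \<otimes> u"] domM[of p u] p p0 u cl a0 by auto
        ultimately show ?thesis using p u q cl unfolding C_def by (metis A.m_closed S_carr A.a_closed)
      qed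
    qed
    show "C a b"
    proof (cases "m \<le> n")
      case True
      then show ?thesis using red[of m n r v a s w b] less by blast
    next
      case False
      then show ?thesis using red[of n m s w b r v a] less C_sym[of b a] by (simp add: add.commute)
    qed
  qed
  then show ?thesis
    unfolding right_ore_def C_def
    by (metis Diff_iff insertI1 leading_term)
qed

end

section \<open>Skew Laurent rings\<close>

lemma (in monoid) nat_pow_units_of: "a [^]\<^bsub>units_of G\<^esub> (n::nat) = a [^] n"
  by (induct n) (simp_all add: units_of_def)

text \<open>Integer powers of a unit agree with those in the group of units, from which the exponent
  laws are then inherited.\<close>

lemma (in monoid) int_pow_units_of:
  assumes "a \<in> Units G" shows "a [^]\<^bsub>units_of G\<^esub> (i::int) = a [^] i"
proof -
  have "a [^] n \<in> Units G" for n :: nat using assms by (induct n) auto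
  then show ?thesis by (simp add: int_pow_def2 nat_pow_units_of units_of_inv del: pow_nat)
qed

lemma (in monoid) Units_int_pow [simp]:
  assumes "a \<in> Units G" shows "a [^] (i::int) \<in> Units G"
  using group.int_pow_closed[OF units_group, of a i] assms int_pow_units_of[OF assms, of i]
  by (simp add: units_of_carrier)

lemma (in monoid) Units_int_pow_carrier [simp]: "a \<in> Units G ==> a [^] (i::int) \<in> carrier G"
  using Units_int_pow by blast

lemma (in monoid) Units_int_pow_add:
  assumes "a \<in> Units G" shows "a [^] (i + j) = a [^] (i::int) \<otimes> a [^] j"
  using group.int_pow_mult[OF units_group, of a i j] assms
  by (simp add: int_pow_units_of[OF assms] units_of_carrier units_of_mult)

lemma (in monoid) Units_int_pow_1 [simp]: "a \<in> Units G ==> a [^] (1::int) = a"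
  using int_pow_int[of G a 1] Units_closed by simp

lemma (in monoid) Units_int_pow_cancel [simp]:
  assumes "a \<in> Units G"
  shows "a [^] (- i :: int) \<otimes> a [^] i = \<one>" "a [^] i \<otimes> a [^] (- i :: int) = \<one>"
  using Units_int_pow_add[OF assms, of "- i" i] Units_int_pow_add[OF assms, of i "- i"] by auto

text \<open>A set normalized by y on both sides is normalized by all integer powers. Positive powers
  go by induction. For negative ones the two conclusions change places, which is why they are proved
  together.\<close>

lemma (in monoid) unit_normalizes:
  assumes y: "y \<in> Units G" and W: "W \<subseteq> carrier G"
    and f: "\<And>w. w \<in> W ==> \<exists>w' \<in> W. y \<otimes> w = w' \<otimes> y"
    and g: "\<And>w. w \<in> W ==> \<exists>w' \<in> W. w \<otimes> y = y \<otimes> w'"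
    and w: "w \<in> W"
  shows "\<exists>w' \<in> W. y [^] (i::int) \<otimes> w = w' \<otimes> y [^] i" "\<exists>w' \<in> W. w \<otimes> y [^] (i::int) = y [^] i \<otimes> w'"
proof -
  have yc: "y \<in> carrier G" using y by auto
  have 1: "\<exists>w' \<in> W. y [^] (int n) \<otimes> w = w' \<otimes> y [^] int n" if "w \<in> W" for n w
    using that
  proof (induct n arbitrary: w)
    case 0
    then have "w \<in> carrier G" using W by blast
    then show ?case using 0 by (intro bexI[of _ w]) auto
  next
    case (Suc n)
    obtain w1 where w1: "w1 \<in> W" "y \<otimes> w = w1 \<otimes> y" using f Suc by blast
    obtain w2 where w2: "w2 \<in> W" "y [^] int n \<otimes> w1 = w2 \<otimes> y [^] int n" using Suc w1 by blast
    have c: "w \<in> carrier G" "w1 \<in> carrier G" "w2 \<in> carrier G" "y [^] int n \<in> carrier G"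
      using Suc w1 w2 W y by (blast, blast, blast, simp)
    have S: "y [^] int (Suc n) = y [^] int n \<otimes> y"
      using Units_int_pow_add[OF y, of "int n" 1] y by (simp add: add.commute)
    have "y [^] int (Suc n) \<otimes> w = y [^] int n \<otimes> w1 \<otimes> y"
      using c yc w1(2) by (simp only: S m_assoc)
    also have "\<dots> = w2 \<otimes> y [^] int (Suc n)" using c yc w2(2) by (simp only: S m_assoc m_closed)
    finally show ?case using w2 by blast
  qed
  have 2: "\<exists>w' \<in> W. w \<otimes> y [^] (int n) = y [^] int n \<otimes> w'" if "w \<in> W" for n w
    using that
  proof (induct n arbitrary: w)
    case 0
    then have "w \<in> carrier G" using W by blast
    then show ?case using 0 by (intro bexI[of _ w]) auto
  next
    case (Suc n)
    obtain w1 where w1: "w1 \<in> W" "w \<otimes> y [^] int n = y [^] int n \<otimes> w1" using Suc by blast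
    obtain w2 where w2: "w2 \<in> W" "w1 \<otimes> y = y \<otimes> w2" using w1 g by blast
    have c: "w \<in> carrier G" "w1 \<in> carrier G" "w2 \<in> carrier G" "y [^] int n \<in> carrier G"
      using Suc w1 w2 W y by (blast, blast, blast, simp)
    have S: "y [^] int (Suc n) = y [^] int n \<otimes> y"
      using Units_int_pow_add[OF y, of "int n" 1] y by (simp add: add.commute)
    have "w \<otimes> y [^] int (Suc n) = y [^] int n \<otimes> (w1 \<otimes> y)"
      using c yc w1(2) by (simp only: S m_assoc flip: m_assoc[of w])
    also have "\<dots> = y [^] int (Suc n) \<otimes> w2" using c yc w2(2) by (simp only: S m_assoc m_closed)
    finally show ?case using w2 by blast
  qed
  \<comment> \<open>Multiplying a commutation rule by the inverse power on both sides turns it into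
    the opposite rule for that inverse power.\<close>
  have flip: "a \<otimes> y [^] (- j) = y [^] (- j) \<otimes> b" if "a \<in> carrier G" "b \<in> carrier G" "y [^] j \<otimes> a = b \<otimes> y [^] j"
    for a b and j :: int
  proof -
    have "a \<otimes> y [^] (- j) = y [^] (- j) \<otimes> (y [^] j \<otimes> a) \<otimes> y [^] (- j)"
      using that(1,2) y by (simp flip: m_assoc)
    also have "\<dots> = y [^] (- j) \<otimes> b" unfolding that(3) using that(1,2) y by (simp add: m_assoc)
    finally show ?thesis .
  qed
  have Wc: "\<And>v. v \<in> W ==> v \<in> carrier G" using W by blast
  show "\<exists>w' \<in> W. y [^] i \<otimes> w = w' \<otimes> y [^] i"
  proof (cases "i \<ge> 0")
    case True
    then show ?thesis using 1[OF w, of "nat i"] by simp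
  next
    case False
    obtain w' where w': "w' \<in> W" "w \<otimes> y [^] (- i) = y [^] (- i) \<otimes> w'" using 2[OF w, of "nat (- i)"] False by auto
    have "w' \<otimes> y [^] (- (- i)) = y [^] (- (- i)) \<otimes> w"
      by (rule flip) (use w' w Wc in auto)
    then show ?thesis using w'(1) by (intro bexI[of _ w']) simp_all
  qed
  show "\<exists>w' \<in> W. w \<otimes> y [^] i = y [^] i \<otimes> w'"
  proof (cases "i \<ge> 0")
    case True
    then show ?thesis using 2[OF w, of "nat i"] by simp
  next
    case False
    obtain w' where w': "w' \<in> W" "y [^] (- i) \<otimes> w = w' \<otimes> y [^] (- i)" using 1[OF w, of "nat (- i)"] False by auto
    have "w \<otimes> y [^] (- (- i)) = y [^] (- (- i)) \<otimes> w'"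
      by (rule flip) (use w' w Wc in auto)
    then show ?thesis using w'(1) by (intro bexI[of _ w']) simp_all
  qed
qed

locale skew_laur =
  fixes K :: "('k, 'm) ring_scheme" and M :: "('k, 'a, 'n) module_scheme" (structure)
    and S :: "'a set" and y :: 'a and \<tau> :: "'a => 'a"
  assumes laur: "skew_laurent_ring K M S y \<tau>"
begin

lemma alg: "nc_algebra K M" and sub: "subalg K M S"
  and tau_iso: "\<tau> \<in> alg_iso K (M\<lparr>carrier := S\<rparr>) (M\<lparr>carrier := S\<rparr>)"
  and y_unit [simp]: "y \<in> Units M"
  and y_comm: "r \<in> S ==> y \<otimes> r = \<tau> r \<otimes> y"
  using laur unfolding skew_laurent_ring_def by auto

lemma free: "free_basis M S (\<lambda>i::int. y [^] i)"
  using laur unfolding skew_laurent_ring_def free_basis_def fin_coeffs_def lcomb_def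
  by (simp add: conj_assoc)

end

sublocale skew_laur \<subseteq> nc_algebra K M
  by (rule alg)

sublocale skew_laur \<subseteq> left_basis M S "\<lambda>i::int. y [^] i"
proof -
  interpret nc_algebra K M by (rule alg)
  show "left_basis M S (\<lambda>i::int. y [^] i)"
    by (intro left_basis.intro left_family.intro left_family_axioms.intro left_basis_axioms.intro
        A.ring_axioms free A.Units_int_pow_carrier y_unit) (use sub in \<open>auto simp: subalg_def\<close>)
qed

section \<open>Normalization by the variable and universal property of
  \<open>S[y\<^sup>\<plusminus>\<^sup>1;\<tau>]\<close>\<close>

context skew_laur
begin

lemmas SD = subalgD[OF sub]

lemma y_carr [simp]: "y \<in> carrier M"
  using y_unit by blast

lemma tau_hom: "\<tau> \<in> alg_hom K (M\<lparr>carrier := S\<rparr>) (M\<lparr>carrier := S\<rparr>)"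
  by (rule alg_isoD(1)[OF tau_iso])

lemma ringS: "ring (M\<lparr>carrier := S\<rparr>)"
  by (rule subring_is_ring[OF S])

lemma tau [simp]: "s \<in> S ==> \<tau> s \<in> S" "\<tau> \<one> = \<one>" "\<tau> \<zero> = \<zero>"
  using alg_homD(1,4)[OF tau_hom] alg_hom_zero[OF ringS ringS tau_hom] by auto

lemma tau_surj: "s \<in> S ==> \<exists>r \<in> S. \<tau> r = s"
  using alg_isoD(3)[OF tau_iso] by simp (metis imageE)

lemma S_carr [simp]: "s \<in> S ==> s \<in> carrier M"
  by (rule S_carrier)

lemma y_add1: "y [^] (i + 1 :: int) = y \<otimes> y [^] i"
  using A.Units_int_pow_add[OF y_unit, of 1 i] by (simp add: add.commute)

lemma y_normalizes:
  assumes "r \<in> S"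
  shows "\<exists>r' \<in> S. y [^] (i::int) \<otimes> r = r' \<otimes> y [^] i" "\<exists>r' \<in> S. r \<otimes> y [^] (i::int) = y [^] i \<otimes> r'"
proof -
  have g: "\<exists>w' \<in> S. w \<otimes> y = y \<otimes> w'" if "w \<in> S" for w using tau_surj[OF that] y_comm by metis
  show "\<exists>r' \<in> S. y [^] (i::int) \<otimes> r = r' \<otimes> y [^] i" "\<exists>r' \<in> S. r \<otimes> y [^] (i::int) = y [^] i \<otimes> r'"
    by (rule A.unit_normalizes[OF y_unit SE(1) _ g assms]; use y_comm in fastforce)+
qed

text \<open>As for skew polynomials, but the target u of the variable must be a unit, so that
  negative exponents have an image.\<close>

lemma laurent_universal:
  fixes N :: "('k, 'c, 'y) module_scheme"
  assumes N: "nc_algebra K N" and phi: "\<phi> \<in> alg_hom K (M\<lparr>carrier := S\<rparr>) N"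
    and u: "u \<in> Units N" and comm: "\<And>r. r \<in> S ==> u \<otimes>\<^bsub>N\<^esub> \<phi> r = \<phi> (\<tau> r) \<otimes>\<^bsub>N\<^esub> u"
  shows "\<exists>\<Phi> \<in> alg_hom K M N. (\<forall>r \<in> S. \<Phi> r = \<phi> r) \<and> \<Phi> y = u"
proof -
  interpret N: nc_algebra K N by fact
  have ph: "\<And>s. s \<in> S ==> \<phi> s \<in> carrier N"
    "\<And>r s. r \<in> S ==> s \<in> S ==> \<phi> (r \<otimes> s) = \<phi> r \<otimes>\<^bsub>N\<^esub> \<phi> s"
    "\<And>r s. r \<in> S ==> s \<in> S ==> \<phi> (r \<oplus> s) = \<phi> r \<oplus>\<^bsub>N\<^esub> \<phi> s"
    "\<phi> \<one> = \<one>\<^bsub>N\<^esub>" "\<And>c s. c \<in> carrier K ==> s \<in> S ==> \<phi> (c \<odot> s) = c \<odot>\<^bsub>N\<^esub> \<phi> s"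
    using alg_homD[OF phi] by auto
  have uk: "u [^]\<^bsub>N\<^esub> k \<in> carrier N" for k :: int using u by simp
  have uc: "u \<in> carrier N" using u by auto
  have u1: "u [^]\<^bsub>N\<^esub> (i + 1) = u \<otimes>\<^bsub>N\<^esub> u [^]\<^bsub>N\<^esub> i" for i :: int
    using N.A.Units_int_pow_add[OF u, of 1 i] u by (simp add: add.commute)
  have "\<exists>F. (\<forall>a \<in> carrier M. F a \<in> carrier N) \<and>
    (\<forall>u \<in> carrier M. \<forall>v \<in> carrier M. F (u \<oplus> v) = F u \<oplus>\<^bsub>N\<^esub> F v) \<and>
    (\<forall>s \<in> S. \<forall>i::int. F (s \<otimes> y [^] i) = \<phi> s \<otimes>\<^bsub>N\<^esub> u [^]\<^bsub>N\<^esub> i)"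
    by (rule basis_extend[where f = "\<lambda>i s. \<phi> s \<otimes>\<^bsub>N\<^esub> u [^]\<^bsub>N\<^esub> i"])
      (auto simp: N.A.abelian_group_axioms ph uk N.A.l_distr)
  then obtain F where F: "\<And>a. a \<in> carrier M ==> F a \<in> carrier N"
    "\<And>u v. u \<in> carrier M ==> v \<in> carrier M ==> F (u \<oplus> v) = F u \<oplus>\<^bsub>N\<^esub> F v"
    "\<And>s i. s \<in> S ==> F (s \<otimes> y [^] (i::int)) = \<phi> s \<otimes>\<^bsub>N\<^esub> u [^]\<^bsub>N\<^esub> i" by blast
  have FS: "F s = \<phi> s" if "s \<in> S" for s using F(3)[OF that, of 0] that ph(1) by simp
  have F1: "F \<one> = \<one>\<^bsub>N\<^esub>" using FS SE(3) ph(4) by simp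
  have Fyi: "F (y [^] i) = u [^]\<^bsub>N\<^esub> i" for i :: int
    using F(3)[OF SE(3), of i] ph(4) uk by simp
  have Fs: "F (s \<otimes> a) = \<phi> s \<otimes>\<^bsub>N\<^esub> F a" if s: "s \<in> S" and a: "a \<in> carrier M" for s a
    using a
  proof (induct rule: basis_induct)
    case (monom r i)
    then have "F (s \<otimes> (r \<otimes> y [^] i)) = F (s \<otimes> r \<otimes> y [^] i)" using s by (simp add: A.m_assoc)
    also have "\<dots> = \<phi> s \<otimes>\<^bsub>N\<^esub> F (r \<otimes> y [^] i)"
      using monom s SE(6)[OF s monom] by (simp add: F ph uk N.A.m_assoc)
    finally show ?case .
  next
    case (add u v)
    then show ?case using s by (simp add: A.r_distr F ph N.A.r_distr)
  qed
  have Fya: "F (y \<otimes> a) = u \<otimes>\<^bsub>N\<^esub> F a" if a: "a \<in> carrier M" for a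
    using a
  proof (induct rule: basis_induct)
    case (monom r i)
    have "y \<otimes> (r \<otimes> y [^] i) = \<tau> r \<otimes> y [^] (i + 1)"
      using monom by (simp add: y_comm y_add1 A.m_assoc flip: A.m_assoc[of y r])
    then have "F (y \<otimes> (r \<otimes> y [^] i)) = \<phi> (\<tau> r) \<otimes>\<^bsub>N\<^esub> u [^]\<^bsub>N\<^esub> (i + 1)"
      using monom by (simp add: F)
    also have "\<dots> = (u \<otimes>\<^bsub>N\<^esub> \<phi> r) \<otimes>\<^bsub>N\<^esub> u [^]\<^bsub>N\<^esub> i"
      using monom uc uk by (simp add: comm ph N.A.m_assoc u1)
    also have "\<dots> = u \<otimes>\<^bsub>N\<^esub> F (r \<otimes> y [^] i)"
      using monom uc uk by (simp add: F ph N.A.m_assoc)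
    finally show ?case .
  next
    case (add v w)
    then show ?case using uc by (simp add: A.r_distr F N.A.r_distr)
  qed
  have Fyn: "F (y [^] int n \<otimes> a) = u [^]\<^bsub>N\<^esub> int n \<otimes>\<^bsub>N\<^esub> F a" if a: "a \<in> carrier M" for a n
    using a
  proof (induct n arbitrary: a)
    case (Suc n)
    have "int (Suc n) = int n + 1" by simp
    then show ?case
      using Suc u uc F(1) Fya uk y_add1[of "int n"] u1[of "int n"] by (simp only: A.m_assoc N.A.m_assoc y_carr A.Units_int_pow_carrier y_unit A.m_closed)
  qed (use F in simp)
  have Fyk: "F (y [^] i \<otimes> a) = u [^]\<^bsub>N\<^esub> i \<otimes>\<^bsub>N\<^esub> F a" if a: "a \<in> carrier M" for a and i :: int
  proof (cases "i \<ge> 0")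
    case True
    then show ?thesis using Fyn[OF a, of "nat i"] by simp
  next
    case False
    let ?n = "nat (- i)"
    have n: "int ?n = - i" using False by simp
    \<comment> \<open>Applies the rule for the positive power \<open>y [^] (- i)\<close> to
      \<open>y [^] i \<otimes> a\<close> and solves for its image.\<close>
    have "F a = F (y [^] (- i) \<otimes> (y [^] i \<otimes> a))" using a by (simp flip: A.m_assoc)
    also have "\<dots> = u [^]\<^bsub>N\<^esub> (- i) \<otimes>\<^bsub>N\<^esub> F (y [^] i \<otimes> a)" using Fyn[of "y [^] i \<otimes> a" ?n] a unfolding n by simp
    finally have "u [^]\<^bsub>N\<^esub> i \<otimes>\<^bsub>N\<^esub> F a = F (y [^] i \<otimes> a)"
      using a u F(1) by (simp flip: N.A.m_assoc)
    then show ?thesis by simp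
  qed
  have "F \<in> alg_hom K M N"
  proof (rule alg_homI)
    fix a b assume a: "a \<in> carrier M" and b: "b \<in> carrier M"
    show "F (a \<otimes> b) = F a \<otimes>\<^bsub>N\<^esub> F b"
      using a
    proof (induct rule: basis_induct)
      case (monom r i)
      then show ?case using b F(1) ph(1) uk by (simp add: A.m_assoc Fs Fyk Fyi N.A.m_assoc)
    next
      case (add u v)
      then show ?case using b by (simp add: A.l_distr F N.A.l_distr)
    qed
  next
    fix c a assume c: "c \<in> carrier K" and a: "a \<in> carrier M"
    show "F (c \<odot> a) = c \<odot>\<^bsub>N\<^esub> F a"
      using a
    proof (induct rule: basis_induct)
      case (monom r i)
      have "c \<odot> (r \<otimes> y [^] i) = (c \<odot> r) \<otimes> y [^] i" using monom c by (simp add: smult_mult_left)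
      then show ?case
        using F(3)[OF SD(2)[OF c monom], of i] F(3)[OF monom, of i] monom c ph uk by (simp add: N.smult_mult_left)
    next
      case (add u v)
      then show ?case using c by (simp add: smult_r_distr F N.smult_r_distr)
    qed
  qed (use F F1 in auto)
  moreover have "F y = u" using Fyi[of 1] u by simp
  ultimately show ?thesis using FS by blast
qed

end

section \<open>Transport of structure\<close>

lemma alg_iso_inv_apply:
  assumes "h \<in> alg_iso K M N" "z \<in> carrier N"
  shows "inv_into (carrier M) h z \<in> carrier M" "h (inv_into (carrier M) h z) = z"
  using assms alg_isoD(3)[OF assms(1)] by (metis inv_into_into, metis f_inv_into_f)

text \<open>Moves an algebra onto another type along an injection. Its zero is recorded because
  later rings of functions on exponent vectors must have a constant function as zero.\<close>

lemma transport_algebra: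
  fixes M :: "('k, 'a, 'n) module_scheme" and h :: "'a => 'b"
  assumes M: "nc_algebra K M" and inj: "inj_on h (carrier M)"
  shows "\<exists>N :: ('k, 'b) module. nc_algebra K N \<and> h \<in> alg_iso K M N \<and> \<zero>\<^bsub>N\<^esub> = h \<zero>\<^bsub>M\<^esub>"
proof -
  interpret M: nc_algebra K M by fact
  let ?g = "inv_into (carrier M) h"
  define N :: "('k, 'b) module" where "N = \<lparr>carrier = h ` carrier M, monoid.mult = \<lambda>x y. h (?g x \<otimes>\<^bsub>M\<^esub> ?g y),
    one = h \<one>\<^bsub>M\<^esub>, zero = h \<zero>\<^bsub>M\<^esub>, add = \<lambda>x y. h (?g x \<oplus>\<^bsub>M\<^esub> ?g y), module.smult = \<lambda>k x. h (k \<odot>\<^bsub>M\<^esub> ?g x)\<rparr>"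
  have g: "?g (h a) = a" if "a \<in> carrier M" for a using inj that by simp
  have cN: "carrier N = h ` carrier M" by (simp add: N_def)
  have op: "h a \<otimes>\<^bsub>N\<^esub> h b = h (a \<otimes>\<^bsub>M\<^esub> b)" "h a \<oplus>\<^bsub>N\<^esub> h b = h (a \<oplus>\<^bsub>M\<^esub> b)"
    if "a \<in> carrier M" "b \<in> carrier M" for a b using that by (simp_all add: N_def g)
  have sm: "k \<odot>\<^bsub>N\<^esub> h a = h (k \<odot>\<^bsub>M\<^esub> a)" if "a \<in> carrier M" for a k using that by (simp add: N_def g)
  have un: "\<one>\<^bsub>N\<^esub> = h \<one>\<^bsub>M\<^esub>" "\<zero>\<^bsub>N\<^esub> = h \<zero>\<^bsub>M\<^esub>" by (simp_all add: N_def)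
  have "abelian_group N"
  proof (rule abelian_groupI)
    fix x assume "x \<in> carrier N"
    then obtain a where a: "a \<in> carrier M" "x = h a" unfolding cN by auto
    then have "h (\<ominus>\<^bsub>M\<^esub> a) \<oplus>\<^bsub>N\<^esub> x = \<zero>\<^bsub>N\<^esub>" by (simp add: op un M.A.l_neg)
    then show "\<exists>y\<in>carrier N. y \<oplus>\<^bsub>N\<^esub> x = \<zero>\<^bsub>N\<^esub>" using a cN by blast
  qed (auto simp: cN op un M.A.a_ac)
  moreover have "monoid N" by (rule monoidI) (auto simp: cN op un M.A.m_assoc)
  ultimately have "ring N" by (rule ringI) (auto simp: cN op M.A.l_distr M.A.r_distr)
  then have "nc_algebra K N"
    by (intro nc_algebraI M.K.field_axioms)
      (auto simp: cN op sm un M.smult_l_distr M.smult_r_distr M.smult_assoc1 M.smult_mult_left M.smult_mult_right)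
  moreover have "h \<in> alg_iso K M N"
    by (intro alg_isoI alg_homI inj) (auto simp: cN op sm un)
  ultimately show ?thesis using un by blast
qed

text \<open>\<open>f'\<close> is the conjugate of f by h, so bijectivity and all laws carry
  over.\<close>

lemma alg_iso_image_sub:
  assumes h: "h \<in> alg_iso K M N" and S: "S \<subseteq> carrier M"
    and f: "f \<in> alg_iso K (M\<lparr>carrier := S\<rparr>) (M\<lparr>carrier := S\<rparr>)"
    and f': "\<And>s. s \<in> S ==> f' (h s) = h (f s)"
    and cl: "\<And>s t. s \<in> S ==> t \<in> S ==> s \<otimes>\<^bsub>M\<^esub> t \<in> S" "\<And>s t. s \<in> S ==> t \<in> S ==> s \<oplus>\<^bsub>M\<^esub> t \<in> S" "\<one>\<^bsub>M\<^esub> \<in> S"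
      "\<And>c s. c \<in> carrier K ==> s \<in> S ==> c \<odot>\<^bsub>M\<^esub> s \<in> S"
  shows "f' \<in> alg_iso K (N\<lparr>carrier := h ` S\<rparr>) (N\<lparr>carrier := h ` S\<rparr>)"
proof -
  note hh = alg_homD[OF alg_isoD(1)[OF h]] and ff = alg_homD[OF alg_isoD(1)[OF f]]
  note sub = subsetD[OF S]
  have fS: "f s \<in> S" if "s \<in> S" for s using ff(1) that by simp
  show ?thesis
  proof (intro alg_isoI alg_homI)
    fix x z assume "x \<in> carrier (N\<lparr>carrier := h ` S\<rparr>)" "z \<in> carrier (N\<lparr>carrier := h ` S\<rparr>)"
    then obtain s t where s: "s \<in> S" "x = h s" and t: "t \<in> S" "z = h t" by auto
    show "f' (x \<otimes>\<^bsub>N\<lparr>carrier := h ` S\<rparr>\<^esub> z) = f' x \<otimes>\<^bsub>N\<lparr>carrier := h ` S\<rparr>\<^esub> f' z"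
      "f' (x \<oplus>\<^bsub>N\<lparr>carrier := h ` S\<rparr>\<^esub> z) = f' x \<oplus>\<^bsub>N\<lparr>carrier := h ` S\<rparr>\<^esub> f' z"
      using s t fS sub ff(2,3) cl f' by (simp_all flip: hh(2,3)[OF sub sub])
  next
    fix c x assume c: "c \<in> carrier K" and "x \<in> carrier (N\<lparr>carrier := h ` S\<rparr>)"
    then obtain s where s: "s \<in> S" "x = h s" by auto
    show "f' (c \<odot>\<^bsub>N\<lparr>carrier := h ` S\<rparr>\<^esub> x) = c \<odot>\<^bsub>N\<lparr>carrier := h ` S\<rparr>\<^esub> f' x"
      using c s fS sub ff(5) cl f' by (simp flip: hh(5)[OF c sub])
  next
    show "f' \<one>\<^bsub>N\<lparr>carrier := h ` S\<rparr>\<^esub> = \<one>\<^bsub>N\<lparr>carrier := h ` S\<rparr>\<^esub>"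
      using ff(4) f'[OF cl(3)] hh(4) by simp
    have "f' ` h ` S = h ` f ` S" using f' by (auto simp: image_iff)
    then show "f' ` carrier (N\<lparr>carrier := h ` S\<rparr>) = carrier (N\<lparr>carrier := h ` S\<rparr>)"
      using alg_isoD(3)[OF f] by simp
    show "inj_on f' (carrier (N\<lparr>carrier := h ` S\<rparr>))"
    proof (rule inj_onI)
      fix x z assume "x \<in> carrier (N\<lparr>carrier := h ` S\<rparr>)" "z \<in> carrier (N\<lparr>carrier := h ` S\<rparr>)" and e: "f' x = f' z"
      then obtain s t where s: "s \<in> S" "x = h s" and t: "t \<in> S" "z = h t" by auto
      then have "h (f s) = h (f t)" using e f' by simp
      then have "f s = f t" using inj_onD[OF alg_isoD(2)[OF h]] s t fS sub by blast
      then show "x = z" using inj_onD[OF alg_isoD(2)[OF f], of s t] s t by simp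
    qed
  qed (use f' fS in auto)
qed

lemma free_basis_transport:
  assumes M: "nc_algebra K M" and N: "nc_algebra K N" and h: "h \<in> alg_iso K M N"
    and S: "subring S M" and b: "\<And>i. b i \<in> carrier M" and fb: "free_basis M S b"
    and b': "\<And>i. b' i = h (b i)"
  shows "free_basis N (h ` S) b'"
proof -
  interpret M: nc_algebra K M by fact
  interpret N: nc_algebra K N by fact
  interpret B: left_basis M S b
    by (intro left_basis.intro left_family.intro left_family_axioms.intro left_basis_axioms.intro M.A.ring_axioms S b fb)
  note hh = alg_homD[OF alg_isoD(1)[OF h]]
  have h0: "h \<zero>\<^bsub>M\<^esub> = \<zero>\<^bsub>N\<^esub>" by (rule alg_hom_zero[OF M.A.ring_axioms N.A.ring_axioms alg_isoD(1)[OF h]])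
  have z: "h a = \<zero>\<^bsub>N\<^esub> \<longleftrightarrow> a = \<zero>\<^bsub>M\<^esub>" if "a \<in> carrier M" for a
    using inj_onD[OF alg_isoD(2)[OF h], of a "\<zero>\<^bsub>M\<^esub>"] that h0 by auto
  have S': "subring (h ` S) N"
  proof (rule N.A.subringI)
    show "\<one>\<^bsub>N\<^esub> \<in> h ` S" using hh(4) B.SE(3) by (metis imageI)
  next
    fix x assume "x \<in> h ` S"
    then obtain s where "s \<in> S" "x = h s" by auto
    then show "\<ominus>\<^bsub>N\<^esub> x \<in> h ` S"
      using alg_hom_minus[OF M.A.ring_axioms N.A.ring_axioms alg_isoD(1)[OF h]] B.SE(5) B.S_carrier by (metis imageI)
  next
    fix x z assume "x \<in> h ` S" "z \<in> h ` S"
    then obtain s t where "s \<in> S" "x = h s" "t \<in> S" "z = h t" by auto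
    then show "x \<otimes>\<^bsub>N\<^esub> z \<in> h ` S" "x \<oplus>\<^bsub>N\<^esub> z \<in> h ` S"
      using hh(2,3)[OF B.S_carrier B.S_carrier] B.SE(6,7) by (metis imageI)+
  qed (use hh(1) B.S_carrier in auto)
  interpret B': left_family N "h ` S" b'
    by (intro left_family.intro left_family_axioms.intro N.A.ring_axioms S') (simp add: b' hh(1) b)
  have hl: "(\<lambda>i. h (c i)) \<in> fin_coeffs N (h ` S)" "h (lcomb M b c) = lcomb N b' (\<lambda>i. h (c i))"
    if c: "c \<in> fin_coeffs M S" for c
  proof -
    have cc: "c i \<in> carrier M" for i using B.fin_coeffsD(3)[OF c] .
    have supp: "{i. h (c i) ~= \<zero>\<^bsub>N\<^esub>} = {i. c i ~= \<zero>\<^bsub>M\<^esub>}" using z[OF cc] by auto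
    show "(\<lambda>i. h (c i)) \<in> fin_coeffs N (h ` S)"
      unfolding fin_coeffs_def using supp B.fin_coeffsD(1,2)[OF c] by auto
    have "h (lcomb M b c) = (\<Oplus>\<^bsub>N\<^esub>i\<in>{i. c i ~= \<zero>\<^bsub>M\<^esub>}. h (c i \<otimes>\<^bsub>M\<^esub> b i))"
      unfolding lcomb_def
      by (rule alg_hom_finsum[OF M.A.ring_axioms N.A.ring_axioms alg_isoD(1)[OF h]]) (use cc b in auto)
    also have "\<dots> = lcomb N b' (\<lambda>i. h (c i))"
      unfolding lcomb_def supp using cc b hh b' by (intro N.A.finsum_cong') auto
    finally show "h (lcomb M b c) = lcomb N b' (\<lambda>i. h (c i))" .
  qed
  show ?thesis
  proof (rule B'.free_basisI)
    fix a assume "a \<in> carrier N"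
    then obtain m where m: "m \<in> carrier M" "a = h m" using alg_isoD(3)[OF h] by (metis imageE)
    then obtain c where "c \<in> fin_coeffs M S" "m = lcomb M b c" using B.coeffs_ex by blast
    then show "\<exists>c\<in>fin_coeffs N (h ` S). a = lcomb N b' c" using hl m by blast
  next
    fix c' assume c': "c' \<in> fin_coeffs N (h ` S)" "lcomb N b' c' = \<zero>\<^bsub>N\<^esub>"
    have "\<forall>i. \<exists>s. s \<in> S \<and> c' i = h s" using B'.fin_coeffsD(1)[OF c'(1)] by blast
    then obtain c where c: "\<And>i. c i \<in> S" "\<And>i. c' i = h (c i)" by metis
    have c'_eq: "c' = (\<lambda>i. h (c i))" using c(2) by auto
    have supp: "{i. c' i ~= \<zero>\<^bsub>N\<^esub>} = {i. c i ~= \<zero>\<^bsub>M\<^esub>}" using z c B.S_carrier by simp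
    have cf: "c \<in> fin_coeffs M S"
      using c(1) B'.fin_coeffsD(2)[OF c'(1)] supp unfolding fin_coeffs_def by simp
    have "h (lcomb M b c) = \<zero>\<^bsub>N\<^esub>" using hl(2)[OF cf] c'(2) c'_eq by simp
    then have "lcomb M b c = \<zero>\<^bsub>M\<^esub>" using z B.lcomb_closed[OF cf] by blast
    then show "c' = (\<lambda>_. \<zero>\<^bsub>N\<^esub>)" using B.coeffs_zero[OF cf] c(2) h0 by auto
  qed
qed

lemma skew_laurent_transport:
  assumes L: "skew_laurent_ring K M S y \<tau>" and N: "nc_algebra K N" and h: "h \<in> alg_iso K M N"
    and t: "\<And>s. s \<in> S ==> \<tau>' (h s) = h (\<tau> s)"
  shows "skew_laurent_ring K N (h ` S) (h y) \<tau>'"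
proof -
  interpret skew_laur K M S y \<tau> by (unfold_locales) (rule L)
  interpret N: nc_algebra K N by fact
  note hh = alg_homD[OF alg_isoD(1)[OF h]]
  have y': "h y \<in> Units N"
    using alg_hom_Units(1)[OF A.ring_axioms N.A.ring_axioms alg_isoD(1)[OF h] y_unit] .
  have "free_basis N (h ` S) (\<lambda>i::int. h y [^]\<^bsub>N\<^esub> i)"
    by (rule free_basis_transport[OF alg N h S b free])
      (simp add: alg_hom_int_pow[OF A.ring_axioms N.A.ring_axioms alg_isoD(1)[OF h] y_unit])
  moreover have "\<tau>' \<in> alg_iso K (N\<lparr>carrier := h ` S\<rparr>) (N\<lparr>carrier := h ` S\<rparr>)"
    by (rule alg_iso_image_sub[OF h SE(1) tau_iso t]) (use SD in auto)
  moreover have "h y \<otimes>\<^bsub>N\<^esub> r = \<tau>' r \<otimes>\<^bsub>N\<^esub> h y" if "r \<in> h ` S" for r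
    using that t y_comm by (auto simp flip: hh(2))
  ultimately show ?thesis
    unfolding skew_laurent_ring_def
    using N y' alg_hom_image_subalg[OF alg N alg_isoD(1)[OF h] sub]
    unfolding free_basis_def fin_coeffs_def lcomb_def by (simp add: conj_assoc)
qed

section \<open>Existence of skew Laurent rings\<close>

text \<open>Integer powers of \<open>\<tau>\<close>, with iterates of \<open>inv_into\<close> for
  negative exponents; only values on the carrier are meaningful. In the downward induction for the
  exponent law, both sides are compared after applying the injective \<open>\<tau>\<close>.\<close>

lemma automorphism_powers:
  assumes C: "nc_algebra K C" and tau: "\<tau> \<in> alg_iso K C C"
  shows "\<exists>t :: int => 'c => 'c. (\<forall>i. t i \<in> alg_hom K C C) \<and> (\<forall>a \<in> carrier C. t 0 a = a) \<and>
    (\<forall>i j. \<forall>a \<in> carrier C. t (i + j) a = t i (t j a)) \<and> (\<forall>a \<in> carrier C. t 1 a = \<tau> a)"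
proof -
  let ?g = "inv_into (carrier C) \<tau>"
  define t where "t i = (if i \<ge> 0 then \<tau> ^^ nat i else ?g ^^ nat (- i))" for i :: int
  have g: "?g \<in> alg_iso K C C" by (rule alg_iso_inv[OF C tau])
  have pw: "f ^^ n \<in> alg_hom K C C" if f: "f \<in> alg_hom K C C" for f and n :: nat
  proof (induct n)
    case 0
    show ?case by (rule alg_homI) auto
  next
    case (Suc n)
    have "(\<lambda>a. f ((f ^^ n) a)) \<in> alg_hom K C C" by (rule alg_hom_comp[OF Suc f])
    then show ?case by (simp add: comp_def)
  qed
  have t_hom: "t i \<in> alg_hom K C C" for i
    unfolding t_def using pw alg_isoD(1)[OF tau] alg_isoD(1)[OF g] by auto
  have tc: "t i a \<in> carrier C" if "a \<in> carrier C" for i a using alg_homD(1)[OF t_hom that] .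
  have t_Suc: "t (i + 1) a = \<tau> (t i a)" if a: "a \<in> carrier C" for i a
  proof (cases "i \<ge> 0")
    case True
    then have "nat (i + 1) = Suc (nat i)" by simp
    then show ?thesis using True by (simp add: t_def)
  next
    case False
    then obtain n where n: "i = - int (Suc n)" by (metis int_cases not_less of_nat_0_le_iff)
    have nn: "nat (- i) = Suc n" using n by simp
    have gn: "(?g ^^ n) a \<in> carrier C" using alg_homD(1)[OF pw[OF alg_isoD(1)[OF g]] a] .
    have "t i a = ?g ((?g ^^ n) a)" using False nn by (simp add: t_def)
    then have "\<tau> (t i a) = (?g ^^ n) a" using alg_iso_inv_apply(2)[OF tau gn] by simp
    also have "\<dots> = t (i + 1) a" by (simp add: t_def n)
    finally show ?thesis by simp
  qed
  have t0: "t 0 a = a" for a by (simp add: t_def)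
  have "t (i + j) a = t i (t j a)" if a: "a \<in> carrier C" for i j a
  proof (induct i rule: int_induct[where k = 0])
    case base
    show ?case by (simp add: t0)
  next
    case (step1 i)
    have "t (i + 1 + j) a = \<tau> (t (i + j) a)" using t_Suc[OF a, of "i + j"] by (simp add: add_ac)
    then show ?case using step1 t_Suc[OF tc[OF a]] by simp
  next
    case (step2 i)
    have "\<tau> (t (i - 1 + j) a) = t (i + j) a" using t_Suc[OF a, of "i - 1 + j"] by (simp add: add_ac)
    also have "\<dots> = \<tau> (t (i - 1) (t j a))" using step2 t_Suc[OF tc[OF a], of "i - 1"] by simp
    finally show ?case using inj_onD[OF alg_isoD(2)[OF tau]] tc a by meson
  qed
  moreover have "t 1 a = \<tau> a" for a by (simp add: t_def)
  ultimately show ?thesis using t_hom t0 by blast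
qed

section \<open>The skew Laurent ring as a ring of finitely supported families\<close>

locale laurent_construction =
  fixes K :: "('k, 'm) ring_scheme" and C :: "('k, 'c, 'n) module_scheme" (structure)
    and t :: "int => 'c => 'c"
  assumes alg: "nc_algebra K C" and t_hom: "\<And>i. t i \<in> alg_hom K C C"
    and t0: "\<And>a. a \<in> carrier C ==> t 0 a = a"
    and t_add: "\<And>i j a. a \<in> carrier C ==> t (i + j) a = t i (t j a)"

sublocale laurent_construction \<subseteq> nc_algebra K C
  by (rule alg)

context laurent_construction
begin

text \<open>A family c stands for the sum of the c_i y^i, and the product is the one forced by y^i a
  = t_i(a) y^i. Summing over the support of c keeps the convolution finite although all integers are
  exponents.\<close>

definition L :: "('k, int => 'c) module" where
  "L = \<lparr>carrier = {c. (\<forall>i. c i \<in> carrier C) \<and> finite {i. c i ~= \<zero>}},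
    monoid.mult = \<lambda>c d m. \<Oplus>i\<in>{i. c i ~= \<zero>}. c i \<otimes> t i (d (m - i)),
    one = (\<lambda>i. if i = 0 then \<one> else \<zero>), zero = (\<lambda>_. \<zero>), add = (\<lambda>c d i. c i \<oplus> d i),
    module.smult = (\<lambda>k c i. k \<odot> c i)\<rparr>"

definition mono :: "'c => int => int => 'c" where
  "mono a i = (\<lambda>j. if j = i then a else \<zero>)"

lemma t_closed [simp]: "a \<in> carrier C ==> t i a \<in> carrier C"
  by (rule alg_homD(1)[OF t_hom])

lemma t_eq: "a \<in> carrier C ==> b \<in> carrier C ==> t i (a \<otimes> b) = t i a \<otimes> t i b"
  "a \<in> carrier C ==> b \<in> carrier C ==> t i (a \<oplus> b) = t i a \<oplus> t i b"
  "k \<in> carrier K ==> a \<in> carrier C ==> t i (k \<odot> a) = k \<odot> t i a"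
  by (auto intro: alg_homD[OF t_hom])

lemma t_simps [simp]: "t i \<one> = \<one>" "t i \<zero> = \<zero>"
  using alg_homD(4)[OF t_hom] alg_hom_zero[OF A.ring_axioms A.ring_axioms t_hom] by auto

lemma LD: "c \<in> carrier L ==> c i \<in> carrier C" "c \<in> carrier L ==> finite {i. c i ~= \<zero>}"
  by (auto simp: L_def)

lemma LI: "(\<And>i. c i \<in> carrier C) ==> finite F ==> (\<And>i. i \<notin> F ==> c i = \<zero>) ==> c \<in> carrier L"
  unfolding L_def by (auto intro: finite_subset[of _ F])

lemma L_simps: "(c \<oplus>\<^bsub>L\<^esub> d) = (\<lambda>i. c i \<oplus> d i)" "(k \<odot>\<^bsub>L\<^esub> c) = (\<lambda>i. k \<odot> c i)" "\<zero>\<^bsub>L\<^esub> = (\<lambda>_. \<zero>)" "\<one>\<^bsub>L\<^esub> = mono \<one> 0"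
  by (auto simp: L_def mono_def)

lemma mono_closed [simp]: "a \<in> carrier C ==> mono a i \<in> carrier L"
  by (rule LI[of _ "{i}"]) (auto simp: mono_def)

lemma add_closed: "c \<in> carrier L ==> d \<in> carrier L ==> c \<oplus>\<^bsub>L\<^esub> d \<in> carrier L"
  by (rule LI[of _ "{i. c i ~= \<zero>} \<union> {i. d i ~= \<zero>}"]) (auto simp: L_simps LD)

lemma smult_closed': "k \<in> carrier K ==> c \<in> carrier L ==> k \<odot>\<^bsub>L\<^esub> c \<in> carrier L"
  by (rule LI[of _ "{i. c i ~= \<zero>}"]) (auto simp: L_simps LD)

lemma abelian: "abelian_group L"
proof (rule abelian_groupI)
  fix c assume c: "c \<in> carrier L"
  have "(\<lambda>i. \<ominus> c i) \<in> carrier L" by (rule LI[of _ "{i. c i ~= \<zero>}"]) (use c in \<open>auto simp: LD\<close>)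
  moreover have "(\<lambda>i. \<ominus> c i) \<oplus>\<^bsub>L\<^esub> c = \<zero>\<^bsub>L\<^esub>" using c by (auto simp: L_simps LD A.l_neg)
  ultimately show "\<exists>y\<in>carrier L. y \<oplus>\<^bsub>L\<^esub> c = \<zero>\<^bsub>L\<^esub>" by blast
next
  show "\<zero>\<^bsub>L\<^esub> \<in> carrier L" by (rule LI[of _ "{}"]) (auto simp: L_simps)
qed (auto simp: add_closed, auto simp: L_simps LD A.a_ac)

lemma L_induct [consumes 1, case_names mono add]:
  assumes "c \<in> carrier L"
    and mono: "\<And>a i. a \<in> carrier C ==> P (mono a i)"
    and add: "\<And>u v. [|u \<in> carrier L; v \<in> carrier L; P u; P v|] ==> P (u \<oplus>\<^bsub>L\<^esub> v)"
  shows "P c"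
proof -
  have "P c" if "finite F" "c \<in> carrier L" "{i. c i ~= \<zero>} \<subseteq> F" for F c
    using that
  proof (induct F arbitrary: c)
    case empty
    then have "c = mono \<zero> 0" by (auto simp: mono_def)
    then show ?case using mono by simp
  next
    case (insert i F)
    let ?d = "\<lambda>j. if j = i then \<zero> else c j"
    have d: "?d \<in> carrier L" by (rule LI[of _ "{i. c i ~= \<zero>}"]) (use insert in \<open>auto simp: LD\<close>)
    have "{j. ?d j ~= \<zero>} \<subseteq> F" using insert(5) by auto
    then have "P ?d" using insert d by blast
    moreover have "c = mono (c i) i \<oplus>\<^bsub>L\<^esub> ?d" using insert(4) by (auto simp: L_simps mono_def LD)
    ultimately show ?case using add[of "mono (c i) i" ?d] mono[of "c i" i] insert(4) d LD by auto
  qed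
  then show ?thesis using assms(1) LD by blast
qed

lemma mult_superset:
  assumes "c \<in> carrier L" "d \<in> carrier L" "finite F" "{i. c i ~= \<zero>} \<subseteq> F"
  shows "(c \<otimes>\<^bsub>L\<^esub> d) m = (\<Oplus>i\<in>F. c i \<otimes> t i (d (m - i)))"
proof -
  have "(c \<otimes>\<^bsub>L\<^esub> d) m = (\<Oplus>i\<in>{i. c i ~= \<zero>}. c i \<otimes> t i (d (m - i)))" by (simp add: L_def)
  also have "\<dots> = (\<Oplus>i\<in>F. c i \<otimes> t i (d (m - i)))"
    by (rule A.add.finprod_mono_neutral_cong_left) (use assms in \<open>auto simp: LD\<close>)
  finally show ?thesis .
qed

lemma mult_l_distr:
  assumes "c \<in> carrier L" "c' \<in> carrier L" "d \<in> carrier L"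
  shows "(c \<oplus>\<^bsub>L\<^esub> c') \<otimes>\<^bsub>L\<^esub> d = (c \<otimes>\<^bsub>L\<^esub> d) \<oplus>\<^bsub>L\<^esub> (c' \<otimes>\<^bsub>L\<^esub> d)"
proof
  fix m
  let ?F = "{i. c i ~= \<zero>} \<union> {i. c' i ~= \<zero>}"
  have F: "finite ?F" "{i. c i ~= \<zero>} \<subseteq> ?F" "{i. c' i ~= \<zero>} \<subseteq> ?F" "{i. (c \<oplus>\<^bsub>L\<^esub> c') i ~= \<zero>} \<subseteq> ?F"
    using LD(2)[OF assms(1)] LD(2)[OF assms(2)] by (auto simp: L_simps)
  have "((c \<oplus>\<^bsub>L\<^esub> c') \<otimes>\<^bsub>L\<^esub> d) m = (\<Oplus>i\<in>?F. (c \<oplus>\<^bsub>L\<^esub> c') i \<otimes> t i (d (m - i)))"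
    by (rule mult_superset[OF add_closed[OF assms(1,2)] assms(3) F(1,4)])
  also have "\<dots> = (\<Oplus>i\<in>?F. c i \<otimes> t i (d (m - i)) \<oplus> c' i \<otimes> t i (d (m - i)))"
    by (rule A.finsum_cong') (use assms in \<open>auto simp: L_simps LD A.l_distr\<close>)
  also have "\<dots> = (\<Oplus>i\<in>?F. c i \<otimes> t i (d (m - i))) \<oplus> (\<Oplus>i\<in>?F. c' i \<otimes> t i (d (m - i)))"
    by (rule A.finsum_addf) (use assms in \<open>auto simp: LD\<close>)
  finally show "((c \<oplus>\<^bsub>L\<^esub> c') \<otimes>\<^bsub>L\<^esub> d) m = ((c \<otimes>\<^bsub>L\<^esub> d) \<oplus>\<^bsub>L\<^esub> (c' \<otimes>\<^bsub>L\<^esub> d)) m"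
    using mult_superset[OF assms(1,3) F(1,2)] mult_superset[OF assms(2,3) F(1,3)] by (simp add: L_simps)
qed

lemma mult_r_distr:
  assumes "c \<in> carrier L" "d \<in> carrier L" "d' \<in> carrier L"
  shows "c \<otimes>\<^bsub>L\<^esub> (d \<oplus>\<^bsub>L\<^esub> d') = (c \<otimes>\<^bsub>L\<^esub> d) \<oplus>\<^bsub>L\<^esub> (c \<otimes>\<^bsub>L\<^esub> d')"
proof
  fix m
  let ?F = "{i. c i ~= \<zero>}"
  have "(c \<otimes>\<^bsub>L\<^esub> (d \<oplus>\<^bsub>L\<^esub> d')) m = (\<Oplus>i\<in>?F. c i \<otimes> t i (d (m - i)) \<oplus> c i \<otimes> t i (d' (m - i)))"
    unfolding mult_superset[OF assms(1) add_closed[OF assms(2,3)] LD(2)[OF assms(1)] subset_refl]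
    by (rule A.finsum_cong') (use assms in \<open>auto simp: L_simps LD A.r_distr t_eq\<close>)
  also have "\<dots> = (\<Oplus>i\<in>?F. c i \<otimes> t i (d (m - i))) \<oplus> (\<Oplus>i\<in>?F. c i \<otimes> t i (d' (m - i)))"
    by (rule A.finsum_addf) (use assms in \<open>auto simp: LD\<close>)
  finally show "(c \<otimes>\<^bsub>L\<^esub> (d \<oplus>\<^bsub>L\<^esub> d')) m = ((c \<otimes>\<^bsub>L\<^esub> d) \<oplus>\<^bsub>L\<^esub> (c \<otimes>\<^bsub>L\<^esub> d')) m"
    by (simp add: L_simps) (simp add: L_def)
qed

lemma mono_mult:
  assumes "a \<in> carrier C" "b \<in> carrier C"
  shows "mono a i \<otimes>\<^bsub>L\<^esub> mono b j = mono (a \<otimes> t i b) (i + j)"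
proof
  fix m
  have "(mono a i \<otimes>\<^bsub>L\<^esub> mono b j) m = (\<Oplus>k\<in>{i}. mono a i k \<otimes> t k (mono b j (m - k)))"
    by (rule mult_superset[OF mono_closed mono_closed]) (use assms in \<open>auto simp: mono_def\<close>)
  also have "\<dots> = a \<otimes> t i (mono b j (m - i))"
    using assms by (subst A.finsum_insert) (auto simp: mono_def)
  also have "\<dots> = mono (a \<otimes> t i b) (i + j) m" using assms by (auto simp: mono_def)
  finally show "(mono a i \<otimes>\<^bsub>L\<^esub> mono b j) m = mono (a \<otimes> t i b) (i + j) m" .
qed

lemma mult_closed: "c \<in> carrier L ==> d \<in> carrier L ==> c \<otimes>\<^bsub>L\<^esub> d \<in> carrier L"
proof (induct c rule: L_induct)
  case (mono a i)
  from mono(2,1) show ?case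
  proof (induct d rule: L_induct)
    case (mono b j)
    then show ?case by (simp add: mono_mult)
  next
    case (add u v)
    then show ?case by (simp add: mult_r_distr add_closed)
  qed
next
  case (add u v)
  then show ?case by (simp add: mult_l_distr add_closed)
qed

text \<open>Distributivity reduces all three factors to monomials, where associativity is the law
  \<open>t (i + j) c = t i (t j c)\<close>.\<close>

lemma mult_assoc:
  assumes "c \<in> carrier L" "d \<in> carrier L" "e \<in> carrier L"
  shows "(c \<otimes>\<^bsub>L\<^esub> d) \<otimes>\<^bsub>L\<^esub> e = c \<otimes>\<^bsub>L\<^esub> (d \<otimes>\<^bsub>L\<^esub> e)"
  using assms(1)
proof (induct c rule: L_induct)
  case (mono a i)
  note a = mono
  show ?case using assms(2)
  proof (induct d rule: L_induct)
    case (mono b j)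
    note b = mono
    show ?case using assms(3)
    proof (induct e rule: L_induct)
      case (mono c k)
      have "t (i + j) c = t i (t j c)" by (rule t_add[OF mono])
      then show ?case using a b mono by (simp add: mono_mult A.m_assoc t_eq add.assoc)
    next
      case (add u v)
      then show ?case using a b by (simp add: mult_r_distr mult_closed)
    qed
  next
    case (add u v)
    then show ?case using a assms(3) by (simp add: mult_r_distr mult_l_distr mult_closed)
  qed
next
  case (add u v)
  then show ?case using assms by (simp add: mult_l_distr mult_closed)
qed

lemma mult_one: "c \<in> carrier L ==> \<one>\<^bsub>L\<^esub> \<otimes>\<^bsub>L\<^esub> c = c" "c \<in> carrier L ==> c \<otimes>\<^bsub>L\<^esub> \<one>\<^bsub>L\<^esub> = c"
  by (induct c rule: L_induct; simp add: L_simps(4) mono_mult t0 mult_r_distr mult_l_distr)+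

lemma smult_mono: "k \<in> carrier K ==> k \<odot>\<^bsub>L\<^esub> mono a i = mono (k \<odot> a) i"
  by (auto simp: L_simps mono_def)

lemma smult_add: "[|k \<in> carrier K; c \<in> carrier L; d \<in> carrier L|] ==> k \<odot>\<^bsub>L\<^esub> (c \<oplus>\<^bsub>L\<^esub> d) = k \<odot>\<^bsub>L\<^esub> c \<oplus>\<^bsub>L\<^esub> k \<odot>\<^bsub>L\<^esub> d"
  by (auto simp: L_simps LD smult_r_distr)

lemma smult_mult:
  assumes "k \<in> carrier K" "c \<in> carrier L" "d \<in> carrier L"
  shows "(k \<odot>\<^bsub>L\<^esub> c) \<otimes>\<^bsub>L\<^esub> d = k \<odot>\<^bsub>L\<^esub> (c \<otimes>\<^bsub>L\<^esub> d)" "c \<otimes>\<^bsub>L\<^esub> (k \<odot>\<^bsub>L\<^esub> d) = k \<odot>\<^bsub>L\<^esub> (c \<otimes>\<^bsub>L\<^esub> d)"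
proof -
  have "(k \<odot>\<^bsub>L\<^esub> c) \<otimes>\<^bsub>L\<^esub> d = k \<odot>\<^bsub>L\<^esub> (c \<otimes>\<^bsub>L\<^esub> d) \<and> c \<otimes>\<^bsub>L\<^esub> (k \<odot>\<^bsub>L\<^esub> d) = k \<odot>\<^bsub>L\<^esub> (c \<otimes>\<^bsub>L\<^esub> d)"
    using assms(2)
  proof (induct c rule: L_induct)
    case (mono a i)
    note a = mono
    show ?case using assms(3)
    proof (induct d rule: L_induct)
      case (mono b j)
      then show ?case using a assms(1) by (simp add: smult_mono mono_mult smult_mult_left smult_mult_right t_eq)
    next
      case (add u v)
      then show ?case using a assms(1) by (simp add: mult_r_distr smult_add smult_closed' mult_closed)
    qed
  next
    case (add u v)
    then show ?case using assms by (simp add: mult_l_distr smult_add smult_closed' mult_closed)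
  qed
  then show "(k \<odot>\<^bsub>L\<^esub> c) \<otimes>\<^bsub>L\<^esub> d = k \<odot>\<^bsub>L\<^esub> (c \<otimes>\<^bsub>L\<^esub> d)" "c \<otimes>\<^bsub>L\<^esub> (k \<odot>\<^bsub>L\<^esub> d) = k \<odot>\<^bsub>L\<^esub> (c \<otimes>\<^bsub>L\<^esub> d)" by auto
qed

lemma L_algebra: "nc_algebra K L"
proof (rule nc_algebraI)
  have "monoid L"
    by (rule monoidI) (auto simp: mult_closed mult_assoc mult_one, simp add: L_simps(4))
  then show "ring L"
    by (rule ringI[OF abelian]) (auto simp: mult_l_distr mult_r_distr)
qed (use K.field_axioms smult_closed' smult_mult smult_add in
    \<open>auto simp: L_simps LD smult_l_distr smult_assoc1\<close>)

abbreviation emb :: "'c => int => 'c" where "emb a \<equiv> mono a 0"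

lemma emb_hom: "emb \<in> alg_hom K C L"
  by (rule alg_homI) (auto simp: mono_mult t0 smult_mono L_simps(4), auto simp: L_simps mono_def)

lemma emb_inj: "inj_on emb (carrier C)"
  by (rule inj_onI) (metis mono_def)

lemma mono_pow: "mono \<one> 1 [^]\<^bsub>L\<^esub> (n :: nat) = mono \<one> (int n)"
proof -
  interpret L: nc_algebra K L by (rule L_algebra)
  show ?thesis by (induct n) (auto simp: L_simps(4) mono_mult add.commute)
qed

lemma mono_unit: "mono \<one> i \<in> Units L" "inv\<^bsub>L\<^esub> (mono \<one> i) = mono \<one> (- i)"
proof -
  interpret L: nc_algebra K L by (rule L_algebra)
  have 1: "mono \<one> i \<otimes>\<^bsub>L\<^esub> mono \<one> (- i) = \<one>\<^bsub>L\<^esub>" "mono \<one> (- i) \<otimes>\<^bsub>L\<^esub> mono \<one> i = \<one>\<^bsub>L\<^esub>"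
    by (simp_all add: mono_mult L_simps(4))
  then show "mono \<one> i \<in> Units L" unfolding Units_def using mono_closed by blast
  show "inv\<^bsub>L\<^esub> (mono \<one> i) = mono \<one> (- i)" using 1 mono_closed L.A.inv_unique' by (metis A.one_closed)
qed

lemma mono_int_pow: "mono \<one> 1 [^]\<^bsub>L\<^esub> (i :: int) = mono \<one> i"
  by (simp add: int_pow_def2 mono_pow mono_unit del: pow_nat)

lemma L_skew_laurent:
  assumes tau: "\<tau> \<in> alg_iso K C C" and t1: "\<And>a. a \<in> carrier C ==> t 1 a = \<tau> a"
    and tau': "\<And>a. a \<in> carrier C ==> \<tau>' (emb a) = emb (\<tau> a)"
  shows "skew_laurent_ring K L (emb ` carrier C) (mono \<one> 1) \<tau>'"
proof -
  interpret L: nc_algebra K L by (rule L_algebra)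
  let ?S = "emb ` carrier C" and ?b = "\<lambda>i::int. mono \<one> 1 [^]\<^bsub>L\<^esub> i"
  have sub: "subalg K L ?S"
    by (rule alg_hom_image_subalg[OF alg L_algebra emb_hom subalg_carrier[OF alg]])
  note SD = subalgD[OF sub]
  interpret B: left_family L ?S ?b
    by (intro left_family.intro left_family_axioms.intro L.A.ring_axioms SD(1)) (simp add: mono_int_pow)
  \<comment> \<open>The coefficient \<open>c i\<close> is itself a family concentrated in exponent
    0, and multiplying it by y^i moves its value there to exponent i. So evaluation at m sees
    \<open>c m\<close> alone.\<close>
  have eval: "lcomb L ?b c m = c m 0" if c: "c \<in> fin_coeffs L ?S" for c m
  proof -
    let ?F = "insert m {i. c i ~= \<zero>\<^bsub>L\<^esub>}"
    have ci: "\<exists>a \<in> carrier C. c i = emb a" for i using B.fin_coeffsD(1)[OF c, of i] by auto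
    have cL: "c i \<in> carrier L" for i using B.fin_coeffsD(3)[OF c] .
    have ev: "(c i \<otimes>\<^bsub>L\<^esub> ?b i) m = (if m = i then c i 0 else \<zero>)" for i
    proof -
      obtain a where a: "a \<in> carrier C" "c i = emb a" using ci by blast
      then show ?thesis by (simp add: mono_int_pow mono_mult) (simp add: mono_def)
    qed
    have "lcomb L ?b c = (\<Oplus>\<^bsub>L\<^esub>i\<in>?F. c i \<otimes>\<^bsub>L\<^esub> ?b i)"
      by (rule B.lcomb_superset[OF c]) (use B.fin_coeffsD(2)[OF c] in auto)
    then have "lcomb L ?b c m = (\<Oplus>\<^bsub>L\<^esub>i\<in>?F. c i \<otimes>\<^bsub>L\<^esub> ?b i) m" by simp
    also have "\<dots> = (\<Oplus>i\<in>?F. (c i \<otimes>\<^bsub>L\<^esub> ?b i) m)"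
      by (rule additive_finsum[OF abelian A.abelian_group_axioms, where f = "\<lambda>c. c m"])
        (use cL mono_int_pow in \<open>auto simp: LD L_simps intro: L.A.m_closed\<close>)
    also have "\<dots> = (\<Oplus>i\<in>?F. (if m = i then c i 0 else \<zero>))" by (simp only: ev)
    also have "\<dots> = c m 0"
      by (rule A.finsum_singleton) (use B.fin_coeffsD(2)[OF c] LD(1)[OF cL] in auto)
    finally show ?thesis .
  qed
  have "free_basis L ?S ?b"
  proof (rule B.free_basisI)
    fix a assume a: "a \<in> carrier L"
    let ?c = "\<lambda>i. emb (a i)"
    have "{i. ?c i ~= \<zero>\<^bsub>L\<^esub>} \<subseteq> {i. a i ~= \<zero>}" by (auto simp: L_simps mono_def)
    then have c: "?c \<in> fin_coeffs L ?S"
      unfolding fin_coeffs_def using LD[OF a] finite_subset by blast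
    have "a = lcomb L ?b ?c" by (rule ext) (simp only: eval[OF c], simp add: mono_def)
    then show "\<exists>c\<in>fin_coeffs L ?S. a = lcomb L ?b c" using c by blast
  next
    fix c assume c: "c \<in> fin_coeffs L ?S" and z: "lcomb L ?b c = \<zero>\<^bsub>L\<^esub>"
    show "c = (\<lambda>_. \<zero>\<^bsub>L\<^esub>)"
    proof
      fix i
      obtain a where a: "a \<in> carrier C" "c i = emb a" using B.fin_coeffsD(1)[OF c, of i] by auto
      have "c i 0 = \<zero>" using eval[OF c, of i] z by (simp add: L_simps)
      then show "c i = \<zero>\<^bsub>L\<^esub>" using a by (auto simp: mono_def L_simps)
    qed
  qed
  moreover have "\<tau>' \<in> alg_iso K (L\<lparr>carrier := ?S\<rparr>) (L\<lparr>carrier := ?S\<rparr>)"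
  proof -
    have 1: "emb \<in> alg_iso K C (L\<lparr>carrier := ?S\<rparr>)"
      using emb_hom emb_inj unfolding alg_iso_iff bij_betw_def
      by (auto intro!: alg_homI simp: alg_homD[OF emb_hom])
    have 2: "\<tau> \<in> alg_iso K (C\<lparr>carrier := carrier C\<rparr>) (C\<lparr>carrier := carrier C\<rparr>)" using tau by simp
    have "\<tau>' \<in> alg_iso K ((L\<lparr>carrier := ?S\<rparr>)\<lparr>carrier := ?S\<rparr>) ((L\<lparr>carrier := ?S\<rparr>)\<lparr>carrier := ?S\<rparr>)"
      by (rule alg_iso_image_sub[OF 1 subset_refl 2 tau']) auto
    then show ?thesis by simp
  qed
  moreover have "mono \<one> 1 \<otimes>\<^bsub>L\<^esub> r = \<tau>' r \<otimes>\<^bsub>L\<^esub> mono \<one> 1" if "r \<in> ?S" for r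
  proof -
    obtain a where a: "a \<in> carrier C" "r = emb a" using \<open>r \<in> ?S\<close> by auto
    have "\<tau> a \<in> carrier C" using alg_homD(1)[OF alg_isoD(1)[OF tau]] a by simp
    then show ?thesis using a t1 tau' by (simp add: mono_mult)
  qed
  ultimately show ?thesis
    unfolding skew_laurent_ring_def
    using L_algebra mono_unit(1) sub
    unfolding free_basis_def fin_coeffs_def lcomb_def by (simp add: conj_assoc)
qed

end

lemma (in nc_algebra) smult_inv_cancel:
  assumes "c \<in> carrier K" "c ~= \<zero>\<^bsub>K\<^esub>" "s \<in> carrier A"
  shows "inv\<^bsub>K\<^esub> c \<odot>\<^bsub>A\<^esub> (c \<odot>\<^bsub>A\<^esub> s) = s" "inv\<^bsub>K\<^esub> c \<in> carrier K" "inv\<^bsub>K\<^esub> c ~= \<zero>\<^bsub>K\<^esub>"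
proof -
  have u: "c \<in> Units K" using assms K.field_Units by simp
  then show i: "inv\<^bsub>K\<^esub> c \<in> carrier K" by simp
  have "inv\<^bsub>K\<^esub> c \<in> Units K" using u by simp
  then show "inv\<^bsub>K\<^esub> c ~= \<zero>\<^bsub>K\<^esub>" using K.field_Units by simp
  have "inv\<^bsub>K\<^esub> c \<odot>\<^bsub>A\<^esub> (c \<odot>\<^bsub>A\<^esub> s) = (inv\<^bsub>K\<^esub> c \<otimes>\<^bsub>K\<^esub> c) \<odot>\<^bsub>A\<^esub> s" by (rule smult_assoc1[symmetric]) (use assms i in auto)
  then show "inv\<^bsub>K\<^esub> c \<odot>\<^bsub>A\<^esub> (c \<odot>\<^bsub>A\<^esub> s) = s" using u assms by simp
qed

lemma alg_hom_id_iso: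
  assumes "(\<lambda>x. x) \<in> alg_hom K C M" "U \<subseteq> carrier C"
  shows "(\<lambda>x. x) \<in> alg_iso K (C\<lparr>carrier := U\<rparr>) (M\<lparr>carrier := U\<rparr>)"
  by (rule alg_isoI) (use alg_hom_restrict[OF assms, of U] in auto)

lemma zero_skew_derivation:
  assumes "nc_algebra K N" "subalg K N S" "\<And>s. s \<in> S ==> \<tau> s \<in> S"
  shows "skew_derivation K (N\<lparr>carrier := S\<rparr>) \<tau> (\<lambda>_. \<zero>\<^bsub>N\<^esub>)"
proof -
  interpret N: nc_algebra K N by fact
  have "s \<in> carrier N" if "s \<in> S" for s using subalgD(3)[OF assms(2)] that by blast
  then show ?thesis
    using subalgD(4)[OF assms(2)] assms(3) unfolding skew_derivation_def klinear_def by auto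
qed

lemma skew_polynomial_transport:
  assumes P: "skew_polynomial_ring K M S x \<tau> (\<lambda>_. z)" and N: "nc_algebra K N" and h: "h \<in> alg_iso K M N"
    and t: "\<And>s. s \<in> S ==> \<tau>' (h s) = h (\<tau> s)" and z': "z' = h z"
  shows "skew_polynomial_ring K N (h ` S) (h x) \<tau>' (\<lambda>_. z')"
proof -
  interpret skew_poly K M S x \<tau> "\<lambda>_. z" by (unfold_locales) (rule P)
  interpret N: nc_algebra K N by fact
  note hh = alg_homD[OF alg_isoD(1)[OF h]]
  \<comment> \<open>A constant map that is additive satisfies z = z + z, so the derivation is zero
    after all.\<close>
  have z: "z \<in> S" "z = z \<oplus>\<^bsub>M\<^esub> z" "\<And>k. k \<in> carrier K ==> z = k \<odot>\<^bsub>M\<^esub> z"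
    using deriv SE(3) unfolding skew_derivation_def klinear_def by auto
  then have z0: "z = \<zero>\<^bsub>M\<^esub>" by (metis A.add.l_cancel_one S_carr)
  have "free_basis N (h ` S) (\<lambda>i::nat. h x [^]\<^bsub>N\<^esub> i)"
    by (rule free_basis_transport[OF alg N h S _ free])
      (simp_all add: alg_hom_pow[OF A.ring_axioms N.A.ring_axioms alg_isoD(1)[OF h] x_closed])
  moreover have "\<tau>' \<in> alg_iso K (N\<lparr>carrier := h ` S\<rparr>) (N\<lparr>carrier := h ` S\<rparr>)"
    by (rule alg_iso_image_sub[OF h SE(1) tau_iso t]) (use SD in auto)
  then have cl: "\<tau>' r \<in> carrier N" if "r \<in> h ` S" for r using that t hh(1) by auto
  moreover have "h x \<otimes>\<^bsub>N\<^esub> r = \<tau>' r \<otimes>\<^bsub>N\<^esub> h x \<oplus>\<^bsub>N\<^esub> z'" if "r \<in> h ` S" for r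
    using that t x_comm z(1) unfolding z' by (auto simp flip: hh(2,3))
  moreover have sub': "subalg K N (h ` S)" by (rule alg_hom_image_subalg[OF alg N alg_isoD(1)[OF h] sub])
  have cl': "\<tau>' r \<in> h ` S" if "r \<in> h ` S" for r using that t tau(1) by auto
  have "z' = \<zero>\<^bsub>N\<^esub>" "z' \<in> h ` S"
    using z0 z' alg_hom_zero[OF A.ring_axioms N.A.ring_axioms alg_isoD(1)[OF h]] imageI[OF z(1), of h] by simp_all
  then have "skew_derivation K (N\<lparr>carrier := h ` S\<rparr>) \<tau>' (\<lambda>_. z')"
    using zero_skew_derivation[OF N sub' cl'] by simp
  ultimately show ?thesis
    using \<open>\<tau>' \<in> alg_iso K (N\<lparr>carrier := h ` S\<rparr>) (N\<lparr>carrier := h ` S\<rparr>)\<close>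
    unfolding skew_polynomial_ring_def
    using N sub' hh(1)[OF x_closed]
    unfolding free_basis_def fin_coeffs_def lcomb_def by (simp add: conj_assoc)
qed

text \<open>The earlier floors of a tower remain the same sets when the ring around them grows from
  C to M; their structure moves along the identity map.\<close>

lemma skew_laurent_extend:
  assumes "nc_algebra K C" "nc_algebra K M" "(\<lambda>x. x) \<in> alg_hom K C M" "subalg K C U"
    "skew_laurent_ring K (C\<lparr>carrier := U\<rparr>) S y \<tau>"
  shows "skew_laurent_ring K (M\<lparr>carrier := U\<rparr>) S y \<tau>"
proof -
  have "subalg K M U" using alg_hom_image_subalg[OF assms(1-4)] by simp
  then have N: "nc_algebra K (M\<lparr>carrier := U\<rparr>)" by (rule subalg_nc_algebra[OF assms(2)])
  show ?thesis
    using skew_laurent_transport[OF assms(5) N alg_hom_id_iso[OF assms(3) subalgD(3)[OF assms(4)]], of \<tau>] by simp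
qed

lemma skew_polynomial_extend:
  assumes "nc_algebra K C" "nc_algebra K M" "(\<lambda>x. x) \<in> alg_hom K C M" "subalg K C U"
    "skew_polynomial_ring K (C\<lparr>carrier := U\<rparr>) S y \<tau> (\<lambda>_. \<zero>\<^bsub>C\<^esub>)"
  shows "skew_polynomial_ring K (M\<lparr>carrier := U\<rparr>) S y \<tau> (\<lambda>_. \<zero>\<^bsub>M\<^esub>)"
proof -
  have "subalg K M U" using alg_hom_image_subalg[OF assms(1-4)] by simp
  then have N: "nc_algebra K (M\<lparr>carrier := U\<rparr>)" by (rule subalg_nc_algebra[OF assms(2)])
  have "\<zero>\<^bsub>M\<^esub> = \<zero>\<^bsub>C\<^esub>"
    using alg_hom_zero[OF nc_algebra_ring[OF assms(1)] nc_algebra_ring[OF assms(2)] assms(3)] by simp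
  then show ?thesis
    using skew_polynomial_transport[OF assms(5) N alg_hom_id_iso[OF assms(3) subalgD(3)[OF assms(4)]], of \<tau>] by simp
qed

text \<open>The new variable uses coordinate \<^term>\<open>Suc i\<close> of the exponent vectors, so that the ring
  obtained literally contains \<^term>\<open>C\<close>.\<close>

lemma laurent_extension:
  fixes C :: "('k, (nat => int) => 'a) module"
  assumes C: "nc_algebra K C" and tau: "\<tau> \<in> alg_iso K C C" and z: "\<zero>\<^bsub>C\<^esub> = (\<lambda>_. z)"
    and supp: "\<And>c \<alpha> j. [|c \<in> carrier C; j > i; \<alpha> j ~= 0|] ==> c \<alpha> = z"
  shows "\<exists>(M :: ('k, (nat => int) => 'a) module) y. skew_laurent_ring K M (carrier C) y \<tau> \<and>
    (\<lambda>x. x) \<in> alg_hom K C M \<and> \<zero>\<^bsub>M\<^esub> = (\<lambda>_. z) \<and>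
    (\<forall>c \<alpha> j. c \<in> carrier M \<longrightarrow> j > Suc i \<longrightarrow> \<alpha> j ~= 0 \<longrightarrow> c \<alpha> = z)"
proof -
  obtain t where t: "\<And>i. t i \<in> alg_hom K C C" "\<And>a. a \<in> carrier C ==> t 0 a = a"
    "\<And>i j a. a \<in> carrier C ==> t (i + j) a = t i (t j a)" "\<And>a. a \<in> carrier C ==> t (1::int) a = \<tau> a"
    using automorphism_powers[OF C tau] by blast
  interpret LC: laurent_construction K C t
    by (rule laurent_construction.intro) (use C t in auto)
  let ?L = "LC.L" and ?e = "LC.emb"
  \<comment> \<open>The coefficient at exponent k of a Laurent polynomial, itself a function of
    exponent vectors, is written at those vectors whose coordinate \<open>Suc i\<close> is k.
    Vectors with later nonzero coordinates get the zero value z, which leaves room for later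
    variables.\<close>
  define h :: "(int => (nat => int) => 'a) => (nat => int) => 'a"
    where "h c = (\<lambda>\<alpha>. if \<forall>j>Suc i. \<alpha> j = 0 then c (\<alpha> (Suc i)) (\<alpha>(Suc i := 0)) else z)" for c
  have "inj_on h (carrier ?L)"
  proof (rule inj_onI, rule ext, rule ext)
    fix c d k \<beta> assume c: "c \<in> carrier ?L" and d: "d \<in> carrier ?L" and eq: "h c = h d"
    show "c k \<beta> = d k \<beta>"
    proof (cases "\<forall>j>i. \<beta> j = 0")
      case True
      let ?\<alpha> = "\<beta>(Suc i := k)"
      have 1: "\<forall>j>Suc i. ?\<alpha> j = 0" "?\<alpha> (Suc i) = k" using True by auto
      have 2: "?\<alpha>(Suc i := 0) = \<beta>" using True by auto
      have "h c ?\<alpha> = h d ?\<alpha>" using eq by simp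
      then show ?thesis unfolding h_def using 1 2 by simp
    next
      case False
      then show ?thesis using supp LC.LD(1)[OF c] LC.LD(1)[OF d] by metis
    qed
  qed
  then obtain M :: "('k, (nat => int) => 'a) module" where M: "nc_algebra K M" "h \<in> alg_iso K ?L M" "\<zero>\<^bsub>M\<^esub> = h \<zero>\<^bsub>?L\<^esub>"
    using transport_algebra[OF LC.L_algebra] by blast
  \<comment> \<open>An element of C already vanishes at vectors with a nonzero coordinate beyond i,
    so giving the constant Laurent polynomial a the coordinate 0 changes nothing.\<close>
  have he: "h (?e a) = a" if a: "a \<in> carrier C" for a
  proof
    fix \<alpha>
    show "h (?e a) \<alpha> = a \<alpha>"
    proof (cases "\<forall>j>i. \<alpha> j = 0")
      case True
      then have "\<alpha>(Suc i := 0) = \<alpha>" by auto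
      then show ?thesis using True unfolding h_def LC.mono_def by simp
    next
      case False
      then obtain j where j: "j > i" "\<alpha> j ~= 0" by auto
      then have "a \<alpha> = z" using supp[OF a] by blast
      moreover have "h (?e a) \<alpha> = z"
      proof (cases "\<forall>j>Suc i. \<alpha> j = 0")
        case True
        then have "\<alpha> (Suc i) ~= 0" using j by (metis Suc_lessI)
        then show ?thesis unfolding h_def LC.mono_def using z True by simp
      qed (auto simp: h_def)
      ultimately show ?thesis by simp
    qed
  qed
  have tau_c: "\<tau> a \<in> carrier C" if "a \<in> carrier C" for a using alg_homD(1)[OF alg_isoD(1)[OF tau] that] .
  \<comment> \<open>Evaluation at exponent 0 recovers a from its embedding, so \<open>\<tau>\<close>
    can be written as a function on the embedded copy.\<close>
  have S: "skew_laurent_ring K ?L (?e ` carrier C) (LC.mono \<one>\<^bsub>C\<^esub> 1) (\<lambda>z. ?e (\<tau> (z 0)))"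
    by (rule LC.L_skew_laurent[OF tau t(4)]) (auto simp: LC.mono_def)
  have "skew_laurent_ring K M (h ` ?e ` carrier C) (h (LC.mono \<one>\<^bsub>C\<^esub> 1)) \<tau>"
  proof (rule skew_laurent_transport[OF S M(1,2)])
    fix s assume "s \<in> ?e ` carrier C"
    then obtain a where a: "a \<in> carrier C" "s = ?e a" by auto
    have "s 0 = a" unfolding a(2) LC.mono_def by simp
    then show "\<tau> (h s) = h (?e (\<tau> (s 0)))" using a he tau_c by simp
  qed
  moreover have "h ` ?e ` carrier C = carrier C" using he by (force simp: image_iff)
  moreover have "(\<lambda>x. x) \<in> alg_hom K C M"
  proof -
    have he_hom: "(\<lambda>x. h (?e x)) \<in> alg_hom K C M" by (rule alg_hom_comp[OF LC.emb_hom alg_isoD(1)[OF M(2)]])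
    show ?thesis
      using alg_homD[OF he_hom] by (intro alg_homI) (simp_all add: he LC.A.one_closed)
  qed
  moreover have "\<zero>\<^bsub>M\<^esub> = (\<lambda>_. z)" unfolding M(3) h_def LC.L_simps z by auto
  moreover have "c \<alpha> = z" if c: "c \<in> carrier M" "j > Suc i" "\<alpha> j ~= 0" for c \<alpha> j
  proof -
    have "c \<in> h ` carrier ?L" using alg_isoD(3)[OF M(2)] c(1) by simp
    then obtain d where "c = h d" by blast
    then show ?thesis using c by (auto simp: h_def)
  qed
  ultimately show ?thesis by metis
qed

section \<open>Polynomial parts and automorphisms\<close>

lemma nat_pow_carrier_update: "x [^]\<^bsub>M\<lparr>carrier := W\<rparr>\<^esub> (n::nat) = x [^]\<^bsub>M\<^esub> n"
  by (simp add: nat_pow_def)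

lemma lcomb_subring:
  assumes M: "ring M" and W: "subring W M" and c: "\<And>i. c i \<in> W" and b: "\<And>i. b i \<in> W"
  shows "lcomb (M\<lparr>carrier := W\<rparr>) b c = lcomb M b c"
proof -
  interpret M: ring M by fact
  interpret W: ring "M\<lparr>carrier := W\<rparr>" by (rule M.subring_is_ring[OF W])
  note WE = subringE[OF W]
  have "finsum (M\<lparr>carrier := W\<rparr>) (\<lambda>i. c i \<otimes>\<^bsub>M\<^esub> b i) {i. c i ~= \<zero>\<^bsub>M\<^esub>} = finsum M (\<lambda>i. c i \<otimes>\<^bsub>M\<^esub> b i) {i. c i ~= \<zero>\<^bsub>M\<^esub>}"
    by (rule additive_finsum[OF W.abelian_group_axioms M.abelian_group_axioms, where f = "\<lambda>x. x"])
      (use WE c b in auto)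
  then show ?thesis unfolding lcomb_def by simp
qed

text \<open>The coefficient at \<open>b k\<close> as an additive map. It tests linear independence
  over a smaller coefficient ring and, later, injectivity of the deleting map.\<close>

lemma (in left_basis) coefficient_functional:
  "\<exists>F. (\<forall>a \<in> carrier M. F a \<in> carrier M) \<and> (\<forall>u \<in> carrier M. \<forall>v \<in> carrier M. F (u \<oplus> v) = F u \<oplus> F v) \<and>
    (\<forall>s \<in> S. \<forall>i. F (s \<otimes> b i) = (if i = k then s else \<zero>))"
  by (rule basis_extend[where f = "\<lambda>i s. if i = k then s else \<zero>"])
    (auto intro: abelian_group_axioms S_carrier)

section \<open>Skew polynomial rings inside skew Laurent rings\<close>

context skew_laur
begin

text \<open>\<open>V[y;\<tau>]\<close> inside \<open>S[y\<^sup>\<plusminus>\<^sup>1;\<tau>]\<close>.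
  V may be smaller than S: in the tower, S is an iterated Laurent ring and V the iterated polynomial
  ring in the same variables.\<close>

definition poly_part :: "'a set => 'a set" where
  "poly_part V = lcomb M (\<lambda>i::nat. y [^] i) ` fin_coeffs M V"

context
  fixes V assumes V: "subalg K M V" and VS: "V \<subseteq> S" and tV: "\<tau> ` V = V"
begin

lemma V_family: "left_family M V (\<lambda>i::nat. y [^] i)"
  by (intro left_family.intro left_family_axioms.intro A.ring_axioms subalgD(1)[OF V]) simp

interpretation VF: left_family M V "\<lambda>i::nat. y [^] i"
  by (rule V_family)

lemma poly_part_carrier: "w \<in> poly_part V ==> w \<in> carrier M"
  unfolding poly_part_def using VF.lcomb_closed by auto

lemma poly_part_add: "u \<in> poly_part V ==> w \<in> poly_part V ==> u \<oplus> w \<in> poly_part V"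
  unfolding poly_part_def by (auto simp: VF.add_coeffs(1) simp flip: VF.add_coeffs(2))

lemma poly_part_monom: "v \<in> V ==> v \<otimes> y [^] (n::nat) \<in> poly_part V"
  using VF.single_coeffs[of v n] unfolding poly_part_def
  by (intro image_eqI[of _ _ "\<lambda>j. if j = n then v else \<zero>"]) simp_all

lemma poly_part_sub: "V \<subseteq> poly_part V"
  using poly_part_monom[of _ 0] VF.S_carrier by (auto simp: subset_iff)

lemma poly_part_y: "y \<in> poly_part V"
  using poly_part_monom[of \<one> 1] subalgD(5)[OF V] by simp

lemma poly_part_induct [consumes 1, case_names monom add]:
  assumes "w \<in> poly_part V" and "\<And>v n. v \<in> V ==> P (v \<otimes> y [^] (n::nat))"
    and "\<And>u w. [|u \<in> carrier M; w \<in> carrier M; P u; P w|] ==> P (u \<oplus> w)"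
  shows "P w"
  using assms(1) VF.lcomb_induct[of _ P] assms(2,3) unfolding poly_part_def by blast

lemma y_normalizes_V:
  assumes "v \<in> V"
  shows "\<exists>r' \<in> V. y [^] (i::int) \<otimes> v = r' \<otimes> y [^] i" "\<exists>r' \<in> V. v \<otimes> y [^] (i::int) = y [^] i \<otimes> r'"
proof -
  have f: "\<exists>w' \<in> V. y \<otimes> w = w' \<otimes> y" if "w \<in> V" for w using that VS tV y_comm by blast
  have g: "\<exists>w' \<in> V. w \<otimes> y = y \<otimes> w'" if "w \<in> V" for w
  proof -
    have "w \<in> \<tau> ` V" using that tV by simp
    then obtain w' where w': "w' \<in> V" "\<tau> w' = w" by blast
    then have "w \<otimes> y = y \<otimes> w'" using y_comm[of w'] VS by auto
    then show ?thesis using w'(1) by blast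
  qed
  show "\<exists>r' \<in> V. y [^] (i::int) \<otimes> v = r' \<otimes> y [^] i" "\<exists>r' \<in> V. v \<otimes> y [^] (i::int) = y [^] i \<otimes> r'"
    by (rule A.unit_normalizes[OF y_unit subalgD(3)[OF V] f g assms]; assumption)+
qed

lemma poly_part_mult:
  assumes "u \<in> poly_part V" "w \<in> poly_part V" shows "u \<otimes> w \<in> poly_part V"
proof -
  have "u \<otimes> w \<in> poly_part V \<and> u \<in> carrier M" using assms(1)
  proof (induct rule: poly_part_induct)
    case (monom v n)
    have vc: "v \<in> carrier M" using monom VF.S_carrier by blast
    have "v \<otimes> y [^] n \<otimes> w \<in> poly_part V \<and> w \<in> carrier M" using assms(2)
    proof (induct rule: poly_part_induct)
      case (monom v' m)
      have vc': "v' \<in> carrier M" using monom VF.S_carrier by blast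
      obtain v'' where v'': "v'' \<in> V" "y [^] n \<otimes> v' = v'' \<otimes> y [^] n"
        using y_normalizes_V(1)[OF monom, of "int n"] by (auto simp: int_pow_int)
      have "v \<otimes> y [^] n \<otimes> (v' \<otimes> y [^] m) = v \<otimes> (y [^] n \<otimes> v') \<otimes> y [^] m"
        using vc vc' by (simp add: A.m_assoc)
      also have "\<dots> = (v \<otimes> v'') \<otimes> y [^] (n + m)"
        unfolding v''(2) using vc v''(1) VF.S_carrier by (simp add: A.m_assoc A.nat_pow_mult)
      finally show ?case
        using poly_part_monom[of "v \<otimes> v''" "n + m"] subalgD(7)[OF V \<open>v \<in> V\<close> v''(1)] vc' by simp
    next
      case (add u w)
      then show ?case using vc by (simp add: A.r_distr poly_part_add)
    qed
    then show ?case using vc by simp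
  next
    case (add u' w')
    then show ?case using assms(2) poly_part_carrier by (simp add: A.l_distr poly_part_add)
  qed
  then show ?thesis by simp
qed

lemma poly_part_subalg: "subalg K M (poly_part V)"
proof -
  have V1: "v \<in> carrier M" if "v \<in> V" for v using that VF.S_carrier by blast
  have sm: "k \<odot> w \<in> poly_part V \<and> w \<in> carrier M" if k: "k \<in> carrier K" and w: "w \<in> poly_part V" for k w
    using w
  proof (induct rule: poly_part_induct)
    case (monom v n)
    then show ?case using poly_part_monom[OF subalgD(2)[OF V k monom], of n] V1 k by (simp add: smult_mult_left)
  next
    case (add u w)
    then show ?case using k by (simp add: smult_r_distr poly_part_add)
  qed
  have one: "\<one> \<in> poly_part V" using poly_part_sub subalgD(5)[OF V] by blast
  have neg: "\<ominus> w \<in> poly_part V" if "w \<in> poly_part V" for w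
  proof -
    have "\<ominus> w = (\<ominus> \<one>) \<otimes> w" using poly_part_carrier[OF that] by (simp add: A.l_minus)
    moreover have "\<ominus> \<one> \<in> poly_part V" using poly_part_sub subalgD(5,6)[OF V] by blast
    ultimately show ?thesis using poly_part_mult that by simp
  qed
  have "subring (poly_part V) M"
    by (rule A.subringI) (use poly_part_carrier one neg poly_part_mult poly_part_add in auto)
  then show ?thesis using sm unfolding subalg_def by blast
qed

text \<open>Spanning holds by construction, and independence over V is inherited from independence
  of all integer powers of y over the larger S.\<close>

lemma poly_part_skew_polynomial: "skew_polynomial_ring K (M\<lparr>carrier := poly_part V\<rparr>) V y \<tau> (\<lambda>_. \<zero>)"
proof -
  let ?W = "poly_part V" and ?b = "\<lambda>i::nat. y [^] i"
  have W: "subring ?W M" using poly_part_subalg unfolding subalg_def by simp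
  interpret WR: ring "M\<lparr>carrier := ?W\<rparr>" by (rule A.subring_is_ring[OF W])
  have bW: "y [^] n \<in> ?W" for n :: nat
    using poly_part_monom[OF subalgD(5)[OF V], of n] by simp
  have VW: "subring V (M\<lparr>carrier := ?W\<rparr>)"
    using subring_sub[OF A.ring_axioms W poly_part_sub] subalgD(1)[OF V] by simp
  interpret WF: left_family "M\<lparr>carrier := ?W\<rparr>" V ?b
    by (intro left_family.intro left_family_axioms.intro WR.ring_axioms VW) (simp add: bW)
  have fc: "fin_coeffs (M\<lparr>carrier := ?W\<rparr>) V = (fin_coeffs M V :: (nat => _) set)" unfolding fin_coeffs_def by simp
  have lc: "lcomb (M\<lparr>carrier := ?W\<rparr>) ?b c = lcomb M ?b c" if "c \<in> fin_coeffs M V" for c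
    by (rule lcomb_subring[OF A.ring_axioms W _ bW]) (use VF.fin_coeffsD(1)[OF that] poly_part_sub in blast)
  have "free_basis (M\<lparr>carrier := ?W\<rparr>) V ?b"
  proof (rule WF.free_basisI)
    fix a assume "a \<in> carrier (M\<lparr>carrier := ?W\<rparr>)"
    then have "a \<in> poly_part V" by simp
    then obtain c where "c \<in> fin_coeffs M V" "a = lcomb M ?b c" unfolding poly_part_def by blast
    then show "\<exists>c\<in>fin_coeffs (M\<lparr>carrier := ?W\<rparr>) V. a = lcomb (M\<lparr>carrier := ?W\<rparr>) ?b c"
      unfolding fc using lc by (intro bexI[of _ c]) simp_all
  next
    fix c assume "c \<in> fin_coeffs (M\<lparr>carrier := ?W\<rparr>) V" and z': "lcomb (M\<lparr>carrier := ?W\<rparr>) ?b c = \<zero>\<^bsub>M\<lparr>carrier := ?W\<rparr>\<^esub>"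
    then have c: "c \<in> fin_coeffs M V" using fc by simp
    then have z: "lcomb M ?b c = \<zero>" using lc[OF c] z' by simp
    have cS: "c j \<in> S" for j using VF.fin_coeffsD(1)[OF c] VS by blast
    have "c k = \<zero>" for k
    proof -
      obtain F where F: "\<And>a. a \<in> carrier M ==> F a \<in> carrier M"
        "\<And>u v. u \<in> carrier M ==> v \<in> carrier M ==> F (u \<oplus> v) = F u \<oplus> F v"
        "\<And>s i. s \<in> S ==> F (s \<otimes> y [^] (i::int)) = (if i = int k then s else \<zero>)"
        using coefficient_functional[of "int k"] by blast
      have F3: "F (c j \<otimes> y [^] j) = (if j = k then c j else \<zero>)" for j
        using F(3)[OF cS, of j "int j"] by (simp add: int_pow_int)
      let ?J = "insert k {i. c i ~= \<zero>}"
      have J: "finite ?J" using VF.fin_coeffsD(2)[OF c] by simp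
      have F0: "F \<zero> = \<zero>" using F(3)[OF SE(2), of "int k"] by simp
      have "\<zero> = F (\<Oplus>j\<in>?J. c j \<otimes> y [^] j)"
        using VF.lcomb_superset[OF c J subset_insertI] z F0 by simp
      also have "\<dots> = (\<Oplus>j\<in>?J. F (c j \<otimes> y [^] j))"
        by (rule additive_finsum[OF A.abelian_group_axioms A.abelian_group_axioms F(1,2)]) (use cS in auto)
      also have "\<dots> = (\<Oplus>j\<in>?J. (if k = j then c j else \<zero>))"
        unfolding F3 by (intro A.finsum_cong') (use cS in auto)
      also have "\<dots> = c k"
        by (rule A.finsum_singleton) (use J cS in auto)
      finally show ?thesis by simp
    qed
    then show "c = (\<lambda>_. \<zero>\<^bsub>M\<lparr>carrier := ?W\<rparr>\<^esub>)" by auto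
  qed
  moreover have "\<tau> \<in> alg_iso K (M\<lparr>carrier := V\<rparr>) (M\<lparr>carrier := V\<rparr>)"
  proof (rule alg_isoI)
    show "\<tau> \<in> alg_hom K (M\<lparr>carrier := V\<rparr>) (M\<lparr>carrier := V\<rparr>)"
      using alg_hom_restrict[OF tau_hom, of V V] VS tV by simp
    show "inj_on \<tau> (carrier (M\<lparr>carrier := V\<rparr>))"
      using alg_isoD(2)[OF tau_iso] VS by (auto intro: inj_on_subset)
  qed (use tV in simp)
  moreover have "skew_derivation K (M\<lparr>carrier := V\<rparr>) \<tau> (\<lambda>_. \<zero>)"
    by (rule zero_skew_derivation[OF alg V]) (use tV in blast)
  moreover have "y \<otimes> r = \<tau> r \<otimes> y \<oplus> \<zero>" if "r \<in> V" for r
    using that VS y_comm VF.S_carrier tV by (metis A.m_closed A.r_zero image_eqI subsetD y_carr)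
  moreover have "subalg K (M\<lparr>carrier := ?W\<rparr>) V"
    using subalg_sub[OF alg poly_part_subalg poly_part_sub] V by simp
  ultimately show ?thesis
    unfolding skew_polynomial_ring_def
    using subalg_nc_algebra[OF alg poly_part_subalg] poly_part_y
    unfolding free_basis_def fin_coeffs_def lcomb_def
    by (simp add: conj_assoc nat_pow_carrier_update)
qed

end

end

section \<open>Automorphisms that scale the variable\<close>

context skew_poly
begin

context
  fixes \<sigma> c
  assumes \<sigma>: "\<sigma> \<in> alg_iso K M M" and \<sigma>S: "\<sigma> ` S \<subseteq> S" and c: "c \<in> carrier K" "c ~= \<zero>\<^bsub>K\<^esub>"
    and \<sigma>x: "\<sigma> x = c \<odot> x"
begin

lemma \<sigma>_hom: "\<sigma> \<in> alg_hom K M M"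
  by (rule alg_isoD(1)[OF \<sigma>])

lemma c_cancel: "s \<in> carrier M ==> t \<in> carrier M ==> c \<odot> s = c \<odot> t ==> s = t"
  using smult_inv_cancel[OF c] by metis

lemma \<sigma>_xpow: "\<exists>d \<in> carrier K. d ~= \<zero>\<^bsub>K\<^esub> \<and> \<sigma> (x [^] (n::nat)) = d \<odot> x [^] n"
proof (induct n)
  case 0
  then show ?case using alg_homD(4)[OF \<sigma>_hom] by (intro bexI[of _ "\<one>\<^bsub>K\<^esub>"]) auto
next
  case (Suc n)
  then obtain d where d: "d \<in> carrier K" "d ~= \<zero>\<^bsub>K\<^esub>" "\<sigma> (x [^] n) = d \<odot> x [^] n" by blast
  have "\<sigma> (x [^] Suc n) = (d \<odot> x [^] n) \<otimes> (c \<odot> x)"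
    using alg_homD(2)[OF \<sigma>_hom, of "x [^] n" x] d(3) \<sigma>x by simp
  also have "\<dots> = (c \<otimes>\<^bsub>K\<^esub> d) \<odot> x [^] Suc n"
    using d(1) c(1) by (simp add: smult_mult_left smult_mult_right smult_assoc1)
  finally show ?case using d c K.integral_iff by (intro bexI[of _ "c \<otimes>\<^bsub>K\<^esub> d"]) auto
qed

lemma \<sigma>_low: "a \<in> low n ==> \<sigma> a \<in> low n"
proof (induct rule: low_induct)
  case zero
  then show ?case using alg_hom_zero[OF A.ring_axioms A.ring_axioms \<sigma>_hom] by simp
next
  case (monom s k)
  obtain d where d: "d \<in> carrier K" "d ~= \<zero>\<^bsub>K\<^esub>" "\<sigma> (x [^] k) = d \<odot> x [^] k" using \<sigma>_xpow by blast
  have \<sigma>s: "\<sigma> s \<in> S" using monom \<sigma>S by blast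
  have "\<sigma> (s \<otimes> x [^] k) = (d \<odot> \<sigma> s) \<otimes> x [^] k"
    using monom d \<sigma>s alg_homD(2)[OF \<sigma>_hom, of s "x [^] k"] by (simp add: smult_mult_left smult_mult_right)
  then show ?case using low_monom[OF SD(2)[OF d(1) \<sigma>s] monom(2)] by simp
next
  case (add u v)
  then show ?case using alg_homD(3)[OF \<sigma>_hom] low_add by simp
qed

text \<open>If \<^term>\<open>\<sigma> b \<in> S\<close>, then \<^term>\<open>b\<close> has degree 0, since \<^term>\<open>\<sigma>\<close> preserves leading terms up to scalars.\<close>

lemma automorphism_restrict: "\<sigma> ` S = S"
proof (rule equalityI[OF \<sigma>S], rule subsetI)
  fix s assume s: "s \<in> S"
  obtain b where b: "b \<in> carrier M" "\<sigma> b = s"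
    using alg_isoD(3)[OF \<sigma>] S_carr[OF s] by (metis imageE)
  show "s \<in> \<sigma> ` S"
  proof (cases "b = \<zero>")
    case True
    then show ?thesis using b SE(2) by blast
  next
    case False
    then obtain n r v where r: "r \<in> S" "r ~= \<zero>" "v \<in> low n" "b = r \<otimes> x [^] n \<oplus> v"
      using leading_term b(1) by metis
    have "n = 0"
    proof (rule ccontr)
      assume n: "n ~= 0"
      obtain d where d: "d \<in> carrier K" "d ~= \<zero>\<^bsub>K\<^esub>" "\<sigma> (x [^] n) = d \<odot> x [^] n" using \<sigma>_xpow by blast
      have \<sigma>r: "\<sigma> r \<in> S" using r \<sigma>S by blast
      have r': "d \<odot> \<sigma> r \<in> S" by (rule SD(2)[OF d(1) \<sigma>r])
      have "\<sigma> (r \<otimes> x [^] n) = (d \<odot> \<sigma> r) \<otimes> x [^] n"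
        using r d \<sigma>r alg_homD(2)[OF \<sigma>_hom, of r "x [^] n"] by (simp add: smult_mult_left smult_mult_right)
      then have "s = (d \<odot> \<sigma> r) \<otimes> x [^] n \<oplus> \<sigma> v"
        using b r alg_homD(3)[OF \<sigma>_hom, of "r \<otimes> x [^] n" v] by simp
      then have "(d \<odot> \<sigma> r) \<otimes> x [^] n = s \<oplus> \<ominus> \<sigma> v"
        using r' s \<sigma>_low[OF r(3)] by (simp add: A.a_assoc A.r_neg)
      moreover have "s \<in> low n" using low_monom[of s 0 n] n s by simp
      ultimately have "(d \<odot> \<sigma> r) \<otimes> x [^] n \<in> low n"
        using low_add low_minus[OF \<sigma>_low[OF r(3)]] by simp
      then have "d \<odot> \<sigma> r = \<zero>" by (rule low_lead_zero[OF r'])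
      moreover have "inv\<^bsub>K\<^esub> d \<odot> (d \<odot> \<sigma> r) = \<sigma> r" "inv\<^bsub>K\<^esub> d \<in> carrier K"
        using smult_inv_cancel[OF d(1,2) S_carr[OF \<sigma>r]] by auto
      ultimately have "\<sigma> r = \<zero>" by simp
      then have "r = \<zero>"
        using inj_onD[OF alg_isoD(2)[OF \<sigma>], of r \<zero>] alg_hom_zero[OF A.ring_axioms A.ring_axioms \<sigma>_hom] r by simp
      then show False using r by simp
    qed
    then have "b = r" using r low_0 by simp
    then show ?thesis using b r by blast
  qed
qed

text \<open>Apply \<open>\<sigma>\<close> to the commutation rule for \<open>x \<otimes> r\<close>,
  once before and once after using the rule, and compare the coefficients of x and of 1. The factor
  c cancels in front of x and survives in front of \<open>\<delta>\<close>.\<close>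

lemma automorphism_commute:
  assumes r: "r \<in> S"
  shows "\<sigma> (\<tau> r) = \<tau> (\<sigma> r)" "\<sigma> (\<delta> r) = c \<odot> \<delta> (\<sigma> r)"
proof -
  have \<sigma>S': "\<sigma> s \<in> S" if "s \<in> S" for s using that \<sigma>S by blast
  have 1: "\<sigma> (x \<otimes> r) = c \<odot> (\<tau> (\<sigma> r) \<otimes> x \<oplus> \<delta> (\<sigma> r))"
    using alg_homD(2)[OF \<sigma>_hom, of x r] r \<sigma>x \<sigma>S'[OF r] c by (simp add: smult_mult_left x_comm)
  have "\<sigma> (x \<otimes> r) = \<sigma> (\<tau> r) \<otimes> (c \<odot> x) \<oplus> \<sigma> (\<delta> r)"
    using r alg_homD(2,3)[OF \<sigma>_hom] \<sigma>x by (simp add: x_comm)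
  then have "(c \<odot> \<sigma> (\<tau> r)) \<otimes> x \<oplus> \<sigma> (\<delta> r) = (c \<odot> \<tau> (\<sigma> r)) \<otimes> x \<oplus> c \<odot> \<delta> (\<sigma> r)"
    unfolding 1 using r \<sigma>S' c by (simp add: smult_mult_left smult_mult_right smult_r_distr)
  \<comment> \<open>Comparison of coefficients in degree at most one.\<close>
  moreover have uniq: "a = a' \<and> e = e'"
    if "a \<in> S" "a' \<in> S" "e \<in> S" "e' \<in> S" "a \<otimes> x \<oplus> e = a' \<otimes> x \<oplus> e'" for a a' e e'
  proof -
    have "(a \<ominus> a') \<otimes> x = e' \<ominus> e"
    proof -
      have "(a \<ominus> a') \<otimes> x = (a \<otimes> x \<oplus> e) \<oplus> (\<ominus> e \<oplus> \<ominus> (a' \<otimes> x))"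
        using that(1-4) by (simp add: a_minus_def A.l_distr A.l_minus A.a_assoc A.r_neg2)
      also have "\<dots> = (a' \<otimes> x \<oplus> e') \<ominus> (a' \<otimes> x \<oplus> e)"
        using that(1-4) unfolding that(5) by (simp add: a_minus_def A.minus_add A.a_comm)
      also have "\<dots> = e' \<ominus> e" using that A.add_cancel_minus[of "a' \<otimes> x" e' e] by (simp add: a_minus_def)
      finally show ?thesis .
    qed
    moreover have e: "e' \<ominus> e \<in> S" "a \<ominus> a' \<in> S" using that SE(5,7) by (simp_all add: a_minus_def)
    moreover have "e' \<ominus> e \<in> low 1" using low_monom[OF e(1), of 0 1] e(1) by simp
    ultimately have "a \<ominus> a' = \<zero>" using low_lead_zero[OF e(2), of 1] by simp
    then have "a = a'" using that by (simp add: A.r_right_minus_eq)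
    then show ?thesis using that by (metis A.a_comm A.add.right_cancel A.m_closed S_carr x_closed)
  qed
  ultimately have "c \<odot> \<sigma> (\<tau> r) = c \<odot> \<tau> (\<sigma> r)" "\<sigma> (\<delta> r) = c \<odot> \<delta> (\<sigma> r)"
    using r c \<sigma>S' SD(2) by (metis (no_types, lifting) tau(1) delta)+
  then show "\<sigma> (\<tau> r) = \<tau> (\<sigma> r)" "\<sigma> (\<delta> r) = c \<odot> \<delta> (\<sigma> r)"
    using c_cancel r \<sigma>S' by (meson S_carr tau(1))+
qed

end

end

section \<open>Gaussian binomial coefficients\<close>

text \<open>The q-Pascal recursion. It avoids the exact division in \<open>qbinom\<close> and is the
  form in which coefficients are evaluated.\<close>

fun gauss :: "nat => nat => int poly" where
  "gauss n 0 = 1"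
| "gauss 0 (Suc m) = 0"
| "gauss (Suc n) (Suc m) = gauss n m + Polynomial.monom 1 (Suc m) * gauss n (Suc m)"

lemma gauss_eq_0: "n < m ==> gauss n m = 0"
  by (induct n m rule: gauss.induct) auto

lemma qint_add: "qint (a + b) = qint a + Polynomial.monom 1 a * qint b"
proof (induct b)
  case (Suc b)
  have "qint (a + Suc b) = qint (a + b) + Polynomial.monom 1 (a + b)" by (simp add: qint_def)
  also have "\<dots> = qint a + Polynomial.monom 1 a * (qint b + Polynomial.monom 1 b)"
    unfolding Suc by (simp add: distrib_left mult_monom)
  finally show ?case by (simp add: qint_def)
qed (simp add: qint_def)

lemma qfact_Suc: "qfact (Suc n) = qint (Suc n) * qfact n"
  unfolding qfact_def by (simp add: atLeastAtMostSuc_conv)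

lemma qfact_nonzero: "qfact n ~= 0"
proof -
  have "Polynomial.coeff (qint i) 0 = 1" if "i \<ge> 1" for i
    using that by (simp add: qint_def coeff_sum sum.delta)
  then have "qint i ~= 0" if "i \<ge> 1" for i using that by fastforce
  then show ?thesis unfolding qfact_def by simp
qed

text \<open>Multiplied by the factorials, the recursion becomes \<open>(m + 1)\<^sub>t +
  t\<^sup>m\<^sup>+\<^sup>1 (n - m)\<^sub>t = (n + 1)\<^sub>t\<close>, the splitting of a geometric
  sum.\<close>

lemma gauss_mult: "m \<le> n ==> gauss n m * (qfact m * qfact (n - m)) = qfact n"
proof (induct n m rule: gauss.induct)
  case (1 n)
  then show ?case by (simp add: qfact_def)
next
  case (3 n m)
  let ?t = "Polynomial.monom 1 (Suc m) :: int poly"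
  have 1: "gauss n m * (qfact (Suc m) * qfact (n - m)) = qint (Suc m) * qfact n"
    using 3 by (simp add: qfact_Suc mult_ac)
  have 2: "gauss n (Suc m) * (qfact (Suc m) * qfact (n - m)) = qint (n - m) * qfact n"
  proof (cases "Suc m \<le> n")
    case True
    then have "n - m = Suc (n - Suc m)" by simp
    then have "gauss n (Suc m) * (qfact (Suc m) * qfact (n - m)) =
      qint (n - m) * (gauss n (Suc m) * (qfact (Suc m) * qfact (n - Suc m)))"
      by (simp add: qfact_Suc mult_ac)
    then show ?thesis using 3 True by simp
  next
    \<comment> \<open>Here n = m, so the Gaussian binomial on the left and the q-integer on the
      right both vanish.\<close>
    case False
    then have "n = m" using 3 by simp
    then show ?thesis by (simp add: gauss_eq_0 qint_def)
  qed
  have "gauss (Suc n) (Suc m) * (qfact (Suc m) * qfact (n - m)) =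
    (qint (Suc m) + ?t * qint (n - m)) * qfact n"
    using 1 2 by (simp add: distrib_right mult.assoc)
  also have "qint (Suc m) + ?t * qint (n - m) = qint (Suc n)"
    using qint_add[of "Suc m" "n - m"] 3 by simp
  finally show ?case by (simp add: qfact_Suc)
qed simp

lemma qbinom_gauss: "m \<le> n ==> qbinom n m = gauss n m"
  using gauss_mult[of m n] qfact_nonzero[of m] qfact_nonzero[of "n - m"]
  unfolding qbinom_def by (metis mult_eq_0_iff nonzero_mult_div_cancel_right)

lemma qbinom_symmetric: "m \<le> n ==> qbinom n (n - m) = qbinom n m"
  unfolding qbinom_def by (simp add: mult.commute)

section \<open>Values of Gaussian binomial coefficients at q\<close>

context field
begin

context
  fixes q assumes q: "q \<in> carrier R"
begin

definition ev :: "int poly => 'a" where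
  "ev p = (\<Oplus> i \<in> {..Polynomial.degree p}. [Polynomial.coeff p i] \<cdot> (q [^] i))"

lemma add_pow_carrier [simp]: "a \<in> carrier R ==> [(k :: int)] \<cdot> a \<in> carrier R"
  by (rule add.int_pow_closed)

lemma zero_add_pow [simp]: "[(0 :: int)] \<cdot> a = \<zero>"
  by (simp add: add_pow_def)

lemma ev_closed [simp]: "ev p \<in> carrier R"
  unfolding ev_def using q by (intro finsum_closed) auto

lemma ev_bound: "Polynomial.degree p \<le> n ==> ev p = (\<Oplus> i \<in> {..n}. [Polynomial.coeff p i] \<cdot> (q [^] i))"
  unfolding ev_def using q
  by (intro add.finprod_mono_neutral_cong_left) (auto simp: coeff_eq_0)

lemma ev_add: "ev (p + p') = ev p \<oplus> ev p'"
proof -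
  let ?n = "max (Polynomial.degree p) (Polynomial.degree p')"
  have "ev (p + p') = (\<Oplus> i \<in> {..?n}. [Polynomial.coeff p i] \<cdot> (q [^] i) \<oplus> [Polynomial.coeff p' i] \<cdot> (q [^] i))"
    unfolding ev_bound[OF degree_add_le_max] using q by (intro finsum_cong') (auto simp: add.int_pow_mult)
  also have "\<dots> = ev p \<oplus> ev p'"
    using q ev_bound[of p ?n] ev_bound[of p' ?n] by (simp add: finsum_addf)
  finally show ?thesis .
qed

lemma ev_pCons: "ev (pCons 0 p) = q \<otimes> ev p"
proof -
  let ?n = "Polynomial.degree p"
  have "ev (pCons 0 p) = (\<Oplus> i \<in> {..Suc ?n}. [Polynomial.coeff (pCons 0 p) i] \<cdot> (q [^] i))"
    by (rule ev_bound) (simp add: degree_pCons_le)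
  also have "\<dots> = (\<Oplus> i \<in> {..?n}. [Polynomial.coeff p i] \<cdot> (q [^] Suc i))"
    using q by (subst finsum_Suc2) auto
  also have "\<dots> = (\<Oplus> i \<in> {..?n}. q \<otimes> [Polynomial.coeff p i] \<cdot> (q [^] i))"
    using q by (intro finsum_cong') (auto simp: add_pow_rdistr_int m_comm)
  also have "\<dots> = q \<otimes> ev p" unfolding ev_def using q by (intro finsum_rdistr[symmetric]) auto
  finally show ?thesis .
qed

lemma ev_monom: "ev (Polynomial.monom 1 j * p) = q [^] j \<otimes> ev p"
proof (induct j)
  case (Suc j)
  have "Polynomial.monom 1 (Suc j) * p = pCons 0 (Polynomial.monom 1 j * p)"
    by (simp add: monom_Suc)
  then show ?case using Suc q by (simp add: ev_pCons m_ac)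
qed simp

lemma ev_simps [simp]: "ev 0 = \<zero>" "ev 1 = \<one>"
proof -
  have "ev 1 = (\<Oplus> i \<in> {..0}. [Polynomial.coeff (1 :: int poly) i] \<cdot> (q [^] i))" by (rule ev_bound) simp
  then show "ev 1 = \<one>" using q by (simp add: add_pow_def int_pow_def2)
qed (simp add: ev_def add_pow_def)

lemma qbinom_at_ev: "qbinom_at R n m q = ev (qbinom n m)"
  unfolding qbinom_at_def ev_def by simp

lemma qbinom_at_closed [simp]: "qbinom_at R n m q \<in> carrier R"
  by (simp add: qbinom_at_ev)

lemma qbinom_at_0: "qbinom_at R n 0 q = \<one>"
  by (simp add: qbinom_at_ev qbinom_gauss)

lemma qbinom_at_symmetric: "m \<le> n ==> qbinom_at R n (n - m) q = qbinom_at R n m q"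
  by (simp add: qbinom_at_ev qbinom_symmetric)

lemma qbinom_at_Suc:
  "Suc m \<le> n ==> qbinom_at R (Suc n) (Suc m) q = qbinom_at R n m q \<oplus> q [^] Suc m \<otimes> qbinom_at R n (Suc m) q"
  by (simp only: qbinom_at_ev qbinom_gauss Suc_le_mono Suc_leD gauss.simps ev_add ev_monom)

text \<open>A telescoping geometric sum: the binomial is the q-integer of \<open>Suc k\<close>. The
  lemma holds at roots of unity as well, where both sides may vanish.\<close>

lemma qbinom_at_1: "(\<one> \<ominus> q) \<otimes> qbinom_at R (Suc k) 1 q = \<one> \<ominus> q [^] Suc k"
proof -
  have 1: "(\<one> \<ominus> q) \<otimes> ev (gauss k 1) = \<one> \<ominus> q [^] k" for k
  proof (induct k)
    case 0
    show ?case using q by (simp add: a_minus_def r_neg)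
  next
    case (Suc k)
    have "(\<one> \<ominus> q) \<otimes> ev (gauss (Suc k) 1) = (\<one> \<ominus> q) \<otimes> (\<one> \<oplus> q \<otimes> ev (gauss k 1))"
      using q ev_monom[of 1 "gauss k 1"] by (simp add: ev_add)
    also have "\<dots> = (\<one> \<ominus> q) \<oplus> q \<otimes> ((\<one> \<ominus> q) \<otimes> ev (gauss k 1))"
      using q by (simp add: r_distr m_lcomm)
    also have "\<dots> = \<one> \<ominus> q [^] Suc k"
      unfolding Suc using q by (simp add: a_minus_def r_distr r_minus a_assoc r_neg1 m_comm)
    finally show ?case .
  qed
  show ?thesis using 1[of "Suc k"] by (simp add: qbinom_at_ev qbinom_gauss)
qed

text \<open>Two zeros above each other in column l of the q-Pascal triangle force a zero in column l
  - 1. Hence a column that is zero from some row on pushes its zeros down to column 0, whose entries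
  are 1.\<close>

lemma qbinom_at_not_all_zero:
  assumes "\<And>m. m > l ==> qbinom_at R m l q = \<zero>"
  shows False
proof -
  have "m > l ==> qbinom_at R m (l - j) q = \<zero>" for j m
  proof (induct j arbitrary: m)
    case 0
    then show ?case using assms by simp
  next
    case (Suc j)
    show ?case
    proof (cases "j < l")
      case True
      then have e: "l - j = Suc (l - Suc j)" by simp
      have "qbinom_at R (Suc m) (l - j) q = \<zero>" "qbinom_at R m (l - j) q = \<zero>" using Suc by auto
      then show ?thesis
        using qbinom_at_Suc[of "l - Suc j" m] Suc(2) q unfolding e by simp
    next
      case False
      then show ?thesis using Suc by simp
    qed
  qed
  then have "qbinom_at R (Suc l) (l - l) q = \<zero>" by blast
  then show False by (simp add: qbinom_at_0)
qed

end

end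

section \<open>Higher skew derivations\<close>

locale higher_der =
  fixes K :: "('k, 'm) ring_scheme" and C :: "('k, 'c, 'n) module_scheme" (structure)
    and \<tau> :: "'c => 'c" and q :: 'k and d :: "nat => 'c => 'c"
  assumes alg: "nc_algebra K C" and dom: "nc_domain C" and tau_iso: "\<tau> \<in> alg_iso K C C"
    and q: "q \<in> carrier K" "q ~= \<zero>\<^bsub>K\<^esub>" "q ~= \<one>\<^bsub>K\<^esub>"
    and higher: "higher_skew_derivation K C q \<tau> d" and nilpotent: "locally_nilpotent C d"
    and iter: "iterative K C q d"

sublocale higher_der \<subseteq> nc_algebra K C
  by (rule alg)

lemma (in nc_algebra) smult_eq_0:
  assumes "c \<in> carrier K" "s \<in> carrier A" "c \<odot>\<^bsub>A\<^esub> s = \<zero>\<^bsub>A\<^esub>" shows "c = \<zero>\<^bsub>K\<^esub> \<or> s = \<zero>\<^bsub>A\<^esub>"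
  using smult_inv_cancel[OF assms(1) _ assms(2)] assms(3) by (metis smult_r_null)

context higher_der
begin

lemma tau_hom: "\<tau> \<in> alg_hom K C C"
  by (rule alg_isoD(1)[OF tau_iso])

lemma tau [simp]: "a \<in> carrier C ==> \<tau> a \<in> carrier C" "\<tau> \<zero> = \<zero>"
  using alg_homD(1)[OF tau_hom] alg_hom_zero[OF A.ring_axioms A.ring_axioms tau_hom] by auto

lemma tau_pow [simp]: "a \<in> carrier C ==> (\<tau> ^^ n) a \<in> carrier C" "(\<tau> ^^ n) \<zero> = \<zero>"
  by (induct n) auto

lemma tau_pow_eq_0: "a \<in> carrier C ==> (\<tau> ^^ n) a = \<zero> ==> a = \<zero>"
proof (induct n)
  case (Suc n)
  then show ?case using inj_onD[OF alg_isoD(2)[OF tau_iso], of "(\<tau> ^^ n) a" \<zero>] by simp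
qed simp

lemma d_closed [simp]: "a \<in> carrier C ==> d i a \<in> carrier C"
  and d_add: "a \<in> carrier C ==> b \<in> carrier C ==> d i (a \<oplus> b) = d i a \<oplus> d i b"
  and d_smult: "c \<in> carrier K ==> a \<in> carrier C ==> d i (c \<odot>\<^bsub>C\<^esub> a) = c \<odot>\<^bsub>C\<^esub> d i a"
  and d_0: "a \<in> carrier C ==> d 0 a = a"
  and leibniz: "a \<in> carrier C ==> b \<in> carrier C ==> d m (a \<otimes> b) = (\<Oplus> i \<in> {..m}. (\<tau> ^^ (m - i)) (d i a) \<otimes> d (m - i) b)"
  and d_tau: "a \<in> carrier C ==> d i (\<tau> a) = (q [^]\<^bsub>K\<^esub> i) \<odot>\<^bsub>C\<^esub> \<tau> (d i a)"
  using higher unfolding higher_skew_derivation_def klinear_def by auto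

lemma d_zero [simp]: "d i \<zero> = \<zero>"
  using d_add[of \<zero> \<zero> i] d_closed[of \<zero> i] by (simp add: A.add.l_cancel_one)

lemma d_d: "a \<in> carrier C ==> d i (d j a) = qbinom_at K (i + j) j q \<odot>\<^bsub>C\<^esub> d (i + j) a"
  using iter unfolding iterative_def by auto

lemma nilp: "a \<in> carrier C ==> \<exists>m. (\<forall>i\<ge>m. d i a = \<zero>) \<and> (\<forall>p<m. d p a ~= \<zero>)"
  using nilpotent unfolding locally_nilpotent_def by auto

text \<open>The indices i with d_i(a) nonzero form an initial segment, by the second half of local
  nilpotence.\<close>

lemma no_gap: "a \<in> carrier C ==> d i a ~= \<zero> ==> j \<le> i ==> d j a ~= \<zero>"
  using nilp by (metis le_trans not_le)

text \<open>The last index with d_i nonzero behaves like a degree. In the Leibniz sum at index s + t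
  only i = s survives, and that term is nonzero since C is a domain and \<open>\<tau>\<close> is
  injective.\<close>

lemma top_mult:
  assumes a: "a \<in> carrier C" "d s a ~= \<zero>" "\<And>i. i > s ==> d i a = \<zero>"
    and b: "b \<in> carrier C" "d t b ~= \<zero>" "\<And>i. i > t ==> d i b = \<zero>"
  shows "d (s + t) (a \<otimes> b) ~= \<zero>" "\<And>i. i > s + t ==> d i (a \<otimes> b) = \<zero>"
proof -
  have z: "(\<tau> ^^ (m - i)) (d i a) \<otimes> d (m - i) b = \<zero>" if "m \<ge> s + t" "i \<le> m" "m ~= s + t \<or> i ~= s" for m i
  proof (cases "i > s")
    case True
    then show ?thesis using a b by simp
  next
    case False
    then have "m - i > t" using that by auto
    then show ?thesis using a b by simp
  qed
  show "d m (a \<otimes> b) = \<zero>" if m: "m > s + t" for m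
  proof -
    have "d m (a \<otimes> b) = (\<Oplus> i \<in> {..m}. \<zero>)"
      unfolding leibniz[OF a(1) b(1)] by (rule A.finsum_cong') (use z m in auto)
    then show ?thesis by simp
  qed
  have "d (s + t) (a \<otimes> b) = (\<Oplus> i \<in> {..s + t}. if s = i then (\<tau> ^^ t) (d i a) \<otimes> d t b else \<zero>)"
    unfolding leibniz[OF a(1) b(1)] by (rule A.finsum_cong') (use a b z[of "s + t"] in auto)
  also have "\<dots> = (\<tau> ^^ t) (d s a) \<otimes> d t b"
    by (rule A.finsum_singleton) (use a b in auto)
  finally have "d (s + t) (a \<otimes> b) = (\<tau> ^^ t) (d s a) \<otimes> d t b" .
  then show "d (s + t) (a \<otimes> b) ~= \<zero>"
    using nc_domainD(3)[OF dom, of "(\<tau> ^^ t) (d s a)" "d t b"] tau_pow_eq_0[of "d s a" t] a(1,2) b(1,2) by auto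
qed

text \<open>When some \<open>(l)\<^sub>q\<close> vanishes, the absence of gaps in the sequences \<open>d\<^sub>0(r), d\<^sub>1(r), \<dots>\<close> leaves
  only the trivial higher derivation: \<open>d\<^sub>1 d\<^sub>l\<^sub>-\<^sub>1 = 0\<close> makes all \<open>d\<^sub>l\<^sub>-\<^sub>1(r)\<close> constants, whereas tops of
  powers are unbounded.\<close>

lemma higher_der_dichotomy:
  "(\<forall>m. qbinom_at K (Suc m) 1 q ~= \<zero>\<^bsub>K\<^esub>) \<or> (\<forall>i a. i \<ge> 1 \<longrightarrow> a \<in> carrier C \<longrightarrow> d i a = \<zero>)"
proof (rule ccontr)
  assume neg: "\<not> ?thesis"
  then obtain l r i where l: "qbinom_at K (Suc l) 1 q = \<zero>\<^bsub>K\<^esub>" and r: "i \<ge> 1" "r \<in> carrier C" "d i r ~= \<zero>"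
    by blast
  obtain m where m: "\<And>i. i \<ge> m ==> d i r = \<zero>" "\<And>p. p < m ==> d p r ~= \<zero>" using nilp[OF r(2)] by blast
  have "m \<ge> 2" using m(1)[of i] r by (cases "m \<le> i") auto
  define s where "s = m - 1"
  have s: "s \<ge> 1" "d s r ~= \<zero>" "\<And>i. i > s ==> d i r = \<zero>" using \<open>m \<ge> 2\<close> m unfolding s_def by auto
  \<comment> \<open>The tops add up, so the power r^(k+1) has top (k + 1)s.\<close>
  have pw: "d (s + k * s) (r [^] Suc k) ~= \<zero> \<and> (\<forall>i > s + k * s. d i (r [^] Suc k) = \<zero>)" for k
  proof (induct k)
    case 0
    then show ?case using s r by simp
  next
    case (Suc k)
    have rk: "r [^] Suc k \<in> carrier C" using r(2) by (rule A.nat_pow_closed)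
    have "r [^] Suc (Suc k) = r [^] Suc k \<otimes> r" by simp
    moreover have "s + Suc k * s = (s + k * s) + s" by simp
    ultimately show ?case
      using top_mult[OF rk _ _ r(2) s(2,3), of "s + k * s"] Suc by presburger
  qed
  \<comment> \<open>As s is positive, suitable powers of r have arbitrarily large tops; absence of
    gaps makes the d_N in between nonzero, too.\<close>
  have big: "\<exists>b \<in> carrier C. d N b ~= \<zero>" for N
  proof -
    have rk: "r [^] Suc N \<in> carrier C" using r(2) by (rule A.nat_pow_closed)
    have "N * 1 \<le> N * s" using mult_le_mono2[OF s(1)] .
    then have "N \<le> s + N * s" by linarith
    then have "d N (r [^] Suc N) ~= \<zero>" using no_gap[OF rk] pw by blast
    then show ?thesis using rk by blast
  qed
  \<comment> \<open>By iterativity d_1 d_l is a multiple of the q-integer of \<open>Suc l\<close>,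
    hence zero. Absence of gaps then kills every d_i with i > 0 on the values of d_l.\<close>
  have const: "d i (d l b) = \<zero>" if b: "b \<in> carrier C" and i: "i \<ge> 1" for i b
  proof -
    have "qbinom_at K (1 + l) l q = \<zero>\<^bsub>K\<^esub>"
      using l K.qbinom_at_symmetric[OF q(1), of 1 "Suc l"] by simp
    then have "d 1 (d l b) = \<zero>" using d_d[OF b, of 1 l] b by simp
    then show ?thesis using no_gap[of "d l b" i 1] b i by auto
  qed
  \<comment> \<open>For m > l, the composite d_(m-l) d_l is zero, while some d_m(b) is not; so the
    binomial in front of d_m must vanish. A whole column of zeros is impossible.\<close>
  have "qbinom_at K m l q = \<zero>\<^bsub>K\<^esub>" if m: "m > l" for m
  proof -
    obtain b where b: "b \<in> carrier C" "d m b ~= \<zero>" using big by blast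
    have "qbinom_at K m l q \<odot>\<^bsub>C\<^esub> d m b = \<zero>"
    proof -
      have e: "m - l + l = m" using m by simp
      have "d (m - l) (d l b) = \<zero>" by (rule const[OF b(1)]) (use m in simp)
      from trans[OF d_d[OF b(1), of "m - l" l, symmetric] this]
      show ?thesis by (simp only: e)
    qed
    from smult_eq_0[OF K.qbinom_at_closed[OF q(1)] d_closed[OF b(1)] this] show ?thesis using b(2) by simp
  qed
  then show False using K.qbinom_at_not_all_zero[OF q(1)] by blast
qed

text \<open>If no q-integer vanishes, d_k d_1 = (k+1)_q d_(k+1) allows induction on k with division
  by (k+1)_q. Otherwise \<open>higher_der_dichotomy\<close> leaves only k = 0.\<close>

lemma automorphism_higher:
  assumes \<sigma>: "\<sigma> \<in> alg_hom K C C" and c: "c \<in> carrier K"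
    and \<sigma>1: "\<And>a. a \<in> carrier C ==> \<sigma> (d 1 a) = c \<odot>\<^bsub>C\<^esub> d 1 (\<sigma> a)"
  shows "a \<in> carrier C ==> \<sigma> (d k a) = (c [^]\<^bsub>K\<^esub> k) \<odot>\<^bsub>C\<^esub> d k (\<sigma> a)"
proof -
  have sc: "\<sigma> a \<in> carrier C" if "a \<in> carrier C" for a using alg_homD(1)[OF \<sigma> that] .
  have s0: "\<sigma> \<zero> = \<zero>" by (rule alg_hom_zero[OF A.ring_axioms A.ring_axioms \<sigma>])
  show "\<sigma> (d k a) = (c [^]\<^bsub>K\<^esub> k) \<odot>\<^bsub>C\<^esub> d k (\<sigma> a)" if a: "a \<in> carrier C"
  proof (cases "\<forall>m. qbinom_at K (Suc m) 1 q ~= \<zero>\<^bsub>K\<^esub>")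
    case False
    then have "d i a = \<zero>" if "i \<ge> 1" "a \<in> carrier C" for i a using higher_der_dichotomy that by blast
    then show ?thesis using a sc s0 c by (cases k) (auto simp: d_0)
  next
    case True
    show ?thesis using a
    proof (induct k arbitrary: a)
      case 0
      then show ?case using sc by (simp add: d_0)
    next
      case (Suc k)
      let ?B = "qbinom_at K (Suc k) 1 q"
      have B: "?B \<in> carrier K" "?B ~= \<zero>\<^bsub>K\<^esub>" using True K.qbinom_at_closed[OF q(1)] by auto
      have dd: "d k (d 1 b) = ?B \<odot>\<^bsub>C\<^esub> d (Suc k) b" if "b \<in> carrier C" for b
        using d_d[OF that, of k 1] by simp
      have "?B \<odot>\<^bsub>C\<^esub> \<sigma> (d (Suc k) a) = \<sigma> (d k (d 1 a))"
        using dd[OF Suc(2)] alg_homD(5)[OF \<sigma> B(1), of "d (Suc k) a"] Suc(2) by simp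
      also have "\<dots> = (c [^]\<^bsub>K\<^esub> k) \<odot>\<^bsub>C\<^esub> d k (\<sigma> (d 1 a))" using Suc by simp
      also have "\<dots> = (c [^]\<^bsub>K\<^esub> k) \<odot>\<^bsub>C\<^esub> (c \<odot>\<^bsub>C\<^esub> (?B \<odot>\<^bsub>C\<^esub> d (Suc k) (\<sigma> a)))"
        by (simp only: \<sigma>1[OF Suc(2)] d_smult[OF c d_closed[OF sc[OF Suc(2)]]] dd[OF sc[OF Suc(2)]])
      also have "\<dots> = ?B \<odot>\<^bsub>C\<^esub> ((c [^]\<^bsub>K\<^esub> Suc k) \<odot>\<^bsub>C\<^esub> d (Suc k) (\<sigma> a))"
        using Suc(2) sc c B by (simp add: smult_assoc1[symmetric] K.m_ac)
      finally show ?case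
        using smult_inv_cancel(1)[OF B] Suc(2) sc c by (metis K.nat_pow_closed d_closed smult_closed)
    qed
  qed
qed

end

section \<open>Deleting a derivation\<close>

lemma (in ring) finsum_subring:
  assumes "subring W R" "finite F" "\<And>i. i \<in> F ==> f i \<in> W"
  shows "finsum R f F \<in> W"
  using assms(2,3)
proof induct
  case empty
  then show ?case using subringE(2)[OF assms(1)] by simp
next
  case (insert i F)
  have "f \<in> F \<rightarrow> carrier R" "f i \<in> carrier R" using insert(4) subringE(1)[OF assms(1)] by auto
  then show ?case using insert subringE(7)[OF assms(1)] by simp
qed

locale higher_emb = higher_der K C \<tau> q d
  for K :: "('k, 'm) ring_scheme" and C :: "('k, 'c, 'n) module_scheme"
    and \<tau> :: "'c => 'c" and q :: 'k and d :: "nat => 'c => 'c" +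
  fixes M :: "('k, 'b, 'p) module_scheme" (structure) and \<theta> :: "'c => 'b" and y :: 'b
  assumes M_alg: "nc_algebra K M" and th: "\<theta> \<in> alg_hom K C M" and y: "y \<in> Units M"
    and comm: "a \<in> carrier C ==> y \<otimes> \<theta> a = \<theta> (\<tau> a) \<otimes> y"

sublocale higher_emb \<subseteq> M: nc_algebra K M
  by (rule M_alg)

section \<open>The deleting homomorphism \<open>g\<close> on the coefficients\<close>

context higher_emb
begin

text \<open>The scalar that solves \<open>coefficient_identity\<close> for all k at once; it exists
  because q is not 1.\<close>

definition u :: 'k where "u = inv\<^bsub>K\<^esub> (\<one>\<^bsub>K\<^esub> \<ominus>\<^bsub>K\<^esub> q)"

definition w :: 'b where "w = u \<odot> inv y"

lemma one_minus_q: "\<one>\<^bsub>K\<^esub> \<ominus>\<^bsub>K\<^esub> q \<in> carrier K" "\<one>\<^bsub>K\<^esub> \<ominus>\<^bsub>K\<^esub> q ~= \<zero>\<^bsub>K\<^esub>"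
  using q K.r_right_minus_eq[of "\<one>\<^bsub>K\<^esub>" q] by auto

lemma u [simp]: "u \<in> carrier K" and u_inv: "u \<otimes>\<^bsub>K\<^esub> (\<one>\<^bsub>K\<^esub> \<ominus>\<^bsub>K\<^esub> q) = \<one>\<^bsub>K\<^esub>"
proof -
  have "\<one>\<^bsub>K\<^esub> \<ominus>\<^bsub>K\<^esub> q \<in> Units K" using one_minus_q K.field_Units by simp
  then show "u \<in> carrier K" "u \<otimes>\<^bsub>K\<^esub> (\<one>\<^bsub>K\<^esub> \<ominus>\<^bsub>K\<^esub> q) = \<one>\<^bsub>K\<^esub>" unfolding u_def by auto
qed

lemma y_carr [simp]: "y \<in> carrier M" and w_carr [simp]: "w \<in> carrier M"
  using y by (auto simp: w_def)

lemma yw: "y \<otimes> w = u \<odot> \<one>" "w \<otimes> y = u \<odot> \<one>"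
  using y by (simp_all add: w_def M.smult_mult_left M.smult_mult_right)

lemma th_closed [simp]: "a \<in> carrier C ==> \<theta> a \<in> carrier M"
  by (rule alg_homD(1)[OF th])

lemma th_eq: "a \<in> carrier C ==> b \<in> carrier C ==> \<theta> (a \<otimes>\<^bsub>C\<^esub> b) = \<theta> a \<otimes> \<theta> b"
  "a \<in> carrier C ==> b \<in> carrier C ==> \<theta> (a \<oplus>\<^bsub>C\<^esub> b) = \<theta> a \<oplus> \<theta> b"
  "c \<in> carrier K ==> a \<in> carrier C ==> \<theta> (c \<odot>\<^bsub>C\<^esub> a) = c \<odot> \<theta> a" "\<theta> \<one>\<^bsub>C\<^esub> = \<one>" "\<theta> \<zero>\<^bsub>C\<^esub> = \<zero>"
  using alg_homD[OF th] alg_hom_zero[OF A.ring_axioms M.A.ring_axioms th] by auto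

lemma th_w:
  assumes "a \<in> carrier C" shows "\<theta> a \<otimes> w = w \<otimes> \<theta> (\<tau> a)"
proof -
  have i: "inv y \<in> carrier M" using y by simp
  have "inv y \<otimes> \<theta> (\<tau> a) = inv y \<otimes> \<theta> (\<tau> a) \<otimes> (y \<otimes> inv y)"
    using y assms i by simp
  also have "\<dots> = inv y \<otimes> (\<theta> (\<tau> a) \<otimes> y) \<otimes> inv y"
    using assms i by (simp add: M.A.m_assoc del: M.A.Units_r_inv)
  also have "\<dots> = (inv y \<otimes> y) \<otimes> (\<theta> a \<otimes> inv y)"
    unfolding comm[OF assms, symmetric] using assms i by (simp add: M.A.m_assoc del: M.A.Units_l_inv)
  also have "\<dots> = \<theta> a \<otimes> inv y" using y assms i by simp
  finally show ?thesis using assms i by (simp add: w_def M.smult_mult_left M.smult_mult_right)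
qed

lemma th_wpow: "a \<in> carrier C ==> \<theta> a \<otimes> w [^] (k::nat) = w [^] k \<otimes> \<theta> ((\<tau> ^^ k) a)"
proof (induct k)
  case (Suc k)
  have "\<theta> a \<otimes> w [^] Suc k = (\<theta> a \<otimes> w [^] k) \<otimes> w" using Suc(2) by (simp add: M.A.m_assoc)
  also have "\<dots> = (w [^] k \<otimes> \<theta> ((\<tau> ^^ k) a)) \<otimes> w" using Suc by simp
  also have "\<dots> = w [^] k \<otimes> (\<theta> ((\<tau> ^^ k) a) \<otimes> w)" using Suc(2) by (simp add: M.A.m_assoc)
  also have "\<dots> = w [^] Suc k \<otimes> \<theta> ((\<tau> ^^ Suc k) a)"
    using Suc(2) by (simp add: th_w M.A.m_assoc)
  finally show ?case .
qed simp

lemma comm_pow: "a \<in> carrier C ==> y [^] (k::nat) \<otimes> \<theta> a = \<theta> ((\<tau> ^^ k) a) \<otimes> y [^] k"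
proof (induct k)
  case (Suc k)
  have "y [^] Suc k \<otimes> \<theta> a = y \<otimes> (y [^] k \<otimes> \<theta> a)"
    using Suc(2) by (subst M.A.nat_pow_Suc2) (simp_all add: M.A.m_assoc)
  also have "\<dots> = (y \<otimes> \<theta> ((\<tau> ^^ k) a)) \<otimes> y [^] k" using Suc by (simp add: M.A.m_assoc)
  also have "\<dots> = \<theta> ((\<tau> ^^ Suc k) a) \<otimes> (y \<otimes> y [^] k)"
    using Suc(2) by (simp add: comm M.A.m_assoc)
  also have "y \<otimes> y [^] k = y [^] Suc k" by (rule M.A.nat_pow_Suc2[symmetric]) simp
  finally show ?case .
qed simp

lemma ypow_wpow: "y [^] (k::nat) \<otimes> w [^] k = (u [^]\<^bsub>K\<^esub> k) \<odot> \<one>"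
proof (induct k)
  case (Suc k)
  have "y [^] Suc k \<otimes> w [^] Suc k = y \<otimes> (y [^] k \<otimes> w [^] k) \<otimes> w"
    by (subst M.A.nat_pow_Suc2) (simp_all add: M.A.m_assoc)
  also have "\<dots> = (u [^]\<^bsub>K\<^esub> Suc k) \<odot> \<one>"
    unfolding Suc by (simp add: M.smult_mult_left M.smult_mult_right yw M.smult_assoc1)
  finally show ?case .
qed simp

text \<open>Finite by local nilpotence. With w^k on the left of \<open>\<theta> (d k a)\<close>,
  multiplying two such sums produces exactly the twists of the Leibniz rule.\<close>

definition g :: "'c => 'b" where
  "g a = (\<Oplus> k \<in> {k. d k a ~= \<zero>\<^bsub>C\<^esub>}. w [^] k \<otimes> \<theta> (d k a))"

lemma d_bounded: "a \<in> carrier C ==> \<exists>n. \<forall>i>n. d i a = \<zero>\<^bsub>C\<^esub>"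
  using nilp[of a] by (metis less_imp_le)

lemma g_bound:
  assumes "a \<in> carrier C" "\<And>i. i > n ==> d i a = \<zero>\<^bsub>C\<^esub>"
  shows "g a = (\<Oplus> k \<in> {..n}. w [^] k \<otimes> \<theta> (d k a))"
proof -
  have "{k. d k a ~= \<zero>\<^bsub>C\<^esub>} \<subseteq> {..n}" using assms(2) by (auto simp: not_less[symmetric])
  then show ?thesis unfolding g_def
    using assms by (intro M.A.add.finprod_mono_neutral_cong_left) (auto simp: th_eq)
qed

lemma g_closed [simp]: "a \<in> carrier C ==> g a \<in> carrier M"
  unfolding g_def by (intro M.A.finsum_closed) auto

lemma g_add:
  assumes "a \<in> carrier C" "b \<in> carrier C" shows "g (a \<oplus>\<^bsub>C\<^esub> b) = g a \<oplus> g b"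
proof -
  obtain n m where n: "\<forall>i>n. d i a = \<zero>\<^bsub>C\<^esub>" and m: "\<forall>i>m. d i b = \<zero>\<^bsub>C\<^esub>" using d_bounded assms by meson
  let ?N = "max n m"
  have "g (a \<oplus>\<^bsub>C\<^esub> b) = (\<Oplus> k \<in> {..?N}. w [^] k \<otimes> \<theta> (d k (a \<oplus>\<^bsub>C\<^esub> b)))"
    by (rule g_bound) (use assms n m d_add in auto)
  also have "\<dots> = (\<Oplus> k \<in> {..?N}. w [^] k \<otimes> \<theta> (d k a) \<oplus> w [^] k \<otimes> \<theta> (d k b))"
    by (rule M.A.finsum_cong') (use assms in \<open>auto simp: d_add th_eq M.A.r_distr\<close>)
  also have "\<dots> = g a \<oplus> g b"
    using assms n m g_bound[of a ?N] g_bound[of b ?N] by (simp add: M.A.finsum_addf)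
  finally show ?thesis .
qed

lemma g_smult:
  assumes "a \<in> carrier C" "c \<in> carrier K" shows "g (c \<odot>\<^bsub>C\<^esub> a) = c \<odot> g a"
proof -
  obtain n where n: "\<forall>i>n. d i a = \<zero>\<^bsub>C\<^esub>" using d_bounded assms by meson
  have "g (c \<odot>\<^bsub>C\<^esub> a) = (\<Oplus> k \<in> {..n}. w [^] k \<otimes> \<theta> (d k (c \<odot>\<^bsub>C\<^esub> a)))"
    by (rule g_bound) (use assms n d_smult in auto)
  also have "\<dots> = (\<Oplus> k \<in> {..n}. c \<odot> (w [^] k \<otimes> \<theta> (d k a)))"
    by (rule M.A.finsum_cong') (use assms in \<open>auto simp: d_smult th_eq M.smult_mult_right\<close>)
  also have "\<dots> = c \<odot> g a"
    using assms n g_bound[of a n] by (simp add: M.finsum_smult_ldistr)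
  finally show ?thesis .
qed

text \<open>If s is the top of 1, then 1 = 1 times 1 has the top s + s by \<open>top_mult\<close>,
  so s = 0.\<close>

lemma d_one: "i > 0 ==> d i \<one>\<^bsub>C\<^esub> = \<zero>\<^bsub>C\<^esub>"
proof -
  assume i: "i > 0"
  obtain m where m: "\<forall>i\<ge>m. d i \<one>\<^bsub>C\<^esub> = \<zero>\<^bsub>C\<^esub>" "\<forall>p<m. d p \<one>\<^bsub>C\<^esub> ~= \<zero>\<^bsub>C\<^esub>" using nilp[OF A.one_closed] by blast
  have "d 0 \<one>\<^bsub>C\<^esub> ~= \<zero>\<^bsub>C\<^esub>" using nc_domainD(2)[OF dom] by (simp add: d_0)
  then have "m > 0" using m(1) by (cases m) auto
  define s where "s = m - 1"
  have s: "d s \<one>\<^bsub>C\<^esub> ~= \<zero>\<^bsub>C\<^esub>" "\<And>i. i > s ==> d i \<one>\<^bsub>C\<^esub> = \<zero>\<^bsub>C\<^esub>" using m \<open>m > 0\<close> by (auto simp: s_def)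
  have "d (s + s) \<one>\<^bsub>C\<^esub> ~= \<zero>\<^bsub>C\<^esub>" using top_mult(1)[OF A.one_closed s A.one_closed s] by simp
  then have "s + s < m" using m(1) by (meson not_le)
  then have "s = 0" using s_def \<open>m > 0\<close> by simp
  then show "d i \<one>\<^bsub>C\<^esub> = \<zero>\<^bsub>C\<^esub>" using s(2) i by simp
qed

lemma g_one: "g \<one>\<^bsub>C\<^esub> = \<one>"
  using g_bound[OF A.one_closed, of 0] d_one by (simp add: d_0 th_eq)

text \<open>In the product of the two sums, w^(k-i) has to move left past
  \<open>\<theta> (d i a)\<close>, which turns \<open>d i a\<close> into its image under
  \<open>\<tau> ^^ (k - i)\<close>. So the terms with w^k add up to the Leibniz formula for d_k(ab),
  and the whole is a Cauchy product.\<close>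

lemma g_mult:
  assumes "a \<in> carrier C" "b \<in> carrier C" shows "g (a \<otimes>\<^bsub>C\<^esub> b) = g a \<otimes> g b"
proof -
  obtain n m where n: "\<And>i. i > n ==> d i a = \<zero>\<^bsub>C\<^esub>" and m: "\<And>i. i > m ==> d i b = \<zero>\<^bsub>C\<^esub>" using d_bounded assms by meson
  let ?f = "\<lambda>k. w [^] k \<otimes> \<theta> (d k a)" and ?h = "\<lambda>k. w [^] k \<otimes> \<theta> (d k b)"
  have "d i (a \<otimes>\<^bsub>C\<^esub> b) = \<zero>\<^bsub>C\<^esub>" if i: "i > n + m" for i
  proof -
    have "d i (a \<otimes>\<^bsub>C\<^esub> b) = (\<Oplus>\<^bsub>C\<^esub> j \<in> {..i}. \<zero>\<^bsub>C\<^esub>)"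
      unfolding leibniz[OF assms]
    proof (rule A.finsum_cong')
      fix j assume "j \<in> {..i}"
      then have "j > n \<or> i - j > m" using i by auto
      then show "(\<tau> ^^ (i - j)) (d j a) \<otimes>\<^bsub>C\<^esub> d (i - j) b = \<zero>\<^bsub>C\<^esub>" using n m assms by auto
    qed auto
    then show ?thesis by simp
  qed
  then have "g (a \<otimes>\<^bsub>C\<^esub> b) = (\<Oplus> k \<in> {..n + m}. w [^] k \<otimes> \<theta> (d k (a \<otimes>\<^bsub>C\<^esub> b)))"
    using assms by (intro g_bound) auto
  also have "\<dots> = (\<Oplus> k \<in> {..n + m}. \<Oplus> i \<in> {..k}. ?f i \<otimes> ?h (k - i))"
  proof (rule M.A.finsum_cong')
    fix k assume "k \<in> {..n + m}"
    have "w [^] k \<otimes> \<theta> (d k (a \<otimes>\<^bsub>C\<^esub> b)) =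
      w [^] k \<otimes> (\<Oplus> i \<in> {..k}. \<theta> ((\<tau> ^^ (k - i)) (d i a) \<otimes>\<^bsub>C\<^esub> d (k - i) b))"
      unfolding leibniz[OF assms]
      by (subst alg_hom_finsum[OF A.ring_axioms M.A.ring_axioms th]) (use assms in auto)
    also have "\<dots> = (\<Oplus> i \<in> {..k}. w [^] k \<otimes> \<theta> ((\<tau> ^^ (k - i)) (d i a) \<otimes>\<^bsub>C\<^esub> d (k - i) b))"
      by (rule M.A.finsum_rdistr) (use assms in auto)
    also have "\<dots> = (\<Oplus> i \<in> {..k}. ?f i \<otimes> ?h (k - i))"
    proof (rule M.A.finsum_cong')
      fix i assume i: "i \<in> {..k}"
      have "?f i \<otimes> ?h (k - i) = w [^] i \<otimes> (\<theta> (d i a) \<otimes> w [^] (k - i)) \<otimes> \<theta> (d (k - i) b)"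
        using assms by (simp add: M.A.m_assoc)
      also have "\<dots> = (w [^] i \<otimes> w [^] (k - i)) \<otimes> (\<theta> ((\<tau> ^^ (k - i)) (d i a)) \<otimes> \<theta> (d (k - i) b))"
        using assms by (simp add: th_wpow M.A.m_assoc)
      also have "w [^] i \<otimes> w [^] (k - i) = w [^] k" using i by (simp add: M.A.nat_pow_mult)
      finally show "w [^] k \<otimes> \<theta> ((\<tau> ^^ (k - i)) (d i a) \<otimes>\<^bsub>C\<^esub> d (k - i) b) = ?f i \<otimes> ?h (k - i)"
        using assms by (simp add: th_eq)
    qed (use assms in auto)
    finally show "w [^] k \<otimes> \<theta> (d k (a \<otimes>\<^bsub>C\<^esub> b)) = (\<Oplus> i \<in> {..k}. ?f i \<otimes> ?h (k - i))" .
  qed (use assms in \<open>auto intro!: M.A.finsum_closed\<close>)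
  also have "\<dots> = (\<Oplus> i \<in> {..n}. ?f i) \<otimes> (\<Oplus> i \<in> {..m}. ?h i)"
    by (rule M.A.cauchy_product) (use assms n m in \<open>auto intro!: bound.intro simp: th_eq\<close>)
  also have "\<dots> = g a \<otimes> g b" using g_bound[OF assms(1) n] g_bound[OF assms(2) m] by simp
  finally show ?thesis .
qed

lemma g_hom: "g \<in> alg_hom K C M"
  by (rule alg_homI) (auto simp: g_mult g_add g_one g_smult)

text \<open>Since u is inverse to 1 - q, the q-integer equals u(1 - q^(k+1)).\<close>

lemma coefficient_identity:
  "u = u \<otimes>\<^bsub>K\<^esub> (q [^]\<^bsub>K\<^esub> Suc k) \<oplus>\<^bsub>K\<^esub> qbinom_at K (Suc k) 1 q"
proof -
  let ?B = "qbinom_at K (Suc k) 1 q" and ?Q = "q [^]\<^bsub>K\<^esub> Suc k"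
  have c: "?B \<in> carrier K" "?Q \<in> carrier K" using q K.qbinom_at_closed[OF q(1)] by auto
  have "?B = (u \<otimes>\<^bsub>K\<^esub> (\<one>\<^bsub>K\<^esub> \<ominus>\<^bsub>K\<^esub> q)) \<otimes>\<^bsub>K\<^esub> ?B" using c by (simp add: u_inv)
  also have "\<dots> = u \<otimes>\<^bsub>K\<^esub> (\<one>\<^bsub>K\<^esub> \<ominus>\<^bsub>K\<^esub> ?Q)"
    using c one_minus_q K.qbinom_at_1[OF q(1), of k] by (simp add: K.m_assoc)
  finally have "u \<otimes>\<^bsub>K\<^esub> ?Q \<oplus>\<^bsub>K\<^esub> ?B = u \<otimes>\<^bsub>K\<^esub> (?Q \<oplus>\<^bsub>K\<^esub> (\<one>\<^bsub>K\<^esub> \<ominus>\<^bsub>K\<^esub> ?Q))"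
    using c by (simp only: K.r_distr u K.one_closed K.minus_closed)
  also have "?Q \<oplus>\<^bsub>K\<^esub> (\<one>\<^bsub>K\<^esub> \<ominus>\<^bsub>K\<^esub> ?Q) = \<one>\<^bsub>K\<^esub>"
    using c by (simp only: a_minus_def K.a_lcomm K.one_closed K.a_inv_closed K.r_neg K.r_zero)
  finally show ?thesis by simp
qed

text \<open>The terms without w match by \<open>comm\<close>. For the others compare the
  coefficients of w^k \<open>\<theta>\<close>(d_(k+1) a): on the left y w = u contributes u; on the
  right \<open>d_tau\<close> contributes u q^(k+1), and d_k d_1 contributes (k+1)_q. These agree by
  \<open>coefficient_identity\<close>.\<close>

lemma y_g:
  assumes a: "a \<in> carrier C" shows "y \<otimes> g a = g (\<tau> a) \<otimes> y \<oplus> g (d 1 a)"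
proof -
  obtain n where n: "\<And>i. i > n ==> d i a = \<zero>\<^bsub>C\<^esub>" using d_bounded a by meson
  let ?t = "\<lambda>k. w [^] k \<otimes> \<theta> (d (Suc k) a)" and ?B = "\<lambda>k. qbinom_at K (Suc k) 1 q"
  have t: "?t k \<in> carrier M" for k using a by simp
  have B: "?B k \<in> carrier K" for k by (rule K.qbinom_at_closed[OF q(1)])
  have qk: "q [^]\<^bsub>K\<^esub> (k::nat) \<in> carrier K" for k using q by simp
  \<comment> \<open>Summing up to \<open>Suc n\<close> instead of n leaves, after the constant term
    is split off, sums over \<open>{..n}\<close> whose k-th term contains
    \<open>d (Suc k) a\<close>. All three sums can then be compared term by term.\<close>
  have "y \<otimes> g a = (\<Oplus> k \<in> {..Suc n}. y \<otimes> (w [^] k \<otimes> \<theta> (d k a)))"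
    unfolding g_bound[OF a n, of "Suc n", simplified] using a by (intro M.A.finsum_rdistr) auto
  also have "\<dots> = (\<Oplus> k \<in> {..n}. y \<otimes> (w [^] Suc k \<otimes> \<theta> (d (Suc k) a))) \<oplus> y \<otimes> \<theta> a"
    using a by (subst M.A.finsum_Suc2) (auto simp: d_0)
  also have "(\<Oplus> k \<in> {..n}. y \<otimes> (w [^] Suc k \<otimes> \<theta> (d (Suc k) a))) = (\<Oplus> k \<in> {..n}. u \<odot> ?t k)"
  proof (rule M.A.finsum_cong')
    fix k
    have "y \<otimes> (w [^] Suc k \<otimes> \<theta> (d (Suc k) a)) = (y \<otimes> w) \<otimes> ?t k"
      using a by (subst M.A.nat_pow_Suc2) (simp_all add: M.A.m_assoc)
    then show "y \<otimes> (w [^] Suc k \<otimes> \<theta> (d (Suc k) a)) = u \<odot> ?t k"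
      using t by (simp add: yw M.smult_mult_left)
  qed (use t in auto)
  finally have 1: "y \<otimes> g a = (\<Oplus> k \<in> {..n}. u \<odot> ?t k) \<oplus> \<theta> (\<tau> a) \<otimes> y"
    using comm[OF a] by simp
  have "d i (\<tau> a) = \<zero>\<^bsub>C\<^esub>" if "i > Suc n" for i using d_tau[OF a] n that qk by simp
  then have "g (\<tau> a) \<otimes> y = (\<Oplus> k \<in> {..Suc n}. w [^] k \<otimes> \<theta> (d k (\<tau> a)) \<otimes> y)"
    using g_bound[of "\<tau> a" "Suc n"] a by (simp add: M.A.finsum_ldistr del: M.A.finsum_Suc)
  also have "\<dots> = (\<Oplus> k \<in> {..n}. w [^] Suc k \<otimes> \<theta> (d (Suc k) (\<tau> a)) \<otimes> y) \<oplus> \<theta> (\<tau> a) \<otimes> y"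
    using a by (subst M.A.finsum_Suc2) (auto simp: d_0)
  also have "(\<Oplus> k \<in> {..n}. w [^] Suc k \<otimes> \<theta> (d (Suc k) (\<tau> a)) \<otimes> y) =
    (\<Oplus> k \<in> {..n}. (u \<otimes>\<^bsub>K\<^esub> (q [^]\<^bsub>K\<^esub> Suc k)) \<odot> ?t k)"
  proof (rule M.A.finsum_cong')
    fix k
    have "w [^] Suc k \<otimes> \<theta> (d (Suc k) (\<tau> a)) \<otimes> y
      = (q [^]\<^bsub>K\<^esub> Suc k) \<odot> (w [^] k \<otimes> (w \<otimes> (\<theta> (\<tau> (d (Suc k) a)) \<otimes> y)))"
      using a q by (simp add: d_tau th_eq M.A.m_assoc M.smult_mult_left M.smult_mult_right)
    also have "\<theta> (\<tau> (d (Suc k) a)) \<otimes> y = y \<otimes> \<theta> (d (Suc k) a)" using comm a by simp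
    also have "w \<otimes> (y \<otimes> \<theta> (d (Suc k) a)) = u \<odot> \<theta> (d (Suc k) a)"
      using a by (simp add: M.A.m_assoc[symmetric] yw M.smult_mult_left)
    finally have "w [^] Suc k \<otimes> \<theta> (d (Suc k) (\<tau> a)) \<otimes> y = (q [^]\<^bsub>K\<^esub> Suc k) \<odot> (u \<odot> ?t k)"
      using a by (simp only: M.smult_mult_right u th_closed d_closed M.A.nat_pow_closed w_carr)
    also have "\<dots> = (u \<otimes>\<^bsub>K\<^esub> (q [^]\<^bsub>K\<^esub> Suc k)) \<odot> ?t k"
      using t qk by (simp only: M.smult_assoc1[symmetric] K.m_comm u)
    finally show "w [^] Suc k \<otimes> \<theta> (d (Suc k) (\<tau> a)) \<otimes> y = (u \<otimes>\<^bsub>K\<^esub> (q [^]\<^bsub>K\<^esub> Suc k)) \<odot> ?t k" .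
  qed (use t qk q(1) in auto)
  finally have 2: "g (\<tau> a) \<otimes> y = (\<Oplus> k \<in> {..n}. (u \<otimes>\<^bsub>K\<^esub> (q [^]\<^bsub>K\<^esub> Suc k)) \<odot> ?t k) \<oplus> \<theta> (\<tau> a) \<otimes> y" .
  have dd: "d k (d 1 a) = ?B k \<odot>\<^bsub>C\<^esub> d (Suc k) a" for k using d_d[OF a, of k 1] by simp
  have "g (d 1 a) = (\<Oplus> k \<in> {..n}. w [^] k \<otimes> \<theta> (d k (d 1 a)))"
    by (rule g_bound) (use a n dd B in auto)
  also have "\<dots> = (\<Oplus> k \<in> {..n}. ?B k \<odot> ?t k)"
    unfolding dd using a B t by (intro M.A.finsum_cong') (auto simp: th_eq M.smult_mult_right)
  finally have 3: "g (d 1 a) = (\<Oplus> k \<in> {..n}. ?B k \<odot> ?t k)" .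
  let ?S2 = "\<Oplus> k \<in> {..n}. (u \<otimes>\<^bsub>K\<^esub> (q [^]\<^bsub>K\<^esub> Suc k)) \<odot> ?t k" and ?S3 = "\<Oplus> k \<in> {..n}. ?B k \<odot> ?t k"
  have S: "?S2 \<in> carrier M" "?S3 \<in> carrier M" using t qk q(1) B by (auto intro!: M.A.finsum_closed)
  have "(\<Oplus> k \<in> {..n}. u \<odot> ?t k) = (\<Oplus> k \<in> {..n}. (u \<otimes>\<^bsub>K\<^esub> (q [^]\<^bsub>K\<^esub> Suc k)) \<odot> ?t k \<oplus> ?B k \<odot> ?t k)"
  proof (rule M.A.finsum_cong')
    fix k
    have "u \<odot> ?t k = (u \<otimes>\<^bsub>K\<^esub> (q [^]\<^bsub>K\<^esub> Suc k) \<oplus>\<^bsub>K\<^esub> ?B k) \<odot> ?t k"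
      using coefficient_identity[of k] by simp
    then show "u \<odot> ?t k = (u \<otimes>\<^bsub>K\<^esub> (q [^]\<^bsub>K\<^esub> Suc k)) \<odot> ?t k \<oplus> ?B k \<odot> ?t k"
      using t qk B by (simp only: M.smult_l_distr K.m_closed u)
  qed (use t qk q(1) B in auto)
  also have "\<dots> = ?S2 \<oplus> ?S3" by (rule M.A.finsum_addf) (use t qk q(1) B in auto)
  finally show ?thesis unfolding 1 2 3 using S a by (simp only: M.A.a_ac th_closed tau(1) M.A.m_closed y_carr)
qed

text \<open>Up to lower terms \<^term>\<open>g a\<close> is \<^term>\<open>\<theta> a\<close>; the lower terms are cleared one after the other.\<close>

lemma ypow_th_mem:
  assumes W: "subalg K M W" and gW: "\<And>a. a \<in> carrier C ==> g a \<in> W" and yW: "y \<in> W"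
  shows "a \<in> carrier C ==> (\<And>i. i \<ge> m ==> d i a = \<zero>\<^bsub>C\<^esub>) ==> y [^] m \<otimes> \<theta> a \<in> W"
proof (induct m arbitrary: a rule: less_induct)
  case (less m)
  note WD = subalgD[OF W]
  have ypW: "y [^] (k::nat) \<in> W" for k using WD yW by (induct k) auto
  show ?case
  proof (cases m)
    case 0
    then have "a = \<zero>\<^bsub>C\<^esub>" using less(2,3) d_0 by fastforce
    then show ?thesis using WD(4) by (simp add: th_eq)
  next
    case (Suc p)
    let ?f = "\<lambda>k. w [^] k \<otimes> \<theta> (d k a)"
    have f: "?f k \<in> carrier M" for k using less(2) by simp
    let ?s = "\<Oplus> k \<in> {1..p}. ?f k"
    have "g a = (\<Oplus> k \<in> {..p}. ?f k)" by (rule g_bound) (use less Suc in auto)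
    also have "{..p} = insert 0 {1..p}" by auto
    also have "(\<Oplus> k \<in> insert 0 {1..p}. ?f k) = \<theta> a \<oplus> ?s"
      using less(2) by (subst M.A.finsum_insert) (auto simp: d_0)
    finally have ga: "g a = \<theta> a \<oplus> ?s" .
    have s: "?s \<in> carrier M" using f by (intro M.A.finsum_closed) auto
    have "y [^] m \<otimes> ?s = (\<Oplus> k \<in> {1..p}. y [^] m \<otimes> ?f k)"
      by (rule M.A.finsum_rdistr) (use f in auto)
    also have "\<dots> \<in> W"
    proof (rule M.A.finsum_subring[OF WD(1)])
      fix k assume k: "k \<in> {1..p}"
      then have "y [^] m = y [^] (m - k) \<otimes> y [^] k" using Suc by (simp add: M.A.nat_pow_mult)
      then have "y [^] m \<otimes> ?f k = y [^] (m - k) \<otimes> (y [^] k \<otimes> w [^] k) \<otimes> \<theta> (d k a)"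
        using less(2) by (simp add: M.A.m_assoc)
      also have "\<dots> = (u [^]\<^bsub>K\<^esub> k) \<odot> (y [^] (m - k) \<otimes> \<theta> (d k a))"
        unfolding ypow_wpow using less(2) by (simp add: M.smult_mult_left M.smult_mult_right)
      finally have e: "y [^] m \<otimes> ?f k = (u [^]\<^bsub>K\<^esub> k) \<odot> (y [^] (m - k) \<otimes> \<theta> (d k a))" .
      \<comment> \<open>The element \<open>d k a\<close> is annihilated already from index m - k on,
        and y^m w^k is a scalar times y^(m-k). So the lower terms are instances of the induction
        hypothesis.\<close>
      have "d i (d k a) = \<zero>\<^bsub>C\<^esub>" if "i \<ge> m - k" for i
        using d_d[OF less(2), of i k] less(3)[of "i + k"] that K.qbinom_at_closed[OF q(1)] by simp
      then have "y [^] (m - k) \<otimes> \<theta> (d k a) \<in> W"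
        using less(1)[of "m - k" "d k a"] k Suc less(2) by simp
      then show "y [^] m \<otimes> ?f k \<in> W" unfolding e using WD(2) by simp
    qed simp
    finally have sW: "y [^] m \<otimes> ?s \<in> W" .
    have "y [^] m \<otimes> \<theta> a = y [^] m \<otimes> g a \<oplus> \<ominus> (y [^] m \<otimes> ?s)"
      unfolding ga using less(2) s by (simp add: M.A.r_distr M.A.a_assoc M.A.r_neg)
    then show ?thesis using WD(6)[OF sW] WD(7)[OF ypW[of m] gW[OF less(2)]] WD(8) by simp
  qed
qed

text \<open>The scalar is a power of q. What counts is that it is nonzero: a and its image under
  \<open>\<tau> ^^ n\<close> are annihilated by the same d_i.\<close>

lemma d_tau_pow: "a \<in> carrier C ==> \<exists>c \<in> carrier K. c ~= \<zero>\<^bsub>K\<^esub> \<and> d i ((\<tau> ^^ n) a) = c \<odot>\<^bsub>C\<^esub> (\<tau> ^^ n) (d i a)"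
proof (induct n)
  case 0
  then show ?case by (intro bexI[of _ "\<one>\<^bsub>K\<^esub>"]) auto
next
  case (Suc n)
  then obtain c where c: "c \<in> carrier K" "c ~= \<zero>\<^bsub>K\<^esub>" "d i ((\<tau> ^^ n) a) = c \<odot>\<^bsub>C\<^esub> (\<tau> ^^ n) (d i a)" by blast
  have qi: "q [^]\<^bsub>K\<^esub> i \<in> carrier K" "q [^]\<^bsub>K\<^esub> i ~= \<zero>\<^bsub>K\<^esub>"
    using q by (simp, induct i) (auto simp: K.integral_iff)
  have "d i ((\<tau> ^^ Suc n) a) = (q [^]\<^bsub>K\<^esub> i \<otimes>\<^bsub>K\<^esub> c) \<odot>\<^bsub>C\<^esub> (\<tau> ^^ Suc n) (d i a)"
    using Suc(2) c qi by (simp add: d_tau alg_homD(5)[OF tau_hom] smult_assoc1)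
  then show ?case using c qi K.integral_iff by (intro bexI[of _ "q [^]\<^bsub>K\<^esub> i \<otimes>\<^bsub>K\<^esub> c"]) auto
qed

text \<open>Write a as \<open>(\<tau> ^^ m) b\<close>. Then
  \<open>\<theta> a \<otimes> y [^] m\<close> equals \<open>y [^] m \<otimes> \<theta> b\<close>,
  and b obeys the same nilpotence bound as a, so the version with y on the left applies.\<close>

lemma th_ypow_mem:
  assumes W: "subalg K M W" and gW: "\<And>a. a \<in> carrier C ==> g a \<in> W" and yW: "y \<in> W"
    and a: "a \<in> carrier C" "\<And>i. i \<ge> m ==> d i a = \<zero>\<^bsub>C\<^esub>"
  shows "\<theta> a \<otimes> y [^] m \<in> W"
proof -
  have surj: "\<exists>b \<in> carrier C. (\<tau> ^^ n) b = a" if "a \<in> carrier C" for n a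
    using that
  proof (induct n arbitrary: a)
    case (Suc n)
    then obtain b where b: "b \<in> carrier C" "\<tau> b = a" using alg_isoD(3)[OF tau_iso] by (metis imageE)
    then show ?case using Suc(1)[OF b(1)] by auto
  qed auto
  then obtain b where b: "b \<in> carrier C" "(\<tau> ^^ m) b = a" using a(1) by blast
  have "d i b = \<zero>\<^bsub>C\<^esub>" if i: "i \<ge> m" for i
  proof -
    obtain c where c: "c \<in> carrier K" "c ~= \<zero>\<^bsub>K\<^esub>" "d i ((\<tau> ^^ m) b) = c \<odot>\<^bsub>C\<^esub> (\<tau> ^^ m) (d i b)"
      using d_tau_pow[OF b(1)] by blast
    then have "(\<tau> ^^ m) (d i b) = \<zero>\<^bsub>C\<^esub>" using smult_eq_0[OF c(1), of "(\<tau> ^^ m) (d i b)"] a(2)[OF i] b by auto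
    then show ?thesis using tau_pow_eq_0[of "d i b" m] b by simp
  qed
  then have "y [^] m \<otimes> \<theta> b \<in> W" using ypow_th_mem[OF W gW yW b(1)] by blast
  then show ?thesis using comm_pow[OF b(1), of m] b(2) by simp
qed

text \<open>Scaling y by c scales w^k by the inverse of c^k, while \<open>\<sigma>\<close> passes
  d_k with the factor c^k; the two factors cancel.\<close>

lemma g_equivariant:
  assumes \<sigma>: "\<sigma> \<in> alg_hom K C C" and \<Sigma>: "\<Sigma> \<in> alg_hom K M M" and c: "c \<in> carrier K" "c ~= \<zero>\<^bsub>K\<^esub>"
    and \<sigma>1: "\<And>a. a \<in> carrier C ==> \<sigma> (d 1 a) = c \<odot>\<^bsub>C\<^esub> d 1 (\<sigma> a)"
    and \<Sigma>\<theta>: "\<And>a. a \<in> carrier C ==> \<Sigma> (\<theta> a) = \<theta> (\<sigma> a)" and \<Sigma>y: "\<Sigma> y = c \<odot> y"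
    and a: "a \<in> carrier C"
  shows "\<Sigma> (g a) = g (\<sigma> a)"
proof -
  have sa: "\<sigma> a \<in> carrier C" using alg_homD(1)[OF \<sigma> a] .
  let ?i = "inv\<^bsub>K\<^esub> c"
  have i: "?i \<in> carrier K" using M.smult_inv_cancel[OF c M.A.one_closed] by simp
  have ci: "?i \<otimes>\<^bsub>K\<^esub> c = \<one>\<^bsub>K\<^esub>"
  proof -
    have "c \<in> Units K" using c K.field_Units by simp
    then show ?thesis by simp
  qed
  have \<Sigma>w: "\<Sigma> w = ?i \<odot> w"
  proof -
    have y': "inv (c \<odot> y) = ?i \<odot> inv y"
    proof (rule M.A.inv_unique'[symmetric])
      have yi: "inv y \<in> carrier M" using y by simp
      show "c \<odot> y \<in> carrier M" "?i \<odot> inv y \<in> carrier M" using c i yi by auto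
      show "(c \<odot> y) \<otimes> (?i \<odot> inv y) = \<one>"
        using c i yi y ci by (simp add: M.smult_mult_left M.smult_mult_right M.smult_assoc1[symmetric])
      show "(?i \<odot> inv y) \<otimes> (c \<odot> y) = \<one>"
        using c i yi y ci by (simp add: M.smult_mult_left M.smult_mult_right M.smult_assoc1[symmetric] K.m_comm)
    qed
    have "\<Sigma> w = u \<odot> (?i \<odot> inv y)"
      unfolding w_def using alg_homD(5)[OF \<Sigma> u] alg_hom_Units(2)[OF M.A.ring_axioms M.A.ring_axioms \<Sigma> y] y y' \<Sigma>y by simp
    then show ?thesis unfolding w_def using i y by (simp add: M.smult_assoc1[symmetric] K.m_comm)
  qed
  have \<Sigma>wk: "\<Sigma> (w [^] k) = (?i [^]\<^bsub>K\<^esub> k) \<odot> w [^] k" for k :: nat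
  proof (induct k)
    case 0
    then show ?case using alg_homD(4)[OF \<Sigma>] by simp
  next
    case (Suc k)
    then show ?case using alg_homD(2)[OF \<Sigma>, of "w [^] k" w] \<Sigma>w i
      by (simp add: M.smult_mult_left M.smult_mult_right M.smult_assoc1[symmetric] K.m_comm)
  qed
  obtain n m where n: "\<forall>i>n. d i a = \<zero>\<^bsub>C\<^esub>" and m: "\<forall>i>m. d i (\<sigma> a) = \<zero>\<^bsub>C\<^esub>" using d_bounded a sa by meson
  let ?N = "max n m"
  have "\<Sigma> (g a) = (\<Oplus> k \<in> {..?N}. \<Sigma> (w [^] k \<otimes> \<theta> (d k a)))"
    using g_bound[of a ?N] a n by (simp add: alg_hom_finsum[OF M.A.ring_axioms M.A.ring_axioms \<Sigma>])
  also have "\<dots> = (\<Oplus> k \<in> {..?N}. w [^] k \<otimes> \<theta> (d k (\<sigma> a)))"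
  proof (rule M.A.finsum_cong')
    fix k :: nat
    have ic: "(?i [^]\<^bsub>K\<^esub> k) \<otimes>\<^bsub>K\<^esub> (c [^]\<^bsub>K\<^esub> k) = \<one>\<^bsub>K\<^esub>"
      using K.nat_pow_distrib[OF i c(1), of k] ci by simp
    then have ic': "(c [^]\<^bsub>K\<^esub> k) \<otimes>\<^bsub>K\<^esub> (?i [^]\<^bsub>K\<^esub> k) = \<one>\<^bsub>K\<^esub>" using i c by (simp add: K.m_comm)
    have "\<Sigma> (w [^] k \<otimes> \<theta> (d k a)) = ((?i [^]\<^bsub>K\<^esub> k) \<odot> w [^] k) \<otimes> \<theta> ((c [^]\<^bsub>K\<^esub> k) \<odot>\<^bsub>C\<^esub> d k (\<sigma> a))"
      using alg_homD(2)[OF \<Sigma>, of "w [^] k" "\<theta> (d k a)"] a \<Sigma>wk \<Sigma>\<theta> automorphism_higher[OF \<sigma> c(1) \<sigma>1 a, of k] by simp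
    also have "\<dots> = w [^] k \<otimes> \<theta> (d k (\<sigma> a))"
      using i c sa ic ic' by (simp add: th_eq M.smult_mult_left M.smult_mult_right M.smult_assoc1[symmetric])
    finally show "\<Sigma> (w [^] k \<otimes> \<theta> (d k a)) = w [^] k \<otimes> \<theta> (d k (\<sigma> a))" .
  qed (use sa in auto)
  also have "\<dots> = g (\<sigma> a)" using g_bound[of "\<sigma> a" ?N] sa m by simp
  finally show ?thesis .
qed

end

section \<open>Fractions and automorphisms of skew Laurent rings\<close>

context skew_laur
begin

text \<open>The Laurent polynomials with coefficients in X, where X will be the image of C or the
  polynomial ring V. They are the intermediate goal when denominators are cleared: first
  coefficients, then negative powers of y.\<close>

definition zspan :: "'a set => 'a set" where
  "zspan X = lcomb M (\<lambda>i::int. y [^] i) ` fin_coeffs M X"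

lemma y_pow_unit [simp]: "y [^] (k::int) \<in> carrier M"
  by simp

context
  fixes X assumes X: "subalg K M X"
    and nX: "\<And>a k. a \<in> X ==> \<exists>a' \<in> X. y [^] (k::int) \<otimes> a = a' \<otimes> y [^] k"
begin

interpretation XF: left_family M X "\<lambda>i::int. y [^] i"
  by (intro left_family.intro left_family_axioms.intro A.ring_axioms subalgD(1)[OF X]) simp

lemma zspan_add: "u \<in> zspan X ==> v \<in> zspan X ==> u \<oplus> v \<in> zspan X"
  unfolding zspan_def by (auto simp: XF.add_coeffs(1) simp flip: XF.add_coeffs(2))

lemma zspan_monom: "a \<in> X ==> a \<otimes> y [^] (k::int) \<in> zspan X"
  using XF.single_coeffs[of a k] unfolding zspan_def
  by (intro image_eqI[of _ _ "\<lambda>j. if j = k then a else \<zero>"]) simp_all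

lemma zspan_monom': "a \<in> X ==> y [^] (k::int) \<otimes> a \<in> zspan X"
  using nX zspan_monom by metis

lemma zspan_induct [consumes 1, case_names monom add]:
  assumes "z \<in> zspan X" and "\<And>a k. a \<in> X ==> P (a \<otimes> y [^] (k::int))"
    and "\<And>u v. [|u \<in> carrier M; v \<in> carrier M; P u; P v|] ==> P (u \<oplus> v)"
  shows "P z"
  using assms(1) XF.lcomb_induct[of _ P] assms(2,3) unfolding zspan_def by blast

lemma zspan_lmult:
  assumes "a \<in> X" "z \<in> zspan X" shows "a \<otimes> z \<in> zspan X"
  using assms XF.smult_coeffs(1)[OF _ assms(1)] unfolding zspan_def
  by (auto simp flip: XF.smult_coeffs(2)[OF _ assms(1)])

lemma zspan_rmult:
  assumes a: "a \<in> X" and z: "z \<in> zspan X" shows "z \<otimes> a \<in> zspan X"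
  using z
proof (induct rule: zspan_induct)
  case (monom b k)
  obtain a' where a': "a' \<in> X" "y [^] k \<otimes> a = a' \<otimes> y [^] k" using nX[OF a] by blast
  have "b \<otimes> y [^] k \<otimes> a = (b \<otimes> a') \<otimes> y [^] k"
    using a a' monom XF.S_carrier by (simp add: A.m_assoc)
  then show ?case using zspan_monom[OF subalgD(7)[OF X monom a'(1)]] by simp
next
  case (add u v)
  then show ?case using a XF.S_carrier zspan_add by (simp add: A.l_distr)
qed

text \<open>Left denominators act directly on the coefficients, so they can be cleared one monomial
  at a time.\<close>

lemma zspan_left_fraction:
  assumes T: "T \<subseteq> X" "\<one> \<in> T" "\<And>s t. s \<in> T ==> t \<in> T ==> s \<otimes> t \<in> T"
    and XS: "X \<subseteq> S" and frac: "\<And>b. b \<in> S ==> \<exists>s \<in> T. s \<otimes> b \<in> X" and l: "l \<in> carrier M"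
  shows "\<exists>s \<in> T. s \<otimes> l \<in> zspan X"
proof -
  have Tc: "t \<in> carrier M" "t \<in> X" "t \<in> S" if "t \<in> T" for t using that T(1) XS XF.S_carrier by auto
  \<comment> \<open>The factor e collects the denominators already spent on other summands.
    Quantifying over it lets two summands be cleared in succession, without a search for common
    multiples in T.\<close>
  have "\<forall>e \<in> T. \<exists>s \<in> T. s \<otimes> (e \<otimes> l) \<in> zspan X"
    using l
  proof (induct rule: basis_induct)
    case (monom b k)
    show ?case
    proof
      fix e assume e: "e \<in> T"
      then have "e \<otimes> b \<in> S" using Tc SE(6) monom by blast
      then obtain s where s: "s \<in> T" "s \<otimes> (e \<otimes> b) \<in> X" using frac by blast
      have "s \<otimes> (e \<otimes> (b \<otimes> y [^] k)) = (s \<otimes> (e \<otimes> b)) \<otimes> y [^] k"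
        using Tc(1)[OF s(1)] Tc(1)[OF e] monom by (simp add: A.m_assoc)
      then show "\<exists>s \<in> T. s \<otimes> (e \<otimes> (b \<otimes> y [^] k)) \<in> zspan X" using zspan_monom[OF s(2)] s(1) by metis
    qed
  next
    case (add u v)
    show ?case
    proof
      fix e assume e: "e \<in> T"
      obtain s1 where s1: "s1 \<in> T" "s1 \<otimes> (e \<otimes> u) \<in> zspan X" using add e by blast
      obtain s2 where s2: "s2 \<in> T" "s2 \<otimes> ((s1 \<otimes> e) \<otimes> v) \<in> zspan X" using add T(3)[OF s1(1) e] by blast
      have c: "e \<in> carrier M" "s1 \<in> carrier M" "s2 \<in> carrier M" using Tc e s1 s2 by auto
      have "(s2 \<otimes> s1) \<otimes> (e \<otimes> (u \<oplus> v)) = s2 \<otimes> (s1 \<otimes> (e \<otimes> u)) \<oplus> s2 \<otimes> ((s1 \<otimes> e) \<otimes> v)"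
        using c add(1,2) by (simp add: A.r_distr A.m_assoc)
      also have "\<dots> \<in> zspan X" using zspan_add zspan_lmult Tc(2) s1 s2 by blast
      finally show "\<exists>s \<in> T. s \<otimes> (e \<otimes> (u \<oplus> v)) \<in> zspan X" using T(3)[OF s2(1) s1(1)] by blast
    qed
  qed
  then show ?thesis using T(2) l by fastforce
qed

text \<open>On the right a power of y separates the coefficient from the denominator, so the
  coefficient must first change sides.\<close>

lemma zspan_right_fraction:
  assumes T: "T \<subseteq> X" "\<one> \<in> T" "\<And>s t. s \<in> T ==> t \<in> T ==> s \<otimes> t \<in> T"
    and XS: "X \<subseteq> S" and frac: "\<And>b. b \<in> S ==> \<exists>s \<in> T. b \<otimes> s \<in> X" and l: "l \<in> carrier M"
  shows "\<exists>s \<in> T. l \<otimes> s \<in> zspan X"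
proof -
  have Tc: "t \<in> carrier M" "t \<in> X" "t \<in> S" if "t \<in> T" for t using that T(1) XS XF.S_carrier by auto
  have "\<forall>e \<in> T. \<exists>s \<in> T. (l \<otimes> e) \<otimes> s \<in> zspan X"
    using l
  proof (induct rule: basis_induct)
    case (monom b k)
    show ?case
    proof
      fix e assume e: "e \<in> T"
      obtain e' where e': "e' \<in> S" "y [^] k \<otimes> e = e' \<otimes> y [^] k" using y_normalizes(1)[OF Tc(3)[OF e]] by blast
      \<comment> \<open>Moves the coefficient behind y^k, where a denominator on the right can reach
        it; after clearing, \<open>zspan_monom'\<close> moves it back.\<close>
      obtain b' where b': "b' \<in> S" "(b \<otimes> e') \<otimes> y [^] k = y [^] k \<otimes> b'"
        using y_normalizes(2)[OF SE(6)[OF monom e'(1)]] by blast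
      obtain s where s: "s \<in> T" "b' \<otimes> s \<in> X" using frac[OF b'(1)] by blast
      have "(b \<otimes> y [^] k \<otimes> e) \<otimes> s = y [^] k \<otimes> (b' \<otimes> s)"
      proof -
        have "b \<otimes> y [^] k \<otimes> e = (b \<otimes> e') \<otimes> y [^] k"
          using e' Tc(1)[OF e] monom by (simp add: A.m_assoc)
        then show ?thesis unfolding b'(2) using b'(1) Tc(1)[OF s(1)] by (simp add: A.m_assoc)
      qed
      then show "\<exists>s \<in> T. (b \<otimes> y [^] k \<otimes> e) \<otimes> s \<in> zspan X" using zspan_monom'[OF s(2)] s(1) by metis
    qed
  next
    case (add u v)
    show ?case
    proof
      fix e assume e: "e \<in> T"
      obtain s1 where s1: "s1 \<in> T" "(u \<otimes> e) \<otimes> s1 \<in> zspan X" using add e by blast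
      obtain s2 where s2: "s2 \<in> T" "(v \<otimes> (e \<otimes> s1)) \<otimes> s2 \<in> zspan X" using add T(3)[OF e s1(1)] by blast
      have c: "e \<in> carrier M" "s1 \<in> carrier M" "s2 \<in> carrier M" using Tc e s1 s2 by auto
      have "((u \<oplus> v) \<otimes> e) \<otimes> (s1 \<otimes> s2) = ((u \<otimes> e) \<otimes> s1) \<otimes> s2 \<oplus> (v \<otimes> (e \<otimes> s1)) \<otimes> s2"
        using c add(1,2) by (simp add: A.l_distr A.m_assoc)
      also have "\<dots> \<in> zspan X" using zspan_add zspan_rmult Tc(2) s1 s2 by blast
      finally show "\<exists>s \<in> T. ((u \<oplus> v) \<otimes> e) \<otimes> s \<in> zspan X" using T(3)[OF s1(1) s2(1)] by blast
    qed
  qed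
  then show ?thesis using T(2) l by fastforce
qed

end

lemma laurent_hom_unique:
  assumes N: "nc_algebra K N" and f: "f \<in> alg_hom K M N" and h: "h \<in> alg_hom K M N"
    and S: "\<And>s. s \<in> S ==> f s = h s" and y: "f y = h y" and a: "a \<in> carrier M"
  shows "f a = h a"
  using a
proof (induct rule: basis_induct)
  case (monom s i)
  have "f (y [^] i) = h (y [^] i)"
    using alg_hom_int_pow[OF A.ring_axioms nc_algebra_ring[OF N] f y_unit]
      alg_hom_int_pow[OF A.ring_axioms nc_algebra_ring[OF N] h y_unit] y by simp
  then show ?case
    using alg_homD(2)[OF f, of s "y [^] i"] alg_homD(2)[OF h, of s "y [^] i"] monom S by simp
next
  case (add u v)
  then show ?case using alg_homD(3)[OF f] alg_homD(3)[OF h] by simp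
qed

lemma extend_automorphism_hom:
  assumes \<Sigma>0: "\<Sigma>0 \<in> alg_iso K (M\<lparr>carrier := S\<rparr>) (M\<lparr>carrier := S\<rparr>)"
    and comm: "\<And>s. s \<in> S ==> \<Sigma>0 (\<tau> s) = \<tau> (\<Sigma>0 s)" and c: "c \<in> carrier K" "c ~= \<zero>\<^bsub>K\<^esub>"
  shows "\<exists>\<Sigma> \<in> alg_hom K M M. (\<forall>s \<in> S. \<Sigma> s = \<Sigma>0 s) \<and> \<Sigma> y = c \<odot> y"
proof (rule laurent_universal[OF alg])
  note s0 = alg_homD[OF alg_isoD(1)[OF \<Sigma>0]]
  show "\<Sigma>0 \<in> alg_hom K (M\<lparr>carrier := S\<rparr>) M"
    by (rule alg_hom_inc[OF alg_isoD(1)[OF \<Sigma>0] SE(1)])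
  note i = smult_inv_cancel[OF c A.one_closed]
  have u: "inv\<^bsub>K\<^esub> c \<otimes>\<^bsub>K\<^esub> c = \<one>\<^bsub>K\<^esub>" "c \<otimes>\<^bsub>K\<^esub> inv\<^bsub>K\<^esub> c = \<one>\<^bsub>K\<^esub>"
  proof -
    have "c \<in> Units K" using c K.field_Units by simp
    then show "inv\<^bsub>K\<^esub> c \<otimes>\<^bsub>K\<^esub> c = \<one>\<^bsub>K\<^esub>" "c \<otimes>\<^bsub>K\<^esub> inv\<^bsub>K\<^esub> c = \<one>\<^bsub>K\<^esub>" by auto
  qed
  have iy: "inv y \<in> carrier M" using y_unit by simp
  have "(c \<odot> y) \<otimes> (inv\<^bsub>K\<^esub> c \<odot> inv y) = \<one>" "(inv\<^bsub>K\<^esub> c \<odot> inv y) \<otimes> (c \<odot> y) = \<one>"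
    using iy i(2) c(1) u by (simp_all add: smult_mult_left smult_mult_right smult_assoc1[symmetric] K.m_comm)
  moreover have "inv\<^bsub>K\<^esub> c \<odot> inv y \<in> carrier M" using iy i(2) by simp
  ultimately show "c \<odot> y \<in> Units M" unfolding Units_def using c(1) by auto
  fix r assume r: "r \<in> S"
  then have "\<Sigma>0 r \<in> S" using s0(1) by simp
  then show "(c \<odot> y) \<otimes> \<Sigma>0 r = \<Sigma>0 (\<tau> r) \<otimes> (c \<odot> y)"
    using r comm c(1) by (simp add: smult_mult_left smult_mult_right y_comm)
qed

lemma poly_part_image:
  assumes V: "subalg K M V" "V \<subseteq> S" "\<tau> ` V = V"
    and \<Sigma>: "\<Sigma> \<in> alg_hom K M M" "\<Sigma> ` V \<subseteq> V" and c: "c \<in> carrier K" "\<Sigma> y = c \<odot> y"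
  shows "\<Sigma> ` poly_part V \<subseteq> poly_part V"
proof -
  note W = subalgD[OF poly_part_subalg[OF V]]
  have "\<Sigma> w \<in> poly_part V" if "w \<in> poly_part V" for w
    using that
  proof (induct rule: poly_part_induct[OF V, consumes 1])
    case (1 v n)
    have "\<Sigma> v \<in> poly_part V" using 1 \<Sigma>(2) poly_part_sub[OF V] by blast
    moreover have "\<Sigma> y \<in> poly_part V" using W(2) c poly_part_y[OF V] by simp
    then have "(\<Sigma> y) [^] n \<in> poly_part V" using W(5,7) by (induct n) auto
    moreover have "\<Sigma> (v \<otimes> y [^] n) = \<Sigma> v \<otimes> (\<Sigma> y) [^] n"
      using alg_homD(2)[OF \<Sigma>(1), of v "y [^] n"] alg_hom_pow[OF A.ring_axioms A.ring_axioms \<Sigma>(1) y_carr] 1 V(2) by auto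
    ultimately show ?case using W(7) by simp
  next
    case (2 u w)
    then show ?case using alg_homD(3)[OF \<Sigma>(1)] W(8) by simp
  qed
  then show ?thesis by blast
qed

text \<open>The inverse arises by the same extension from the inverse of \<open>\<Sigma>0\<close>
  and the inverse scalar. Both composites fix S and y, hence everything, and the same two inclusions
  give equality on the polynomial part.\<close>

lemma extend_automorphism:
  assumes \<Sigma>0: "\<Sigma>0 \<in> alg_iso K (M\<lparr>carrier := S\<rparr>) (M\<lparr>carrier := S\<rparr>)"
    and comm: "\<And>s. s \<in> S ==> \<Sigma>0 (\<tau> s) = \<tau> (\<Sigma>0 s)" and c: "c \<in> carrier K" "c ~= \<zero>\<^bsub>K\<^esub>"
    and V: "subalg K M V" "V \<subseteq> S" "\<tau> ` V = V" and \<Sigma>0V: "\<Sigma>0 ` V = V"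
  shows "\<exists>\<Sigma> \<in> alg_iso K M M. (\<forall>s \<in> S. \<Sigma> s = \<Sigma>0 s) \<and> \<Sigma> y = c \<odot> y \<and> \<Sigma> ` poly_part V = poly_part V"
proof -
  let ?I = "inv_into S \<Sigma>0" and ?c = "inv\<^bsub>K\<^esub> c"
  have MS: "nc_algebra K (M\<lparr>carrier := S\<rparr>)" by (rule subalg_nc_algebra[OF alg sub])
  have I: "?I \<in> alg_iso K (M\<lparr>carrier := S\<rparr>) (M\<lparr>carrier := S\<rparr>)" using alg_iso_inv[OF MS \<Sigma>0] by simp
  have Is: "?I s \<in> S" "\<Sigma>0 (?I s) = s" if "s \<in> S" for s using alg_iso_inv_apply[OF \<Sigma>0, of s] that by auto
  have sI: "\<Sigma>0 s \<in> S" "?I (\<Sigma>0 s) = s" if "s \<in> S" for s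
    using alg_homD(1)[OF alg_isoD(1)[OF \<Sigma>0]] alg_isoD(2)[OF \<Sigma>0] that by auto
  have commI: "?I (\<tau> s) = \<tau> (?I s)" if "s \<in> S" for s
    using comm[OF Is(1)[OF that]] Is[OF that] sI(2)[of "\<tau> (?I s)"] by simp
  have ci: "?c \<in> carrier K" "?c ~= \<zero>\<^bsub>K\<^esub>" "?c \<otimes>\<^bsub>K\<^esub> c = \<one>\<^bsub>K\<^esub>" "c \<otimes>\<^bsub>K\<^esub> ?c = \<one>\<^bsub>K\<^esub>"
  proof -
    have "c \<in> Units K" using c K.field_Units by simp
    then show "?c \<in> carrier K" "?c \<otimes>\<^bsub>K\<^esub> c = \<one>\<^bsub>K\<^esub>" "c \<otimes>\<^bsub>K\<^esub> ?c = \<one>\<^bsub>K\<^esub>" by auto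
    then show "?c ~= \<zero>\<^bsub>K\<^esub>" using c by auto
  qed
  obtain F where F: "F \<in> alg_hom K M M" "\<And>s. s \<in> S ==> F s = \<Sigma>0 s" "F y = c \<odot> y"
    using extend_automorphism_hom[OF \<Sigma>0 comm c] by blast
  obtain G where G: "G \<in> alg_hom K M M" "\<And>s. s \<in> S ==> G s = ?I s" "G y = ?c \<odot> y"
    using extend_automorphism_hom[OF I commI ci(1,2)] by blast
  have cy: "?c \<odot> (c \<odot> y) = y" "c \<odot> (?c \<odot> y) = y"
    by (subst smult_assoc1[symmetric]; use c ci in simp)+
  have id: "(\<lambda>x. x) \<in> alg_hom K M M" by (rule alg_homI) auto
  have FG: "F (G a) = a" if "a \<in> carrier M" for a
    using laurent_hom_unique[OF alg alg_hom_comp[OF G(1) F(1)] id _ _ that] F G Is ci cy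
    by (simp add: alg_homD(5)[OF F(1)])
  have GF: "G (F a) = a" if "a \<in> carrier M" for a
    using laurent_hom_unique[OF alg alg_hom_comp[OF F(1) G(1)] id _ _ that] F G sI c ci cy
    by (simp add: alg_homD(5)[OF G(1)])
  have "bij_betw F (carrier M) (carrier M)"
    by (rule bij_betw_byWitness[of _ G]) (use FG GF alg_homD(1)[OF F(1)] alg_homD(1)[OF G(1)] in auto)
  then have iso: "F \<in> alg_iso K M M" using F(1) by (simp add: alg_iso_iff)
  have FV: "F ` V \<subseteq> V" using F(2) V(2) \<Sigma>0V by auto
  have GV: "G ` V \<subseteq> V"
  proof (rule image_subsetI)
    fix v assume v: "v \<in> V"
    then obtain v' where v': "v' \<in> V" "v = \<Sigma>0 v'" using \<Sigma>0V by auto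
    then have "v \<in> S" "v' \<in> S" using v V(2) by auto
    then show "G v \<in> V" using G(2)[of v] sI(2)[of v'] v' by simp
  qed
  have "F ` poly_part V \<subseteq> poly_part V" by (rule poly_part_image[OF V F(1) FV c(1) F(3)])
  have "G ` poly_part V \<subseteq> poly_part V" by (rule poly_part_image[OF V G(1) GV ci(1) G(3)])
  then have Gw: "G w \<in> poly_part V" if "w \<in> poly_part V" for w using that by blast
  have "poly_part V \<subseteq> F ` poly_part V"
  proof
    fix w assume w: "w \<in> poly_part V"
    show "w \<in> F ` poly_part V"
      by (rule image_eqI[of _ _ "G w"]) (use FG[OF poly_part_carrier[OF V w]] Gw[OF w] in auto)
  qed
  with \<open>F ` poly_part V \<subseteq> poly_part V\<close> have "F ` poly_part V = poly_part V" by blast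
  then show ?thesis using iso F(2,3) by blast
qed

text \<open>With the nonzero elements of V as denominators the coefficients are brought into V; then
  a high power of y on the left removes the negative exponents.\<close>

lemma poly_part_left_fraction:
  assumes V: "subalg K M V" "V \<subseteq> S" "\<tau> ` V = V"
    and domS: "\<And>a b. a \<in> S ==> b \<in> S ==> a \<otimes> b = \<zero> ==> a = \<zero> \<or> b = \<zero>" and one: "\<one> ~= \<zero>"
    and frac: "\<And>b. b \<in> S ==> \<exists>p \<in> V. p ~= \<zero> \<and> p \<otimes> b \<in> V" and l: "l \<in> carrier M"
  shows "\<exists>p \<in> poly_part V. p ~= \<zero> \<and> p \<otimes> l \<in> poly_part V"
proof -
  have nV: "\<exists>a' \<in> V. y [^] k \<otimes> a = a' \<otimes> y [^] k" if "a \<in> V" for a and k :: int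
    using y_normalizes_V(1)[OF V that] by blast
  note VD = subalgD[OF V(1)]
  have "\<exists>s \<in> V - {\<zero>}. s \<otimes> l \<in> zspan V"
  proof (rule zspan_left_fraction[OF V(1) nV _ _ _ V(2) _ l])
    show "s \<otimes> t \<in> V - {\<zero>}" if "s \<in> V - {\<zero>}" "t \<in> V - {\<zero>}" for s t
      using that VD(7) domS V(2) by blast
    show "\<exists>s\<in>V - {\<zero>}. s \<otimes> b \<in> V" if "b \<in> S" for b using frac[OF that] by blast
  qed (use VD one in auto)
  then obtain s where s: "s \<in> V" "s ~= \<zero>" "s \<otimes> l \<in> zspan V" by blast
  have sc: "s \<in> carrier M" using s(1) VD(3) by blast
  note W = subalgD[OF poly_part_subalg[OF V]]
  \<comment> \<open>Membership for all large exponents, not just one, so that the bounds of two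
    summands can be combined by \<open>max\<close>.\<close>
  have "\<exists>m. \<forall>m' \<ge> m. y [^] (m' :: nat) \<otimes> z \<in> poly_part V" if z: "z \<in> zspan V" for z
  proof (rule zspan_induct[OF V(1) _ z])
    show "\<exists>a' \<in> V. y [^] k \<otimes> a = a' \<otimes> y [^] k" if "a \<in> V" for a and k :: int by (rule nV[OF that])
  next
    fix a k assume a: "a \<in> V"
    have "y [^] m' \<otimes> (a \<otimes> y [^] k) \<in> poly_part V" if m: "m' \<ge> nat (- k)" for m' :: nat
    proof -
      obtain a' where a': "a' \<in> V" "y [^] int m' \<otimes> a = a' \<otimes> y [^] int m'" using nV[OF a] by blast
      have c: "a \<in> carrier M" "a' \<in> carrier M" using a a' VD(3) by auto
      have "y [^] int m' \<otimes> (a \<otimes> y [^] k) = (y [^] int m' \<otimes> a) \<otimes> y [^] k" using c by (simp add: A.m_assoc)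
      also have "\<dots> = a' \<otimes> (y [^] int m' \<otimes> y [^] k)" unfolding a'(2) using c by (simp only: A.m_assoc y_pow_unit)
      also have "y [^] int m' \<otimes> y [^] k = y [^] (int m' + k)" by (rule A.Units_int_pow_add[symmetric]) simp
      also have "int m' + k = int (nat (int m' + k))" using m by simp
      finally have "y [^] m' \<otimes> (a \<otimes> y [^] k) = a' \<otimes> y [^] (nat (int m' + k))"
        by (simp only: int_pow_int)
      then show ?thesis using poly_part_monom[OF V a'(1)] by simp
    qed
    then show "\<exists>m. \<forall>m' \<ge> m. y [^] (m' :: nat) \<otimes> (a \<otimes> y [^] k) \<in> poly_part V" by blast
  next
    fix u v assume uv: "u \<in> carrier M" "v \<in> carrier M"
      "\<exists>m. \<forall>m' \<ge> m. y [^] (m' :: nat) \<otimes> u \<in> poly_part V" "\<exists>m. \<forall>m' \<ge> m. y [^] (m' :: nat) \<otimes> v \<in> poly_part V"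
    then obtain m n where mn: "\<forall>m' \<ge> m. y [^] (m' :: nat) \<otimes> u \<in> poly_part V" "\<forall>m' \<ge> n. y [^] (m' :: nat) \<otimes> v \<in> poly_part V"
      by blast
    then have "\<forall>m' \<ge> max m n. y [^] (m' :: nat) \<otimes> (u \<oplus> v) \<in> poly_part V"
      using uv(1,2) W(8) by (simp add: A.r_distr)
    then show "\<exists>m. \<forall>m' \<ge> m. y [^] (m' :: nat) \<otimes> (u \<oplus> v) \<in> poly_part V" by blast
  qed
  then obtain m where m: "y [^] (m :: nat) \<otimes> (s \<otimes> l) \<in> poly_part V" using s(3) by blast
  let ?p = "y [^] m \<otimes> s"
  have ym: "y [^] m \<in> Units M" by (induct m) auto
  have "y [^] m \<in> poly_part V" using poly_part_monom[OF V VD(5), of m] by simp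
  then have "?p \<in> poly_part V" using W(7) s(1) poly_part_sub[OF V] by blast
  moreover have "?p ~= \<zero>"
  proof
    assume "?p = \<zero>"
    then have "y [^] m \<otimes> s = y [^] m \<otimes> \<zero>" by simp
    then have "s = \<zero>" using A.Units_l_cancel[OF ym sc A.zero_closed] by blast
    then show False using s by blast
  qed
  moreover have "?p \<otimes> l \<in> poly_part V" using m sc l by (simp add: A.m_assoc)
  ultimately show ?thesis by blast
qed

end

lemma (in skew_poly) skew_hom_unique:
  assumes N: "nc_algebra K N" and f: "f \<in> alg_hom K M N" and h: "h \<in> alg_hom K M N"
    and S: "\<And>s. s \<in> S ==> f s = h s" and x: "f x = h x" and a: "a \<in> carrier M"
  shows "f a = h a"
  using a
proof (induct rule: basis_induct)
  case (monom s i)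
  have "f (x [^] i) = h (x [^] i)"
    using alg_hom_pow[OF A.ring_axioms nc_algebra_ring[OF N] f x_closed]
      alg_hom_pow[OF A.ring_axioms nc_algebra_ring[OF N] h x_closed] x by simp
  then show ?case
    using alg_homD(2)[OF f, of s "x [^] i"] alg_homD(2)[OF h, of s "x [^] i"] monom S by simp
next
  case (add u v)
  then show ?case using alg_homD(3)[OF f] alg_homD(3)[OF h] by simp
qed

section \<open>Multiplicative sets\<close>

lemma mult_set_generated_submonoid:
  assumes "monoid A" "G \<subseteq> carrier A"
  shows "submonoid (mult_set_generated A G) A"
proof -
  interpret monoid A by fact
  have "submonoid (carrier A) A" by (rule submonoid.intro) auto
  then show ?thesis
    unfolding mult_set_generated_def using assms(2)
    by (intro submonoid.intro) (auto simp: submonoid_def)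
qed

lemma mult_set_generated_generators: "G \<subseteq> mult_set_generated A G"
  unfolding mult_set_generated_def by auto

lemma mult_set_generated_least: "submonoid H A ==> G \<subseteq> H ==> mult_set_generated A G \<subseteq> H"
  unfolding mult_set_generated_def by auto

section \<open>One step of the deleting derivations map\<close>

text \<open>\<open>S'\<close> is \<open>C[x;\<tau>,\<delta>]\<close>, with the derivation still
  present; B is the Laurent ring built so far, containing C via \<open>\<theta>\<close>, and M is B
  with the new Laurent variable y. The map \<open>\<tau>L\<close> extends \<open>\<tau>\<close>
  along \<open>\<theta>\<close>.\<close>

locale one_step = higher_emb K C \<tau> q d M \<theta> y
  for K :: "('k, 'm) ring_scheme" and C :: "('k, 'c, 'n) module_scheme"
    and \<tau> :: "'c => 'c" and q :: 'k and d :: "nat => 'c => 'c"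
    and M :: "('k, 'b, 'p) module_scheme" (structure) and \<theta> :: "'c => 'b" and y :: 'b +
  fixes S' :: "('k, 'c, 'n) module_scheme" and x :: 'c and \<delta> :: "'c => 'c"
    and B :: "'b set" and \<tau>L :: "'b => 'b"
  assumes skew': "skew_polynomial_ring K S' (carrier C) x \<tau> \<delta>"
    and C_eq: "S'\<lparr>carrier := carrier C\<rparr> = C"
    and delta: "\<And>a. a \<in> carrier C ==> \<delta> a = d 1 a"
    and laur': "skew_laurent_ring K M B y \<tau>L"
    and th_B: "\<And>a. a \<in> carrier C ==> \<theta> a \<in> B"
    and th_inj: "inj_on \<theta> (carrier C)"
    and tauL: "\<And>a. a \<in> carrier C ==> \<tau>L (\<theta> a) = \<theta> (\<tau> a)"

sublocale one_step \<subseteq> P: skew_poly K S' "carrier C" x \<tau> \<delta>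
  by (rule skew_poly.intro[OF skew'])

sublocale one_step \<subseteq> LL: skew_laur K M B y \<tau>L
  by (rule skew_laur.intro[OF laur'])

context one_step
begin

lemma C_ops: "a \<otimes>\<^bsub>S'\<^esub> b = a \<otimes>\<^bsub>C\<^esub> b" "a \<oplus>\<^bsub>S'\<^esub> b = a \<oplus>\<^bsub>C\<^esub> b" "\<one>\<^bsub>S'\<^esub> = \<one>\<^bsub>C\<^esub>" "\<zero>\<^bsub>S'\<^esub> = \<zero>\<^bsub>C\<^esub>" "c \<odot>\<^bsub>S'\<^esub> a = c \<odot>\<^bsub>C\<^esub> a"
  by (subst C_eq[symmetric], simp)+

lemma Theta_ex: "\<exists>\<Phi>. \<Phi> \<in> alg_hom K S' M \<and> (\<forall>r \<in> carrier C. \<Phi> r = g r) \<and> \<Phi> x = y"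
proof -
  have 1: "g \<in> alg_hom K (S'\<lparr>carrier := carrier C\<rparr>) M" unfolding C_eq by (rule g_hom)
  have 2: "y \<otimes> g r = g (\<tau> r) \<otimes> y \<oplus> g (\<delta> r)" if "r \<in> carrier C" for r
    using y_g[OF that] delta[OF that] by simp
  show ?thesis using P.skew_universal[OF M_alg 1 y_carr 2] by blast
qed

definition Theta :: "'c => 'b" where
  "Theta = (SOME \<Phi>. \<Phi> \<in> alg_hom K S' M \<and> (\<forall>r \<in> carrier C. \<Phi> r = g r) \<and> \<Phi> x = y)"

lemma Theta: "Theta \<in> alg_hom K S' M" "\<And>r. r \<in> carrier C ==> Theta r = g r" "Theta x = y"
  using someI_ex[OF Theta_ex] unfolding Theta_def by auto

definition W :: "'b set" where "W = Theta ` carrier S'"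

lemma W: "subalg K M W"
  unfolding W_def by (rule alg_hom_image_subalg[OF P.alg M_alg Theta(1) subalg_carrier[OF P.alg]])

lemma gW: "a \<in> carrier C ==> g a \<in> W"
  unfolding W_def using Theta(2) P.S_carr by (metis imageI)

lemma yW: "y \<in> W"
  unfolding W_def using Theta(3) P.x_closed by (metis imageI)

text \<open>The coefficient of \<^term>\<open>y [^] n\<close> in the image of a polynomial of degree \<^term>\<open>n\<close> is the image of the
  leading coefficient.\<close>

lemma Theta_inj: "inj_on Theta (carrier S')"
proof -
  have ker: "a = \<zero>\<^bsub>S'\<^esub>" if a: "a \<in> carrier S'" and z: "Theta a = \<zero>" for a
  proof (rule ccontr)
    assume "a ~= \<zero>\<^bsub>S'\<^esub>"
    then obtain n r v where r: "r \<in> carrier C" "r ~= \<zero>\<^bsub>S'\<^esub>" "v \<in> P.low n" "a = r \<otimes>\<^bsub>S'\<^esub> x [^]\<^bsub>S'\<^esub> n \<oplus>\<^bsub>S'\<^esub> v"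
      using P.leading_term[OF a] by metis
    obtain F where F: "\<And>a. a \<in> carrier M ==> F a \<in> carrier M"
      "\<And>u v. u \<in> carrier M ==> v \<in> carrier M ==> F (u \<oplus> v) = F u \<oplus> F v"
      "\<And>s i. s \<in> B ==> F (s \<otimes> y [^] (i::int)) = (if i = int n then s else \<zero>)"
      using LL.coefficient_functional[of "int n"] by blast
    have F0: "F \<zero> = \<zero>" using F(3)[OF LL.SE(2), of "int n"] by simp
    \<comment> \<open>Up to a coefficient, w^j is y^(-j), so the exponent of this term is k - j.
      With k at most n it reaches n only for j = 0 and k = n.\<close>
    have tm: "F (w [^] j \<otimes> \<theta> b \<otimes> y [^] k) = (if j = 0 \<and> k = n then \<theta> b else \<zero>)"
      if b: "b \<in> carrier C" and k: "k \<le> n" for j k :: nat and b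
    proof (cases "j = 0")
      case True
      then show ?thesis using F(3)[OF th_B[OF b], of "int k"] b by (simp add: int_pow_int)
    next
      case False
      obtain b' where b': "b' \<in> B" "y [^] (- int j) \<otimes> \<theta> b = b' \<otimes> y [^] (- int j)"
        using LL.y_normalizes(1)[OF th_B[OF b]] by blast
      have wj: "w [^] j = (u [^]\<^bsub>K\<^esub> j) \<odot> y [^] (- int j)"
      proof -
        have "y [^] (- int j) \<otimes> (y [^] j \<otimes> w [^] j) = (u [^]\<^bsub>K\<^esub> j) \<odot> y [^] (- int j)"
          unfolding ypow_wpow using y by (simp add: M.smult_mult_right)
        moreover have "y [^] (- int j) \<otimes> (y [^] int j \<otimes> w [^] j) = w [^] j"
          using y by (simp only: M.A.m_assoc[symmetric] M.A.Units_int_pow_cancel M.A.Units_int_pow_carrier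
              M.A.nat_pow_closed w_carr M.A.l_one)
        ultimately show ?thesis by (simp add: int_pow_int)
      qed
      have sB: "(u [^]\<^bsub>K\<^esub> j) \<odot> b' \<in> B" using LL.SD(2) b'(1) by simp
      have "w [^] j \<otimes> \<theta> b \<otimes> y [^] int k
        = ((u [^]\<^bsub>K\<^esub> j) \<odot> b') \<otimes> (y [^] (- int j) \<otimes> y [^] int k)"
        unfolding wj using y b b' by (simp add: M.smult_mult_left M.A.m_assoc del: pow_nat)
      also have "y [^] (- int j) \<otimes> y [^] int k = y [^] (- int j + int k)"
        by (rule M.A.Units_int_pow_add[OF y, symmetric])
      finally show ?thesis using F(3)[OF sB, of "- int j + int k"] False k by (simp add: int_pow_int)
    qed
    have Fg: "F (g s \<otimes> y [^] k) = (if k = n then \<theta> s else \<zero>)" if s: "s \<in> carrier C" and k: "k \<le> n" for s and k :: nat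
    proof -
      obtain m where m: "\<And>i. i > m ==> d i s = \<zero>\<^bsub>C\<^esub>" using d_bounded[OF s] by blast
      have cl: "w [^] j \<otimes> \<theta> (d j s) \<otimes> y [^] k \<in> carrier M" for j using s by simp
      have gs: "g s = (\<Oplus> j \<in> {..m}. w [^] j \<otimes> \<theta> (d j s))" by (rule g_bound[OF s m])
      have "g s \<otimes> y [^] k = (\<Oplus> j \<in> {..m}. w [^] j \<otimes> \<theta> (d j s) \<otimes> y [^] k)"
        unfolding gs using s by (intro M.A.finsum_ldistr) auto
      then have "F (g s \<otimes> y [^] k) = (\<Oplus> j \<in> {..m}. F (w [^] j \<otimes> \<theta> (d j s) \<otimes> y [^] k))"
        by (simp only:) (rule additive_finsum[OF M.A.abelian_group_axioms M.A.abelian_group_axioms F(1,2)];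
          use cl in simp)
      also have "\<dots> = (\<Oplus> j \<in> {..m}. if 0 = j then (if k = n then \<theta> s else \<zero>) else \<zero>)"
        by (rule M.A.finsum_cong') (use s tm k in \<open>auto simp: d_0\<close>)
      also have "\<dots> = (if k = n then \<theta> s else \<zero>)"
        by (rule M.A.finsum_singleton) (use s in auto)
      finally show ?thesis .
    qed
    have Th: "Theta (s \<otimes>\<^bsub>S'\<^esub> x [^]\<^bsub>S'\<^esub> k) = g s \<otimes> y [^] k" if "s \<in> carrier C" for s and k :: nat
      using alg_homD(2)[OF Theta(1), of s "x [^]\<^bsub>S'\<^esub> k"] that Theta(2,3)
        alg_hom_pow[OF P.A.ring_axioms M.A.ring_axioms Theta(1) P.x_closed] by simp
    have "F (Theta v) = \<zero>" using r(3)
    proof (induct rule: P.low_induct)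
      case zero
      then show ?case using alg_hom_zero[OF P.A.ring_axioms M.A.ring_axioms Theta(1)] F0 by simp
    next
      case (monom s k)
      then show ?case using Th Fg[of s k] by simp
    next
      case (add u v)
      then show ?case using alg_homD(1,3)[OF Theta(1)] F(2) by simp
    qed
    then have "F (Theta a) = \<theta> r"
      using r Th[OF r(1)] Fg[OF r(1), of n] alg_homD(1,3)[OF Theta(1)] F(2) by simp
    then have "\<theta> r = \<zero>" using z F0 by simp
    then have "r = \<zero>\<^bsub>C\<^esub>" using inj_onD[OF th_inj, of r "\<zero>\<^bsub>C\<^esub>"] r(1) th_eq(5) by simp
    then show False using r(2) C_ops by simp
  qed
  show ?thesis
  proof (rule inj_onI)
    fix a b assume ab: "a \<in> carrier S'" "b \<in> carrier S'" "Theta a = Theta b"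
    have "Theta (a \<ominus>\<^bsub>S'\<^esub> b) = \<zero>"
      using ab alg_homD(1,3)[OF Theta(1)] alg_hom_minus[OF P.A.ring_axioms M.A.ring_axioms Theta(1)]
      by (simp add: a_minus_def M.A.r_neg)
    then have "a \<ominus>\<^bsub>S'\<^esub> b = \<zero>\<^bsub>S'\<^esub>" using ker ab by simp
    then show "a = b" using ab P.A.r_right_minus_eq by simp
  qed
qed

lemma th_image: "subalg K M (\<theta> ` carrier C)"
  by (rule alg_hom_image_subalg[OF alg M_alg th subalg_carrier[OF alg]])

lemma th_normalizes:
  assumes "a \<in> carrier C"
  shows "\<exists>b \<in> carrier C. y [^] (k::int) \<otimes> \<theta> a = \<theta> b \<otimes> y [^] k"
    "\<exists>b \<in> carrier C. \<theta> a \<otimes> y [^] (k::int) = y [^] k \<otimes> \<theta> b"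
proof -
  have f: "\<exists>w' \<in> \<theta> ` carrier C. y \<otimes> w = w' \<otimes> y" if "w \<in> \<theta> ` carrier C" for w
    using that comm by auto
  have g: "\<exists>w' \<in> \<theta> ` carrier C. w \<otimes> y = y \<otimes> w'" if "w \<in> \<theta> ` carrier C" for w
  proof -
    obtain a where a: "a \<in> carrier C" "w = \<theta> a" using \<open>w \<in> \<theta> ` carrier C\<close> by blast
    have "a \<in> \<tau> ` carrier C" using alg_isoD(3)[OF tau_iso] a(1) by simp
    then obtain b where b: "b \<in> carrier C" "a = \<tau> b" by blast
    then show ?thesis by (intro bexI[of _ "\<theta> b"]) (use comm[OF b(1)] a b in simp_all)
  qed
  have sub: "\<theta> ` carrier C \<subseteq> carrier M" by auto
  show "\<exists>b \<in> carrier C. y [^] (k::int) \<otimes> \<theta> a = \<theta> b \<otimes> y [^] k"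
    using M.A.unit_normalizes(1)[OF y sub f g imageI[OF assms], of k] by blast
  show "\<exists>b \<in> carrier C. \<theta> a \<otimes> y [^] (k::int) = y [^] k \<otimes> \<theta> b"
    using M.A.unit_normalizes(2)[OF y sub f g imageI[OF assms], of k] by blast
qed

lemma W_mem:
  assumes a: "a \<in> carrier C"
  shows "\<exists>m. \<forall>n \<ge> m. y [^] (n::nat) \<otimes> \<theta> a \<in> W \<and> \<theta> a \<otimes> y [^] n \<in> W"
proof -
  obtain m where "\<And>i. i \<ge> m ==> d i a = \<zero>\<^bsub>C\<^esub>" using nilp[OF a] by blast
  then have "\<forall>n \<ge> m. y [^] (n::nat) \<otimes> \<theta> a \<in> W \<and> \<theta> a \<otimes> y [^] n \<in> W"
    using ypow_th_mem[OF W gW yW a] th_ypow_mem[OF W gW yW a] by (meson le_trans)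
  then show ?thesis by blast
qed

text \<open>A high power of y must do two things for a monomial with coefficient
  \<open>\<theta> a\<close>: compensate the exponent and exceed the nilpotence bound of
  \<open>W_mem\<close>.\<close>

lemma zspan_W:
  assumes z: "z \<in> LL.zspan (\<theta> ` carrier C)"
  shows "\<exists>m. \<forall>n \<ge> m. y [^] (n::nat) \<otimes> z \<in> W \<and> z \<otimes> y [^] n \<in> W"
proof (rule LL.zspan_induct[OF th_image _ z])
  show "\<exists>a' \<in> \<theta> ` carrier C. y [^] k \<otimes> a = a' \<otimes> y [^] k" if "a \<in> \<theta> ` carrier C" for a and k :: int
    using that th_normalizes(1) by blast
next
  fix a' k assume "a' \<in> \<theta> ` carrier C"
  then obtain a where a: "a \<in> carrier C" "a' = \<theta> a" by blast
  obtain b where b: "b \<in> carrier C" "\<theta> a \<otimes> y [^] (k::int) = y [^] k \<otimes> \<theta> b"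
    using th_normalizes(2)[OF a(1)] by blast
  obtain m1 m2 where m1: "\<forall>n \<ge> m1. y [^] (n::nat) \<otimes> \<theta> a \<in> W \<and> \<theta> a \<otimes> y [^] n \<in> W"
    and m2: "\<forall>n \<ge> m2. y [^] (n::nat) \<otimes> \<theta> b \<in> W \<and> \<theta> b \<otimes> y [^] n \<in> W"
    using W_mem a(1) b(1) by meson
  \<comment> \<open>From here on n + k is a nonnegative exponent above both bounds. The bound m2 is
    that of b, the coefficient after y^k has been moved to its left.\<close>
  let ?m = "max m1 m2 + nat (- k)"
  have "y [^] n \<otimes> (\<theta> a \<otimes> y [^] k) \<in> W \<and> (\<theta> a \<otimes> y [^] k) \<otimes> y [^] n \<in> W"
    if n: "n \<ge> ?m" for n :: nat
  proof -
    have e: "int n + k = int (nat (int n + k))" "k + int n = int (nat (int n + k))"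
      "nat (int n + k) \<ge> m1" "nat (int n + k) \<ge> m2" using n by auto
    have "y [^] n \<otimes> (y [^] k \<otimes> \<theta> b) = (y [^] int n \<otimes> y [^] k) \<otimes> \<theta> b"
      using y b by (simp add: M.A.m_assoc int_pow_int)
    also have "y [^] int n \<otimes> y [^] k = y [^] int (nat (int n + k))"
      unfolding e(1)[symmetric] by (rule M.A.Units_int_pow_add[OF y, symmetric])
    finally have 1: "y [^] n \<otimes> (y [^] k \<otimes> \<theta> b) = y [^] nat (int n + k) \<otimes> \<theta> b"
      by (simp only: int_pow_int)
    have "(\<theta> a \<otimes> y [^] k) \<otimes> y [^] n = \<theta> a \<otimes> (y [^] k \<otimes> y [^] int n)"
      using y a by (simp add: M.A.m_assoc int_pow_int)
    also have "y [^] k \<otimes> y [^] int n = y [^] int (nat (int n + k))"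
      unfolding e(2)[symmetric] by (rule M.A.Units_int_pow_add[OF y, symmetric])
    finally have 2: "(\<theta> a \<otimes> y [^] k) \<otimes> y [^] n = \<theta> a \<otimes> y [^] nat (int n + k)"
      by (simp only: int_pow_int)
    have "y [^] n \<otimes> (\<theta> a \<otimes> y [^] k) \<in> W"
      unfolding b(2) 1 using m2 e(4) by blast
    moreover have "(\<theta> a \<otimes> y [^] k) \<otimes> y [^] n \<in> W" unfolding 2 using m1 e(3) by blast
    ultimately show ?thesis by blast
  qed
  then show "\<exists>m. \<forall>n \<ge> m. y [^] (n::nat) \<otimes> (a' \<otimes> y [^] k) \<in> W \<and> (a' \<otimes> y [^] k) \<otimes> y [^] n \<in> W"
    unfolding a(2) by blast
next
  fix u v assume uv: "u \<in> carrier M" "v \<in> carrier M"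
    "\<exists>m. \<forall>n \<ge> m. y [^] (n::nat) \<otimes> u \<in> W \<and> u \<otimes> y [^] n \<in> W"
    "\<exists>m. \<forall>n \<ge> m. y [^] (n::nat) \<otimes> v \<in> W \<and> v \<otimes> y [^] n \<in> W"
  then obtain m1 m2 where "\<forall>n \<ge> m1. y [^] (n::nat) \<otimes> u \<in> W \<and> u \<otimes> y [^] n \<in> W"
    "\<forall>n \<ge> m2. y [^] (n::nat) \<otimes> v \<in> W \<and> v \<otimes> y [^] n \<in> W" by blast
  then have "\<forall>n \<ge> max m1 m2. y [^] (n::nat) \<otimes> (u \<oplus> v) \<in> W \<and> (u \<oplus> v) \<otimes> y [^] n \<in> W"
    using uv(1,2) subalgD(8)[OF W] by (simp add: M.A.r_distr M.A.l_distr)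
  then show "\<exists>m. \<forall>n \<ge> m. y [^] (n::nat) \<otimes> (u \<oplus> v) \<in> W \<and> (u \<oplus> v) \<otimes> y [^] n \<in> W" by blast
qed

section \<open>Denominators of the next stage\<close>

context
  fixes t :: "'i => 'c" and J :: "'i set"
  assumes J: "finite J" and t: "t ` J \<subseteq> carrier C"
    and tau_t: "\<And>j. j \<in> J ==> \<exists>\<mu> \<in> carrier K. \<mu> ~= \<zero>\<^bsub>K\<^esub> \<and> \<tau> (t j) = \<mu> \<odot>\<^bsub>C\<^esub> t j"
begin

abbreviation "T \<equiv> mult_set_generated C (t ` J)"

lemma T_submonoid: "submonoid T C"
  by (rule mult_set_generated_submonoid[OF A.monoid_axioms t])

text \<open>Every exponent above the bound of one generator works for it, so finitely many
  generators share one exponent N.\<close>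

lemma generators_ex: "\<exists>N. \<forall>j \<in> J. \<exists>s \<in> carrier S'. Theta s = \<theta> (t j) \<otimes> y [^] (N::nat)"
proof -
  have "\<exists>N. \<forall>j \<in> F. \<forall>n \<ge> N. \<exists>s \<in> carrier S'. Theta s = \<theta> (t j) \<otimes> y [^] (n::nat)" if "finite F" "F \<subseteq> J" for F
    using that
  proof induct
    case (insert j F)
    then obtain N where N: "\<forall>j \<in> F. \<forall>n \<ge> N. \<exists>s \<in> carrier S'. Theta s = \<theta> (t j) \<otimes> y [^] (n::nat)" by auto
    have "t j \<in> carrier C" using insert t by auto
    then obtain m where m: "\<forall>n \<ge> m. \<theta> (t j) \<otimes> y [^] (n::nat) \<in> W" using W_mem by blast
    have "\<forall>i \<in> insert j F. \<forall>n \<ge> max N m. \<exists>s \<in> carrier S'. Theta s = \<theta> (t i) \<otimes> y [^] (n::nat)"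
      using N m unfolding W_def by (metis (no_types, opaque_lifting) imageE insertE max.bounded_iff)
    then show ?case by blast
  qed auto
  from this[OF J subset_refl] show ?thesis by blast
qed

context
  fixes t' :: "'i => 'c" and N :: nat
  assumes t': "\<And>j. j \<in> J ==> t' j \<in> carrier S'" "\<And>j. j \<in> J ==> Theta (t' j) = \<theta> (t j) \<otimes> y [^] N"
begin

abbreviation "T' \<equiv> mult_set_generated S' (insert x (t' ` J))"

lemma T'_gen: "insert x (t' ` J) \<subseteq> carrier S'"
  using t'(1) by auto

lemma T'_submonoid: "submonoid T' S'"
  by (rule mult_set_generated_submonoid[OF P.A.monoid_axioms T'_gen])

text \<open>The generators of T are eigenvectors of \<open>\<tau>\<close>, hence so are their
  products, and powers of y move past them at the price of scalars. So every s in T has, up to a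
  nonzero scalar and a power of y, a counterpart in \<open>T'\<close>. The scalar is carried along
  because \<open>T'\<close> need not contain scalar multiples.\<close>

lemma T_pow:
  assumes "s \<in> T"
  shows "\<exists>\<mu> \<in> carrier K. \<mu> ~= \<zero>\<^bsub>K\<^esub> \<and> \<tau> s = \<mu> \<odot>\<^bsub>C\<^esub> s"
    "\<exists>s' \<in> T'. \<exists>n. \<exists>c \<in> carrier K. c ~= \<zero>\<^bsub>K\<^esub> \<and> Theta s' = c \<odot> (\<theta> s \<otimes> y [^] (n::nat))"
proof -
  let ?R = "\<lambda>s. (\<exists>\<mu> \<in> carrier K. \<mu> ~= \<zero>\<^bsub>K\<^esub> \<and> \<tau> s = \<mu> \<odot>\<^bsub>C\<^esub> s) \<and>
    (\<exists>s' \<in> T'. \<exists>n. \<exists>c \<in> carrier K. c ~= \<zero>\<^bsub>K\<^esub> \<and> Theta s' = c \<odot> (\<theta> s \<otimes> y [^] (n::nat)))"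
  have one: "\<one>\<^bsub>K\<^esub> \<in> carrier K" "\<one>\<^bsub>K\<^esub> ~= \<zero>\<^bsub>K\<^esub>" by auto
  have T'c: "s \<in> carrier S'" if "s \<in> T'" for s using T'_submonoid that by (rule submonoid.mem_carrier)
  have "submonoid {s \<in> carrier C. ?R s} C"
  proof (rule submonoid.intro)
    have "Theta \<one>\<^bsub>S'\<^esub> = \<one>\<^bsub>K\<^esub> \<odot> (\<theta> \<one>\<^bsub>C\<^esub> \<otimes> y [^] (0::nat))"
      using alg_homD(4)[OF Theta(1)] th_eq(4) by simp
    then have 2: "\<exists>s' \<in> T'. \<exists>n. \<exists>c \<in> carrier K. c ~= \<zero>\<^bsub>K\<^esub> \<and> Theta s' = c \<odot> (\<theta> \<one>\<^bsub>C\<^esub> \<otimes> y [^] (n::nat))"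
      using submonoid.one_closed[OF T'_submonoid] one by blast
    have "\<tau> \<one>\<^bsub>C\<^esub> = \<one>\<^bsub>K\<^esub> \<odot>\<^bsub>C\<^esub> \<one>\<^bsub>C\<^esub>" using alg_homD(4)[OF tau_hom] by simp
    then have 1: "\<exists>\<mu> \<in> carrier K. \<mu> ~= \<zero>\<^bsub>K\<^esub> \<and> \<tau> \<one>\<^bsub>C\<^esub> = \<mu> \<odot>\<^bsub>C\<^esub> \<one>\<^bsub>C\<^esub>" using one by blast
    show "\<one>\<^bsub>C\<^esub> \<in> {s \<in> carrier C. ?R s}" using 1 2 by blast
  next
    fix s1 s2 assume "s1 \<in> {s \<in> carrier C. ?R s}" "s2 \<in> {s \<in> carrier C. ?R s}"
    then obtain \<mu>1 \<mu>2 s1' s2' n1 n2 c1 c2 where s1: "s1 \<in> carrier C" "\<mu>1 \<in> carrier K" "\<mu>1 ~= \<zero>\<^bsub>K\<^esub>" "\<tau> s1 = \<mu>1 \<odot>\<^bsub>C\<^esub> s1"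
      "s1' \<in> T'" "c1 \<in> carrier K" "c1 ~= \<zero>\<^bsub>K\<^esub>" "Theta s1' = c1 \<odot> (\<theta> s1 \<otimes> y [^] (n1::nat))"
      and s2: "s2 \<in> carrier C" "\<mu>2 \<in> carrier K" "\<mu>2 ~= \<zero>\<^bsub>K\<^esub>" "\<tau> s2 = \<mu>2 \<odot>\<^bsub>C\<^esub> s2"
      "s2' \<in> T'" "c2 \<in> carrier K" "c2 ~= \<zero>\<^bsub>K\<^esub>" "Theta s2' = c2 \<odot> (\<theta> s2 \<otimes> y [^] (n2::nat))"
      by blast
    have "\<tau> (s1 \<otimes>\<^bsub>C\<^esub> s2) = (\<mu>2 \<otimes>\<^bsub>K\<^esub> \<mu>1) \<odot>\<^bsub>C\<^esub> (s1 \<otimes>\<^bsub>C\<^esub> s2)"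
      using s1 s2 alg_homD(2)[OF tau_hom, of s1 s2] by (simp add: smult_mult_left smult_mult_right smult_assoc1)
    moreover have "\<mu>2 \<otimes>\<^bsub>K\<^esub> \<mu>1 \<in> carrier K" "\<mu>2 \<otimes>\<^bsub>K\<^esub> \<mu>1 ~= \<zero>\<^bsub>K\<^esub>" using s1(2,3) s2(2,3) K.integral_iff by auto
    ultimately have 1: "\<exists>\<mu> \<in> carrier K. \<mu> ~= \<zero>\<^bsub>K\<^esub> \<and> \<tau> (s1 \<otimes>\<^bsub>C\<^esub> s2) = \<mu> \<odot>\<^bsub>C\<^esub> (s1 \<otimes>\<^bsub>C\<^esub> s2)" by blast
    have tp: "(\<tau> ^^ n) s2 = (\<mu>2 [^]\<^bsub>K\<^esub> n) \<odot>\<^bsub>C\<^esub> s2" for n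
    proof (induct n)
      case (Suc n)
      then show ?case using s2(1,2,4) alg_homD(5)[OF tau_hom, of "\<mu>2 [^]\<^bsub>K\<^esub> n" s2]
        by (simp add: smult_assoc1[symmetric])
    qed (use s2 in simp)
    have pn: "\<mu>2 [^]\<^bsub>K\<^esub> n \<in> carrier K" "\<mu>2 [^]\<^bsub>K\<^esub> n ~= \<zero>\<^bsub>K\<^esub>" for n :: nat
      using s2(2,3) by (simp, induct n) (auto simp: K.integral_iff)
    have "Theta (s1' \<otimes>\<^bsub>S'\<^esub> s2') = (c1 \<odot> (\<theta> s1 \<otimes> y [^] n1)) \<otimes> (c2 \<odot> (\<theta> s2 \<otimes> y [^] n2))"
      using alg_homD(2)[OF Theta(1) T'c[OF s1(5)] T'c[OF s2(5)]] s1(8) s2(8) by simp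
    also have "\<dots> = (c2 \<otimes>\<^bsub>K\<^esub> c1) \<odot> (\<theta> s1 \<otimes> (y [^] n1 \<otimes> \<theta> s2) \<otimes> y [^] n2)"
      using s1(1,6) s2(1,6) by (simp add: M.smult_mult_left M.smult_mult_right M.smult_assoc1 M.A.m_assoc)
    also have "y [^] n1 \<otimes> \<theta> s2 = (\<mu>2 [^]\<^bsub>K\<^esub> n1) \<odot> (\<theta> s2 \<otimes> y [^] n1)"
      using comm_pow[OF s2(1), of n1] tp[of n1] pn s2(1) by (simp add: th_eq M.smult_mult_left)
    also have "(c2 \<otimes>\<^bsub>K\<^esub> c1) \<odot> (\<theta> s1 \<otimes> ((\<mu>2 [^]\<^bsub>K\<^esub> n1) \<odot> (\<theta> s2 \<otimes> y [^] n1)) \<otimes> y [^] n2)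
      = (c2 \<otimes>\<^bsub>K\<^esub> c1 \<otimes>\<^bsub>K\<^esub> (\<mu>2 [^]\<^bsub>K\<^esub> n1)) \<odot> (\<theta> (s1 \<otimes>\<^bsub>C\<^esub> s2) \<otimes> y [^] (n1 + n2))"
      using s1(1,6) s2(1,6) pn[of n1]
      by (simp add: th_eq M.smult_mult_left M.smult_mult_right M.smult_assoc1 M.A.m_assoc flip: M.A.nat_pow_mult)
    finally have "Theta (s1' \<otimes>\<^bsub>S'\<^esub> s2') =
      (c2 \<otimes>\<^bsub>K\<^esub> c1 \<otimes>\<^bsub>K\<^esub> (\<mu>2 [^]\<^bsub>K\<^esub> n1)) \<odot> (\<theta> (s1 \<otimes>\<^bsub>C\<^esub> s2) \<otimes> y [^] (n1 + n2))" .
    moreover have "c2 \<otimes>\<^bsub>K\<^esub> c1 \<otimes>\<^bsub>K\<^esub> (\<mu>2 [^]\<^bsub>K\<^esub> n1) \<in> carrier K" "c2 \<otimes>\<^bsub>K\<^esub> c1 \<otimes>\<^bsub>K\<^esub> (\<mu>2 [^]\<^bsub>K\<^esub> n1) ~= \<zero>\<^bsub>K\<^esub>"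
      using s1(6,7) s2(6,7) pn[of n1] K.integral_iff by auto
    moreover have "s1' \<otimes>\<^bsub>S'\<^esub> s2' \<in> T'" using submonoid.m_closed[OF T'_submonoid s1(5) s2(5)] .
    ultimately have 2: "\<exists>s' \<in> T'. \<exists>n. \<exists>c \<in> carrier K. c ~= \<zero>\<^bsub>K\<^esub> \<and> Theta s' = c \<odot> (\<theta> (s1 \<otimes>\<^bsub>C\<^esub> s2) \<otimes> y [^] (n::nat))"
      by blast
    show "s1 \<otimes>\<^bsub>C\<^esub> s2 \<in> {s \<in> carrier C. ?R s}" using 1 2 s1(1) s2(1) by simp
  qed auto
  moreover have "t ` J \<subseteq> {s \<in> carrier C. ?R s}"
  proof (rule image_subsetI)
    fix j assume j: "j \<in> J"
    have tj: "t j \<in> carrier C" using t j by auto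
    have "t' j \<in> T'" by (rule subsetD[OF mult_set_generated_generators]) (use j in auto)
    moreover have "Theta (t' j) = \<one>\<^bsub>K\<^esub> \<odot> (\<theta> (t j) \<otimes> y [^] N)" using t'(2)[OF j] tj by simp
    ultimately show "t j \<in> {s \<in> carrier C. ?R s}" using tau_t[OF j] tj one by blast
  qed
  ultimately have "T \<subseteq> {s \<in> carrier C. ?R s}" by (rule mult_set_generated_least)
  then show "\<exists>\<mu> \<in> carrier K. \<mu> ~= \<zero>\<^bsub>K\<^esub> \<and> \<tau> s = \<mu> \<odot>\<^bsub>C\<^esub> s"
    "\<exists>s' \<in> T'. \<exists>n. \<exists>c \<in> carrier K. c ~= \<zero>\<^bsub>K\<^esub> \<and> Theta s' = c \<odot> (\<theta> s \<otimes> y [^] (n::nat))"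
    using assms by blast+
qed

lemma x_pow_T': "x [^]\<^bsub>S'\<^esub> (n::nat) \<in> T'"
proof (induct n)
  case 0
  then show ?case using submonoid.one_closed[OF T'_submonoid] by simp
next
  case (Suc n)
  then show ?case
    using submonoid.m_closed[OF T'_submonoid Suc] mult_set_generated_generators[of "insert x (t' ` J)" S'] by auto
qed

lemma Theta_x_pow: "Theta (x [^]\<^bsub>S'\<^esub> (n::nat)) = y [^] n"
  using alg_hom_pow[OF P.A.ring_axioms M.A.ring_axioms Theta(1) P.x_closed] Theta(3) by simp

lemma T'_units:
  assumes "\<And>s. s \<in> T ==> \<theta> s \<in> Units M" "s \<in> T'"
  shows "Theta s \<in> Units M"
proof -
  have "submonoid {s \<in> carrier S'. Theta s \<in> Units M} S'"
    using alg_homD(2,4)[OF Theta(1)] by (intro submonoid.intro) auto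
  moreover have "insert x (t' ` J) \<subseteq> {s \<in> carrier S'. Theta s \<in> Units M}"
  proof -
    have "y [^] N \<in> Units M" using y by (induct N) auto
    moreover have "\<theta> (t j) \<in> Units M" if "j \<in> J" for j
      by (rule assms(1), rule subsetD[OF mult_set_generated_generators]) (use that in auto)
    ultimately have "Theta (t' j) \<in> Units M" if "j \<in> J" for j
      unfolding t'(2)[OF that] using that by (intro M.A.Units_m_closed) auto
    then show ?thesis using t'(1) Theta(3) y by auto
  qed
  ultimately show ?thesis using mult_set_generated_least assms(2) by blast
qed

text \<open>An element s of T brings the coefficients of l into the image of C, and a power of y
  brings the result into W. The counterpart of s in \<open>T'\<close> has its power of y on the
  wrong side of s; as s is an eigenvector this is corrected by a scalar, and W is closed under
  scalars.\<close>

lemma T'_left_fraction: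
  assumes frac: "\<And>b. b \<in> B ==> \<exists>s \<in> T. \<theta> s \<otimes> b \<in> \<theta> ` carrier C" and l: "l \<in> carrier M"
  shows "\<exists>s \<in> T'. Theta s \<otimes> l \<in> W"
proof -
  have Tc: "s \<in> carrier C" if "s \<in> T" for s using T_submonoid that by (rule submonoid.mem_carrier)
  have "\<exists>s \<in> \<theta> ` T. s \<otimes> l \<in> LL.zspan (\<theta> ` carrier C)"
  proof (rule LL.zspan_left_fraction[OF th_image])
    show "\<exists>a' \<in> \<theta> ` carrier C. y [^] k \<otimes> a = a' \<otimes> y [^] k" if "a \<in> \<theta> ` carrier C" for a and k :: int
      using that th_normalizes(1) by blast
    show "\<one> \<in> \<theta> ` T" using submonoid.one_closed[OF T_submonoid] th_eq(4) by (metis imageI)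
    show "s \<otimes> t \<in> \<theta> ` T" if "s \<in> \<theta> ` T" "t \<in> \<theta> ` T" for s t
      using that submonoid.m_closed[OF T_submonoid] Tc by (auto simp flip: th_eq(1))
  qed (use Tc th_B frac l in auto)
  then obtain s where s: "s \<in> T" "\<theta> s \<otimes> l \<in> LL.zspan (\<theta> ` carrier C)" by blast
  have sc: "s \<in> carrier C" using Tc s(1) .
  obtain m where m: "\<forall>n \<ge> m. y [^] (n::nat) \<otimes> (\<theta> s \<otimes> l) \<in> W" using zspan_W[OF s(2)] by blast
  obtain s' n c where s': "s' \<in> T'" "c \<in> carrier K" "Theta s' = c \<odot> (\<theta> s \<otimes> y [^] (n::nat))"
    using T_pow(2)[OF s(1)] by blast
  obtain \<mu> where \<mu>: "\<mu> \<in> carrier K" "\<mu> ~= \<zero>\<^bsub>K\<^esub>" "\<tau> s = \<mu> \<odot>\<^bsub>C\<^esub> s" using T_pow(1)[OF s(1)] by blast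
  \<comment> \<open>Here e is the inverse of the n-th power of the eigenvalue of s.\<close>
  have "\<exists>e \<in> carrier K. \<theta> s \<otimes> y [^] n = e \<odot> (y [^] n \<otimes> \<theta> s)" for n :: nat
  proof -
    have tp: "(\<tau> ^^ n) s = (\<mu> [^]\<^bsub>K\<^esub> n) \<odot>\<^bsub>C\<^esub> s"
    proof (induct n)
      case (Suc n)
      then show ?case using sc \<mu> alg_homD(5)[OF tau_hom, of "\<mu> [^]\<^bsub>K\<^esub> n" s]
        by (simp add: smult_assoc1[symmetric])
    qed (use sc in simp)
    have pn: "\<mu> [^]\<^bsub>K\<^esub> n \<in> carrier K" "\<mu> [^]\<^bsub>K\<^esub> n ~= \<zero>\<^bsub>K\<^esub>"
      using \<mu>(1,2) by (simp, induct n) (auto simp: K.integral_iff)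
    have "y [^] n \<otimes> \<theta> s = (\<mu> [^]\<^bsub>K\<^esub> n) \<odot> (\<theta> s \<otimes> y [^] n)"
      using comm_pow[OF sc, of n] tp pn sc by (simp add: th_eq M.smult_mult_left)
    then show ?thesis
      using M.smult_inv_cancel[OF pn, of "\<theta> s \<otimes> y [^] n"] sc by (intro bexI[of _ "inv\<^bsub>K\<^esub> (\<mu> [^]\<^bsub>K\<^esub> n)"]) simp_all
  qed
  then obtain e where e: "e \<in> carrier K" "\<theta> s \<otimes> y [^] n = e \<odot> (y [^] n \<otimes> \<theta> s)" by blast
  have xs: "x [^]\<^bsub>S'\<^esub> m \<otimes>\<^bsub>S'\<^esub> s' \<in> T'" using submonoid.m_closed[OF T'_submonoid x_pow_T' s'(1)] .
  have s'c: "s' \<in> carrier S'" using T'_submonoid s'(1) by (rule submonoid.mem_carrier)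
  have "Theta (x [^]\<^bsub>S'\<^esub> m \<otimes>\<^bsub>S'\<^esub> s') \<otimes> l = y [^] m \<otimes> (c \<odot> (e \<odot> (y [^] n \<otimes> \<theta> s))) \<otimes> l"
    using alg_homD(2)[OF Theta(1), of "x [^]\<^bsub>S'\<^esub> m" s'] s'c Theta_x_pow s'(3) e(2) by simp
  also have "\<dots> = (c \<otimes>\<^bsub>K\<^esub> e) \<odot> (y [^] (m + n) \<otimes> (\<theta> s \<otimes> l))"
    using s'(2) e(1) sc l by (simp add: M.smult_mult_left M.smult_mult_right M.smult_assoc1 M.A.m_assoc flip: M.A.nat_pow_mult)
  also have "\<dots> \<in> W" using m s'(2) e(1) by (intro subalgD(2)[OF W]) auto
  finally show ?thesis using xs by blast
qed

text \<open>Here the powers of y coming from the counterpart of s and from x meet directly on the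
  right of \<open>\<theta> s\<close>, so no eigenvalue intervenes.\<close>

lemma T'_right_fraction:
  assumes frac: "\<And>b. b \<in> B ==> \<exists>s \<in> T. b \<otimes> \<theta> s \<in> \<theta> ` carrier C" and l: "l \<in> carrier M"
  shows "\<exists>s \<in> T'. l \<otimes> Theta s \<in> W"
proof -
  have Tc: "s \<in> carrier C" if "s \<in> T" for s using T_submonoid that by (rule submonoid.mem_carrier)
  have "\<exists>s \<in> \<theta> ` T. l \<otimes> s \<in> LL.zspan (\<theta> ` carrier C)"
  proof (rule LL.zspan_right_fraction[OF th_image])
    show "\<exists>a' \<in> \<theta> ` carrier C. y [^] k \<otimes> a = a' \<otimes> y [^] k" if "a \<in> \<theta> ` carrier C" for a and k :: int
      using that th_normalizes(1) by blast
    show "\<one> \<in> \<theta> ` T" using submonoid.one_closed[OF T_submonoid] th_eq(4) by (metis imageI)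
    show "s \<otimes> t \<in> \<theta> ` T" if "s \<in> \<theta> ` T" "t \<in> \<theta> ` T" for s t
      using that submonoid.m_closed[OF T_submonoid] Tc by (auto simp flip: th_eq(1))
  qed (use Tc th_B frac l in auto)
  then obtain s where s: "s \<in> T" "l \<otimes> \<theta> s \<in> LL.zspan (\<theta> ` carrier C)" by blast
  have sc: "s \<in> carrier C" using Tc s(1) .
  obtain m where m: "\<forall>n \<ge> m. (l \<otimes> \<theta> s) \<otimes> y [^] (n::nat) \<in> W" using zspan_W[OF s(2)] by blast
  obtain s' n c where s': "s' \<in> T'" "c \<in> carrier K" "Theta s' = c \<odot> (\<theta> s \<otimes> y [^] (n::nat))"
    using T_pow(2)[OF s(1)] by blast
  have xs: "s' \<otimes>\<^bsub>S'\<^esub> x [^]\<^bsub>S'\<^esub> m \<in> T'" using submonoid.m_closed[OF T'_submonoid s'(1) x_pow_T'] .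
  have s'c: "s' \<in> carrier S'" using T'_submonoid s'(1) by (rule submonoid.mem_carrier)
  have "l \<otimes> Theta (s' \<otimes>\<^bsub>S'\<^esub> x [^]\<^bsub>S'\<^esub> m) = l \<otimes> ((c \<odot> (\<theta> s \<otimes> y [^] n)) \<otimes> y [^] m)"
    using alg_homD(2)[OF Theta(1), of s' "x [^]\<^bsub>S'\<^esub> m"] s'c Theta_x_pow s'(3) by simp
  also have "\<dots> = c \<odot> ((l \<otimes> \<theta> s) \<otimes> y [^] (n + m))"
    using s'(2) sc l by (simp add: M.smult_mult_left M.smult_mult_right M.A.m_assoc flip: M.A.nat_pow_mult)
  also have "\<dots> \<in> W" using m s'(2) by (intro subalgD(2)[OF W]) auto
  finally show ?thesis using xs by blast
qed

end

end

end

text \<open>\<open>\<Sigma>\<close> extends \<open>\<Sigma>0\<close> by scaling y. Equivariance of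
  \<open>Theta\<close> holds on C by \<open>g_equivariant\<close> and at x by the scaling, hence on
  all polynomials.\<close>

lemma (in one_step) step_automorphism:
  assumes \<sigma>: "\<sigma> \<in> alg_iso K S' S'" "\<sigma> ` carrier C = carrier C" and c: "c \<in> carrier K" "c ~= \<zero>\<^bsub>K\<^esub>"
    and \<sigma>x: "\<sigma> x = c \<odot>\<^bsub>S'\<^esub> x"
    and \<Sigma>0: "\<Sigma>0 \<in> alg_iso K (M\<lparr>carrier := B\<rparr>) (M\<lparr>carrier := B\<rparr>)"
    and \<Sigma>0\<theta>: "\<And>a. a \<in> carrier C ==> \<Sigma>0 (\<theta> a) = \<theta> (\<sigma> a)"
    and frac: "\<And>b. b \<in> B ==> \<exists>s \<in> carrier C. \<theta> s \<in> Units (M\<lparr>carrier := B\<rparr>) \<and> \<theta> s \<otimes> b \<in> \<theta> ` carrier C"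
    and V: "subalg K M V" "V \<subseteq> B" "\<tau>L ` V = V" and \<Sigma>0V: "\<Sigma>0 ` V = V"
  shows "\<exists>\<Sigma> \<in> alg_iso K M M. (\<forall>b \<in> B. \<Sigma> b = \<Sigma>0 b) \<and> \<Sigma> y = c \<odot> y \<and>
    \<Sigma> ` LL.poly_part V = LL.poly_part V \<and> (\<forall>a \<in> carrier S'. \<Sigma> (Theta a) = Theta (\<sigma> a))"
proof -
  have \<sigma>c: "\<sigma> a \<in> carrier C" if "a \<in> carrier C" for a
    using \<sigma>(2) that by auto
  have \<sigma>_hom: "\<sigma> \<in> alg_hom K C C"
    using alg_hom_restrict[OF alg_isoD(1)[OF \<sigma>(1)], of "carrier C" "carrier C"] \<sigma>(2) P.SE(1) C_eq by simp
  have \<sigma>\<tau>: "\<sigma> (\<tau> a) = \<tau> (\<sigma> a)" if "a \<in> carrier C" for a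
    using P.automorphism_commute(1)[OF \<sigma>(1) _ c \<sigma>x that] \<sigma>(2) by simp
  have \<sigma>d: "\<sigma> (d 1 a) = c \<odot>\<^bsub>C\<^esub> d 1 (\<sigma> a)" if "a \<in> carrier C" for a
    using P.automorphism_commute(2)[OF \<sigma>(1) _ c \<sigma>x that] \<sigma>(2) \<sigma>c[OF that] delta that C_ops(5) by simp
  let ?MB = "M\<lparr>carrier := B\<rparr>"
  have MB: "ring ?MB" by (rule LL.ringS)
  interpret MB: ring ?MB by (rule MB)
  \<comment> \<open>Both composites are homomorphisms that agree on the image of C, and every
    element of B is a left fraction of such elements.\<close>
  have comm: "\<Sigma>0 (\<tau>L b) = \<tau>L (\<Sigma>0 b)" if b: "b \<in> B" for b
  proof -
    let ?f = "\<lambda>x. \<Sigma>0 (\<tau>L x)" and ?h = "\<lambda>x. \<tau>L (\<Sigma>0 x)"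
    have f: "?f \<in> alg_hom K ?MB ?MB" by (rule alg_hom_comp[OF LL.tau_hom alg_isoD(1)[OF \<Sigma>0]])
    have h: "?h \<in> alg_hom K ?MB ?MB" by (rule alg_hom_comp[OF alg_isoD(1)[OF \<Sigma>0] LL.tau_hom])
    have agree: "?f (\<theta> a) = ?h (\<theta> a)" if "a \<in> carrier C" for a
      using that tauL \<Sigma>0\<theta> \<sigma>\<tau> \<sigma>c by simp
    obtain s where s: "s \<in> carrier C" "\<theta> s \<in> Units ?MB" "\<theta> s \<otimes> b \<in> \<theta> ` carrier C" using frac[OF b] by blast
    then obtain a where a: "a \<in> carrier C" "\<theta> s \<otimes> b = \<theta> a" by blast
    have "?f (\<theta> s) \<otimes>\<^bsub>?MB\<^esub> ?f b = ?f (\<theta> a)" "?h (\<theta> s) \<otimes>\<^bsub>?MB\<^esub> ?h b = ?h (\<theta> a)"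
      using alg_homD(2)[OF f, of "\<theta> s" b] alg_homD(2)[OF h, of "\<theta> s" b] a(2) b th_B[OF s(1)] by simp_all
    then have "?f (\<theta> s) \<otimes>\<^bsub>?MB\<^esub> ?f b = ?f (\<theta> s) \<otimes>\<^bsub>?MB\<^esub> ?h b" using agree[OF a(1)] agree[OF s(1)] by simp
    moreover have "?f (\<theta> s) \<in> Units ?MB" using alg_hom_Units(1)[OF MB MB f s(2)] .
    moreover have "?f b \<in> carrier ?MB" "?h b \<in> carrier ?MB" using alg_homD(1)[OF f] alg_homD(1)[OF h] b by auto
    ultimately show ?thesis using MB.Units_l_cancel by blast
  qed
  obtain \<Sigma> where \<Sigma>: "\<Sigma> \<in> alg_iso K M M" "\<And>b. b \<in> B ==> \<Sigma> b = \<Sigma>0 b" "\<Sigma> y = c \<odot> y"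
    "\<Sigma> ` LL.poly_part V = LL.poly_part V"
    using LL.extend_automorphism[OF \<Sigma>0 comm c V \<Sigma>0V] by blast
  have \<Sigma>\<theta>: "\<Sigma> (\<theta> a) = \<theta> (\<sigma> a)" if "a \<in> carrier C" for a using \<Sigma>(2)[OF th_B[OF that]] \<Sigma>0\<theta>[OF that] by simp
  have "\<Sigma> (Theta a) = Theta (\<sigma> a)" if "a \<in> carrier S'" for a
  proof (rule P.skew_hom_unique[OF M_alg alg_hom_comp[OF Theta(1) alg_isoD(1)[OF \<Sigma>(1)]]
        alg_hom_comp[OF alg_isoD(1)[OF \<sigma>(1)] Theta(1)] _ _ that])
    show "\<Sigma> (Theta s) = Theta (\<sigma> s)" if "s \<in> carrier C" for s
      using Theta(2) that \<sigma>c g_equivariant[OF \<sigma>_hom alg_isoD(1)[OF \<Sigma>(1)] c \<sigma>d \<Sigma>\<theta> \<Sigma>(3) that] by simp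
    show "\<Sigma> (Theta x) = Theta (\<sigma> x)"
      using Theta(3) \<Sigma>(3) \<sigma>x alg_homD(5)[OF Theta(1) c(1) P.x_closed] by simp
  qed
  then show ?thesis using \<Sigma> by blast
qed

text \<open>Clearing the first factor on the left and the second on the right turns a vanishing
  product into one of elements of C.\<close>

lemma domain_of_fractions:
  fixes L (structure)
  assumes C: "nc_domain C" and L: "ring L" and \<theta>: "\<theta> \<in> alg_hom K C L" and inj: "inj_on \<theta> (carrier C)"
    and left: "\<And>l. l \<in> carrier L ==> \<exists>s \<in> carrier C. \<theta> s \<in> Units L \<and> \<theta> s \<otimes> l \<in> \<theta> ` carrier C"
    and right: "\<And>l. l \<in> carrier L ==> \<exists>s \<in> carrier C. \<theta> s \<in> Units L \<and> l \<otimes> \<theta> s \<in> \<theta> ` carrier C"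
  shows "nc_domain L"
proof -
  interpret C: ring C using C by (rule nc_domainD)
  interpret L: ring L by fact
  have \<theta>0: "\<theta> \<zero>\<^bsub>C\<^esub> = \<zero>" by (rule alg_hom_zero[OF C.ring_axioms L \<theta>])
  have z: "a = \<zero>\<^bsub>C\<^esub>" if "a \<in> carrier C" "\<theta> a = \<zero>" for a
    using inj_onD[OF inj, of a "\<zero>\<^bsub>C\<^esub>"] that \<theta>0 by simp
  show ?thesis
    unfolding nc_domain_def
  proof (intro conjI ballI impI L)
    show "\<one> ~= \<zero>" using z[OF C.one_closed] alg_homD(4)[OF \<theta>] nc_domainD(2)[OF C] by auto
    fix l m assume lm: "l \<in> carrier L" "m \<in> carrier L" "l \<otimes> m = \<zero>"
    obtain s a where s: "s \<in> carrier C" "\<theta> s \<in> Units L" "a \<in> carrier C" "\<theta> s \<otimes> l = \<theta> a" using left[OF lm(1)] by blast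
    obtain r b where r: "r \<in> carrier C" "\<theta> r \<in> Units L" "b \<in> carrier C" "m \<otimes> \<theta> r = \<theta> b" using right[OF lm(2)] by blast
    have c: "\<theta> s \<in> carrier L" "\<theta> r \<in> carrier L" using s r by auto
    have "\<theta> (a \<otimes>\<^bsub>C\<^esub> b) = \<theta> s \<otimes> (l \<otimes> m) \<otimes> \<theta> r"
      using alg_homD(2)[OF \<theta> s(3) r(3)] lm(1,2) c by (simp add: L.m_assoc flip: s(4) r(4))
    then have "\<theta> (a \<otimes>\<^bsub>C\<^esub> b) = \<zero>" using lm(3) c by simp
    then have "a \<otimes>\<^bsub>C\<^esub> b = \<zero>\<^bsub>C\<^esub>" using z s r by simp
    then have "a = \<zero>\<^bsub>C\<^esub> \<or> b = \<zero>\<^bsub>C\<^esub>" using nc_domainD(3)[OF C] s r by blast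
    then show "l = \<zero> \<or> m = \<zero>"
    proof
      assume "a = \<zero>\<^bsub>C\<^esub>"
      then have "\<theta> s \<otimes> l = \<theta> s \<otimes> \<zero>" using s(4) \<theta>0 c by simp
      then show ?thesis using L.Units_l_cancel[OF s(2) lm(1) L.zero_closed] by simp
    next
      assume "b = \<zero>\<^bsub>C\<^esub>"
      then have "m \<otimes> \<theta> r = \<zero>" using r(4) \<theta>0 by simp
      moreover have "(m \<otimes> \<theta> r) \<otimes> inv \<theta> r = m"
        using lm(2) r(2) c by (simp only: L.m_assoc L.Units_inv_closed L.Units_r_inv L.r_one)
      ultimately have "m = \<zero>" using r(2) by simp
      then show ?thesis by simp
    qed
  qed
qed

section \<open>Induction on the number of variables\<close>

locale tower =
  fixes K :: "'k ring" and A :: "('k, 'a) module" and S :: "nat => 'a set" and n :: nat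
    and x :: "nat => 'a" and \<tau> \<delta> :: "nat => 'a => 'a" and lam :: "nat => nat => 'k" and q :: "nat => 'k"
    and d :: "nat => nat => 'a => 'a"
  assumes A: "iterated_skew_polynomial_ring K A S n x \<tau> \<delta>"
    and R_domain: "nc_domain (A\<lparr>carrier := S 0\<rparr>)"
    and tau_R: "\<And>i. i \<in> {1..n} ==> \<tau> i ` S 0 \<subseteq> S 0"
    and lam: "\<And>i j. i \<in> {1..n} ==> j \<in> {1..<i} ==> lam i j \<in> carrier K \<and> lam i j ~= \<zero>\<^bsub>K\<^esub>"
    and tau_x: "\<And>i j. i \<in> {1..n} ==> j \<in> {1..<i} ==> \<tau> i (x j) = lam i j \<odot>\<^bsub>A\<^esub> x j"
    and q: "\<And>i. i \<in> {1..n} ==> q i \<in> carrier K \<and> q i ~= \<zero>\<^bsub>K\<^esub> \<and> q i ~= \<one>\<^bsub>K\<^esub>"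
    and higher: "\<And>i. i \<in> {1..n} ==> higher_skew_derivation K (A\<lparr>carrier := S (i - 1)\<rparr>) (q i) (\<tau> i) (d i) \<and>
          (\<forall>s \<in> S (i - 1). d i 1 s = \<delta> i s) \<and> locally_nilpotent (A\<lparr>carrier := S (i - 1)\<rparr>) (d i) \<and>
          iterative K (A\<lparr>carrier := S (i - 1)\<rparr>) (q i) (d i)"
begin

abbreviation "AS i \<equiv> A\<lparr>carrier := S i\<rparr>"

lemma algA: "nc_algebra K A" and Sn: "S n = carrier A"
  using A unfolding iterated_skew_polynomial_ring_def by auto

lemma skp: "i < n ==> skew_polynomial_ring K (AS (Suc i)) (S i) (x (Suc i)) (\<tau> (Suc i)) (\<delta> (Suc i))"
proof -
  assume i: "i < n"
  have "\<forall>i\<in>{1..n}. skew_polynomial_ring K (AS i) (S (i - 1)) (x i) (\<tau> i) (\<delta> i)"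
    using A unfolding iterated_skew_polynomial_ring_def by simp
  from bspec[OF this, of "Suc i"] i show ?thesis by simp
qed

lemma subA: "i \<le> n ==> subalg K A (S i)"
proof (induct "n - i" arbitrary: i)
  case 0
  then show ?case using Sn subalg_carrier[OF algA] by simp
next
  case (Suc k)
  then have 1: "subalg K A (S (Suc i))" by simp
  interpret skew_poly K "AS (Suc i)" "S i" "x (Suc i)" "\<tau> (Suc i)" "\<delta> (Suc i)"
    by (rule skew_poly.intro[OF skp]) (use Suc in simp)
  have "S i \<subseteq> S (Suc i)" using SE(1) by simp
  then show ?case using sub subalg_sub[OF algA 1] by simp
qed

lemma S_Suc: "i < n ==> S i \<subseteq> S (Suc i)"
proof -
  assume "i < n"
  interpret skew_poly K "AS (Suc i)" "S i" "x (Suc i)" "\<tau> (Suc i)" "\<delta> (Suc i)"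
    by (rule skew_poly.intro[OF skp[OF \<open>i < n\<close>]])
  show ?thesis using SE(1) by simp
qed

lemma S_mono: "i \<le> j ==> j \<le> n ==> S i \<subseteq> S j"
proof (induct j)
  case (Suc j)
  then show ?case using S_Suc[of j] by (cases "i = Suc j") auto
qed simp

lemma algS: "i \<le> n ==> nc_algebra K (AS i)"
  by (rule subalg_nc_algebra[OF algA subA])

lemma x_mem: "1 \<le> j ==> j \<le> i ==> i \<le> n ==> x j \<in> S i"
proof -
  assume j: "1 \<le> j" "j \<le> i" "i \<le> n"
  then obtain k where k: "j = Suc k" by (cases j) auto
  interpret skew_poly K "AS (Suc k)" "S k" "x (Suc k)" "\<tau> (Suc k)" "\<delta> (Suc k)"
    by (rule skew_poly.intro[OF skp]) (use j k in simp)
  have "x j \<in> S j" using x_closed k by simp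
  then show ?thesis using S_mono[of j i] j by auto
qed

lemma domS: "i \<le> n ==> nc_domain (AS i)"
proof (induct i)
  case (Suc i)
  interpret skew_poly K "AS (Suc i)" "S i" "x (Suc i)" "\<tau> (Suc i)" "\<delta> (Suc i)"
    by (rule skew_poly.intro[OF skp]) (use Suc in simp)
  show ?case using skew_poly_domain Suc by simp
qed (rule R_domain)

text \<open>The class of automorphisms for which the induction is strong enough: it contains the
  automorphism of the next variable and is stable under restriction to earlier floors, whatever the
  scalars are.\<close>

definition adm :: "nat => ('a => 'a) => (nat => 'k) => bool" where
  "adm i \<sigma> l \<longleftrightarrow> \<sigma> \<in> alg_iso K (AS i) (AS i) \<and> (\<forall>j\<le>i. \<sigma> ` S j = S j) \<and>
    (\<forall>j\<in>{1..i}. l j \<in> carrier K \<and> l j ~= \<zero>\<^bsub>K\<^esub> \<and> \<sigma> (x j) = l j \<odot>\<^bsub>A\<^esub> x j)"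

lemma restrict_iso:
  assumes "\<sigma> \<in> alg_iso K (AS i) (AS i)" "\<sigma> ` S j = S j" "j \<le> i" "i \<le> n"
  shows "\<sigma> \<in> alg_iso K (AS j) (AS j)"
proof -
  have sub: "S j \<subseteq> S i" using S_mono assms by blast
  show ?thesis
  proof (rule alg_isoI)
    show "\<sigma> \<in> alg_hom K (AS j) (AS j)"
      using alg_hom_restrict[OF alg_isoD(1)[OF assms(1)], of "S j" "S j"] sub assms(2) by simp
    show "inj_on \<sigma> (carrier (AS j))"
      using alg_isoD(2)[OF assms(1)] sub by (auto intro: inj_on_subset)
  qed (use assms(2) in simp)
qed

lemma adm_restrict: "adm (Suc i) \<sigma> l ==> Suc i \<le> n ==> adm i \<sigma> l"
  using restrict_iso[of \<sigma> "Suc i" i] unfolding adm_def by auto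

text \<open>The hypotheses give only an inclusion on \<open>S 0\<close>. Inclusions climb the tower
  through the generators; equalities then descend from the top floor, where surjectivity is known,
  by \<open>automorphism_restrict\<close>.\<close>

lemma adm_tau:
  assumes i: "i < n" shows "adm i (\<tau> (Suc i)) (lam (Suc i))"
proof -
  let ?\<sigma> = "\<tau> (Suc i)" and ?l = "lam (Suc i)"
  interpret I: skew_poly K "AS (Suc i)" "S i" "x (Suc i)" ?\<sigma> "\<delta> (Suc i)"
    by (rule skew_poly.intro[OF skp[OF i]])
  have iso: "?\<sigma> \<in> alg_iso K (AS i) (AS i)" using I.tau_iso by simp
  note hom = alg_homD[OF alg_isoD(1)[OF iso]]
  have lx: "?l j \<in> carrier K" "?l j ~= \<zero>\<^bsub>K\<^esub>" "?\<sigma> (x j) = ?l j \<odot>\<^bsub>A\<^esub> x j" if "j \<in> {1..i}" for j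
    using lam[of "Suc i" j] tau_x[of "Suc i" j] that i by auto
  \<comment> \<open>Upwards from \<open>S 0\<close>: elements of the next floor are sums of products
    of elements of this floor with powers of a variable that is only scaled.\<close>
  have le: "?\<sigma> ` S j \<subseteq> S j" if "j \<le> i" for j
    using that
  proof (induct j)
    case 0
    then show ?case using tau_R[of "Suc i"] i by simp
  next
    case (Suc j)
    interpret J: skew_poly K "AS (Suc j)" "S j" "x (Suc j)" "\<tau> (Suc j)" "\<delta> (Suc j)"
      by (rule skew_poly.intro[OF skp]) (use Suc i in simp)
    have sub: "S j \<subseteq> S (Suc j)" "S (Suc j) \<subseteq> S i" using S_mono[of j "Suc j"] S_mono[of "Suc j" i] Suc i by auto
    have xj: "x (Suc j) \<in> S (Suc j)" using J.x_closed by simp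
    have pw: "?\<sigma> (x (Suc j) [^]\<^bsub>A\<^esub> k) \<in> S (Suc j) \<and> x (Suc j) [^]\<^bsub>A\<^esub> k \<in> S (Suc j)" for k :: nat
    proof (induct k)
      case 0
      then show ?case using hom(4) J.A.one_closed by simp
    next
      case (Suc k)
      have "?\<sigma> (x (Suc j) [^]\<^bsub>A\<^esub> k \<otimes>\<^bsub>A\<^esub> x (Suc j)) = ?\<sigma> (x (Suc j) [^]\<^bsub>A\<^esub> k) \<otimes>\<^bsub>A\<^esub> (?l (Suc j) \<odot>\<^bsub>A\<^esub> x (Suc j))"
        using hom(2)[of "x (Suc j) [^]\<^bsub>A\<^esub> k" "x (Suc j)"] Suc xj sub(2) lx[of "Suc j"] \<open>Suc j \<le> i\<close> by auto
      moreover have "?l (Suc j) \<odot>\<^bsub>A\<^esub> x (Suc j) \<in> S (Suc j)" using J.smult_closed[of "?l (Suc j)" "x (Suc j)"] lx[of "Suc j"] xj \<open>Suc j \<le> i\<close> by simp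
      ultimately show ?case using Suc xj J.A.m_closed by simp
    qed
    have "?\<sigma> a \<in> S (Suc j)" if "a \<in> carrier (AS (Suc j))" for a
      using that
    proof (induct rule: J.basis_induct)
      case (monom s k)
      have "?\<sigma> (s \<otimes>\<^bsub>A\<^esub> x (Suc j) [^]\<^bsub>A\<^esub> k) = ?\<sigma> s \<otimes>\<^bsub>A\<^esub> ?\<sigma> (x (Suc j) [^]\<^bsub>A\<^esub> k)"
        using hom(2)[of s "x (Suc j) [^]\<^bsub>A\<^esub> k"] monom sub pw by auto
      moreover have "?\<sigma> s \<in> S (Suc j)" using Suc monom sub by auto
      ultimately show ?case using pw[of k] J.A.m_closed by (simp add: nat_pow_carrier_update)
    next
      case (add u v)
      then have "u \<in> S i" "v \<in> S i" using sub by auto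
      then show ?case using hom(3)[of u v] J.A.a_closed[of "?\<sigma> u" "?\<sigma> v"] add by simp
    qed
    then show ?case by auto
  qed
  \<comment> \<open>Downwards from \<open>S i\<close>: surjectivity on one floor and the inclusion
    on the floor below give surjectivity there.\<close>
  have eq: "?\<sigma> ` S (i - k) = S (i - k)" if "k \<le> i" for k
    using that
  proof (induct k)
    case 0
    then show ?case using alg_isoD(3)[OF iso] by simp
  next
    case (Suc k)
    then obtain j where j: "j = i - Suc k" "Suc j = i - k" "Suc j \<le> i" by (metis Suc_diff_Suc Suc_le_lessD diff_le_self)
    interpret J: skew_poly K "AS (Suc j)" "S j" "x (Suc j)" "\<tau> (Suc j)" "\<delta> (Suc j)"
      by (rule skew_poly.intro[OF skp]) (use j i in simp)
    have \<sigma>J: "?\<sigma> \<in> alg_iso K (AS (Suc j)) (AS (Suc j))"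
      by (rule restrict_iso[OF iso]) (use Suc j i in auto)
    have "?\<sigma> (x (Suc j)) = ?l (Suc j) \<odot>\<^bsub>AS (Suc j)\<^esub> x (Suc j)" using lx(3)[of "Suc j"] j by simp
    then have "?\<sigma> ` S j = S j"
      using J.automorphism_restrict[OF \<sigma>J le _ _] lx[of "Suc j"] j by simp
    then show ?case using j by simp
  qed
  have "?\<sigma> ` S j = S j" if "j \<le> i" for j using eq[of "i - j"] that by simp
  then show ?thesis unfolding adm_def using iso lx by auto
qed

text \<open>The elements \<open>t\<^sub>1,\<dots>,t\<^sub>i\<close> generate the denominators, and \<open>V\<^sub>0 \<subseteq> V\<^sub>1 \<subseteq> \<dots>\<close> are the skew polynomial rings inside
  the skew Laurent rings \<open>U\<^sub>0 \<subseteq> U\<^sub>1 \<subseteq> \<dots>\<close>. The condition on exponents of variables after the \<open>i\<close>-th leaves room for the next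
  variable; the last condition carries the next automorphism over to \<^term>\<open>L\<close>.\<close>

definition stage :: "nat => ('k, (nat => int) => 'a) module => (nat => ((nat => int) => 'a) set) =>
    (nat => ((nat => int) => 'a) set) => (nat => (nat => int) => 'a) =>
    (nat => ((nat => int) => 'a) => (nat => int) => 'a) => ('a => (nat => int) => 'a) => ('a => (nat => int) => 'a) =>
    (nat => 'a) => bool" where
  "stage i L U V y \<tau>' \<theta> \<iota> t \<longleftrightarrow>
    (nc_algebra K L \<and> U i = carrier L \<and> V 0 = U 0 \<and>
      (\<forall>j\<le>i. subalg K L (U j)) \<and> (\<forall>j\<le>i. subalg K L (V j)) \<and>
      (\<forall>j\<in>{1..i}. skew_laurent_ring K (L\<lparr>carrier := U j\<rparr>) (U (j - 1)) (y j) (\<tau>' j)) \<and>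
      (\<forall>j\<in>{1..i}. skew_polynomial_ring K (L\<lparr>carrier := V j\<rparr>) (V (j - 1)) (y j) (\<tau>' j) (\<lambda>_. \<zero>\<^bsub>L\<^esub>))) \<and>
    (\<iota> \<in> alg_iso K (AS 0) (L\<lparr>carrier := U 0\<rparr>) \<and>
      (\<forall>j\<in>{1..i}. \<forall>r\<in>S 0. \<tau>' j (\<iota> r) = \<iota> (\<tau> j r)) \<and>
      (\<forall>j\<in>{1..i}. \<forall>k\<in>{1..<j}. \<tau>' j (y k) = lam j k \<odot>\<^bsub>L\<^esub> y k)) \<and>
    (\<theta> \<in> alg_hom K (AS i) L \<and> inj_on \<theta> (S i) \<and> t ` {1..i} \<subseteq> S i \<and>
      (\<forall>s\<in>mult_set_generated (AS i) (t ` {1..i}). \<theta> s \<in> Units L) \<and>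
      (\<forall>l\<in>carrier L. \<exists>s\<in>mult_set_generated (AS i) (t ` {1..i}). \<theta> s \<otimes>\<^bsub>L\<^esub> l \<in> \<theta> ` S i) \<and>
      (\<forall>l\<in>carrier L. \<exists>s\<in>mult_set_generated (AS i) (t ` {1..i}). l \<otimes>\<^bsub>L\<^esub> \<theta> s \<in> \<theta> ` S i)) \<and>
    (\<forall>l\<in>carrier L. \<exists>p\<in>V i. p ~= \<zero>\<^bsub>L\<^esub> \<and> p \<otimes>\<^bsub>L\<^esub> l \<in> V i) \<and>
    (\<zero>\<^bsub>L\<^esub> = (\<lambda>_. \<zero>\<^bsub>A\<^esub>) \<and> (\<forall>c\<in>carrier L. \<forall>\<alpha> j. j > i \<longrightarrow> \<alpha> j ~= 0 \<longrightarrow> c \<alpha> = \<zero>\<^bsub>A\<^esub>)) \<and>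
    (\<forall>\<sigma> l. adm i \<sigma> l \<longrightarrow>
      (\<forall>j\<in>{1..i}. \<exists>\<mu>\<in>carrier K. \<mu> ~= \<zero>\<^bsub>K\<^esub> \<and> \<sigma> (t j) = \<mu> \<odot>\<^bsub>A\<^esub> t j) \<and>
      (\<exists>\<Sigma>\<in>alg_iso K L L. (\<forall>s\<in>S i. \<Sigma> (\<theta> s) = \<theta> (\<sigma> s)) \<and> (\<forall>r\<in>S 0. \<Sigma> (\<iota> r) = \<iota> (\<sigma> r)) \<and>
        (\<forall>j\<in>{1..i}. \<Sigma> (y j) = l j \<odot>\<^bsub>L\<^esub> y j) \<and> \<Sigma> ` V i = V i))"

lemma stage_0: "\<exists>L U V y \<tau>' \<theta> \<iota> t. stage 0 L U V y \<tau>' \<theta> \<iota> t"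
proof -
  \<comment> \<open>Coordinate 0 of an exponent vector belongs to no variable. So an element of R
    becomes a function that is constant on the vectors without positive coordinates in use.\<close>
  define h where "h r = (\<lambda>\<alpha> :: nat => int. if \<forall>j>0. \<alpha> j = 0 then r else \<zero>\<^bsub>A\<^esub>)" for r
  have inj: "inj_on h (carrier (AS 0))"
  proof (rule inj_onI)
    fix r s assume "h r = h s"
    then have "h r (\<lambda>_. 0) = h s (\<lambda>_. 0)" by simp
    then show "r = s" by (simp add: h_def)
  qed
  obtain L :: "('k, (nat => int) => 'a) module" where
    L: "nc_algebra K L" "h \<in> alg_iso K (AS 0) L" "\<zero>\<^bsub>L\<^esub> = h \<zero>\<^bsub>AS 0\<^esub>"
    using transport_algebra[OF algS[of 0] inj] by blast
  interpret L: nc_algebra K L by (rule L)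
  note hh = alg_homD[OF alg_isoD(1)[OF L(2)]]
  have hS: "h ` S 0 = carrier L" using alg_isoD(3)[OF L(2)] by simp
  interpret C: nc_algebra K "AS 0" by (rule algS) simp
  have T: "\<one>\<^bsub>A\<^esub> \<in> mult_set_generated (AS 0) {}"
    using submonoid.one_closed[OF mult_set_generated_submonoid[OF C.A.monoid_axioms, of "{}"]] by simp
  have T1: "s = \<one>\<^bsub>A\<^esub>" if "s \<in> mult_set_generated (AS 0) {}" for s
  proof -
    have "submonoid {\<one>\<^bsub>A\<^esub>} (AS 0)"
      by (rule submonoid.intro) (use C.A.one_closed C.A.l_one[OF C.A.one_closed] in auto)
    then show ?thesis using mult_set_generated_least that by blast
  qed
  have e: "(\<lambda>_. \<one>\<^bsub>A\<^esub>) ` {1..0::nat} = {}" by simp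
  have h1: "h \<one>\<^bsub>A\<^esub> = \<one>\<^bsub>L\<^esub>" using hh(4) by simp
  have ne: "\<one>\<^bsub>L\<^esub> ~= \<zero>\<^bsub>L\<^esub>"
    using inj_onD[OF inj, of "\<one>\<^bsub>A\<^esub>" "\<zero>\<^bsub>A\<^esub>"] h1 L(3) nc_domainD(2)[OF R_domain] C.A.one_closed C.A.zero_closed by auto
  have "stage 0 L (\<lambda>_. carrier L) (\<lambda>_. carrier L) (\<lambda>_. \<one>\<^bsub>L\<^esub>) (\<lambda>_ z. z) h h (\<lambda>_. \<one>\<^bsub>A\<^esub>)"
    unfolding stage_def
  proof (intro conjI)
    show "\<forall>l\<in>carrier L. \<exists>p\<in>carrier L. p ~= \<zero>\<^bsub>L\<^esub> \<and> p \<otimes>\<^bsub>L\<^esub> l \<in> carrier L"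
      using ne L.A.one_closed by (intro ballI bexI[of _ "\<one>\<^bsub>L\<^esub>"]) auto
    show "\<zero>\<^bsub>L\<^esub> = (\<lambda>_. \<zero>\<^bsub>A\<^esub>)" unfolding L(3) by (simp add: h_def)
    show "\<forall>c\<in>carrier L. \<forall>\<alpha> j. j > 0 \<longrightarrow> \<alpha> j ~= 0 \<longrightarrow> c \<alpha> = \<zero>\<^bsub>A\<^esub>"
      unfolding hS[symmetric] by (auto simp: h_def)
    show "\<forall>l\<in>carrier L. \<exists>s\<in>mult_set_generated (AS 0) ((\<lambda>_. \<one>\<^bsub>A\<^esub>) ` {1..0::nat}). h s \<otimes>\<^bsub>L\<^esub> l \<in> h ` S 0"
      "\<forall>l\<in>carrier L. \<exists>s\<in>mult_set_generated (AS 0) ((\<lambda>_. \<one>\<^bsub>A\<^esub>) ` {1..0::nat}). l \<otimes>\<^bsub>L\<^esub> h s \<in> h ` S 0"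
      unfolding e using T h1 hS by (auto intro!: bexI[of _ "\<one>\<^bsub>A\<^esub>"])
    show "\<forall>s\<in>mult_set_generated (AS 0) ((\<lambda>_. \<one>\<^bsub>A\<^esub>) ` {1..0::nat}). h s \<in> Units L"
      unfolding e using T1 h1 by auto
    show "\<forall>\<sigma> l. adm 0 \<sigma> l \<longrightarrow>
      (\<forall>j\<in>{1..0::nat}. \<exists>\<mu>\<in>carrier K. \<mu> ~= \<zero>\<^bsub>K\<^esub> \<and> \<sigma> \<one>\<^bsub>A\<^esub> = \<mu> \<odot>\<^bsub>A\<^esub> \<one>\<^bsub>A\<^esub>) \<and>
      (\<exists>\<Sigma>\<in>alg_iso K L L. (\<forall>s\<in>S 0. \<Sigma> (h s) = h (\<sigma> s)) \<and> (\<forall>r\<in>S 0. \<Sigma> (h r) = h (\<sigma> r)) \<and>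
        (\<forall>j\<in>{1..0::nat}. \<Sigma> \<one>\<^bsub>L\<^esub> = l j \<odot>\<^bsub>L\<^esub> \<one>\<^bsub>L\<^esub>) \<and> \<Sigma> ` carrier L = carrier L)"
    proof (intro allI impI conjI)
      fix \<sigma> l assume "adm 0 \<sigma> l"
      then have \<sigma>: "\<sigma> \<in> alg_iso K (AS 0) (AS 0)" unfolding adm_def by blast
      let ?\<Sigma> = "\<lambda>z. h (\<sigma> (inv_into (carrier (AS 0)) h z))"
      have "?\<Sigma> \<in> alg_iso K L L"
        by (rule alg_iso_comp[OF alg_iso_comp[OF alg_iso_inv[OF algS[of 0] L(2)] \<sigma>] L(2)]) simp
      moreover from this have "?\<Sigma> ` carrier L = carrier L" by (rule alg_isoD(3))
      moreover have "?\<Sigma> (h s) = h (\<sigma> s)" if "s \<in> S 0" for s using that inj by simp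
      ultimately show "\<exists>\<Sigma>\<in>alg_iso K L L. (\<forall>s\<in>S 0. \<Sigma> (h s) = h (\<sigma> s)) \<and> (\<forall>r\<in>S 0. \<Sigma> (h r) = h (\<sigma> r)) \<and>
        (\<forall>j\<in>{1..0::nat}. \<Sigma> \<one>\<^bsub>L\<^esub> = l j \<odot>\<^bsub>L\<^esub> \<one>\<^bsub>L\<^esub>) \<and> \<Sigma> ` carrier L = carrier L"
        by (intro bexI[of _ ?\<Sigma>]) simp_all
    qed auto
  qed (use L inj subalg_carrier[OF L(1)] alg_isoD(1) in auto)
  then show ?thesis by blast
qed

text \<open>The last clause of \<open>stage\<close>, applied to the automorphism of the new
  variable, provides its extension to L; this makes the next Laurent ring M available. The remaining
  clauses are the results on \<open>one_step\<close>, and the last one is re-established by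
  \<open>step_automorphism\<close>.\<close>

lemma stage_Suc:
  assumes st: "stage i L U V y \<tau>' \<theta> \<iota> t" and i: "i < n"
  shows "\<exists>L U V y \<tau>' \<theta> \<iota> t. stage (Suc i) L U V y \<tau>' \<theta> \<iota> t"
proof -
  note st' = st[unfolded stage_def]
  note s1 = conjunct1[OF st'] and s2 = conjunct1[OF conjunct2[OF st']]
    and s3 = conjunct1[OF conjunct2[OF conjunct2[OF st']]]
    and s4 = conjunct1[OF conjunct2[OF conjunct2[OF conjunct2[OF st']]]]
    and s5 = conjunct1[OF conjunct2[OF conjunct2[OF conjunct2[OF conjunct2[OF st']]]]]
    and s6 = conjunct2[OF conjunct2[OF conjunct2[OF conjunct2[OF conjunct2[OF st']]]]]
  have L: "nc_algebra K L" "U i = carrier L" "V 0 = U 0" using s1 by auto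
  let ?C = "AS i" and ?S = "AS (Suc i)" and ?\<sigma> = "\<tau> (Suc i)"
  \<comment> \<open>The automorphism over which the new variable of M is adjoined. That it fixes
    \<open>V i\<close> as a set is needed for the polynomial part of M to be a skew polynomial
    ring.\<close>
  obtain \<tau>L where \<tau>L: "\<tau>L \<in> alg_iso K L L" "\<And>s. s \<in> S i ==> \<tau>L (\<theta> s) = \<theta> (?\<sigma> s)"
    "\<And>r. r \<in> S 0 ==> \<tau>L (\<iota> r) = \<iota> (?\<sigma> r)" "\<And>j. j \<in> {1..i} ==> \<tau>L (y j) = lam (Suc i) j \<odot>\<^bsub>L\<^esub> y j" "\<tau>L ` V i = V i"
    using conjunct2[OF mp[OF spec[OF spec[OF s6]] adm_tau[OF i]]] by (elim bexE) auto
  have \<mu>: "\<exists>\<mu>\<in>carrier K. \<mu> ~= \<zero>\<^bsub>K\<^esub> \<and> ?\<sigma> (t j) = \<mu> \<odot>\<^bsub>A\<^esub> t j" if "j \<in> {1..i}" for j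
    using bspec[OF conjunct1[OF mp[OF spec[OF spec[OF s6]] adm_tau[OF i]]] that] .
  obtain M :: "('k, (nat => int) => 'a) module" and y1 where M: "skew_laurent_ring K M (carrier L) y1 \<tau>L"
    "(\<lambda>x. x) \<in> alg_hom K L M" "\<zero>\<^bsub>M\<^esub> = (\<lambda>_. \<zero>\<^bsub>A\<^esub>)"
    "\<And>c \<alpha> j. c \<in> carrier M ==> j > Suc i ==> \<alpha> j ~= 0 ==> c \<alpha> = \<zero>\<^bsub>A\<^esub>"
    using laurent_extension[OF L(1) \<tau>L(1), of "\<zero>\<^bsub>A\<^esub>" i] s5 by blast
  interpret LM: skew_laur K M "carrier L" y1 \<tau>L by (rule skew_laur.intro[OF M(1)])
  interpret LA: nc_algebra K L by (rule L)
  have ops: "a \<otimes>\<^bsub>L\<^esub> b = a \<otimes>\<^bsub>M\<^esub> b" "c \<in> carrier K ==> c \<odot>\<^bsub>L\<^esub> a = c \<odot>\<^bsub>M\<^esub> a"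
    if "a \<in> carrier L" "b \<in> carrier L" for a b c
    using alg_homD(2,5)[OF M(2)] that by auto
  have z: "\<zero>\<^bsub>L\<^esub> = \<zero>\<^bsub>M\<^esub>" "\<one>\<^bsub>L\<^esub> = \<one>\<^bsub>M\<^esub>" using M(3) s5 alg_homD(4)[OF M(2)] by auto
  have subM: "subalg K M W" if "subalg K L W" for W
    using alg_hom_image_subalg[OF L(1) LM.alg M(2) that] by simp
  have \<theta>: "\<theta> \<in> alg_hom K ?C L" "inj_on \<theta> (S i)" "t ` {1..i} \<subseteq> S i" using s3 by auto
  have unitsM: "u \<in> Units M" if "u \<in> Units L" for u
    using alg_hom_Units(1)[OF LA.A.ring_axioms LM.A.ring_axioms M(2) that] .
  interpret O: one_step K ?C ?\<sigma> "q (Suc i)" "d (Suc i)" M \<theta> y1 ?S "x (Suc i)" "\<delta> (Suc i)" "carrier L" \<tau>L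
  proof (intro one_step.intro higher_emb.intro higher_der.intro higher_emb_axioms.intro one_step_axioms.intro)
    show "nc_algebra K ?C" using algS i by simp
    show "nc_domain ?C" using domS i by simp
    show "?\<sigma> \<in> alg_iso K ?C ?C" using adm_tau[OF i] unfolding adm_def by blast
    show "q (Suc i) \<in> carrier K" "q (Suc i) ~= \<zero>\<^bsub>K\<^esub>" "q (Suc i) ~= \<one>\<^bsub>K\<^esub>" using q[of "Suc i"] i by auto
    show "higher_skew_derivation K ?C (q (Suc i)) ?\<sigma> (d (Suc i))" "locally_nilpotent ?C (d (Suc i))"
      "iterative K ?C (q (Suc i)) (d (Suc i))" using higher[of "Suc i"] i by auto
    show "nc_algebra K M" by (rule LM.alg)
    show \<theta>M: "\<theta> \<in> alg_hom K ?C M" using alg_hom_comp[OF \<theta>(1) M(2)] by simp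
    show "y1 \<in> Units M" by simp
    show "y1 \<otimes>\<^bsub>M\<^esub> \<theta> a = \<theta> (?\<sigma> a) \<otimes>\<^bsub>M\<^esub> y1" if "a \<in> carrier ?C" for a
      using LM.y_comm[of "\<theta> a"] \<tau>L(2)[of a] alg_homD(1)[OF \<theta>(1), of a] that by simp
    show "skew_polynomial_ring K ?S (carrier ?C) (x (Suc i)) ?\<sigma> (\<delta> (Suc i))" using skp[OF i] by simp
    show "\<delta> (Suc i) a = d (Suc i) 1 a" if "a \<in> carrier ?C" for a using higher[of "Suc i"] i that by simp
    show "\<theta> a \<in> carrier L" if "a \<in> carrier ?C" for a using alg_homD(1)[OF \<theta>(1) that] .
  qed (use M(1) \<theta>(2) \<tau>L(2) in auto)
  let ?T = "mult_set_generated ?C (t ` {1..i})"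
  have T: "\<And>s. s \<in> ?T ==> \<theta> s \<in> Units L" "\<And>l. l \<in> carrier L ==> \<exists>s\<in>?T. \<theta> s \<otimes>\<^bsub>L\<^esub> l \<in> \<theta> ` S i"
    "\<And>l. l \<in> carrier L ==> \<exists>s\<in>?T. l \<otimes>\<^bsub>L\<^esub> \<theta> s \<in> \<theta> ` S i" using s3 by auto
  have tC: "t ` {1..i} \<subseteq> carrier ?C" using \<theta>(3) by simp
  have \<mu>C: "\<exists>\<mu>\<in>carrier K. \<mu> ~= \<zero>\<^bsub>K\<^esub> \<and> ?\<sigma> (t j) = \<mu> \<odot>\<^bsub>?C\<^esub> t j" if "j \<in> {1..i}" for j using \<mu>[OF that] by simp
  have TC: "s \<in> S i" if "s \<in> ?T" for s
    using submonoid.mem_carrier[OF mult_set_generated_submonoid[OF O.A.monoid_axioms tC] that] by simp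
  have \<theta>c: "\<theta> s \<in> carrier L" if "s \<in> S i" for s using alg_homD(1)[OF \<theta>(1)] that by simp
  have domL: "nc_domain L"
  proof (rule domain_of_fractions[OF domS LA.A.ring_axioms \<theta>(1)])
    show "\<exists>s\<in>carrier ?C. \<theta> s \<in> Units L \<and> \<theta> s \<otimes>\<^bsub>L\<^esub> l \<in> \<theta> ` carrier ?C" if "l \<in> carrier L" for l
      using T(1) T(2)[OF that] TC by auto
    show "\<exists>s\<in>carrier ?C. \<theta> s \<in> Units L \<and> l \<otimes>\<^bsub>L\<^esub> \<theta> s \<in> \<theta> ` carrier ?C" if "l \<in> carrier L" for l
      using T(1) T(3)[OF that] TC by auto
  qed (use i \<theta> in auto)
  \<comment> \<open>The old denominators do not lie in the image of \<open>Theta\<close> in general;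
    multiplied by a power of the new variable they do.\<close>
  obtain N t' where t': "\<And>j. j \<in> {1..i} ==> t' j \<in> S (Suc i)" "\<And>j. j \<in> {1..i} ==> O.Theta (t' j) = \<theta> (t j) \<otimes>\<^bsub>M\<^esub> y1 [^]\<^bsub>M\<^esub> (N::nat)"
  proof -
    obtain N where "\<forall>j \<in> {1..i}. \<exists>s \<in> carrier ?S. O.Theta s = \<theta> (t j) \<otimes>\<^bsub>M\<^esub> y1 [^]\<^bsub>M\<^esub> (N::nat)"
      using O.generators_ex[OF _ tC \<mu>C] by auto
    then have "\<forall>j. \<exists>s. j \<in> {1..i} \<longrightarrow> s \<in> S (Suc i) \<and> O.Theta s = \<theta> (t j) \<otimes>\<^bsub>M\<^esub> y1 [^]\<^bsub>M\<^esub> (N::nat)" by auto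
    then show ?thesis using that by metis
  qed
  have t'S: "t' j \<in> carrier ?S" if "j \<in> {1..i}" for j using t'(1)[OF that] by simp
  \<comment> \<open>The preimages of the modified old generators, together with the new variable
    itself, are the i + 1 generators; inverting x is what inverts y.\<close>
  let ?t = "t'(Suc i := x (Suc i))" and ?y = "y(Suc i := y1)" and ?U = "U(Suc i := carrier M)"
    and ?V = "V(Suc i := LM.poly_part (V i))" and ?\<tau> = "\<tau>'(Suc i := \<tau>L)"
  have tim: "?t ` {1..Suc i} = insert (x (Suc i)) (t' ` {1..i})"
    unfolding atLeastAtMostSuc_conv[of 1 i, simplified] by (auto simp: image_iff)
  let ?T' = "mult_set_generated ?S (insert (x (Suc i)) (t' ` {1..i}))"
  have VL: "subalg K L (V i)" using s1 by auto
  note V = subM[OF VL] subalgD(3)[OF VL]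
  have Tunits: "\<theta> s \<in> Units M" if "s \<in> ?T" for s using unitsM[OF T(1)[OF that]] .
  have frL: "\<exists>s\<in>?T. \<theta> s \<otimes>\<^bsub>M\<^esub> b \<in> \<theta> ` carrier ?C" if "b \<in> carrier L" for b
    using T(2)[OF that] ops(1)[OF \<theta>c[OF TC] that] by auto
  have frR: "\<exists>s\<in>?T. b \<otimes>\<^bsub>M\<^esub> \<theta> s \<in> \<theta> ` carrier ?C" if "b \<in> carrier L" for b
    using T(3)[OF that] ops(1)[OF that \<theta>c[OF TC]] by auto
  have st1: "nc_algebra K M \<and> ?U (Suc i) = carrier M \<and> ?V 0 = ?U 0 \<and>
      (\<forall>j\<le>Suc i. subalg K M (?U j)) \<and> (\<forall>j\<le>Suc i. subalg K M (?V j)) \<and>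
      (\<forall>j\<in>{1..Suc i}. skew_laurent_ring K (M\<lparr>carrier := ?U j\<rparr>) (?U (j - 1)) (?y j) (?\<tau> j)) \<and>
      (\<forall>j\<in>{1..Suc i}. skew_polynomial_ring K (M\<lparr>carrier := ?V j\<rparr>) (?V (j - 1)) (?y j) (?\<tau> j) (\<lambda>_. \<zero>\<^bsub>M\<^esub>))"
  proof (intro conjI ballI allI impI)
    show "nc_algebra K M" by (rule LM.alg)
    show "?V 0 = ?U 0" using L(3) by simp
    show "subalg K M (?U j)" if "j \<le> Suc i" for j
      using that s1 subM subalg_carrier[OF LM.alg] by (cases "j = Suc i") auto
    show "subalg K M (?V j)" if "j \<le> Suc i" for j
      using that s1 subM LM.poly_part_subalg[OF V \<tau>L(5)] by (cases "j = Suc i") auto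
    fix j assume j: "j \<in> {1..Suc i}"
    show "skew_laurent_ring K (M\<lparr>carrier := ?U j\<rparr>) (?U (j - 1)) (?y j) (?\<tau> j)"
    proof (cases "j = Suc i")
      case True
      then show ?thesis using M(1) L(2) by simp
    next
      case False
      then have "j \<in> {1..i}" "j - 1 ~= Suc i" using j by auto
      then show ?thesis using skew_laurent_extend[OF L(1) LM.alg M(2)] s1 False by simp
    qed
    show "skew_polynomial_ring K (M\<lparr>carrier := ?V j\<rparr>) (?V (j - 1)) (?y j) (?\<tau> j) (\<lambda>_. \<zero>\<^bsub>M\<^esub>)"
    proof (cases "j = Suc i")
      case True
      then show ?thesis using LM.poly_part_skew_polynomial[OF V \<tau>L(5)] by simp
    next
      case False
      then have "j \<in> {1..i}" "j - 1 ~= Suc i" using j by auto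
      then show ?thesis using skew_polynomial_extend[OF L(1) LM.alg M(2)] s1 False by simp
    qed
  qed simp
  have y_in: "y j \<in> carrier L" if "j \<in> {1..i}" for j
  proof -
    have "subalg K L (U j)" using s1 that by auto
    moreover have "skew_laurent_ring K (L\<lparr>carrier := U j\<rparr>) (U (j - 1)) (y j) (\<tau>' j)"
      using s1 that by auto
    ultimately have "skew_laurent_ring K (L\<lparr>carrier := U j\<rparr>) (U (j - 1)) (y j) (\<tau>' j)" "U j \<subseteq> carrier L"
      using subalgD(3)[of K L "U j"] by auto
    then show ?thesis using skew_laur.y_carr[OF skew_laur.intro] by fastforce
  qed
  have \<iota>: "\<iota> \<in> alg_iso K (AS 0) (L\<lparr>carrier := U 0\<rparr>)" "subalg K L (U 0)" using s1 s2 by auto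
  have st2: "\<iota> \<in> alg_iso K (AS 0) (M\<lparr>carrier := ?U 0\<rparr>) \<and>
      (\<forall>j\<in>{1..Suc i}. \<forall>r\<in>S 0. ?\<tau> j (\<iota> r) = \<iota> (\<tau> j r)) \<and>
      (\<forall>j\<in>{1..Suc i}. \<forall>k\<in>{1..<j}. ?\<tau> j (?y k) = lam j k \<odot>\<^bsub>M\<^esub> ?y k)"
  proof (intro conjI ballI)
    show "\<iota> \<in> alg_iso K (AS 0) (M\<lparr>carrier := ?U 0\<rparr>)"
      using alg_iso_comp[OF \<iota>(1) alg_hom_id_iso[OF M(2) subalgD(3)[OF \<iota>(2)]]] by simp
    show "?\<tau> j (\<iota> r) = \<iota> (\<tau> j r)" if "j \<in> {1..Suc i}" "r \<in> S 0" for j r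
      using s2 \<tau>L(3) that by (cases "j = Suc i") auto
    fix j k assume j: "j \<in> {1..Suc i}" and k: "k \<in> {1..<j}"
    have ki: "k \<in> {1..i}" using j k by auto
    have lk: "lam j k \<in> carrier K" using lam[of j k] j k i by auto
    have "?\<tau> j (y k) = lam j k \<odot>\<^bsub>L\<^esub> y k" using s2 \<tau>L(4)[OF ki] j k by (cases "j = Suc i") auto
    then show "?\<tau> j (?y k) = lam j k \<odot>\<^bsub>M\<^esub> ?y k" using ops(2)[OF y_in[OF ki] y_in[OF ki] lk] ki by auto
  qed
  have W: "O.W = O.Theta ` S (Suc i)" unfolding O.W_def by simp
  have st3: "O.Theta \<in> alg_hom K ?S M \<and> inj_on O.Theta (S (Suc i)) \<and> ?t ` {1..Suc i} \<subseteq> S (Suc i) \<and>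
      (\<forall>s\<in>mult_set_generated ?S (?t ` {1..Suc i}). O.Theta s \<in> Units M) \<and>
      (\<forall>l\<in>carrier M. \<exists>s\<in>mult_set_generated ?S (?t ` {1..Suc i}). O.Theta s \<otimes>\<^bsub>M\<^esub> l \<in> O.Theta ` S (Suc i)) \<and>
      (\<forall>l\<in>carrier M. \<exists>s\<in>mult_set_generated ?S (?t ` {1..Suc i}). l \<otimes>\<^bsub>M\<^esub> O.Theta s \<in> O.Theta ` S (Suc i))"
    unfolding tim
  proof (intro conjI ballI)
    show "inj_on O.Theta (S (Suc i))" using O.Theta_inj by simp
    show "insert (x (Suc i)) (t' ` {1..i}) \<subseteq> S (Suc i)" using t'(1) x_mem[of "Suc i" "Suc i"] i by auto
    show "O.Theta s \<in> Units M" if "s \<in> ?T'" for s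
      using O.T'_units[OF _ tC \<mu>C t'S t'(2) Tunits that] by simp
    show "\<exists>s\<in>?T'. O.Theta s \<otimes>\<^bsub>M\<^esub> l \<in> O.Theta ` S (Suc i)" if "l \<in> carrier M" for l
      using O.T'_left_fraction[OF _ tC \<mu>C t'S t'(2) frL that] unfolding W by simp
    show "\<exists>s\<in>?T'. l \<otimes>\<^bsub>M\<^esub> O.Theta s \<in> O.Theta ` S (Suc i)" if "l \<in> carrier M" for l
      using O.T'_right_fraction[OF _ tC \<mu>C t'S t'(2) frR that] unfolding W by simp
  qed (rule O.Theta(1))
  have st4: "\<forall>l\<in>carrier M. \<exists>p\<in>?V (Suc i). p ~= \<zero>\<^bsub>M\<^esub> \<and> p \<otimes>\<^bsub>M\<^esub> l \<in> ?V (Suc i)"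
  proof
    fix l assume l: "l \<in> carrier M"
    have "\<exists>p\<in>V i. p ~= \<zero>\<^bsub>M\<^esub> \<and> p \<otimes>\<^bsub>M\<^esub> b \<in> V i" if b: "b \<in> carrier L" for b
    proof -
      obtain p where p: "p \<in> V i" "p ~= \<zero>\<^bsub>L\<^esub>" "p \<otimes>\<^bsub>L\<^esub> b \<in> V i" using bspec[OF s4 b] by blast
      then show ?thesis using ops(1)[OF subsetD[OF V(2) p(1)] b] z(1) by (intro bexI[of _ p]) simp_all
    qed
    moreover have "a = \<zero>\<^bsub>M\<^esub> \<or> b = \<zero>\<^bsub>M\<^esub>" if "a \<in> carrier L" "b \<in> carrier L" "a \<otimes>\<^bsub>M\<^esub> b = \<zero>\<^bsub>M\<^esub>" for a b
      using nc_domainD(3)[OF domL that(1,2)] ops(1)[OF that(1,2)] that(3) z(1) by simp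
    moreover have "\<one>\<^bsub>M\<^esub> ~= \<zero>\<^bsub>M\<^esub>" using nc_domainD(2)[OF domL] z by simp
    ultimately show "\<exists>p\<in>?V (Suc i). p ~= \<zero>\<^bsub>M\<^esub> \<and> p \<otimes>\<^bsub>M\<^esub> l \<in> ?V (Suc i)"
      using LM.poly_part_left_fraction[OF V \<tau>L(5) _ _ _ l] by simp
  qed
  have st6: "\<forall>\<sigma> l. adm (Suc i) \<sigma> l \<longrightarrow>
      (\<forall>j\<in>{1..Suc i}. \<exists>\<mu>\<in>carrier K. \<mu> ~= \<zero>\<^bsub>K\<^esub> \<and> \<sigma> (?t j) = \<mu> \<odot>\<^bsub>A\<^esub> ?t j) \<and>
      (\<exists>\<Sigma>\<in>alg_iso K M M. (\<forall>s\<in>S (Suc i). \<Sigma> (O.Theta s) = O.Theta (\<sigma> s)) \<and> (\<forall>r\<in>S 0. \<Sigma> (\<iota> r) = \<iota> (\<sigma> r)) \<and>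
        (\<forall>j\<in>{1..Suc i}. \<Sigma> (?y j) = l j \<odot>\<^bsub>M\<^esub> ?y j) \<and> \<Sigma> ` ?V (Suc i) = ?V (Suc i))"
  proof (intro allI impI)
    fix \<sigma> l assume ad: "adm (Suc i) \<sigma> l"
    let ?c = "l (Suc i)"
    have \<sigma>: "\<sigma> \<in> alg_iso K ?S ?S" "\<sigma> ` carrier ?C = carrier ?C" and c: "?c \<in> carrier K" "?c ~= \<zero>\<^bsub>K\<^esub>"
      and \<sigma>x: "\<sigma> (x (Suc i)) = ?c \<odot>\<^bsub>?S\<^esub> x (Suc i)" "\<sigma> (x (Suc i)) = ?c \<odot>\<^bsub>A\<^esub> x (Suc i)"
      using ad unfolding adm_def by auto
    have adm_i: "adm i \<sigma> l" by (rule adm_restrict[OF ad]) (use i in simp)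
    obtain \<Sigma>0 where \<Sigma>0: "\<Sigma>0 \<in> alg_iso K L L" "\<And>s. s \<in> S i ==> \<Sigma>0 (\<theta> s) = \<theta> (\<sigma> s)"
      "\<And>r. r \<in> S 0 ==> \<Sigma>0 (\<iota> r) = \<iota> (\<sigma> r)" "\<And>j. j \<in> {1..i} ==> \<Sigma>0 (y j) = l j \<odot>\<^bsub>L\<^esub> y j" "\<Sigma>0 ` V i = V i"
      using conjunct2[OF mp[OF spec[OF spec[OF s6]] adm_i]] by (elim bexE) auto
    have \<mu>': "\<exists>\<mu>\<in>carrier K. \<mu> ~= \<zero>\<^bsub>K\<^esub> \<and> \<sigma> (t j) = \<mu> \<odot>\<^bsub>A\<^esub> t j" if "j \<in> {1..i}" for j
      using bspec[OF conjunct1[OF mp[OF spec[OF spec[OF s6]] adm_i]] that] .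
    let ?MB = "M\<lparr>carrier := carrier L\<rparr>"
    \<comment> \<open>L and the subring of M on the carrier of L may differ as records outside the
      carrier, so facts about L are moved along the identity map.\<close>
    have idi: "(\<lambda>x. x) \<in> alg_iso K L ?MB" using alg_hom_id_iso[OF M(2) subset_refl] by simp
    have "(\<lambda>x. x) \<in> alg_hom K ?MB L" by (rule alg_homI) (use ops alg_homD(3)[OF M(2)] z in auto)
    then have idi': "(\<lambda>x. x) \<in> alg_iso K ?MB L" by (rule alg_isoI) auto
    have \<Sigma>0': "\<Sigma>0 \<in> alg_iso K ?MB ?MB"
      using alg_iso_comp[OF alg_iso_comp[OF idi' \<Sigma>0(1)] idi] by simp
    have MBring: "ring ?MB" by (rule LM.ringS)
    have fr: "\<exists>s \<in> carrier ?C. \<theta> s \<in> Units ?MB \<and> \<theta> s \<otimes>\<^bsub>M\<^esub> b \<in> \<theta> ` carrier ?C" if b: "b \<in> carrier L" for b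
    proof -
      obtain s where s: "s \<in> ?T" "\<theta> s \<otimes>\<^bsub>M\<^esub> b \<in> \<theta> ` carrier ?C" using frL[OF b] by blast
      have "\<theta> s \<in> Units ?MB"
        using alg_hom_Units(1)[OF LA.A.ring_axioms MBring alg_isoD(1)[OF idi] T(1)[OF s(1)]] .
      then show ?thesis using s TC by auto
    qed
    obtain \<Sigma> where \<Sigma>: "\<Sigma> \<in> alg_iso K M M" "\<And>b. b \<in> carrier L ==> \<Sigma> b = \<Sigma>0 b" "\<Sigma> y1 = ?c \<odot>\<^bsub>M\<^esub> y1"
      "\<Sigma> ` LM.poly_part (V i) = LM.poly_part (V i)" "\<And>a. a \<in> carrier ?S ==> \<Sigma> (O.Theta a) = O.Theta (\<sigma> a)"
      using O.step_automorphism[OF \<sigma> c \<sigma>x(1) \<Sigma>0' _ fr V \<tau>L(5) \<Sigma>0(5)] \<Sigma>0(2) by auto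
    have \<iota>L: "\<iota> r \<in> carrier L" if "r \<in> S 0" for r
      using alg_homD(1)[OF alg_isoD(1)[OF \<iota>(1)], of r] subalgD(3)[OF \<iota>(2)] that by auto
    have lc: "l j \<in> carrier K" if "j \<in> {1..i}" for j using ad that unfolding adm_def by auto
    show "(\<forall>j\<in>{1..Suc i}. \<exists>\<mu>\<in>carrier K. \<mu> ~= \<zero>\<^bsub>K\<^esub> \<and> \<sigma> (?t j) = \<mu> \<odot>\<^bsub>A\<^esub> ?t j) \<and>
      (\<exists>\<Sigma>\<in>alg_iso K M M. (\<forall>s\<in>S (Suc i). \<Sigma> (O.Theta s) = O.Theta (\<sigma> s)) \<and> (\<forall>r\<in>S 0. \<Sigma> (\<iota> r) = \<iota> (\<sigma> r)) \<and>
        (\<forall>j\<in>{1..Suc i}. \<Sigma> (?y j) = l j \<odot>\<^bsub>M\<^esub> ?y j) \<and> \<Sigma> ` ?V (Suc i) = ?V (Suc i))"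
    proof (intro conjI ballI bexI[OF _ \<Sigma>(1)])
      fix j assume j: "j \<in> {1..Suc i}"
      show "\<exists>\<mu>\<in>carrier K. \<mu> ~= \<zero>\<^bsub>K\<^esub> \<and> \<sigma> (?t j) = \<mu> \<odot>\<^bsub>A\<^esub> ?t j"
      proof (cases "j = Suc i")
        case True
        then show ?thesis using c \<sigma>x(2) by auto
      next
        case False
        then have ji: "j \<in> {1..i}" using j by auto
        obtain \<mu> where \<mu>: "\<mu> \<in> carrier K" "\<mu> ~= \<zero>\<^bsub>K\<^esub>" "\<sigma> (t j) = \<mu> \<odot>\<^bsub>A\<^esub> t j" using \<mu>'[OF ji] by blast
        have tj: "t j \<in> S i" using \<theta>(3) ji by auto
        have cN: "?c [^]\<^bsub>K\<^esub> N \<in> carrier K" "?c [^]\<^bsub>K\<^esub> N ~= \<zero>\<^bsub>K\<^esub>"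
          using c by (simp, induct N) (auto simp: LM.K.integral_iff)
        have \<theta>t: "\<theta> (\<sigma> (t j)) = \<mu> \<odot>\<^bsub>M\<^esub> \<theta> (t j)" using O.th_eq(3)[OF \<mu>(1), of "t j"] \<mu>(3) tj by simp
        have yN: "\<Sigma> (y1 [^]\<^bsub>M\<^esub> k) = (?c [^]\<^bsub>K\<^esub> k) \<odot>\<^bsub>M\<^esub> y1 [^]\<^bsub>M\<^esub> k" for k :: nat
        proof (induct k)
          case 0
          then show ?case using alg_homD(4)[OF alg_isoD(1)[OF \<Sigma>(1)]] by simp
        next
          case (Suc k)
          then show ?case using alg_homD(2)[OF alg_isoD(1)[OF \<Sigma>(1)], of "y1 [^]\<^bsub>M\<^esub> k" y1] \<Sigma>(3) c(1)
            by (simp add: LM.smult_mult_left LM.smult_mult_right LM.smult_assoc1[symmetric] LM.K.m_comm)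
        qed
        \<comment> \<open>The new generator is again an eigenvector: its eigenvalue is that of
          \<open>t j\<close> times c^N from the factor y^N. The equation is checked in M and pulled
          back by injectivity.\<close>
        have "O.Theta (\<sigma> (t' j)) = \<Sigma> (\<theta> (t j) \<otimes>\<^bsub>M\<^esub> y1 [^]\<^bsub>M\<^esub> N)" using \<Sigma>(5)[OF t'S[OF ji]] t'(2)[OF ji] by simp
        also have "\<dots> = (\<mu> \<odot>\<^bsub>M\<^esub> \<theta> (t j)) \<otimes>\<^bsub>M\<^esub> ((?c [^]\<^bsub>K\<^esub> N) \<odot>\<^bsub>M\<^esub> y1 [^]\<^bsub>M\<^esub> N)"
          using alg_homD(2)[OF alg_isoD(1)[OF \<Sigma>(1)], of "\<theta> (t j)" "y1 [^]\<^bsub>M\<^esub> N"] tj \<Sigma>(2)[OF \<theta>c[OF tj]] \<Sigma>0(2)[OF tj] \<theta>t yN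
            LM.S_carr[OF \<theta>c[OF tj]] by simp
        also have "\<dots> = (?c [^]\<^bsub>K\<^esub> N \<otimes>\<^bsub>K\<^esub> \<mu>) \<odot>\<^bsub>M\<^esub> O.Theta (t' j)"
          using t'(2)[OF ji] cN(1) \<mu>(1) LM.S_carr[OF \<theta>c[OF tj]]
          by (simp add: LM.smult_mult_left LM.smult_mult_right LM.smult_assoc1)
        also have "\<dots> = O.Theta ((?c [^]\<^bsub>K\<^esub> N \<otimes>\<^bsub>K\<^esub> \<mu>) \<odot>\<^bsub>?S\<^esub> t' j)"
          using alg_homD(5)[OF O.Theta(1) _ t'S[OF ji]] cN(1) \<mu>(1) by simp
        finally have "\<sigma> (t' j) = (?c [^]\<^bsub>K\<^esub> N \<otimes>\<^bsub>K\<^esub> \<mu>) \<odot>\<^bsub>?S\<^esub> t' j"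
          using inj_onD[OF O.Theta_inj] t'S[OF ji] alg_homD(1)[OF alg_isoD(1)[OF \<sigma>(1)] t'S[OF ji]]
            O.P.smult_closed[OF _ t'S[OF ji]] cN(1) \<mu>(1) by (meson LM.K.m_closed)
        then show ?thesis using False cN \<mu>(1,2) LM.K.integral_iff
          by (intro bexI[of _ "?c [^]\<^bsub>K\<^esub> N \<otimes>\<^bsub>K\<^esub> \<mu>"]) auto
      qed
      show "\<Sigma> (?y j) = l j \<odot>\<^bsub>M\<^esub> ?y j"
      proof (cases "j = Suc i")
        case True
        then show ?thesis using \<Sigma>(3) by simp
      next
        case False
        then have ji: "j \<in> {1..i}" using j by auto
        then show ?thesis using \<Sigma>(2)[OF y_in[OF ji]] \<Sigma>0(4)[OF ji] ops(2)[OF y_in[OF ji] y_in[OF ji] lc[OF ji]] False by simp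
      qed
    next
      show "\<Sigma> (O.Theta s) = O.Theta (\<sigma> s)" if "s \<in> S (Suc i)" for s using \<Sigma>(5) that by simp
      show "\<Sigma> (\<iota> r) = \<iota> (\<sigma> r)" if "r \<in> S 0" for r using \<Sigma>(2)[OF \<iota>L[OF that]] \<Sigma>0(3)[OF that] by simp
      show "\<Sigma> ` ?V (Suc i) = ?V (Suc i)" using \<Sigma>(4) by simp
    qed
  qed
  have "stage (Suc i) M ?U ?V ?y ?\<tau> O.Theta \<iota> ?t"
    unfolding stage_def by (intro conjI[OF st1] conjI[OF st2] conjI[OF st3] conjI[OF st4] conjI[OF _ st6])
      (use M(3,4) in auto)
  then show ?thesis by blast
qed

theorem stage_exists: "i \<le> n ==> \<exists>L U V y \<tau>' \<theta> \<iota> t. stage i L U V y \<tau>' \<theta> \<iota> t"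
proof (induct i)
  case 0
  show ?case by (rule stage_0)
next
  case (Suc i)
  then obtain L U V y \<tau>' \<theta> \<iota> t where "stage i L U V y \<tau>' \<theta> \<iota> t" by auto
  then show ?case using stage_Suc Suc(2) by simp
qed

end

section \<open>Noetherian domains are Ore domains\<close>

text \<open>Turns statements about right ideals and right multiples into their left
  versions.\<close>

definition opposite :: "('a, 'm) ring_scheme => ('a, 'm) ring_scheme" where
  "opposite R = R\<lparr>monoid.mult := \<lambda>a b. b \<otimes>\<^bsub>R\<^esub> a\<rparr>"

lemma opposite_simps [simp]: "carrier (opposite R) = carrier R" "a \<otimes>\<^bsub>opposite R\<^esub> b = b \<otimes>\<^bsub>R\<^esub> a"
  "\<one>\<^bsub>opposite R\<^esub> = \<one>\<^bsub>R\<^esub>" "\<zero>\<^bsub>opposite R\<^esub> = \<zero>\<^bsub>R\<^esub>" "a \<oplus>\<^bsub>opposite R\<^esub> b = a \<oplus>\<^bsub>R\<^esub> b"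
  by (simp_all add: opposite_def)

lemma opposite_ring:
  assumes "ring R" shows "ring (opposite R)"
proof -
  interpret ring R by fact
  show ?thesis
  proof (rule ringI)
    show "abelian_group (opposite R)"
      by (rule abelian_groupI) (auto simp: a_ac intro!: bexI[of _ "\<ominus>\<^bsub>R\<^esub> x" for x] l_neg)
    show "monoid (opposite R)" by (rule monoidI) (auto simp: m_assoc)
  qed (auto simp: l_distr r_distr)
qed

lemma opposite_domain: "nc_domain R ==> nc_domain (opposite R)"
  unfolding nc_domain_def using opposite_ring by auto

lemma opposite_additive_subgroup: "additive_subgroup I (opposite R) \<longleftrightarrow> additive_subgroup I R"
  unfolding additive_subgroup_def subgroup_def by (simp add: m_inv_def)

lemma opposite_noetherian: "nc_noetherian R ==> nc_noetherian (opposite R)"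
  unfolding nc_noetherian_def left_ideal_def right_ideal_def
  using opposite_ring[of R] by (simp add: opposite_additive_subgroup)

lemma opposite_right_ore: "right_ore (opposite R) \<longleftrightarrow> left_ore R"
  unfolding right_ore_def left_ore_def by simp

text \<open>If \<^term>\<open>a\<close> and \<^term>\<open>b\<close> have no common right multiple, then the sums
  \<open>bR + abR + \<dots> + a\<^sup>nbR\<close> form a strictly increasing chain.\<close>

theorem noetherian_right_ore:
  fixes R (structure)
  assumes dom: "nc_domain R" and noeth: "nc_noetherian R"
  shows "right_ore R"
proof (rule ccontr)
  interpret ring R using dom by (rule nc_domainD)
  assume "\<not> right_ore R"
  then obtain a b where a: "a \<in> carrier R" "a ~= \<zero>" and b: "b \<in> carrier R" "b ~= \<zero>"
    and no: "\<And>u v. u \<in> carrier R ==> v \<in> carrier R ==> a \<otimes> u = b \<otimes> v ==> a \<otimes> u = \<zero>"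
    unfolding right_ore_def by force
  \<comment> \<open>The recursion I(n+1) = bR + a I(n) builds the partial sums of the chain without
    naming their summands.\<close>
  define I where "I = rec_nat {\<zero>} (\<lambda>_ J. {b \<otimes> r \<oplus> a \<otimes> v |r v. r \<in> carrier R \<and> v \<in> J})"
  have I0: "I 0 = {\<zero>}" and IS: "I (Suc n) = {b \<otimes> r \<oplus> a \<otimes> v |r v. r \<in> carrier R \<and> v \<in> I n}" for n
    by (simp_all add: I_def)
  have Ic: "v \<in> carrier R" if "v \<in> I n" for v n
    using that a b by (induct n arbitrary: v) (auto simp: I0 IS)
  have Iadd: "u \<oplus> v \<in> I n" if "u \<in> I n" "v \<in> I n" for u v n
    using that
  proof (induct n arbitrary: u v)
    case 0
    then show ?case by (simp add: I0)
  next
    case (Suc n)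
    obtain r s u' v' where u: "r \<in> carrier R" "u' \<in> I n" "u = b \<otimes> r \<oplus> a \<otimes> u'"
      and v: "s \<in> carrier R" "v' \<in> I n" "v = b \<otimes> s \<oplus> a \<otimes> v'" using Suc(2,3) unfolding IS by blast
    have "u \<oplus> v = b \<otimes> (r \<oplus> s) \<oplus> a \<otimes> (u' \<oplus> v')"
      using u v a b Ic by (simp add: r_distr a_ac)
    then show ?case unfolding IS using Suc(1)[OF u(2) v(2)] u(1) v(1) by blast
  qed
  have Imul: "v \<otimes> s \<in> I n" if "v \<in> I n" "s \<in> carrier R" for v s n
    using that
  proof (induct n arbitrary: v)
    case 0
    then show ?case by (simp add: I0)
  next
    case (Suc n)
    obtain r v' where v: "r \<in> carrier R" "v' \<in> I n" "v = b \<otimes> r \<oplus> a \<otimes> v'" using Suc(2) unfolding IS by blast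
    have "v \<otimes> s = b \<otimes> (r \<otimes> s) \<oplus> a \<otimes> (v' \<otimes> s)"
      using v a b Ic Suc(3) by (simp add: l_distr m_assoc)
    then show ?case unfolding IS using Suc(1)[OF v(2) Suc(3)] v(1) Suc(3) by blast
  qed
  have Izero: "\<zero> \<in> I n" for n
  proof (induct n)
    case (Suc n)
    have "\<zero> = b \<otimes> \<zero> \<oplus> a \<otimes> \<zero>" using a b by simp
    then show ?case unfolding IS using Suc by blast
  qed (simp add: I0)
  have Ineg: "\<ominus> v \<in> I n" if "v \<in> I n" for v n
  proof -
    have "\<ominus> v = v \<otimes> (\<ominus> \<one>)" using Ic[OF that] by (simp add: r_minus)
    then show ?thesis using Imul[OF that, of "\<ominus> \<one>"] by simp
  qed
  have Imono: "I n \<subseteq> I (Suc n)" for n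
  proof (induct n)
    case 0
    then show ?case using Izero[of 1] by (simp add: I0)
  next
    case (Suc n)
    then show ?case unfolding IS[of "Suc n"] IS[of n] by blast
  qed
  have Ile: "I n \<subseteq> I m" if "n \<le> m" for n m
    by (rule lift_Suc_mono_le[of I, OF Imono that])
  have ideal: "right_ideal J R"
    if J: "J \<subseteq> carrier R" "\<zero> \<in> J" "\<And>u v. u \<in> J ==> v \<in> J ==> u \<oplus> v \<in> J" "\<And>v. v \<in> J ==> \<ominus> v \<in> J"
      "\<And>v s. v \<in> J ==> s \<in> carrier R ==> v \<otimes> s \<in> J" for J
    unfolding right_ideal_def using J by (auto intro!: additive_subgroup.intro add.subgroupI)
  have I: "right_ideal (\<Union>n. I n) R"
  proof (rule ideal)
    fix u v assume "u \<in> (\<Union>n. I n)" "v \<in> (\<Union>n. I n)"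
    then obtain n m where "u \<in> I n" "v \<in> I m" by auto
    then have "u \<in> I (max n m)" "v \<in> I (max n m)" using Ile[of n "max n m"] Ile[of m "max n m"] by auto
    then show "u \<oplus> v \<in> (\<Union>n. I n)" using Iadd by blast
  next
    show "\<Union> (range I) \<subseteq> carrier R" using Ic by blast
    show "\<zero> \<in> \<Union> (range I)" using Izero by blast
    show "\<ominus> v \<in> \<Union> (range I)" if "v \<in> \<Union> (range I)" for v using that Ineg by blast
    show "v \<otimes> s \<in> \<Union> (range I)" if "v \<in> \<Union> (range I)" "s \<in> carrier R" for v s using that Imul by blast
  qed
  \<comment> \<open>A finite generating set of the union already lies in one member I(N), where the
    chain must stop.\<close>
  then obtain F where F: "F \<subseteq> carrier R" "finite F" "(\<Union>n. I n) = \<Inter>{J. right_ideal J R \<and> F \<subseteq> J}"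
    using mp[OF spec[OF conjunct2[OF conjunct2[OF noeth[unfolded nc_noetherian_def]]]] I] by (elim exE conjE)
  have "F \<subseteq> (\<Union>n. I n)" unfolding F(3) by blast
  then have "\<forall>f \<in> F. \<exists>m. f \<in> I m" by auto
  then obtain m where m: "\<forall>f \<in> F. f \<in> I (m f)" by (auto dest: bchoice)
  have "F \<subseteq> I (Max (m ` F))"
  proof
    fix f assume f: "f \<in> F"
    then have "m f \<le> Max (m ` F)" using F(2) by simp
    then show "f \<in> I (Max (m ` F))" using Ile m f by blast
  qed
  then obtain N where "F \<subseteq> I N" by blast
  moreover have "right_ideal (I N) R" by (rule ideal) (use Ic Izero Ineg Imul Iadd in auto)
  ultimately have stable: "(\<Union>n. I n) \<subseteq> I N" unfolding F(3) by blast
  have pin: "a [^] n \<otimes> b \<in> I (Suc n)" for n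
  proof (induct n)
    case 0
    have "\<one> \<otimes> b = b \<otimes> \<one> \<oplus> a \<otimes> \<zero>" using a b by simp
    then show ?case unfolding IS using Izero[of 0] by auto
  next
    case (Suc n)
    have "a [^] Suc n \<otimes> b = b \<otimes> \<zero> \<oplus> a \<otimes> (a [^] n \<otimes> b)"
      unfolding nat_pow_Suc2[OF a(1)] using a b by (simp add: m_assoc)
    then show ?case unfolding IS[of "Suc n"] using Suc by blast
  qed
  have pout: "a [^] n \<otimes> b \<notin> I n" for n
  proof (induct n)
    case 0
    then show ?case using b by (simp add: I0)
  next
    case (Suc n)
    show ?case
    proof
      assume "a [^] Suc n \<otimes> b \<in> I (Suc n)"
      then obtain r v where r: "r \<in> carrier R" "v \<in> I n" "a [^] Suc n \<otimes> b = b \<otimes> r \<oplus> a \<otimes> v"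
        unfolding IS by blast
      let ?e = "a [^] n \<otimes> b \<ominus> v"
      have c: "v \<in> carrier R" "a [^] n \<otimes> b \<in> carrier R" using Ic r a b by auto
      have "a \<otimes> (a [^] n \<otimes> b) = b \<otimes> r \<oplus> a \<otimes> v"
        using r(3) unfolding nat_pow_Suc2[OF a(1)] using a b by (simp add: m_assoc)
      \<comment> \<open>The chain grows strictly: otherwise a times (a^n b - v) is a common right
        multiple of a and b, hence zero, and cancelling a puts a^n b into I(n).\<close>
      then have "a \<otimes> ?e = b \<otimes> r"
        using a b c r(1) by (simp add: a_minus_def r_distr r_minus a_assoc r_neg)
      then have "a \<otimes> ?e = \<zero>" using no[of ?e r] r c by simp
      then have "?e = \<zero>" using nc_domainD(3)[OF dom, of a ?e] a c by simp
      then have "a [^] n \<otimes> b = v" using c by simp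
      then show False using Suc r by simp
    qed
  qed
  have "a [^] N \<otimes> b \<in> (\<Union>n. I n)" using pin[of N] by blast
  then show False using stable pout[of N] by blast
qed

corollary noetherian_left_ore: "nc_domain R ==> nc_noetherian R ==> left_ore R"
  using noetherian_right_ore[OF opposite_domain opposite_noetherian] opposite_right_ore by blast

section \<open>The division ring of fractions of a right Ore domain\<close>

locale ore_domain =
  fixes K :: "('k, 'm) ring_scheme" and L :: "('k, 'l, 'n) module_scheme" (structure)
  assumes alg: "nc_algebra K L" and dom: "nc_domain L" and ore: "right_ore L"

sublocale ore_domain \<subseteq> nc_algebra K L
  by (rule alg)

section \<open>Fractions as maximal partial right linear maps\<close>

context ore_domain
begin

lemma integral: "a \<in> carrier L ==> b \<in> carrier L ==> a \<otimes> b = \<zero> ==> a = \<zero> \<or> b = \<zero>"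
  by (rule nc_domainD(3)[OF dom])

lemma nonzero_mult: "a \<in> carrier L ==> b \<in> carrier L ==> a ~= \<zero> ==> b ~= \<zero> ==> a \<otimes> b ~= \<zero>"
  using integral by blast

lemma r_cancel:
  assumes "a \<in> carrier L" "b \<in> carrier L" "c \<in> carrier L" "c ~= \<zero>" "a \<otimes> c = b \<otimes> c" shows "a = b"
proof -
  have "(a \<ominus> b) \<otimes> c = \<zero>" using assms by (simp add: a_minus_def A.l_distr A.l_minus A.r_neg)
  then have "a \<ominus> b = \<zero>" using integral[of "a \<ominus> b" c] assms by simp
  then show ?thesis using assms by simp
qed

lemma common_multiple:
  assumes "a \<in> carrier L" "a ~= \<zero>" "b \<in> carrier L" "b ~= \<zero>"
  obtains u v where "u \<in> carrier L" "v \<in> carrier L" "u ~= \<zero>" "v ~= \<zero>" "a \<otimes> u = b \<otimes> v" "a \<otimes> u ~= \<zero>"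
proof -
  obtain u v where uv: "u \<in> carrier L" "v \<in> carrier L" "a \<otimes> u = b \<otimes> v" "a \<otimes> u ~= \<zero>"
    using right_oreD[OF ore assms] by blast
  then have "u ~= \<zero>" "v ~= \<zero>" using assms by auto
  then show ?thesis using uv that by blast
qed

text \<open>A fraction is represented by the set of all pairs \<open>(x, z)\<close> such that it maps \<open>z\<close> to \<open>x\<close> by left
  multiplication.\<close>

definition is_line :: "('l \<times> 'l) set => bool" where
  "is_line X \<longleftrightarrow> X \<subseteq> carrier L \<times> carrier L \<and>
     (\<forall>x y z. (x, z) \<in> X \<longrightarrow> (y, z) \<in> X \<longrightarrow> x = y) \<and>
     (\<forall>x z r. (x, z) \<in> X \<longrightarrow> r \<in> carrier L \<longrightarrow> (x \<otimes> r, z \<otimes> r) \<in> X) \<and>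
     (\<forall>x z x' z'. (x, z) \<in> X \<longrightarrow> (x', z') \<in> X \<longrightarrow> (x \<oplus> x', z \<oplus> z') \<in> X) \<and>
     (\<forall>x z r. x \<in> carrier L \<longrightarrow> z \<in> carrier L \<longrightarrow> r \<in> carrier L \<longrightarrow> r ~= \<zero> \<longrightarrow> (x \<otimes> r, z \<otimes> r) \<in> X \<longrightarrow> (x, z) \<in> X) \<and>
     (\<exists>x z. (x, z) \<in> X \<and> z ~= \<zero>)"

lemma is_lineI:
  assumes "X \<subseteq> carrier L \<times> carrier L"
    and "\<And>x y z. (x, z) \<in> X ==> (y, z) \<in> X ==> x = y"
    and "\<And>x z r. (x, z) \<in> X ==> r \<in> carrier L ==> (x \<otimes> r, z \<otimes> r) \<in> X"
    and "\<And>x z x' z'. (x, z) \<in> X ==> (x', z') \<in> X ==> (x \<oplus> x', z \<oplus> z') \<in> X"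
    and "\<And>x z r. x \<in> carrier L ==> z \<in> carrier L ==> r \<in> carrier L ==> r ~= \<zero> ==> (x \<otimes> r, z \<otimes> r) \<in> X ==> (x, z) \<in> X"
    and "\<exists>x z. (x, z) \<in> X \<and> z ~= \<zero>"
  shows "is_line X"
  unfolding is_line_def
  by (intro conjI allI impI; (rule assms(1) assms(6) | erule (1) assms(2) | erule (1) assms(3) | erule (1) assms(4)
    | erule (4) assms(5)))

lemma lineD:
  assumes "is_line X"
  shows "(x, z) \<in> X ==> x \<in> carrier L" "(x, z) \<in> X ==> z \<in> carrier L"
    "(x, z) \<in> X ==> (y, z) \<in> X ==> x = y"
    "(x, z) \<in> X ==> r \<in> carrier L ==> (x \<otimes> r, z \<otimes> r) \<in> X"
    "(x, z) \<in> X ==> (x', z') \<in> X ==> (x \<oplus> x', z \<oplus> z') \<in> X"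
    "x \<in> carrier L ==> z \<in> carrier L ==> r \<in> carrier L ==> r ~= \<zero> ==> (x \<otimes> r, z \<otimes> r) \<in> X ==> (x, z) \<in> X"
proof -
  note h = assms[unfolded is_line_def]
  note h2 = conjunct2[OF h] note h3 = conjunct2[OF h2] note h4 = conjunct2[OF h3] note h5 = conjunct2[OF h4]
  show "(x, z) \<in> X ==> x \<in> carrier L" "(x, z) \<in> X ==> z \<in> carrier L" using conjunct1[OF h] by auto
  show "(x, z) \<in> X ==> (y, z) \<in> X ==> x = y" using conjunct1[OF h2] by blast
  show "(x, z) \<in> X ==> r \<in> carrier L ==> (x \<otimes> r, z \<otimes> r) \<in> X" using conjunct1[OF h3] by blast
  show "(x, z) \<in> X ==> (x', z') \<in> X ==> (x \<oplus> x', z \<oplus> z') \<in> X" using conjunct1[OF h4] by blast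
  show "x \<in> carrier L ==> z \<in> carrier L ==> r \<in> carrier L ==> r ~= \<zero> ==> (x \<otimes> r, z \<otimes> r) \<in> X ==> (x, z) \<in> X"
    using conjunct1[OF h5] by blast
qed

lemma line_denominator: "is_line X ==> \<exists>x z. (x, z) \<in> X \<and> z ~= \<zero>"
  unfolding is_line_def by blast

lemma line_zero: "is_line X ==> (\<zero>, \<zero>) \<in> X"
proof -
  assume X: "is_line X"
  obtain x z where "(x, z) \<in> X" using line_denominator[OF X] by blast
  then show ?thesis using lineD(4)[OF X, of x z \<zero>] lineD(1,2)[OF X, of x z] by simp
qed

text \<open>The denominators of X form a nonzero right ideal; by the Ore condition it meets mL for
  every nonzero m. This makes sums and composites of fractions nontrivial.\<close>

lemma line_at:
  assumes X: "is_line X" and m: "m \<in> carrier L"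
  shows "\<exists>u x. u \<in> carrier L \<and> u ~= \<zero> \<and> (x, m \<otimes> u) \<in> X"
proof (cases "m = \<zero>")
  case True
  then show ?thesis using line_zero[OF X] nc_domainD(2)[OF dom] by (intro exI[of _ \<one>] exI[of _ \<zero>]) simp
next
  case False
  obtain x z where xz: "(x, z) \<in> X" "z ~= \<zero>" using line_denominator[OF X] by blast
  obtain u v where uv: "u \<in> carrier L" "v \<in> carrier L" "u ~= \<zero>" "m \<otimes> u = z \<otimes> v"
    using common_multiple[OF m False lineD(2)[OF X xz(1)] xz(2)] by metis
  have "(x \<otimes> v, m \<otimes> u) \<in> X" using lineD(4)[OF X xz(1) uv(2)] uv(4) by simp
  then show ?thesis using uv by blast
qed

text \<open>The instrument for all ring laws below: two fractions are equal as soon as one pair with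
  nonzero denominator is common to them. Any other pair acquires a denominator in common with it,
  and the two agree by single-valuedness.\<close>

lemma line_eqI:
  assumes X: "is_line X" and Y: "is_line Y" and xz: "(x, z) \<in> X" "(x, z) \<in> Y" "z ~= \<zero>"
  shows "X = Y"
proof -
  have sub: "X \<subseteq> Y" if X: "is_line X" and Y: "is_line Y" and xz: "(x, z) \<in> X" "(x, z) \<in> Y" "z ~= \<zero>" for X Y
  proof
    fix p assume "p \<in> X"
    then obtain x' z' where p: "p = (x', z')" "(x', z') \<in> X" by (metis surj_pair)
    note c = lineD(1,2)[OF X p(2)] lineD(1,2)[OF X xz(1)]
    have "\<exists>u \<in> carrier L. \<exists>v \<in> carrier L. u ~= \<zero> \<and> z' \<otimes> u = z \<otimes> v"
    proof (cases "z' = \<zero>")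
      case True
      then show ?thesis using c nc_domainD(2)[OF dom] by (intro bexI[of _ \<one>] bexI[of _ \<zero>]) auto
    next
      case False
      then show ?thesis using common_multiple[OF c(2) False c(4) xz(3)] by metis
    qed
    then obtain u v where uv: "u \<in> carrier L" "v \<in> carrier L" "u ~= \<zero>" "z' \<otimes> u = z \<otimes> v" by blast
    have "(x' \<otimes> u, z' \<otimes> u) \<in> X" "(x \<otimes> v, z' \<otimes> u) \<in> X" "(x \<otimes> v, z' \<otimes> u) \<in> Y"
      using lineD(4)[OF X p(2) uv(1)] lineD(4)[OF X xz(1) uv(2)] lineD(4)[OF Y xz(2) uv(2)] uv(4) by auto
    then have "(x' \<otimes> u, z' \<otimes> u) \<in> Y" using lineD(3)[OF X] by metis
    then show "p \<in> Y" using lineD(6)[OF Y c(1,2) uv(1,3)] p(1) by simp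
  qed
  show ?thesis using sub[OF X Y xz] sub[OF Y X xz(2,1,3)] by blast
qed

text \<open>Pointwise sums and composites need not contain every pair representing the same
  fraction. Cancelling common right factors makes them maximal, so that equality of fractions
  becomes equality of sets.\<close>

definition saturation :: "('l \<times> 'l) set => ('l \<times> 'l) set" where
  "saturation Z = {(x, z). x \<in> carrier L \<and> z \<in> carrier L \<and> (\<exists>r \<in> carrier L. r ~= \<zero> \<and> (x \<otimes> r, z \<otimes> r) \<in> Z)}"

definition ladd :: "('l \<times> 'l) set => ('l \<times> 'l) set => ('l \<times> 'l) set" where
  "ladd X Y = saturation {(x \<oplus> y, z) |x y z. (x, z) \<in> X \<and> (y, z) \<in> Y}"

definition lmult :: "('l \<times> 'l) set => ('l \<times> 'l) set => ('l \<times> 'l) set" where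
  "lmult X Y = saturation {(x, z) |x m z. (x, m) \<in> X \<and> (m, z) \<in> Y}"

definition lemb :: "'l => ('l \<times> 'l) set" where
  "lemb a = {(a \<otimes> z, z) |z. z \<in> carrier L}"

lemma one_nonzero: "\<one> ~= \<zero>"
  by (rule nc_domainD(2)[OF dom])

lemma saturation_mem: "(x, z) \<in> Z ==> x \<in> carrier L ==> z \<in> carrier L ==> (x, z) \<in> saturation Z"
  unfolding saturation_def using one_nonzero by (auto intro!: bexI[of _ \<one>])

lemma ladd_mem: "is_line X ==> is_line Y ==> (x1, z) \<in> X ==> (x2, z) \<in> Y ==> (x1 \<oplus> x2, z) \<in> ladd X Y"
  unfolding ladd_def using lineD(1,2)[of X x1 z] lineD(1)[of Y x2 z] by (intro saturation_mem) blast+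

lemma lmult_mem: "is_line X ==> is_line Y ==> (x, m) \<in> X ==> (m, z) \<in> Y ==> (x, z) \<in> lmult X Y"
  unfolding lmult_def using lineD(1)[of X x m] lineD(2)[of Y m z] by (intro saturation_mem) blast+

lemma lemb_line: "a \<in> carrier L ==> is_line (lemb a)"
proof (rule is_lineI)
  assume a: "a \<in> carrier L"
  show "(x, z) \<in> lemb a" if h: "x \<in> carrier L" "z \<in> carrier L" "r \<in> carrier L" "r ~= \<zero>" "(x \<otimes> r, z \<otimes> r) \<in> lemb a" for x z r
  proof -
    have "x \<otimes> r = (a \<otimes> z) \<otimes> r" using h a unfolding lemb_def by (auto simp: A.m_assoc)
    then have "x = a \<otimes> z" using r_cancel[of x "a \<otimes> z" r] h a by simp
    then show ?thesis using h unfolding lemb_def by blast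
  qed
  show "\<exists>x z. (x, z) \<in> lemb a \<and> z ~= \<zero>" unfolding lemb_def using one_nonzero by auto
  show "(x \<otimes> r, z \<otimes> r) \<in> lemb a" if "(x, z) \<in> lemb a" "r \<in> carrier L" for x z r
    using that a unfolding lemb_def by (auto simp: A.m_assoc)
  show "(x \<oplus> x', z \<oplus> z') \<in> lemb a" if "(x, z) \<in> lemb a" "(x', z') \<in> lemb a" for x z x' z'
    using that a unfolding lemb_def by (auto simp: A.r_distr)
qed (auto simp: lemb_def)

text \<open>The clauses of \<open>is_line\<close> are proved by returning to Z, where a nonzero
  right factor is available to be cancelled afterwards.\<close>

lemma saturation_line:
  assumes Z: "Z \<subseteq> carrier L \<times> carrier L" and sv: "\<And>x y z. (x, z) \<in> Z ==> (y, z) \<in> Z ==> x = y"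
    and mul: "\<And>x z r. (x, z) \<in> Z ==> r \<in> carrier L ==> (x \<otimes> r, z \<otimes> r) \<in> Z"
    and add: "\<And>x z x' z'. (x, z) \<in> Z ==> (x', z') \<in> Z ==> (x \<oplus> x', z \<oplus> z') \<in> Z"
    and den: "\<exists>x z. (x, z) \<in> Z \<and> z ~= \<zero>"
  shows "is_line (saturation Z)"
proof (rule is_lineI)
  have c: "x \<in> carrier L" "z \<in> carrier L" if "(x, z) \<in> saturation Z" for x z
    using that unfolding saturation_def by auto
  have ex: "\<exists>r \<in> carrier L. r ~= \<zero> \<and> (x \<otimes> r, z \<otimes> r) \<in> Z" if "(x, z) \<in> saturation Z" for x z
    using that unfolding saturation_def by auto
  have I: "(x, z) \<in> saturation Z" if "x \<in> carrier L" "z \<in> carrier L" "r \<in> carrier L" "r ~= \<zero>" "(x \<otimes> r, z \<otimes> r) \<in> Z" for x z r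
    using that unfolding saturation_def by auto
  \<comment> \<open>Each pair enters Z after multiplication by a factor of its own; a common right
    multiple of the two factors serves both pairs.\<close>
  have common: "\<exists>h \<in> carrier L. h ~= \<zero> \<and> (x \<otimes> h, z \<otimes> h) \<in> Z \<and> (x' \<otimes> h, z' \<otimes> h) \<in> Z"
    if xz: "(x, z) \<in> saturation Z" "(x', z') \<in> saturation Z" for x z x' z'
  proof -
    obtain r where r: "r \<in> carrier L" "r ~= \<zero>" "(x \<otimes> r, z \<otimes> r) \<in> Z" using ex[OF xz(1)] by blast
    obtain s where s: "s \<in> carrier L" "s ~= \<zero>" "(x' \<otimes> s, z' \<otimes> s) \<in> Z" using ex[OF xz(2)] by blast
    obtain f g where fg: "f \<in> carrier L" "g \<in> carrier L" "r \<otimes> f = s \<otimes> g" "r \<otimes> f ~= \<zero>"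
      using common_multiple[OF r(1,2) s(1,2)] by metis
    have "(x \<otimes> (r \<otimes> f), z \<otimes> (r \<otimes> f)) \<in> Z" using mul[OF r(3) fg(1)] c[OF xz(1)] r(1) fg(1) by (simp add: A.m_assoc)
    moreover have "(x' \<otimes> (r \<otimes> f), z' \<otimes> (r \<otimes> f)) \<in> Z"
      unfolding fg(3) using mul[OF s(3) fg(2)] c[OF xz(2)] s(1) fg(2) by (simp add: A.m_assoc)
    ultimately show ?thesis using fg(4) A.m_closed[OF r(1) fg(1)] by blast
  qed
  show "saturation Z \<subseteq> carrier L \<times> carrier L" using c by auto
  show "x = y" if h: "(x, z) \<in> saturation Z" "(y, z) \<in> saturation Z" for x y z
  proof -
    obtain h where "h \<in> carrier L" "h ~= \<zero>" "(x \<otimes> h, z \<otimes> h) \<in> Z" "(y \<otimes> h, z \<otimes> h) \<in> Z" using common[OF h] by blast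
    then show ?thesis using r_cancel[of x y h] sv c h by blast
  qed
  show "(x \<oplus> x', z \<oplus> z') \<in> saturation Z" if xz: "(x, z) \<in> saturation Z" "(x', z') \<in> saturation Z" for x z x' z'
  proof -
    obtain h where h: "h \<in> carrier L" "h ~= \<zero>" "(x \<otimes> h, z \<otimes> h) \<in> Z" "(x' \<otimes> h, z' \<otimes> h) \<in> Z" using common[OF xz] by blast
    note cc = c[OF xz(1)] c[OF xz(2)]
    have "((x \<oplus> x') \<otimes> h, (z \<oplus> z') \<otimes> h) \<in> Z" using add[OF h(3,4)] cc h(1) by (simp add: A.l_distr)
    then show ?thesis using I[OF _ _ h(1,2)] cc by simp
  qed
  show "(x \<otimes> s, z \<otimes> s) \<in> saturation Z" if xz: "(x, z) \<in> saturation Z" and s: "s \<in> carrier L" for x z s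
  proof -
    obtain r where r: "r \<in> carrier L" "r ~= \<zero>" "(x \<otimes> r, z \<otimes> r) \<in> Z" using ex[OF xz] by blast
    obtain t f where tf: "t \<in> carrier L" "f \<in> carrier L" "t ~= \<zero>" "s \<otimes> t = r \<otimes> f"
    proof (cases "s = \<zero>")
      case True
      then show ?thesis using that[of \<one> \<zero>] one_nonzero r by simp
    next
      case False
      then show ?thesis using common_multiple[OF s False r(1,2)] that by metis
    qed
    have "((x \<otimes> s) \<otimes> t, (z \<otimes> s) \<otimes> t) \<in> Z" using mul[OF r(3) tf(2)] c[OF xz] r(1) tf s by (simp add: A.m_assoc)
    then show ?thesis using I[OF _ _ tf(1,3)] c[OF xz] s by simp
  qed
  show "(x, z) \<in> saturation Z"
    if xz: "x \<in> carrier L" "z \<in> carrier L" "s \<in> carrier L" "s ~= \<zero>" "(x \<otimes> s, z \<otimes> s) \<in> saturation Z" for x z s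
  proof -
    obtain r where r: "r \<in> carrier L" "r ~= \<zero>" "(x \<otimes> s \<otimes> r, z \<otimes> s \<otimes> r) \<in> Z" using ex[OF xz(5)] by blast
    then show ?thesis using I[OF xz(1,2), of "s \<otimes> r"] nonzero_mult xz by (simp add: A.m_assoc)
  qed
  show "\<exists>x z. (x, z) \<in> saturation Z \<and> z ~= \<zero>" using den Z saturation_mem by blast
qed

lemma ladd_line:
  assumes X: "is_line X" and Y: "is_line Y" shows "is_line (ladd X Y)"
  unfolding ladd_def
proof (rule saturation_line)
  let ?Z = "{(x \<oplus> y, z) |x y z. (x, z) \<in> X \<and> (y, z) \<in> Y}"
  note XD = lineD[OF X] and YD = lineD[OF Y]
  have E: "\<exists>a b. x = a \<oplus> b \<and> (a, z) \<in> X \<and> (b, z) \<in> Y" if "(x, z) \<in> ?Z" for x z using that by blast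
  show "?Z \<subseteq> carrier L \<times> carrier L" using XD(1,2) YD(1) by auto
  show "x = y" if "(x, z) \<in> ?Z" "(y, z) \<in> ?Z" for x y z using E[OF that(1)] E[OF that(2)] XD(3) YD(3) by metis
  show "(x \<otimes> r, z \<otimes> r) \<in> ?Z" if xz: "(x, z) \<in> ?Z" and r: "r \<in> carrier L" for x z r
  proof -
    obtain a b where ab: "x = a \<oplus> b" "(a, z) \<in> X" "(b, z) \<in> Y" using E[OF xz] by blast
    then have "x \<otimes> r = a \<otimes> r \<oplus> b \<otimes> r" using XD(1) YD(1) r by (simp add: A.l_distr)
    then show ?thesis using XD(4)[OF ab(2) r] YD(4)[OF ab(3) r] by blast
  qed
  show "(x \<oplus> x', z \<oplus> z') \<in> ?Z" if xz: "(x, z) \<in> ?Z" "(x', z') \<in> ?Z" for x z x' z'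
  proof -
    obtain a b where ab: "x = a \<oplus> b" "(a, z) \<in> X" "(b, z) \<in> Y" using E[OF xz(1)] by blast
    obtain a' b' where ab': "x' = a' \<oplus> b'" "(a', z') \<in> X" "(b', z') \<in> Y" using E[OF xz(2)] by blast
    have "x \<oplus> x' = (a \<oplus> a') \<oplus> (b \<oplus> b')"
      using ab(1) ab'(1) XD(1)[OF ab(2)] XD(1)[OF ab'(2)] YD(1)[OF ab(3)] YD(1)[OF ab'(3)] by (simp add: A.a_ac)
    then show ?thesis using XD(5)[OF ab(2) ab'(2)] YD(5)[OF ab(3) ab'(3)] by blast
  qed
  obtain x z where xz: "(x, z) \<in> X" "z ~= \<zero>" using line_denominator[OF X] by blast
  obtain u y where u: "u \<in> carrier L" "u ~= \<zero>" "(y, z \<otimes> u) \<in> Y" using line_at[OF Y XD(2)[OF xz(1)]] by blast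
  show "\<exists>x z. (x, z) \<in> ?Z \<and> z ~= \<zero>"
    using XD(4)[OF xz(1) u(1)] u(3) nonzero_mult[OF XD(2)[OF xz(1)] u(1) xz(2) u(2)] by blast
qed

lemma lmult_line:
  assumes X: "is_line X" and Y: "is_line Y" shows "is_line (lmult X Y)"
  unfolding lmult_def
proof (rule saturation_line)
  let ?Z = "{(x, z) |x m z. (x, m) \<in> X \<and> (m, z) \<in> Y}"
  note XD = lineD[OF X] and YD = lineD[OF Y]
  have E: "\<exists>m. (x, m) \<in> X \<and> (m, z) \<in> Y" if "(x, z) \<in> ?Z" for x z using that by blast
  show "?Z \<subseteq> carrier L \<times> carrier L" using XD(1) YD(2) by auto
  show "x = y" if "(x, z) \<in> ?Z" "(y, z) \<in> ?Z" for x y z using E[OF that(1)] E[OF that(2)] XD(3) YD(3) by metis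
  show "(x \<otimes> r, z \<otimes> r) \<in> ?Z" if "(x, z) \<in> ?Z" "r \<in> carrier L" for x z r
    using E[OF that(1)] XD(4)[OF _ that(2)] YD(4)[OF _ that(2)] by blast
  show "(x \<oplus> x', z \<oplus> z') \<in> ?Z" if "(x, z) \<in> ?Z" "(x', z') \<in> ?Z" for x z x' z'
    using E[OF that(1)] E[OF that(2)] XD(5) YD(5) by blast
  obtain m z where mz: "(m, z) \<in> Y" "z ~= \<zero>" using line_denominator[OF Y] by blast
  obtain u x where u: "u \<in> carrier L" "u ~= \<zero>" "(x, m \<otimes> u) \<in> X" using line_at[OF X YD(1)[OF mz(1)]] by blast
  show "\<exists>x z. (x, z) \<in> ?Z \<and> z ~= \<zero>"
    using YD(4)[OF mz(1) u(1)] u(3) nonzero_mult[OF YD(2)[OF mz(1)] u(1) mz(2) u(2)] by blast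
qed

definition Q :: "('k, ('l \<times> 'l) set) module" where
  "Q = \<lparr>carrier = {X. is_line X}, monoid.mult = lmult, one = lemb \<one>, zero = lemb \<zero>, add = ladd,
    module.smult = (\<lambda>k X. lmult (lemb (k \<odot>\<^bsub>L\<^esub> \<one>)) X)\<rparr>"

lemma Q_simps [simp]: "X \<in> carrier Q \<longleftrightarrow> is_line X" "X \<otimes>\<^bsub>Q\<^esub> Y = lmult X Y" "X \<oplus>\<^bsub>Q\<^esub> Y = ladd X Y"
  "\<one>\<^bsub>Q\<^esub> = lemb \<one>" "\<zero>\<^bsub>Q\<^esub> = lemb \<zero>" "k \<odot>\<^bsub>Q\<^esub> X = lmult (lemb (k \<odot>\<^bsub>L\<^esub> \<one>)) X"
  by (simp_all add: Q_def)

lemma lemb_mem: "z \<in> carrier L ==> (a \<otimes> z, z) \<in> lemb a"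
  unfolding lemb_def by blast

lemma line_common:
  assumes X: "is_line X" and Y: "is_line Y"
  obtains x y z where "(x, z) \<in> X" "(y, z) \<in> Y" "z ~= \<zero>" "z \<in> carrier L"
proof -
  obtain x z where xz: "(x, z) \<in> X" "z ~= \<zero>" using line_denominator[OF X] by blast
  obtain u y where u: "u \<in> carrier L" "u ~= \<zero>" "(y, z \<otimes> u) \<in> Y" using line_at[OF Y lineD(2)[OF X xz(1)]] by blast
  show ?thesis
    using that[OF lineD(4)[OF X xz(1) u(1)] u(3)] nonzero_mult[OF lineD(2)[OF X xz(1)] u(1) xz(2) u(2)]
      lineD(2)[OF X xz(1)] u(1) by simp
qed

lemma ladd_comm: "is_line X ==> is_line Y ==> ladd X Y = ladd Y X"
proof -
  assume X: "is_line X" and Y: "is_line Y"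
  obtain x y z where xyz: "(x, z) \<in> X" "(y, z) \<in> Y" "z ~= \<zero>" using line_common[OF X Y] by metis
  have "x \<oplus> y = y \<oplus> x" using lineD(1)[OF X xyz(1)] lineD(1)[OF Y xyz(2)] by (rule A.a_comm)
  then show ?thesis
    using line_eqI[OF ladd_line[OF X Y] ladd_line[OF Y X] ladd_mem[OF X Y xyz(1,2)] _ xyz(3)] ladd_mem[OF Y X xyz(2,1)]
    by simp
qed

lemma ladd_assoc:
  assumes X: "is_line X" and Y: "is_line Y" and Z: "is_line Z"
  shows "ladd (ladd X Y) Z = ladd X (ladd Y Z)"
proof -
  obtain x y z where xyz: "(x, z) \<in> X" "(y, z) \<in> Y" "z ~= \<zero>" "z \<in> carrier L" using line_common[OF X Y] by metis
  obtain u w where u: "u \<in> carrier L" "u ~= \<zero>" "(w, z \<otimes> u) \<in> Z" using line_at[OF Z xyz(4)] by blast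
  note x = lineD(4)[OF X xyz(1) u(1)] and y = lineD(4)[OF Y xyz(2) u(1)]
  have "((x \<otimes> u \<oplus> y \<otimes> u) \<oplus> w, z \<otimes> u) \<in> ladd (ladd X Y) Z"
    by (rule ladd_mem[OF ladd_line[OF X Y] Z ladd_mem[OF X Y x y] u(3)])
  moreover have "(x \<otimes> u \<oplus> (y \<otimes> u \<oplus> w), z \<otimes> u) \<in> ladd X (ladd Y Z)"
    by (rule ladd_mem[OF X ladd_line[OF Y Z] x ladd_mem[OF Y Z y u(3)]])
  moreover have "(x \<otimes> u \<oplus> y \<otimes> u) \<oplus> w = x \<otimes> u \<oplus> (y \<otimes> u \<oplus> w)"
    using lineD(1)[OF X x] lineD(1)[OF Y y] lineD(1)[OF Z u(3)] by (rule A.a_assoc)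
  ultimately show ?thesis
    using line_eqI[OF ladd_line[OF ladd_line[OF X Y] Z] ladd_line[OF X ladd_line[OF Y Z]]]
      nonzero_mult[OF xyz(4) u(1) xyz(3) u(2)] by metis
qed

text \<open>A common test pair is found from right to left: start with a denominator of Z and
  enlarge it until first Y and then X can be applied.\<close>

lemma lmult_assoc:
  assumes X: "is_line X" and Y: "is_line Y" and Z: "is_line Z"
  shows "lmult (lmult X Y) Z = lmult X (lmult Y Z)"
proof -
  obtain c d where cd: "(c, d) \<in> Z" "d ~= \<zero>" using line_denominator[OF Z] by blast
  note cdc = lineD(1,2)[OF Z cd(1)]
  obtain u b where u: "u \<in> carrier L" "u ~= \<zero>" "(b, c \<otimes> u) \<in> Y" using line_at[OF Y cdc(1)] by blast
  obtain v a where v: "v \<in> carrier L" "v ~= \<zero>" "(a, b \<otimes> v) \<in> X" using line_at[OF X lineD(1)[OF Y u(3)]] by blast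
  note y = lineD(4)[OF Y u(3) v(1)] and z = lineD(4)[OF Z lineD(4)[OF Z cd(1) u(1)] v(1)]
  have "(a, d \<otimes> u \<otimes> v) \<in> lmult (lmult X Y) Z"
    by (rule lmult_mem[OF lmult_line[OF X Y] Z lmult_mem[OF X Y v(3) y] z])
  moreover have "(a, d \<otimes> u \<otimes> v) \<in> lmult X (lmult Y Z)"
    by (rule lmult_mem[OF X lmult_line[OF Y Z] v(3) lmult_mem[OF Y Z y z]])
  moreover have "d \<otimes> u \<otimes> v ~= \<zero>" using nonzero_mult cdc cd(2) u v by simp
  ultimately show ?thesis
    using line_eqI[OF lmult_line[OF lmult_line[OF X Y] Z] lmult_line[OF X lmult_line[OF Y Z]]] by metis
qed

lemma lmult_l_distr:
  assumes X: "is_line X" and Y: "is_line Y" and Z: "is_line Z"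
  shows "lmult (ladd X Y) Z = ladd (lmult X Z) (lmult Y Z)"
proof -
  obtain c d where cd: "(c, d) \<in> Z" "d ~= \<zero>" using line_denominator[OF Z] by blast
  note cdc = lineD(1,2)[OF Z cd(1)]
  obtain u x where u: "u \<in> carrier L" "u ~= \<zero>" "(x, c \<otimes> u) \<in> X" using line_at[OF X cdc(1)] by blast
  obtain v y where v: "v \<in> carrier L" "v ~= \<zero>" "(y, c \<otimes> u \<otimes> v) \<in> Y" using line_at[OF Y lineD(2)[OF X u(3)]] by blast
  note x = lineD(4)[OF X u(3) v(1)] and z = lineD(4)[OF Z lineD(4)[OF Z cd(1) u(1)] v(1)]
  have "(x \<otimes> v \<oplus> y, d \<otimes> u \<otimes> v) \<in> lmult (ladd X Y) Z"
    by (rule lmult_mem[OF ladd_line[OF X Y] Z ladd_mem[OF X Y x v(3)] z])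
  moreover have "(x \<otimes> v \<oplus> y, d \<otimes> u \<otimes> v) \<in> ladd (lmult X Z) (lmult Y Z)"
    by (rule ladd_mem[OF lmult_line[OF X Z] lmult_line[OF Y Z] lmult_mem[OF X Z x z] lmult_mem[OF Y Z v(3) z]])
  moreover have "d \<otimes> u \<otimes> v ~= \<zero>" using nonzero_mult cdc cd(2) u v by simp
  ultimately show ?thesis
    using line_eqI[OF lmult_line[OF ladd_line[OF X Y] Z] ladd_line[OF lmult_line[OF X Z] lmult_line[OF Y Z]]] by metis
qed

lemma lmult_r_distr:
  assumes X: "is_line X" and Y: "is_line Y" and Z: "is_line Z"
  shows "lmult Z (ladd X Y) = ladd (lmult Z X) (lmult Z Y)"
proof -
  obtain b c d where bcd: "(b, d) \<in> X" "(c, d) \<in> Y" "d ~= \<zero>" "d \<in> carrier L" using line_common[OF X Y] by metis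
  note bc = lineD(1)[OF X bcd(1)] lineD(1)[OF Y bcd(2)]
  obtain v x where v: "v \<in> carrier L" "v ~= \<zero>" "(x, b \<otimes> v) \<in> Z" using line_at[OF Z bc(1)] by blast
  obtain w y where w: "w \<in> carrier L" "w ~= \<zero>" "(y, c \<otimes> v \<otimes> w) \<in> Z" using line_at[OF Z, of "c \<otimes> v"] bc v by auto
  note x = lineD(4)[OF Z v(3) w(1)]
  note X' = lineD(4)[OF X lineD(4)[OF X bcd(1) v(1)] w(1)] and Y' = lineD(4)[OF Y lineD(4)[OF Y bcd(2) v(1)] w(1)]
  have "(x \<otimes> w \<oplus> y, d \<otimes> v \<otimes> w) \<in> lmult Z (ladd X Y)"
    by (rule lmult_mem[OF Z ladd_line[OF X Y] lineD(5)[OF Z x w(3)] ladd_mem[OF X Y X' Y']])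
  moreover have "(x \<otimes> w \<oplus> y, d \<otimes> v \<otimes> w) \<in> ladd (lmult Z X) (lmult Z Y)"
    by (rule ladd_mem[OF lmult_line[OF Z X] lmult_line[OF Z Y] lmult_mem[OF Z X x X'] lmult_mem[OF Z Y w(3) Y']])
  moreover have "d \<otimes> v \<otimes> w ~= \<zero>" using nonzero_mult bcd v w by simp
  ultimately show ?thesis
    using line_eqI[OF lmult_line[OF Z ladd_line[OF X Y]] ladd_line[OF lmult_line[OF Z X] lmult_line[OF Z Y]]] by metis
qed

lemma lemb_add: "a \<in> carrier L ==> b \<in> carrier L ==> ladd (lemb a) (lemb b) = lemb (a \<oplus> b)"
  using line_eqI[OF ladd_line lemb_line, of "lemb a" "lemb b" "a \<oplus> b" "a \<oplus> b" \<one>]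
    ladd_mem[of "lemb a" "lemb b" a \<one> b] lemb_mem[OF A.one_closed, of a] lemb_mem[OF A.one_closed, of b]
    lemb_mem[OF A.one_closed, of "a \<oplus> b"] lemb_line one_nonzero by simp

lemma lemb_mult: "a \<in> carrier L ==> b \<in> carrier L ==> lmult (lemb a) (lemb b) = lemb (a \<otimes> b)"
  using line_eqI[OF lmult_line lemb_line, of "lemb a" "lemb b" "a \<otimes> b" "a \<otimes> b" \<one>]
    lmult_mem[of "lemb a" "lemb b" "a \<otimes> b" b \<one>] lemb_mem[of b a] lemb_mem[OF A.one_closed, of b]
    lemb_mem[OF A.one_closed, of "a \<otimes> b"] lemb_line one_nonzero by simp

lemma lmult_one: "is_line X ==> lmult (lemb \<one>) X = X" "is_line X ==> lmult X (lemb \<one>) = X"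
proof -
  assume X: "is_line X"
  obtain x z where xz: "(x, z) \<in> X" "z ~= \<zero>" using line_denominator[OF X] by blast
  note c = lineD(1,2)[OF X xz(1)] and E = lemb_line[OF A.one_closed]
  have 1: "(x, x) \<in> lemb \<one>" "(z, z) \<in> lemb \<one>" using lemb_mem[of x \<one>] lemb_mem[of z \<one>] c by auto
  show "lmult (lemb \<one>) X = X"
    by (rule line_eqI[OF lmult_line[OF E X] X lmult_mem[OF E X 1(1) xz(1)] xz])
  show "lmult X (lemb \<one>) = X"
    by (rule line_eqI[OF lmult_line[OF X E] X lmult_mem[OF X E xz(1) 1(2)] xz])
qed

lemma ladd_zero: "is_line X ==> ladd (lemb \<zero>) X = X"
proof -
  assume X: "is_line X"
  obtain x z where xz: "(x, z) \<in> X" "z ~= \<zero>" using line_denominator[OF X] by blast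
  note c = lineD(1,2)[OF X xz(1)] and E = lemb_line[OF A.zero_closed]
  have "(\<zero>, z) \<in> lemb \<zero>" using lemb_mem[of z \<zero>] c by auto
  from ladd_mem[OF E X this xz(1)] have "(x, z) \<in> ladd (lemb \<zero>) X" using c by simp
  from line_eqI[OF ladd_line[OF E X] X this xz] show ?thesis .
qed

text \<open>Multiples of 1 by scalars are central in L, and X is closed under multiplication of both
  entries from the right.\<close>

lemma lmult_central:
  assumes "k \<in> carrier K" and X: "is_line X"
  shows "lmult (lemb (k \<odot>\<^bsub>L\<^esub> \<one>)) X = lmult X (lemb (k \<odot>\<^bsub>L\<^esub> \<one>))"
proof -
  obtain x z where xz: "(x, z) \<in> X" "z ~= \<zero>" using line_denominator[OF X] by blast
  note c = lineD(1,2)[OF X xz(1)]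
  let ?k = "k \<odot>\<^bsub>L\<^esub> \<one>"
  have k: "?k \<in> carrier L" using assms by simp
  note E = lemb_line[OF k]
  have e: "?k \<otimes> w = w \<otimes> ?k" if "w \<in> carrier L" for w
    using that assms(1) by (simp add: smult_mult_left smult_mult_right)
  have "(x \<otimes> ?k, z \<otimes> ?k) \<in> X" by (rule lineD(4)[OF X xz(1) k])
  then have 1: "(?k \<otimes> x, ?k \<otimes> z) \<in> X" using e[OF c(1)] e[OF c(2)] by simp
  show ?thesis
    by (rule line_eqI[OF lmult_line[OF E X] lmult_line[OF X E] lmult_mem[OF E X lemb_mem[OF c(1)] xz(1)]
          lmult_mem[OF X E 1 lemb_mem[OF c(2)]] xz(2)])
qed

lemma Q_ring: "ring Q"
proof (rule ringI)
  show "abelian_group Q"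
  proof (rule abelian_groupI)
    fix X assume "X \<in> carrier Q"
    then have X: "is_line X" by simp
    have M: "\<ominus> \<one> \<in> carrier L" by simp
    \<comment> \<open>The negative of X is X multiplied by the fraction -1, so its existence reduces
      to distributivity.\<close>
    have "ladd (lmult (lemb (\<ominus> \<one>)) X) (lmult (lemb \<one>) X) = lmult (lemb \<zero>) X"
      using lmult_l_distr[OF lemb_line[OF M] lemb_line[OF A.one_closed] X] lemb_add[OF M A.one_closed]
      by (simp add: A.l_neg)
    moreover have "lmult (lemb \<zero>) X = lemb \<zero>"
    proof -
      obtain x z where xz: "(x, z) \<in> X" "z ~= \<zero>" using line_denominator[OF X] by blast
      note c = lineD(1,2)[OF X xz(1)] and E = lemb_line[OF A.zero_closed]
      have "(\<zero>, x) \<in> lemb \<zero>" "(\<zero>, z) \<in> lemb \<zero>" using lemb_mem[of _ \<zero>] c by force+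
      then show ?thesis using line_eqI[OF lmult_line[OF E X] E lmult_mem[OF E X _ xz(1)] _ xz(2)] by blast
    qed
    ultimately show "\<exists>Y\<in>carrier Q. Y \<oplus>\<^bsub>Q\<^esub> X = \<zero>\<^bsub>Q\<^esub>"
      using lmult_line[OF lemb_line[OF M] X] lmult_one(1)[OF X] by (intro bexI[of _ "lmult (lemb (\<ominus> \<one>)) X"]) simp_all
    fix Y assume "Y \<in> carrier Q"
    then show "X \<oplus>\<^bsub>Q\<^esub> Y = Y \<oplus>\<^bsub>Q\<^esub> X" using ladd_comm[OF X, of Y] by simp
  qed (simp_all add: ladd_line ladd_assoc ladd_zero lemb_line)
  show "monoid Q" by (rule monoidI) (auto simp: lmult_line lmult_assoc lmult_one lemb_line)
qed (auto simp: lmult_l_distr lmult_r_distr)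

lemma Q_algebra: "nc_algebra K Q"
proof (rule nc_algebraI[OF K.field_axioms Q_ring])
  have E: "is_line (lemb (k \<odot>\<^bsub>L\<^esub> \<one>))" if "k \<in> carrier K" for k using that by (intro lemb_line) simp
  show "k \<odot>\<^bsub>Q\<^esub> X \<in> carrier Q" if "k \<in> carrier K" "X \<in> carrier Q" for k X
    using that lmult_line[OF E] by simp
  show "(a \<oplus>\<^bsub>K\<^esub> b) \<odot>\<^bsub>Q\<^esub> X = a \<odot>\<^bsub>Q\<^esub> X \<oplus>\<^bsub>Q\<^esub> b \<odot>\<^bsub>Q\<^esub> X" if "a \<in> carrier K" "b \<in> carrier K" "X \<in> carrier Q" for a b X
    using that E by (simp add: smult_l_distr lmult_l_distr flip: lemb_add)
  show "a \<odot>\<^bsub>Q\<^esub> (X \<oplus>\<^bsub>Q\<^esub> Y) = a \<odot>\<^bsub>Q\<^esub> X \<oplus>\<^bsub>Q\<^esub> a \<odot>\<^bsub>Q\<^esub> Y" if "a \<in> carrier K" "X \<in> carrier Q" "Y \<in> carrier Q" for a X Y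
    using that E by (simp add: lmult_r_distr)
  show "(a \<otimes>\<^bsub>K\<^esub> b) \<odot>\<^bsub>Q\<^esub> X = a \<odot>\<^bsub>Q\<^esub> (b \<odot>\<^bsub>Q\<^esub> X)" if "a \<in> carrier K" "b \<in> carrier K" "X \<in> carrier Q" for a b X
  proof -
    have "(a \<otimes>\<^bsub>K\<^esub> b) \<odot>\<^bsub>L\<^esub> \<one> = (a \<odot>\<^bsub>L\<^esub> \<one>) \<otimes> (b \<odot>\<^bsub>L\<^esub> \<one>)"
      using that by (simp add: smult_mult_left smult_assoc1)
    then show ?thesis using that E by (simp add: lmult_assoc flip: lemb_mult)
  qed
  show "\<one>\<^bsub>K\<^esub> \<odot>\<^bsub>Q\<^esub> X = X" if "X \<in> carrier Q" for X using that lmult_one by simp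
  show "(a \<odot>\<^bsub>Q\<^esub> X) \<otimes>\<^bsub>Q\<^esub> Y = a \<odot>\<^bsub>Q\<^esub> (X \<otimes>\<^bsub>Q\<^esub> Y)" if "a \<in> carrier K" "X \<in> carrier Q" "Y \<in> carrier Q" for a X Y
    using that E by (simp add: lmult_assoc)
  show "X \<otimes>\<^bsub>Q\<^esub> (a \<odot>\<^bsub>Q\<^esub> Y) = a \<odot>\<^bsub>Q\<^esub> (X \<otimes>\<^bsub>Q\<^esub> Y)" if "a \<in> carrier K" "X \<in> carrier Q" "Y \<in> carrier Q" for a X Y
    using lmult_assoc[of X "lemb (a \<odot>\<^bsub>L\<^esub> \<one>)" Y] lmult_assoc[of "lemb (a \<odot>\<^bsub>L\<^esub> \<one>)" X Y] lmult_central[of a X] that E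
    by simp
qed

lemma lemb_hom: "lemb \<in> alg_hom K L Q"
proof (rule alg_homI)
  fix k a assume k: "k \<in> carrier K" and a: "a \<in> carrier L"
  then have "(k \<odot>\<^bsub>L\<^esub> \<one>) \<otimes> a = k \<odot>\<^bsub>L\<^esub> a" by (simp add: smult_mult_left)
  then show "lemb (k \<odot>\<^bsub>L\<^esub> a) = k \<odot>\<^bsub>Q\<^esub> lemb a" using k a by (simp add: lemb_mult)
qed (auto simp: lemb_line lemb_mult lemb_add)

lemma lemb_inj: "inj_on lemb (carrier L)"
proof (rule inj_onI)
  fix a b assume ab: "a \<in> carrier L" "b \<in> carrier L" "lemb a = lemb b"
  have "(a, \<one>) \<in> lemb a" "(b, \<one>) \<in> lemb b"
    using lemb_mem[OF A.one_closed, of a] lemb_mem[OF A.one_closed, of b] ab by auto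
  then show "a = b" using lineD(3)[OF lemb_line[OF ab(1)]] ab(3) by simp
qed

lemma Q_fraction:
  assumes "X \<in> carrier Q"
  shows "\<exists>a \<in> carrier L. \<exists>b \<in> carrier L. b ~= \<zero> \<and> X \<otimes>\<^bsub>Q\<^esub> lemb b = lemb a"
proof -
  have X: "is_line X" using assms by simp
  obtain a b where ab: "(a, b) \<in> X" "b ~= \<zero>" using line_denominator[OF X] by blast
  note c = lineD(1,2)[OF X ab(1)]
  have "(b, \<one>) \<in> lemb b" "(a, \<one>) \<in> lemb a"
    using lemb_mem[OF A.one_closed, of b] lemb_mem[OF A.one_closed, of a] c by auto
  then have "lmult X (lemb b) = lemb a"
    using line_eqI[OF lmult_line[OF X lemb_line[OF c(2)]] lemb_line[OF c(1)] lmult_mem[OF X lemb_line[OF c(2)] ab(1)] _ one_nonzero]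
    by blast
  then show ?thesis using c ab by auto
qed

text \<open>The inverse of a nonzero fraction is the converse relation, which exchanges numerators
  and denominators.\<close>

lemma Q_division: "division_ring Q"
proof -
  interpret Q: ring Q by (rule Q_ring)
  have ne: "lemb \<one> ~= lemb \<zero>" using inj_onD[OF lemb_inj, of \<one> \<zero>] one_nonzero by auto
  have "X \<in> Units Q" if X: "is_line X" and nz: "X ~= lemb \<zero>" for X
  proof -
    \<comment> \<open>A nonzero fraction has trivial kernel: a nonzero denominator with numerator
      zero would identify it with the zero fraction. This makes the converse single-valued.\<close>
    have z: "z = \<zero>" if "(\<zero>, z) \<in> X" for z
    proof (rule ccontr)
      assume "z ~= \<zero>"
      moreover have "(\<zero>, z) \<in> lemb \<zero>" using lemb_mem[of z \<zero>] lineD(2)[OF X that] by simp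
      ultimately show False using line_eqI[OF X lemb_line[OF A.zero_closed] that] nz by blast
    qed
    obtain x z where xz: "(x, z) \<in> X" "z ~= \<zero>" using line_denominator[OF X] by blast
    then have x: "x ~= \<zero>" using z by auto
    note c = lineD(1,2)[OF X xz(1)]
    have Y: "is_line (X\<inverse>)"
    proof (rule is_lineI)
      show "X\<inverse> \<subseteq> carrier L \<times> carrier L" using lineD(1,2)[OF X] by auto
      show "a = b" if "(a, e) \<in> X\<inverse>" "(b, e) \<in> X\<inverse>" for a b e
      proof -
        have ab: "(e, a) \<in> X" "(e, b) \<in> X" using that by auto
        note cc = lineD(1,2)[OF X ab(1)] lineD(2)[OF X ab(2)]
        have "(e \<otimes> \<ominus> \<one>, b \<otimes> \<ominus> \<one>) \<in> X" by (rule lineD(4)[OF X ab(2)]) simp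
        from lineD(5)[OF X ab(1) this] have "(\<zero>, a \<oplus> b \<otimes> \<ominus> \<one>) \<in> X" using cc by (simp add: A.r_minus A.r_neg)
        then have "a \<oplus> b \<otimes> \<ominus> \<one> = \<zero>" by (rule z)
        then have "a \<ominus> b = \<zero>" using cc by (simp add: a_minus_def A.r_minus)
        then show ?thesis using cc by simp
      qed
      show "\<exists>e f. (e, f) \<in> X\<inverse> \<and> f ~= \<zero>" using xz x by auto
      show "(a \<otimes> r, e \<otimes> r) \<in> X\<inverse>" if "(a, e) \<in> X\<inverse>" "r \<in> carrier L" for a e r
        using lineD(4)[OF X _ that(2), of e a] that(1) by simp
      show "(a \<oplus> a', e \<oplus> e') \<in> X\<inverse>" if "(a, e) \<in> X\<inverse>" "(a', e') \<in> X\<inverse>" for a e a' e'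
        using lineD(5)[OF X, of e a e' a'] that by simp
      show "(a, e) \<in> X\<inverse>" if "a \<in> carrier L" "e \<in> carrier L" "r \<in> carrier L" "r ~= \<zero>" "(a \<otimes> r, e \<otimes> r) \<in> X\<inverse>" for a e r
        using lineD(6)[OF X that(2,1,3,4)] that(5) by simp
    qed
    have "lmult X (X\<inverse>) = lemb \<one>"
    proof (rule line_eqI[OF lmult_line[OF X Y] lemb_line[OF A.one_closed] _ _ x])
      show "(x, x) \<in> lmult X (X\<inverse>)" by (rule lmult_mem[OF X Y xz(1)]) (use xz in auto)
      show "(x, x) \<in> lemb \<one>" using lemb_mem[of x \<one>] c by simp
    qed
    moreover have "lmult (X\<inverse>) X = lemb \<one>"
    proof (rule line_eqI[OF lmult_line[OF Y X] lemb_line[OF A.one_closed] _ _ xz(2)])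
      show "(z, z) \<in> lmult (X\<inverse>) X" by (rule lmult_mem[OF Y X _ xz(1)]) (use xz in auto)
      show "(z, z) \<in> lemb \<one>" using lemb_mem[of z \<one>] c by simp
    qed
    ultimately show ?thesis using X Y unfolding Units_def by auto
  qed
  moreover have "lemb \<zero> \<notin> Units Q"
  proof
    assume "lemb \<zero> \<in> Units Q"
    then have "\<zero>\<^bsub>Q\<^esub> \<in> Units Q" by simp
    then have "\<one>\<^bsub>Q\<^esub> = \<zero>\<^bsub>Q\<^esub>" by (metis Q.Units_l_inv Q.Units_inv_closed Q.r_null)
    then show False using ne by simp
  qed
  ultimately have "X \<in> Units Q \<longleftrightarrow> X \<in> carrier Q - {\<zero>\<^bsub>Q\<^esub>}" for X
    using Q.Units_closed[of X] by (metis Diff_iff singleton_iff Q_simps(1,5))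
  then have "Units Q = carrier Q - {\<zero>\<^bsub>Q\<^esub>}" by blast
  then show ?thesis unfolding division_ring_def using Q_ring ne by simp
qed

end

section \<open>Ore sets, transfer along isomorphisms, and localization\<close>

lemma ore_set_nonzero:
  fixes A (structure)
  assumes dom: "nc_domain A" and left: "left_ore A" and right: "right_ore A"
  shows "ore_set A (carrier A - {\<zero>})"
  unfolding ore_set_def
proof (intro conjI ballI)
  note D = nc_domainD[OF dom]
  interpret ring A by (rule D(1))
  show "submonoid (carrier A - {\<zero>}) A"
    by (rule submonoid.intro) (use D(2,3) in auto)
  fix a t assume a: "a \<in> carrier A" and t: "t \<in> carrier A - {\<zero>}"
  show "\<exists>b\<in>carrier A. \<exists>s\<in>carrier A - {\<zero>}. a \<otimes> s = t \<otimes> b"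
  proof (cases "a = \<zero>")
    case True
    then show ?thesis using t D(2) by (intro bexI[of _ "\<zero>"] bexI[of _ "\<one>"]) auto
  next
    case False
    obtain u v where uv: "u \<in> carrier A" "v \<in> carrier A" "a \<otimes> u = t \<otimes> v" "a \<otimes> u ~= \<zero>"
      using right_oreD[OF right a False] t by blast
    have "u ~= \<zero>" using uv(4) a by auto
    then show ?thesis using uv by blast
  qed
  show "\<exists>b\<in>carrier A. \<exists>s\<in>carrier A - {\<zero>}. s \<otimes> a = b \<otimes> t"
  proof (cases "a = \<zero>")
    case True
    then show ?thesis using t D(2) by (intro bexI[of _ "\<zero>"] bexI[of _ "\<one>"]) auto
  next
    case False
    obtain u v where uv: "u \<in> carrier A" "v \<in> carrier A" "u \<otimes> a = v \<otimes> t" "u \<otimes> a ~= \<zero>"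
      using left_oreD[OF left a False] t by blast
    have "u ~= \<zero>" using uv(4) a by auto
    then show ?thesis using uv by blast
  qed
qed

lemma ore_transfer:
  assumes C: "nc_algebra K C" and D: "nc_algebra K D" and f: "f \<in> alg_iso K C D"
  shows "nc_domain C ==> nc_domain D" "left_ore C ==> left_ore D" "right_ore C ==> right_ore D"
    "division_ring C ==> division_ring D"
proof -
  interpret C: nc_algebra K C by fact
  interpret D: nc_algebra K D by fact
  note h = alg_homD[OF alg_isoD(1)[OF f]]
  have f0: "f \<zero>\<^bsub>C\<^esub> = \<zero>\<^bsub>D\<^esub>" by (rule alg_hom_zero[OF C.A.ring_axioms D.A.ring_axioms alg_isoD(1)[OF f]])
  have z: "f a = \<zero>\<^bsub>D\<^esub> \<longleftrightarrow> a = \<zero>\<^bsub>C\<^esub>" if "a \<in> carrier C" for a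
    using inj_onD[OF alg_isoD(2)[OF f], of a "\<zero>\<^bsub>C\<^esub>"] that f0 by auto
  have pre: "\<exists>a \<in> carrier C. f a = b" if "b \<in> carrier D" for b
    using that unfolding alg_isoD(3)[OF f, symmetric] by blast
  have all: "(\<forall>b \<in> carrier D. P b) \<longleftrightarrow> (\<forall>a \<in> carrier C. P (f a))" for P
    unfolding alg_isoD(3)[OF f, symmetric] by blast
  show "nc_domain D" if dom: "nc_domain C"
    unfolding nc_domain_def all
  proof (intro conjI ballI impI)
    note CD = nc_domainD[OF dom]
    show "ring D" by (rule D.A.ring_axioms)
    show "\<one>\<^bsub>D\<^esub> ~= \<zero>\<^bsub>D\<^esub>" using z[of "\<one>\<^bsub>C\<^esub>"] h(4) CD(2) by simp
    fix a b assume "a \<in> carrier C" "b \<in> carrier C" "f a \<otimes>\<^bsub>D\<^esub> f b = \<zero>\<^bsub>D\<^esub>"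
    then show "f a = \<zero>\<^bsub>D\<^esub> \<or> f b = \<zero>\<^bsub>D\<^esub>" using CD(3)[of a b] z[of "a \<otimes>\<^bsub>C\<^esub> b"] z h(2) by auto
  qed
  have all': "(\<forall>b \<in> carrier D - {\<zero>\<^bsub>D\<^esub>}. P b) \<longleftrightarrow> (\<forall>a \<in> carrier C - {\<zero>\<^bsub>C\<^esub>}. P (f a))" for P
    using all[of "\<lambda>b. b ~= \<zero>\<^bsub>D\<^esub> \<longrightarrow> P b"] z by blast
  show "left_ore D" if ore: "left_ore C"
    unfolding left_ore_def all'
  proof (intro ballI)
    fix a b assume ab: "a \<in> carrier C - {\<zero>\<^bsub>C\<^esub>}" "b \<in> carrier C - {\<zero>\<^bsub>C\<^esub>}"
    obtain u v where uv: "u \<in> carrier C" "v \<in> carrier C" "u \<otimes>\<^bsub>C\<^esub> a = v \<otimes>\<^bsub>C\<^esub> b" "u \<otimes>\<^bsub>C\<^esub> a ~= \<zero>\<^bsub>C\<^esub>"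
      using left_oreD[OF ore] ab by blast
    show "\<exists>u\<in>carrier D. \<exists>v\<in>carrier D. u \<otimes>\<^bsub>D\<^esub> f a = v \<otimes>\<^bsub>D\<^esub> f b \<and> u \<otimes>\<^bsub>D\<^esub> f a ~= \<zero>\<^bsub>D\<^esub>"
      using h(1)[OF uv(1)] h(1)[OF uv(2)] h(2)[of u a] h(2)[of v b] z[of "u \<otimes>\<^bsub>C\<^esub> a"] uv ab
      by (intro bexI[of _ "f u"] bexI[of _ "f v"]) simp_all
  qed
  show "right_ore D" if ore: "right_ore C"
    unfolding right_ore_def all'
  proof (intro ballI)
    fix a b assume ab: "a \<in> carrier C - {\<zero>\<^bsub>C\<^esub>}" "b \<in> carrier C - {\<zero>\<^bsub>C\<^esub>}"
    obtain u v where uv: "u \<in> carrier C" "v \<in> carrier C" "a \<otimes>\<^bsub>C\<^esub> u = b \<otimes>\<^bsub>C\<^esub> v" "a \<otimes>\<^bsub>C\<^esub> u ~= \<zero>\<^bsub>C\<^esub>"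
      using right_oreD[OF ore] ab by blast
    show "\<exists>u\<in>carrier D. \<exists>v\<in>carrier D. f a \<otimes>\<^bsub>D\<^esub> u = f b \<otimes>\<^bsub>D\<^esub> v \<and> f a \<otimes>\<^bsub>D\<^esub> u ~= \<zero>\<^bsub>D\<^esub>"
      using h(1)[OF uv(1)] h(1)[OF uv(2)] h(2)[of a u] h(2)[of b v] z[of "a \<otimes>\<^bsub>C\<^esub> u"] uv ab
      by (intro bexI[of _ "f u"] bexI[of _ "f v"]) simp_all
  qed
  show "division_ring D" if div: "division_ring C"
  proof -
    have CD: "\<one>\<^bsub>C\<^esub> ~= \<zero>\<^bsub>C\<^esub>" "Units C = carrier C - {\<zero>\<^bsub>C\<^esub>}" using div unfolding division_ring_def by auto
    have one: "\<one>\<^bsub>D\<^esub> ~= \<zero>\<^bsub>D\<^esub>" using z[of "\<one>\<^bsub>C\<^esub>"] h(4) CD(1) by simp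
    have "b \<in> Units D" if b: "b \<in> carrier D" "b ~= \<zero>\<^bsub>D\<^esub>" for b
    proof -
      obtain a where a: "a \<in> carrier C" "f a = b" using pre[OF b(1)] by blast
      then have "a \<in> Units C" using CD(2) z b(2) by auto
      then show ?thesis using alg_hom_Units(1)[OF C.A.ring_axioms D.A.ring_axioms alg_isoD(1)[OF f]] a(2) by blast
    qed
    moreover have "\<zero>\<^bsub>D\<^esub> \<notin> Units D" using D.A.Units_l_inv[of "\<zero>\<^bsub>D\<^esub>"] D.A.Units_inv_closed[of "\<zero>\<^bsub>D\<^esub>"] one by auto
    ultimately have "Units D = carrier D - {\<zero>\<^bsub>D\<^esub>}" using D.A.Units_closed by blast
    then show ?thesis unfolding division_ring_def using D.A.ring_axioms one by blast
  qed
qed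

lemma iterated_skew_polynomial_ore:
  assumes A: "iterated_skew_polynomial_ring K A S n x \<tau> \<delta>"
    and "nc_domain (A\<lparr>carrier := S 0\<rparr>)" "left_ore (A\<lparr>carrier := S 0\<rparr>)" "right_ore (A\<lparr>carrier := S 0\<rparr>)"
  shows "nc_domain (A\<lparr>carrier := S n\<rparr>) \<and> left_ore (A\<lparr>carrier := S n\<rparr>) \<and> right_ore (A\<lparr>carrier := S n\<rparr>)"
proof -
  have "i \<le> n ==> nc_domain (A\<lparr>carrier := S i\<rparr>) \<and> left_ore (A\<lparr>carrier := S i\<rparr>) \<and> right_ore (A\<lparr>carrier := S i\<rparr>)" for i
  proof (induct i)
    case (Suc i)
    have "\<forall>i\<in>{1..n}. skew_polynomial_ring K (A\<lparr>carrier := S i\<rparr>) (S (i - 1)) (x i) (\<tau> i) (\<delta> i)"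
      using A unfolding iterated_skew_polynomial_ring_def by simp
    from bspec[OF this, of "Suc i"] Suc(2)
    interpret skew_poly K "A\<lparr>carrier := S (Suc i)\<rparr>" "S i" "x (Suc i)" "\<tau> (Suc i)" "\<delta> (Suc i)"
      by (intro skew_poly.intro) simp
    show ?case using skew_poly_domain skew_poly_left_ore skew_poly_right_ore Suc by simp
  qed (use assms in simp)
  then show ?thesis by simp
qed

text \<open>An element of the localization is encoded by the set of all pairs \<open>(a, t)\<close> with value \<open>at\<^sup>-\<^sup>1\<close>, so
  that the localization lives on a type determined by that of the ring.\<close>

lemma right_localization_exists:
  fixes A :: "('k, 'a, 'n) module_scheme"
  assumes A: "nc_algebra K A" and L: "nc_algebra K L" and \<theta>: "\<theta> \<in> alg_hom K A L" "inj_on \<theta> (carrier A)"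
    and T: "T \<subseteq> carrier A" and units: "\<And>t. t \<in> T ==> \<theta> t \<in> Units L"
    and right: "\<And>l. l \<in> carrier L ==> \<exists>t \<in> T. l \<otimes>\<^bsub>L\<^esub> \<theta> t \<in> \<theta> ` carrier A"
  shows "\<exists>(B :: ('k, ('a \<times> 'a) set) module) \<phi> h. right_localization K A T B \<phi> \<and> h \<in> alg_iso K B L"
proof -
  interpret A: nc_algebra K A by fact
  interpret L: nc_algebra K L by fact
  note th = alg_homD[OF \<theta>(1)]
  define e where "e l = {(a, t). a \<in> carrier A \<and> t \<in> T \<and> l \<otimes>\<^bsub>L\<^esub> \<theta> t = \<theta> a}" for l
  have "inj_on e (carrier L)"
  proof (rule inj_onI)
    fix l l' assume l: "l \<in> carrier L" "l' \<in> carrier L" and eq: "e l = e l'"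
    obtain t a where t: "t \<in> T" "a \<in> carrier A" "l \<otimes>\<^bsub>L\<^esub> \<theta> t = \<theta> a" using right[OF l(1)] by auto
    then have "(a, t) \<in> e l'" unfolding eq[symmetric] by (simp add: e_def)
    then have "l \<otimes>\<^bsub>L\<^esub> \<theta> t = l' \<otimes>\<^bsub>L\<^esub> \<theta> t" using t(3) by (simp add: e_def)
    then have "(l \<otimes>\<^bsub>L\<^esub> \<theta> t) \<otimes>\<^bsub>L\<^esub> inv\<^bsub>L\<^esub> \<theta> t = (l' \<otimes>\<^bsub>L\<^esub> \<theta> t) \<otimes>\<^bsub>L\<^esub> inv\<^bsub>L\<^esub> \<theta> t" by simp
    then show "l = l'" using l units[OF t(1)] L.A.Units_closed[OF units[OF t(1)]] by (simp add: L.A.m_assoc)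
  qed
  then obtain B :: "('k, ('a \<times> 'a) set) module" where B: "nc_algebra K B" "e \<in> alg_iso K L B"
    using transport_algebra[OF L] by blast
  interpret B: nc_algebra K B by (rule B)
  let ?\<phi> = "\<lambda>a. e (\<theta> a)"
  have \<phi>: "?\<phi> \<in> alg_hom K A B" by (rule alg_hom_comp[OF \<theta>(1) alg_isoD(1)[OF B(2)]])
  note eU = alg_hom_Units[OF L.A.ring_axioms B.A.ring_axioms alg_isoD(1)[OF B(2)]]
  have \<phi>0: "?\<phi> \<zero>\<^bsub>A\<^esub> = \<zero>\<^bsub>B\<^esub>" by (rule alg_hom_zero[OF A.A.ring_axioms B.A.ring_axioms \<phi>])
  have "inj_on ?\<phi> (carrier A)"
    by (rule inj_onI) (metis inj_onD[OF \<theta>(2)] inj_onD[OF alg_isoD(2)[OF B(2)]] th(1))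
  then have zero: "?\<phi> a = \<zero>\<^bsub>B\<^esub> ==> a = \<zero>\<^bsub>A\<^esub>" if "a \<in> carrier A" for a using that \<phi>0 inj_onD by fastforce
  have "right_localization K A T B ?\<phi>"
    unfolding right_localization_def
  proof (intro conjI ballI)
    show "?\<phi> t \<in> Units B" if "t \<in> T" for t using eU(1) units that by blast
    show "\<exists>a\<in>carrier A. \<exists>t\<in>T. b = ?\<phi> a \<otimes>\<^bsub>B\<^esub> inv\<^bsub>B\<^esub> ?\<phi> t" if b: "b \<in> carrier B" for b
    proof -
      obtain l where l: "l \<in> carrier L" "b = e l" using b alg_isoD(3)[OF B(2)] by blast
      obtain t a where t: "t \<in> T" "a \<in> carrier A" "l \<otimes>\<^bsub>L\<^esub> \<theta> t = \<theta> a" using right[OF l(1)] by auto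
      have "l = \<theta> a \<otimes>\<^bsub>L\<^esub> inv\<^bsub>L\<^esub> \<theta> t" using t(3)[symmetric] l(1) units[OF t(1)] L.A.Units_closed[OF units[OF t(1)]] by (simp add: L.A.m_assoc)
      then have "b = ?\<phi> a \<otimes>\<^bsub>B\<^esub> e (inv\<^bsub>L\<^esub> \<theta> t)"
        using l(2) alg_homD(2)[OF alg_isoD(1)[OF B(2)], of "\<theta> a" "inv\<^bsub>L\<^esub> \<theta> t"] th(1)[OF t(2)] units[OF t(1)] by simp
      then show ?thesis using eU(2)[OF units[OF t(1)]] t by auto
    qed
    show "?\<phi> a = \<zero>\<^bsub>B\<^esub> \<longleftrightarrow> (\<exists>t\<in>T. a \<otimes>\<^bsub>A\<^esub> t = \<zero>\<^bsub>A\<^esub>)" if a: "a \<in> carrier A" for a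
    proof
      assume "?\<phi> a = \<zero>\<^bsub>B\<^esub>"
      moreover obtain t where "t \<in> T" using right[of "\<zero>\<^bsub>L\<^esub>"] by auto
      ultimately show "\<exists>t\<in>T. a \<otimes>\<^bsub>A\<^esub> t = \<zero>\<^bsub>A\<^esub>" using zero[OF a] T by (intro bexI[of _ t]) auto
    next
      assume "\<exists>t\<in>T. a \<otimes>\<^bsub>A\<^esub> t = \<zero>\<^bsub>A\<^esub>"
      then obtain t where t: "t \<in> T" "a \<otimes>\<^bsub>A\<^esub> t = \<zero>\<^bsub>A\<^esub>" by blast
      have tA: "t \<in> carrier A" using t(1) T by blast
      have U: "?\<phi> t \<in> Units B" using eU(1) units t(1) by blast
      have c: "?\<phi> a \<in> carrier B" by (rule alg_homD(1)[OF \<phi> a])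
      have "?\<phi> a \<otimes>\<^bsub>B\<^esub> ?\<phi> t = \<zero>\<^bsub>B\<^esub>" using alg_homD(2)[OF \<phi> a tA] t(2) \<phi>0 by simp
      then have "(?\<phi> a \<otimes>\<^bsub>B\<^esub> ?\<phi> t) \<otimes>\<^bsub>B\<^esub> inv\<^bsub>B\<^esub> ?\<phi> t = \<zero>\<^bsub>B\<^esub>" using U by simp
      then show "?\<phi> a = \<zero>\<^bsub>B\<^esub>" using U c B.A.Units_closed[OF U] by (simp add: B.A.m_assoc)
    qed
  qed (use A B \<phi> in auto)
  then show ?thesis using alg_iso_inv[OF L B(2)] by blast
qed

text \<open>The Ore conditions can be read off from L: the element t^-1 a is also a right fraction b
  s^-1, which says a s = t b; similarly a t^-1 is a left fraction.\<close>

lemma unit_fractions_ore: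
  fixes L (structure)
  assumes A: "nc_algebra K A" and L: "nc_algebra K L" and \<theta>: "\<theta> \<in> alg_hom K A L" "inj_on \<theta> (carrier A)"
    and T: "submonoid T A" and units: "\<And>t. t \<in> T ==> \<theta> t \<in> Units L"
    and left: "\<And>l. l \<in> carrier L ==> \<exists>t \<in> T. \<theta> t \<otimes> l \<in> \<theta> ` carrier A"
    and right: "\<And>l. l \<in> carrier L ==> \<exists>t \<in> T. l \<otimes> \<theta> t \<in> \<theta> ` carrier A"
  shows "ore_set A T"
  unfolding ore_set_def
proof (intro conjI ballI)
  interpret A: nc_algebra K A by fact
  interpret L: nc_algebra K L by fact
  note th = alg_homD[OF \<theta>(1)] and inj = inj_onD[OF \<theta>(2)]
  show "submonoid T A" by fact
  fix a t assume a: "a \<in> carrier A" and t: "t \<in> T"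
  have tA: "t \<in> carrier A" if "t \<in> T" for t using submonoid.mem_carrier[OF T that] .
  note U = units[OF t]
  have c: "\<theta> a \<in> carrier L" "\<theta> t \<in> carrier L" using th(1) a tA[OF t] by auto
  show "\<exists>b\<in>carrier A. \<exists>s\<in>T. a \<otimes>\<^bsub>A\<^esub> s = t \<otimes>\<^bsub>A\<^esub> b"
  proof -
    obtain s b where s: "s \<in> T" "b \<in> carrier A" "(inv \<theta> t \<otimes> \<theta> a) \<otimes> \<theta> s = \<theta> b"
      using right[of "inv \<theta> t \<otimes> \<theta> a"] U c by auto
    have sc: "\<theta> s \<in> carrier L" using th(1) tA s(1) by simp
    have "\<theta> t \<otimes> \<theta> b = (\<theta> t \<otimes> inv \<theta> t) \<otimes> (\<theta> a \<otimes> \<theta> s)"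
      unfolding s(3)[symmetric] using U c sc L.A.Units_inv_closed by (simp only: L.A.m_assoc L.A.m_closed)
    then have "\<theta> (t \<otimes>\<^bsub>A\<^esub> b) = \<theta> (a \<otimes>\<^bsub>A\<^esub> s)" using U c sc th(2) a tA[OF t] tA[OF s(1)] s(2) by simp
    then show ?thesis using inj[of "t \<otimes>\<^bsub>A\<^esub> b" "a \<otimes>\<^bsub>A\<^esub> s"] a tA[OF t] tA[OF s(1)] s by force
  qed
  show "\<exists>b\<in>carrier A. \<exists>s\<in>T. s \<otimes>\<^bsub>A\<^esub> a = b \<otimes>\<^bsub>A\<^esub> t"
  proof -
    obtain s b where s: "s \<in> T" "b \<in> carrier A" "\<theta> s \<otimes> (\<theta> a \<otimes> inv \<theta> t) = \<theta> b"
      using left[of "\<theta> a \<otimes> inv \<theta> t"] U c by auto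
    have sc: "\<theta> s \<in> carrier L" using th(1) tA s(1) by simp
    have "\<theta> b \<otimes> \<theta> t = (\<theta> s \<otimes> \<theta> a) \<otimes> (inv \<theta> t \<otimes> \<theta> t)"
      unfolding s(3)[symmetric] using U c sc L.A.Units_inv_closed by (simp only: L.A.m_assoc L.A.m_closed)
    then have "\<theta> (b \<otimes>\<^bsub>A\<^esub> t) = \<theta> (s \<otimes>\<^bsub>A\<^esub> a)" using U c sc th(2) a tA[OF t] tA[OF s(1)] s(2) by simp
    then show ?thesis using inj[of "b \<otimes>\<^bsub>A\<^esub> t" "s \<otimes>\<^bsub>A\<^esub> a"] a tA[OF t] tA[OF s(1)] s by force
  qed
qed

text \<open>The situation occurs twice over the same L: for A with its embedding, and for the skew
  polynomial ring with the inclusion. Everything is compared through the one division ring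
  \<open>Q.Q\<close> of L.\<close>

locale fractions_over =
  fixes K :: "('k, 'm) ring_scheme" and C :: "('k, 'c, 'o) module_scheme"
    and L :: "('k, 'l, 'n) module_scheme" (structure) and \<theta> :: "'c => 'l"
  assumes algC: "nc_algebra K C" and domC: "nc_domain C" and left_oreC: "left_ore C" and right_oreC: "right_ore C"
    and algL: "nc_algebra K L" and domL: "nc_domain L"
    and hom: "\<theta> \<in> alg_hom K C L" and inj: "inj_on \<theta> (carrier C)"
    and right: "\<And>l. l \<in> carrier L ==> \<exists>s \<in> carrier C. s ~= \<zero>\<^bsub>C\<^esub> \<and> l \<otimes> \<theta> s \<in> \<theta> ` carrier C"
begin

interpretation C: nc_algebra K C by (rule algC)
interpretation L: nc_algebra K L by (rule algL)

lemmas th = alg_homD[OF hom]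

lemma th_zero: "a \<in> carrier C ==> \<theta> a = \<zero> \<longleftrightarrow> a = \<zero>\<^bsub>C\<^esub>"
  using alg_hom_zero[OF C.A.ring_axioms L.A.ring_axioms hom] inj_onD[OF inj, of a "\<zero>\<^bsub>C\<^esub>"] by auto

lemma common_denominator:
  assumes l: "l \<in> carrier L" "l' \<in> carrier L"
  obtains s a a' where "s \<in> carrier C" "s ~= \<zero>\<^bsub>C\<^esub>" "a \<in> carrier C" "a' \<in> carrier C" "l \<otimes> \<theta> s = \<theta> a" "l' \<otimes> \<theta> s = \<theta> a'"
proof -
  obtain s a where s: "s \<in> carrier C" "s ~= \<zero>\<^bsub>C\<^esub>" "a \<in> carrier C" "l \<otimes> \<theta> s = \<theta> a" using right[OF l(1)] by blast
  have "l' \<otimes> \<theta> s \<in> carrier L" using l th(1)[OF s(1)] by simp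
  then obtain r a' where r: "r \<in> carrier C" "r ~= \<zero>\<^bsub>C\<^esub>" "a' \<in> carrier C" "(l' \<otimes> \<theta> s) \<otimes> \<theta> r = \<theta> a'"
    using right by blast
  have "s \<otimes>\<^bsub>C\<^esub> r ~= \<zero>\<^bsub>C\<^esub>" using nc_domainD(3)[OF domC] s r by blast
  moreover have "l \<otimes> \<theta> (s \<otimes>\<^bsub>C\<^esub> r) = \<theta> (a \<otimes>\<^bsub>C\<^esub> r)"
    using s r l th(1,2) by (simp flip: L.A.m_assoc)
  moreover have "l' \<otimes> \<theta> (s \<otimes>\<^bsub>C\<^esub> r) = \<theta> a'"
    using s r l th(1,2) by (simp flip: L.A.m_assoc)
  ultimately show ?thesis using that[of "s \<otimes>\<^bsub>C\<^esub> r" "a \<otimes>\<^bsub>C\<^esub> r" a'] s r by simp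
qed

text \<open>Over a common denominator the condition for two elements of L becomes the one for their
  numerators in C.\<close>

lemma right_oreL: "right_ore L"
  unfolding right_ore_def
proof (intro ballI)
  note LD = nc_domainD(3)[OF domL]
  fix l l' assume l: "l \<in> carrier L - {\<zero>}" "l' \<in> carrier L - {\<zero>}"
  obtain s a a' where s: "s \<in> carrier C" "s ~= \<zero>\<^bsub>C\<^esub>" "a \<in> carrier C" "a' \<in> carrier C" "l \<otimes> \<theta> s = \<theta> a" "l' \<otimes> \<theta> s = \<theta> a'"
    using common_denominator l by blast
  have nz: "\<theta> s ~= \<zero>" "\<theta> s \<in> carrier L" using th_zero[OF s(1)] s th(1) by auto
  have "\<theta> a ~= \<zero>" "\<theta> a' ~= \<zero>" unfolding s(5,6)[symmetric] using LD[OF _ nz(2)] nz(1) l by blast+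
  then have "a ~= \<zero>\<^bsub>C\<^esub>" "a' ~= \<zero>\<^bsub>C\<^esub>" using th_zero s by auto
  then obtain u v where uv: "u \<in> carrier C" "v \<in> carrier C" "a \<otimes>\<^bsub>C\<^esub> u = a' \<otimes>\<^bsub>C\<^esub> v" "a \<otimes>\<^bsub>C\<^esub> u ~= \<zero>\<^bsub>C\<^esub>"
    using right_oreD[OF right_oreC s(3) _ s(4)] by blast
  have c: "\<theta> u \<in> carrier L" "\<theta> v \<in> carrier L" using uv th by auto
  have 1: "l \<otimes> (\<theta> s \<otimes> \<theta> u) = \<theta> (a \<otimes>\<^bsub>C\<^esub> u)" using l nz(2) c s(3,5) uv(1) th(2) by (simp flip: L.A.m_assoc)
  have 2: "l' \<otimes> (\<theta> s \<otimes> \<theta> v) = \<theta> (a' \<otimes>\<^bsub>C\<^esub> v)" using l nz(2) c s(4,6) uv(2) th(2) by (simp flip: L.A.m_assoc)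
  have 3: "\<theta> (a \<otimes>\<^bsub>C\<^esub> u) ~= \<zero>" using th_zero[of "a \<otimes>\<^bsub>C\<^esub> u"] s(3) uv(1,4) by simp
  show "\<exists>u\<in>carrier L. \<exists>v\<in>carrier L. l \<otimes> u = l' \<otimes> v \<and> l \<otimes> u ~= \<zero>"
    by (intro bexI[of _ "\<theta> s \<otimes> \<theta> u"] bexI[of _ "\<theta> s \<otimes> \<theta> v"] conjI) (use 1 2 3 uv(3) c nz(2) in simp_all)
qed

end

sublocale fractions_over \<subseteq> Q: ore_domain K L
  by (rule ore_domain.intro[OF algL domL right_oreL])

context fractions_over
begin

lemma emb: "(\<lambda>a. Q.lemb (\<theta> a)) \<in> alg_hom K C Q.Q" "inj_on (\<lambda>a. Q.lemb (\<theta> a)) (carrier C)"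
  using alg_hom_comp[OF hom Q.lemb_hom] comp_inj_on[OF inj inj_on_subset[OF Q.lemb_inj]] th(1)
  by (auto simp: comp_def image_subset_iff)

lemma emb_unit: "s \<in> carrier C ==> s ~= \<zero>\<^bsub>C\<^esub> ==> Q.lemb (\<theta> s) \<in> Units Q.Q"
proof -
  assume s: "s \<in> carrier C" "s ~= \<zero>\<^bsub>C\<^esub>"
  have "Units Q.Q = carrier Q.Q - {\<zero>\<^bsub>Q.Q\<^esub>}" using Q.Q_division unfolding division_ring_def by blast
  moreover have "Q.lemb (\<theta> s) ~= Q.lemb \<zero>"
    using inj_onD[OF Q.lemb_inj, of "\<theta> s" "\<zero>"] th_zero[OF s(1)] s th(1) by auto
  ultimately show ?thesis using alg_homD(1)[OF emb(1) s(1)] by simp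
qed

lemma emb_fraction:
  assumes X: "X \<in> carrier Q.Q"
  shows "\<exists>s \<in> carrier C. s ~= \<zero>\<^bsub>C\<^esub> \<and> X \<otimes>\<^bsub>Q.Q\<^esub> Q.lemb (\<theta> s) \<in> (\<lambda>a. Q.lemb (\<theta> a)) ` carrier C"
proof -
  interpret QQ: ring Q.Q by (rule Q.Q_ring)
  obtain l m where lm: "l \<in> carrier L" "m \<in> carrier L" "m ~= \<zero>" "X \<otimes>\<^bsub>Q.Q\<^esub> Q.lemb m = Q.lemb l"
    using Q.Q_fraction[OF X] by blast
  obtain s a b where s: "s \<in> carrier C" "s ~= \<zero>\<^bsub>C\<^esub>" "a \<in> carrier C" "b \<in> carrier C" "l \<otimes> \<theta> s = \<theta> a" "m \<otimes> \<theta> s = \<theta> b"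
    using common_denominator[OF lm(1,2)] by blast
  have c: "\<theta> s \<in> carrier L" "\<theta> s ~= \<zero>" using th(1) th_zero s by auto
  note h = alg_homD[OF Q.lemb_hom]
  have "X \<otimes>\<^bsub>Q.Q\<^esub> Q.lemb (\<theta> b) = X \<otimes>\<^bsub>Q.Q\<^esub> (Q.lemb m \<otimes>\<^bsub>Q.Q\<^esub> Q.lemb (\<theta> s))"
    unfolding s(6)[symmetric] using h(2)[OF lm(2) c(1)] by simp
  also have "\<dots> = Q.lemb l \<otimes>\<^bsub>Q.Q\<^esub> Q.lemb (\<theta> s)"
    unfolding lm(4)[symmetric] by (rule QQ.m_assoc[symmetric]) (use X h(1) lm c in blast)+
  also have "\<dots> = Q.lemb (\<theta> a)" unfolding s(5)[symmetric] by (rule h(2)[OF lm(1) c(1), symmetric])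
  finally have "X \<otimes>\<^bsub>Q.Q\<^esub> Q.lemb (\<theta> b) = Q.lemb (\<theta> a)" .
  moreover have "b ~= \<zero>\<^bsub>C\<^esub>"
    using nc_domainD(3)[OF domL lm(2) c(1)] lm(3) c(2) s(6) th_zero[OF s(4)] by auto
  ultimately show ?thesis using s(3,4) by blast
qed

text \<open>\<open>Q.Q\<close> lives on a type derived from L. The encoding of localizations by
  pairs gives an isomorphic copy on the type that belongs to C.\<close>

theorem fraction_ring_exists:
  "\<exists>(D :: ('k, ('c \<times> 'c) set) module) \<phi> h. division_ring_of_fractions K C D \<phi> \<and> h \<in> alg_iso K D Q.Q"
proof -
  have frac: "\<exists>s \<in> carrier C - {\<zero>\<^bsub>C\<^esub>}. X \<otimes>\<^bsub>Q.Q\<^esub> Q.lemb (\<theta> s) \<in> (\<lambda>a. Q.lemb (\<theta> a)) ` carrier C"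
    if "X \<in> carrier Q.Q" for X using emb_fraction[OF that] by blast
  have unit: "Q.lemb (\<theta> s) \<in> Units Q.Q" if "s \<in> carrier C - {\<zero>\<^bsub>C\<^esub>}" for s using emb_unit that by blast
  obtain D :: "('k, ('c \<times> 'c) set) module" and \<phi> h where
    D: "right_localization K C (carrier C - {\<zero>\<^bsub>C\<^esub>}) D \<phi>" "h \<in> alg_iso K D Q.Q"
    using right_localization_exists[OF algC Q.Q_algebra emb, of "carrier C - {\<zero>\<^bsub>C\<^esub>}", OF _ unit frac] by blast
  have alg: "nc_algebra K D" using D(1) unfolding right_localization_def by blast
  have "division_ring D" by (rule ore_transfer(4)[OF Q.Q_algebra alg alg_iso_inv[OF alg D(2)] Q.Q_division])
  then show ?thesis
    using D ore_set_nonzero[OF domC left_oreC right_oreC] unfolding division_ring_of_fractions_def by blast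
qed

end

section \<open>Polynomial identities\<close>

definition poly_value :: "('a, 'm) ring_scheme => (nat list => int) => (nat => 'a) => 'a" where
  "poly_value R f v = (\<Oplus>\<^bsub>R\<^esub> w \<in> {w. f w ~= 0}. [f w] \<cdot>\<^bsub>R\<^esub> word_value R v w)"

lemma monic_identity_iff:
  "monic_identity R d f \<longleftrightarrow> finite {w. f w ~= 0} \<and> (\<forall>w. f w ~= 0 \<longrightarrow> length w \<le> d) \<and>
    (\<exists>w. length w = d \<and> f w = 1) \<and> (\<forall>v. range v \<subseteq> carrier R \<longrightarrow> poly_value R f v = \<zero>\<^bsub>R\<^esub>)"
  unfolding monic_identity_def poly_value_def by simp

lemma word_value_simps [simp]: "word_value R v [] = \<one>\<^bsub>R\<^esub>" "word_value R v (i # w) = v i \<otimes>\<^bsub>R\<^esub> word_value R v w"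
  by (simp_all add: word_value_def)

lemma word_value_cong: "(\<And>i. i \<in> set w ==> v i = v' i) ==> word_value R v w = word_value R v' w"
  by (induct w) auto

lemma (in ring) word_value_closed [simp]: "range v \<subseteq> carrier R ==> word_value R v w \<in> carrier R"
  by (induct w) auto

lemma (in ring) word_value_append:
  "range v \<subseteq> carrier R ==> word_value R v (u @ w) = word_value R v u \<otimes> word_value R v w"
  by (induct u) (auto simp: m_assoc image_subset_iff)

lemma (in ring) int_add_pow_closed [simp]: "x \<in> carrier R ==> [(k::int)] \<cdot> x \<in> carrier R"
  by (rule add.int_pow_closed)

lemma (in ring) int_add_pow_finsum:
  assumes "g \<in> F \<rightarrow> carrier R" shows "[(k::int)] \<cdot> (\<Oplus>i\<in>F. g i) = (\<Oplus>i\<in>F. [k] \<cdot> g i)"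
proof (rule additive_finsum[OF is_abelian_group is_abelian_group _ _ assms])
  fix x y assume xy: "x \<in> carrier R" "y \<in> carrier R"
  have e: "[k] \<cdot> z = ([k] \<cdot> \<one>) \<otimes> z" if "z \<in> carrier R" for z using add_pow_ldistr_int[of \<one> z k] that by simp
  show "[k] \<cdot> (x \<oplus> y) = [k] \<cdot> x \<oplus> [k] \<cdot> y"
    using e[of x] e[of y] e[of "x \<oplus> y"] xy by (simp add: r_distr)
qed simp

text \<open>Expanding a product of sums means choosing one summand for each letter, that is, a word
  \<open>ps\<close> lifting u along c.\<close>

lemma (in ring) word_value_sum:
  assumes E: "finite E" and z: "range z \<subseteq> carrier R"
  shows "word_value R (\<lambda>i. \<Oplus>p\<in>{p \<in> E. c p = i}. z p) u =
    (\<Oplus>ps\<in>{ps. set ps \<subseteq> E \<and> map c ps = u}. word_value R z ps)"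
proof (induct u)
  case Nil
  have "{ps. set ps \<subseteq> E \<and> map c ps = []} = {[]}" by auto
  then show ?case by simp
next
  case (Cons i u)
  let ?M = "{ps. set ps \<subseteq> E \<and> map c ps = u}" and ?P = "{p \<in> E. c p = i}"
  have zc: "z p \<in> carrier R" for p using z by auto
  have fin: "finite ?M"
    by (rule finite_subset[OF _ finite_lists_length_eq[OF E, of "length u"]]) auto
  have M: "{ps. set ps \<subseteq> E \<and> map c ps = i # u} = (\<Union>p\<in>?P. (#) p ` ?M)"
    by (auto simp: map_eq_Cons_conv)
  have "(\<Oplus>ps\<in>(\<Union>p\<in>?P. (#) p ` ?M). word_value R z ps) = (\<Oplus>p\<in>?P. \<Oplus>ps\<in>(#) p ` ?M. word_value R z ps)"
    by (rule add.finprod_UN_disjoint) (use E fin z in \<open>auto simp: pairwise_def disjnt_def\<close>)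
  also have "\<dots> = (\<Oplus>p\<in>?P. z p \<otimes> (\<Oplus>ps\<in>?M. word_value R z ps))"
  proof (rule finsum_cong')
    fix p
    have "(\<Oplus>ps\<in>(#) p ` ?M. word_value R z ps) = (\<Oplus>ps\<in>?M. z p \<otimes> word_value R z ps)"
      by (subst finsum_reindex) (use z zc in \<open>auto simp: inj_on_def\<close>)
    then show "(\<Oplus>ps\<in>(#) p ` ?M. word_value R z ps) = z p \<otimes> (\<Oplus>ps\<in>?M. word_value R z ps)"
      using finsum_rdistr[OF fin zc] z by simp
  qed (use z zc in auto)
  also have "\<dots> = (\<Oplus>p\<in>?P. z p) \<otimes> (\<Oplus>ps\<in>?M. word_value R z ps)"
    by (rule finsum_ldistr[symmetric]) (use E z zc in auto)
  finally show ?case unfolding M using Cons by simp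
qed

text \<open>Substituting for \<open>X\<^sub>i\<close> the sum of those \<open>Z\<^sub>p\<close>, \<open>p \<in> E\<close>, such that the word \<open>w\<close> has the letter \<open>i\<close> at
  position \<open>p\<close>, and running through all sets \<open>E\<close>, isolates the part of degree one in each \<open>Z\<^sub>p\<close>.\<close>

theorem multilinear_identity:
  fixes R (structure)
  assumes R: "ring R" and f: "monic_identity R d f"
  shows "\<exists>g. monic_identity R d g \<and> (\<forall>u. g u ~= 0 \<longrightarrow> distinct u \<and> set u = {..<d})"
proof -
  interpret ring R by fact
  note f' = f[unfolded monic_identity_iff]
  obtain w where w: "length w = d" "f w = 1" using f' by blast
  \<comment> \<open>\<open>c p\<close> is the letter of w at position p. The new indeterminates are
    positions, and they will be restricted to those below d.\<close>
  define c where "c = (!) w"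
  define g where "g u = (if distinct u \<and> set u = {..<d} then f (map c u) else 0)" for u
  let ?t = "\<lambda>z ps. [f (map c ps)] \<cdot> word_value R z ps"
  \<comment> \<open>\<open>?S E\<close> consists of the words in letters from E, \<open>?H E\<close>
    of those using every letter of E; only the former arise directly from substitutions.\<close>
  let ?S = "\<lambda>E. {ps. set ps \<subseteq> E \<and> f (map c ps) ~= 0}" and ?H = "\<lambda>E. {ps. set ps = E \<and> f (map c ps) ~= 0}"
  have finS: "finite (?S E)" if "finite E" for E
    by (rule finite_subset[OF _ finite_lists_length_le[OF that, of d]]) (use f' in force)
  have S0: "(\<Oplus>ps\<in>?S E. ?t z ps) = \<zero>" if E: "finite E" and z: "range z \<subseteq> carrier R" for E z
  proof -
    let ?M = "\<lambda>u. {ps. set ps \<subseteq> E \<and> map c ps = u}" and ?v = "\<lambda>i. \<Oplus>p\<in>{p \<in> E. c p = i}. z p"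
    have v: "range ?v \<subseteq> carrier R" using z by (auto intro!: finsum_closed)
    have finM: "finite (?M u)" for u
      by (rule finite_subset[OF _ finite_lists_length_eq[OF E, of "length u"]]) auto
    have S: "?S E = (\<Union>u\<in>{u. f u ~= 0}. ?M u)" by auto
    have "(\<Oplus>ps\<in>?S E. ?t z ps) = (\<Oplus>u\<in>{u. f u ~= 0}. \<Oplus>ps\<in>?M u. ?t z ps)"
      unfolding S by (rule add.finprod_UN_disjoint) (use f' finM z in \<open>auto simp: pairwise_def disjnt_def\<close>)
    also have "\<dots> = (\<Oplus>u\<in>{u. f u ~= 0}. [f u] \<cdot> word_value R ?v u)"
    proof (rule finsum_cong')
      fix u
      have "(\<Oplus>ps\<in>?M u. ?t z ps) = (\<Oplus>ps\<in>?M u. [f u] \<cdot> word_value R z ps)"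
        by (rule finsum_cong') (use z in auto)
      then show "(\<Oplus>ps\<in>?M u. ?t z ps) = [f u] \<cdot> word_value R ?v u"
        unfolding word_value_sum[OF E z] using int_add_pow_finsum[of "word_value R z" "?M u" "f u"] z by simp
    qed (use v in auto)
    also have "\<dots> = \<zero>" using f' v unfolding poly_value_def by blast
    finally show ?thesis .
  qed
  \<comment> \<open>The words over E are sorted by the set of letters they use. By induction all
    proper subsets contribute zero, so the part using all of E is zero as well; this replaces
    inclusion and exclusion with signs.\<close>
  have H0: "(\<Oplus>ps\<in>?H E. ?t z ps) = \<zero>" if E: "finite E" and z: "range z \<subseteq> carrier R" for E z
    using E
  proof (induct rule: finite_psubset_induct)
    case (psubset E)
    have fin: "finite (?H E')" if "E' \<subseteq> E" for E'
      by (rule finite_subset[OF _ finS[OF psubset(1)]]) (use that in auto)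
    have S: "?S E = (\<Union>E'\<in>Pow E. ?H E')" by auto
    have "\<zero> = (\<Oplus>E'\<in>Pow E. \<Oplus>ps\<in>?H E'. ?t z ps)"
      unfolding S0[OF psubset(1) z, symmetric] S
      by (rule add.finprod_UN_disjoint) (use psubset(1) fin z in \<open>auto simp: pairwise_def disjnt_def\<close>)
    also have "\<dots> = (\<Oplus>E'\<in>insert E (Pow E - {E}). \<Oplus>ps\<in>?H E'. ?t z ps)"
      by (rule arg_cong[of _ _ "finsum R _"]) auto
    also have "\<dots> = (\<Oplus>ps\<in>?H E. ?t z ps) \<oplus> (\<Oplus>E'\<in>Pow E - {E}. \<Oplus>ps\<in>?H E'. ?t z ps)"
      by (rule finsum_insert) (use psubset(1) z in \<open>auto intro!: finsum_closed\<close>)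
    also have "(\<Oplus>E'\<in>Pow E - {E}. \<Oplus>ps\<in>?H E'. ?t z ps) = (\<Oplus>E'\<in>Pow E - {E}. \<zero>)"
      by (rule finsum_cong') (use psubset(2) in auto)
    finally show ?case using z by (simp add: finsum_closed)
  qed
  \<comment> \<open>Words of length at most d that use d different letters use each of them exactly
    once.\<close>
  have supp: "{u. g u ~= 0} = ?H {..<d}"
  proof (intro equalityI subsetI)
    fix u assume u: "u \<in> ?H {..<d}"
    then have "length u \<le> d" using f' by force
    then have "card (set u) = length u" using u card_length[of u] by auto
    then have "distinct u" by (rule card_distinct)
    then show "u \<in> {u. g u ~= 0}" using u unfolding g_def by auto
  qed (auto simp: g_def split: if_splits)
  have "poly_value R g z = \<zero>" if z: "range z \<subseteq> carrier R" for z
  proof -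
    have "poly_value R g z = (\<Oplus>ps\<in>?H {..<d}. ?t z ps)"
      unfolding poly_value_def supp[symmetric]
      by (rule finsum_cong') (use z in \<open>auto simp: g_def split: if_splits\<close>)
    then show ?thesis using H0 z by simp
  qed
  moreover have "finite {u. g u ~= 0}" unfolding supp by (rule finite_subset[OF _ finS[of "{..<d}"]]) auto
  \<comment> \<open>The positions of w in their natural order give back w, so the monic coefficient
    survives.\<close>
  moreover have "map c [0..<d] = w" unfolding c_def using w(1) map_nth by blast
  then have "length [0..<d] = d \<and> g [0..<d] = 1" using w(2) by (auto simp: g_def)
  moreover have sup: "distinct u \<and> set u = {..<d}" if "g u ~= 0" for u using that unfolding g_def by metis
  moreover have "length u \<le> d" if "g u ~= 0" for u
    using sup[OF that] distinct_card[of u] by simp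
  ultimately show ?thesis unfolding monic_identity_iff by blast
qed

text \<open>After normalising one \<open>p u\<close> to 1, subtracting the conjugate by \<open>t\<close> of the system from its shift
  eliminates one summand.\<close>

lemma inverse_power_relation:
  fixes Q (structure)
  assumes Q: "division_ring Q" and t: "t \<in> Units Q" and "finite G"
    and "\<And>u. u \<in> G ==> p u \<in> carrier Q" "\<And>u. u \<in> G ==> r u \<in> carrier Q"
    and "\<And>N::nat. (\<Oplus>u\<in>G. p u \<otimes> (t [^] N \<otimes> r u)) = \<zero>"
  shows "(\<Oplus>u\<in>G. p u \<otimes> (inv t \<otimes> r u)) = \<zero>"
  using assms(3-6)
proof (induct G arbitrary: p rule: finite_induct)
  case empty
  interpret ring Q using Q unfolding division_ring_def by blast
  show ?case by simp
next
  case (insert u0 G)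
  interpret ring Q using Q unfolding division_ring_def by blast
  have tc: "t \<in> carrier Q" "inv t \<in> carrier Q" using t by auto
  have r: "r u0 \<in> carrier Q" "\<And>u. u \<in> G ==> r u \<in> carrier Q" and p: "p u0 \<in> carrier Q" "\<And>u. u \<in> G ==> p u \<in> carrier Q"
    using insert by auto
  have expand: "(\<Oplus>u\<in>insert u0 G. p u \<otimes> (s \<otimes> r u)) =
      p u0 \<otimes> (s \<otimes> r u0) \<oplus> (\<Oplus>u\<in>G. p u \<otimes> (s \<otimes> r u))" if "s \<in> carrier Q" for s
    by (rule finsum_insert) (use insert(1,2) r p that in auto)
  show ?case
  proof (cases "p u0 = \<zero>")
    case True
    have e: "(\<Oplus>u\<in>insert u0 G. p u \<otimes> (s \<otimes> r u)) = (\<Oplus>u\<in>G. p u \<otimes> (s \<otimes> r u))" if "s \<in> carrier Q" for s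
      unfolding expand[OF that] using True r p that by (simp add: finsum_closed)
    have "(\<Oplus>u\<in>G. p u \<otimes> (t [^] N \<otimes> r u)) = \<zero>" for N :: nat
      using insert(6)[of N] e[of "t [^] N"] tc by simp
    from insert(3)[OF p(2) r(2) this] show ?thesis using e tc by simp
  next
    case False
    then have p0: "p u0 \<in> Units Q" using Q p(1) unfolding division_ring_def by blast
    define a where "a = inv p u0"
    have a: "a \<in> carrier Q" "a \<otimes> p u0 = \<one>" "p u0 \<otimes> a = \<one>" using p0 by (auto simp: a_def)
    \<comment> \<open>Normalized so that the coefficient of the distinguished summand u0 is
      1.\<close>
    let ?q = "\<lambda>u. a \<otimes> p u"
    define F where "F s = (\<Oplus>u\<in>G. ?q u \<otimes> (s \<otimes> r u))" for s
    have Fc: "F s \<in> carrier Q" if "s \<in> carrier Q" for s unfolding F_def using a p r that by (auto intro!: finsum_closed)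
    have scale: "a \<otimes> (\<Oplus>u\<in>insert u0 G. p u \<otimes> (s \<otimes> r u)) = s \<otimes> r u0 \<oplus> F s" if s: "s \<in> carrier Q" for s
    proof -
      have "a \<otimes> (\<Oplus>u\<in>G. p u \<otimes> (s \<otimes> r u)) = (\<Oplus>u\<in>G. a \<otimes> (p u \<otimes> (s \<otimes> r u)))"
        by (rule finsum_rdistr) (use insert(1) a p r s in auto)
      also have "\<dots> = F s" unfolding F_def by (rule finsum_cong') (use a p r s in \<open>auto simp: m_assoc\<close>)
      finally have "a \<otimes> (\<Oplus>u\<in>G. p u \<otimes> (s \<otimes> r u)) = F s" .
      moreover have "a \<otimes> (p u0 \<otimes> (s \<otimes> r u0)) = s \<otimes> r u0"
        using a p(1) r(1) s by (simp flip: m_assoc)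
      moreover have "(\<Oplus>u\<in>G. p u \<otimes> (s \<otimes> r u)) \<in> carrier Q" using p r s by (auto intro!: finsum_closed)
      ultimately show ?thesis unfolding expand[OF s] using a p(1) r(1) s by (simp add: r_distr)
    qed
    have eq: "t [^] N \<otimes> r u0 \<oplus> F (t [^] N) = \<zero>" for N :: nat
      using scale[of "t [^] N"] insert(6)[of N] tc a by simp
    \<comment> \<open>F(ts) - tF(s) is again a sum of the given shape, but over the smaller set G:
      the summand u0 has coefficient 1, which commutes with t, and drops out.\<close>
    have diff: "(\<Oplus>u\<in>G. (?q u \<otimes> t \<ominus> t \<otimes> ?q u) \<otimes> (s \<otimes> r u)) = F (t \<otimes> s) \<ominus> t \<otimes> F s" if s: "s \<in> carrier Q" for s
    proof -
      have tF: "\<ominus> t \<otimes> F s = (\<Oplus>u\<in>G. \<ominus> t \<otimes> (?q u \<otimes> (s \<otimes> r u)))"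
        unfolding F_def by (rule finsum_rdistr) (use insert(1) a p r s tc in auto)
      have "(\<Oplus>u\<in>G. (?q u \<otimes> t \<ominus> t \<otimes> ?q u) \<otimes> (s \<otimes> r u)) =
          (\<Oplus>u\<in>G. ?q u \<otimes> ((t \<otimes> s) \<otimes> r u) \<oplus> \<ominus> t \<otimes> (?q u \<otimes> (s \<otimes> r u)))"
        by (rule finsum_cong') (use a p r s tc in \<open>auto simp: a_minus_def l_distr l_minus m_assoc\<close>)
      also have "\<dots> = F (t \<otimes> s) \<oplus> \<ominus> t \<otimes> F s"
        unfolding tF unfolding F_def by (rule finsum_addf) (use a p r s tc in auto)
      finally show ?thesis using Fc[OF s] tc by (simp add: a_minus_def l_minus)
    qed
    have "(\<Oplus>u\<in>G. (?q u \<otimes> t \<ominus> t \<otimes> ?q u) \<otimes> (t [^] N \<otimes> r u)) = \<zero>" for N :: nat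
    proof -
      let ?s = "t [^] N"
      have sc: "?s \<in> carrier Q" using tc by simp
      have "t \<otimes> ?s \<otimes> r u0 \<oplus> F (t \<otimes> ?s) = \<zero>" using eq[of "Suc N"] unfolding nat_pow_Suc2[OF tc(1)] .
      then have 1: "F (t \<otimes> ?s) = \<ominus> (t \<otimes> ?s \<otimes> r u0)"
        using Fc[of "t \<otimes> ?s"] tc sc r(1) by (metis minus_equality m_closed a_comm minus_minus)
      have 2: "F ?s = \<ominus> (?s \<otimes> r u0)"
        using eq[of N] Fc[of ?s] tc sc r(1) by (metis minus_equality m_closed a_comm minus_minus)
      show ?thesis unfolding diff[OF sc] 1 2 using tc sc r(1) by (simp add: a_minus_def r_minus m_assoc r_neg l_neg)
    qed
    \<comment> \<open>The induction hypothesis at t^-1 gives F(1) = t F(t^-1). Together with the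
      relation for exponent 0 this is the claim multiplied from the left by t.\<close>
    from insert(3)[OF _ r(2) this] a p tc
    have "F (t \<otimes> inv t) \<ominus> t \<otimes> F (inv t) = \<zero>" unfolding diff[OF tc(2)] by simp
    then have 3: "F \<one> = t \<otimes> F (inv t)" using t tc Fc by simp
    have "r u0 \<oplus> F \<one> = \<zero>" using eq[of 0] r(1) by simp
    then have "inv t \<otimes> (r u0 \<oplus> t \<otimes> F (inv t)) = \<zero>" unfolding 3 using tc by simp
    then have "inv t \<otimes> r u0 \<oplus> F (inv t) = \<zero>"
      using r(1) t tc Fc[OF tc(2)] by (simp add: r_distr flip: m_assoc)
    then have z: "a \<otimes> (\<Oplus>u\<in>insert u0 G. p u \<otimes> (inv t \<otimes> r u)) = \<zero>" unfolding scale[OF tc(2)] .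
    have Sc: "(\<Oplus>u\<in>insert u0 G. p u \<otimes> (inv t \<otimes> r u)) \<in> carrier Q" using p r tc by (auto intro!: finsum_closed)
    have "p u0 \<otimes> (a \<otimes> (\<Oplus>u\<in>insert u0 G. p u \<otimes> (inv t \<otimes> r u))) = \<zero>" unfolding z using p(1) by simp
    then show ?thesis using a p(1) Sc by (simp flip: m_assoc)
  qed
qed

lemma alg_hom_poly_value:
  assumes "ring A" "ring B" and f: "f \<in> alg_hom K A B" and v: "range v \<subseteq> carrier A"
  shows "f (poly_value A g v) = poly_value B g (\<lambda>i. f (v i))"
proof -
  interpret A: ring A by fact
  interpret B: ring B by fact
  note h = alg_homD[OF f]
  have w: "f (word_value A v w) = word_value B (\<lambda>i. f (v i)) w" for w
    using v by (induct w) (auto simp: h(2,4) image_subset_iff)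
  have fv: "range (\<lambda>i. f (v i)) \<subseteq> carrier B" using v h(1) by auto
  have "group_hom (add_monoid A) (add_monoid B) f"
    by (intro group_hom.intro group_hom_axioms.intro A.a_group B.a_group) (use h(1,3) in \<open>auto simp: hom_def\<close>)
  then have k: "f ([(k::int)] \<cdot>\<^bsub>A\<^esub> x) = [k] \<cdot>\<^bsub>B\<^esub> f x" if "x \<in> carrier A" for k x
    unfolding add_pow_def using group_hom.hom_int_pow that by fastforce
  have "f (poly_value A g v) = (\<Oplus>\<^bsub>B\<^esub>w\<in>{w. g w ~= 0}. f ([g w] \<cdot>\<^bsub>A\<^esub> word_value A v w))"
    unfolding poly_value_def by (rule alg_hom_finsum[OF assms(1-3)]) (use v in auto)
  also have "\<dots> = poly_value B g (\<lambda>i. f (v i))"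
    unfolding poly_value_def by (rule B.finsum_cong') (use k w v fv in auto)
  finally show ?thesis .
qed

section \<open>Identities of a ring and of its division ring of fractions\<close>

context fractions_over
begin

interpretation C: nc_algebra K C by (rule algC)
interpretation QQ: ring Q.Q by (rule Q.Q_ring)

lemma identity_restrict:
  assumes f: "monic_identity Q.Q d f" shows "monic_identity C d f"
proof -
  have "poly_value C f v = \<zero>\<^bsub>C\<^esub>" if v: "range v \<subseteq> carrier C" for v
  proof -
    let ?e = "\<lambda>a. Q.lemb (\<theta> a)"
    have "range (\<lambda>i. ?e (v i)) \<subseteq> carrier Q.Q" using v alg_homD(1)[OF emb(1)] by blast
    then have "?e (poly_value C f v) = \<zero>\<^bsub>Q.Q\<^esub>"
      using f alg_hom_poly_value[OF C.A.ring_axioms QQ.ring_axioms emb(1) v, of f] unfolding monic_identity_iff by simp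
    moreover have "poly_value C f v \<in> carrier C"
      unfolding poly_value_def using v by (auto intro!: C.A.finsum_closed)
    ultimately show ?thesis
      using inj_onD[OF emb(2), of "poly_value C f v" "\<zero>\<^bsub>C\<^esub>"] alg_hom_zero[OF C.A.ring_axioms QQ.ring_axioms emb(1)]
      by simp
  qed
  then show ?thesis using f unfolding monic_identity_iff by blast
qed

text \<open>The identity is first made multilinear, which keeps its degree. Then the variables are
  freed one at a time: m counts those with arbitrary values, and the others still take values in the
  image of C.\<close>

lemma identity_extend:
  assumes f: "monic_identity C d f" shows "\<exists>g. monic_identity Q.Q d g"
proof -
  obtain g where g: "monic_identity C d g" "\<And>u. g u ~= 0 ==> distinct u \<and> set u = {..<d}"
    using multilinear_identity[OF C.A.ring_axioms f] by blast
  let ?e = "\<lambda>a. Q.lemb (\<theta> a)" and ?G = "{u. g u ~= 0}"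
  have fin: "finite ?G" using g(1) unfolding monic_identity_iff by blast
  note e = alg_homD[OF emb(1)]
  have "poly_value Q.Q g z = \<zero>\<^bsub>Q.Q\<^esub>"
    if "m \<le> d" "range z \<subseteq> carrier Q.Q" "\<And>i. i \<ge> m ==> z i \<in> ?e ` carrier C" for m z
    using that
  proof (induct m arbitrary: z)
    case 0
    then have "\<forall>i. \<exists>a \<in> carrier C. z i = ?e a" by blast
    then obtain a where a: "\<And>i. a i \<in> carrier C" "\<And>i. z i = ?e (a i)" by metis
    have ext: "z = (\<lambda>i. ?e (a i))" using a(2) by blast
    have v: "range a \<subseteq> carrier C" using a by auto
    have "poly_value Q.Q g z = ?e (poly_value C g a)"
      using alg_hom_poly_value[OF C.A.ring_axioms QQ.ring_axioms emb(1) v, of g] unfolding ext[symmetric] by (rule sym)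
    also have "\<dots> = ?e \<zero>\<^bsub>C\<^esub>" using g(1) v unfolding monic_identity_iff by simp
    finally show ?case using alg_hom_zero[OF C.A.ring_axioms QQ.ring_axioms emb(1)] by simp
  next
    case (Suc m)
    have zc: "z i \<in> carrier Q.Q" for i using Suc(3) by blast
    obtain b a where b: "b \<in> carrier C" "b ~= \<zero>\<^bsub>C\<^esub>" "a \<in> carrier C" "z m \<otimes>\<^bsub>Q.Q\<^esub> ?e b = ?e a"
      using emb_fraction[OF zc] by blast
    define t where "t = ?e b"
    have t: "t \<in> Units Q.Q" unfolding t_def using emb_unit b by blast
    have tc: "t \<in> carrier Q.Q" "inv\<^bsub>Q.Q\<^esub> t \<in> carrier Q.Q" using t by (blast intro: QQ.Units_closed QQ.Units_inv_closed)+
    have ac: "?e a \<in> carrier Q.Q" by (rule e(1)[OF b(3)])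
    have "?e a \<otimes>\<^bsub>Q.Q\<^esub> inv\<^bsub>Q.Q\<^esub> t = (z m \<otimes>\<^bsub>Q.Q\<^esub> t) \<otimes>\<^bsub>Q.Q\<^esub> inv\<^bsub>Q.Q\<^esub> t" unfolding b(4)[symmetric] t_def ..
    then have zm: "z m = ?e a \<otimes>\<^bsub>Q.Q\<^esub> inv\<^bsub>Q.Q\<^esub> t"
      using QQ.m_assoc[OF zc[of m] tc] QQ.Units_r_inv[OF t] QQ.r_one[OF zc] by metis
    \<comment> \<open>By multilinearity the variable m occurs exactly once in each word; these are
      the parts before and after it. So the value is a sum of the shape treated in
      \<open>inverse_power_relation\<close>.\<close>
    let ?l = "takeWhile (\<lambda>i. i ~= m)" and ?r = "\<lambda>u. tl (dropWhile (\<lambda>i. i ~= m) u)"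
    let ?p = "\<lambda>u. [g u] \<cdot>\<^bsub>Q.Q\<^esub> word_value Q.Q z (?l u)" and ?q = "\<lambda>u. word_value Q.Q z (?r u)"
    note wc = QQ.word_value_closed[OF Suc(3)]
    have pc: "?p u \<in> carrier Q.Q" for u by (rule QQ.int_add_pow_closed[OF wc])
    have val: "poly_value Q.Q g (z(m := x)) = (\<Oplus>\<^bsub>Q.Q\<^esub>u\<in>?G. ?p u \<otimes>\<^bsub>Q.Q\<^esub> (x \<otimes>\<^bsub>Q.Q\<^esub> ?q u))"
      if x: "x \<in> carrier Q.Q" for x
      unfolding poly_value_def
    proof (rule QQ.finsum_cong')
      fix u assume u: "u \<in> ?G"
      have "m \<in> set u" "distinct u" using g(2)[of u] u Suc(2) by auto
      then obtain u1 u2 where s: "u = u1 @ m # u2" "m \<notin> set u1" "m \<notin> set u2" by (metis split_list distinct.simps(2) distinct_append not_distinct_conv_prefix split_list_first)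
      then have l: "?l u = u1" "?r u = u2" by (auto simp: takeWhile_append dropWhile_append)
      have rx: "range (z(m := x)) \<subseteq> carrier Q.Q" using zc x by (auto simp del: Q.Q_simps)
      have w: "word_value Q.Q (z(m := x)) u1 = word_value Q.Q z u1" "word_value Q.Q (z(m := x)) u2 = word_value Q.Q z u2"
        by (rule word_value_cong; use s in auto)+
      have "word_value Q.Q (z(m := x)) u = word_value Q.Q z u1 \<otimes>\<^bsub>Q.Q\<^esub> (x \<otimes>\<^bsub>Q.Q\<^esub> word_value Q.Q z u2)"
        unfolding s(1) QQ.word_value_append[OF rx] word_value_simps w by simp
      then show "[g u] \<cdot>\<^bsub>Q.Q\<^esub> word_value Q.Q (z(m := x)) u = ?p u \<otimes>\<^bsub>Q.Q\<^esub> (x \<otimes>\<^bsub>Q.Q\<^esub> ?q u)"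
        unfolding l using QQ.add_pow_ldistr_int[OF wc QQ.m_closed[OF x wc]] by metis
    next
      show "(\<lambda>u. ?p u \<otimes>\<^bsub>Q.Q\<^esub> (x \<otimes>\<^bsub>Q.Q\<^esub> ?q u)) \<in> ?G \<rightarrow> carrier Q.Q"
        by (intro Pi_I QQ.m_closed pc x wc)
    qed simp
    have assoc: "?p u \<otimes>\<^bsub>Q.Q\<^esub> ((?e a \<otimes>\<^bsub>Q.Q\<^esub> s) \<otimes>\<^bsub>Q.Q\<^esub> ?q u) = (?p u \<otimes>\<^bsub>Q.Q\<^esub> ?e a) \<otimes>\<^bsub>Q.Q\<^esub> (s \<otimes>\<^bsub>Q.Q\<^esub> ?q u)"
      if "s \<in> carrier Q.Q" for s u
      using pc[of u] ac that wc[of "?r u"] by (simp only: QQ.m_assoc QQ.m_closed)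
    \<comment> \<open>For the value a b^N of variable m, an element of C, the identity is known by
      induction. The true value is a b^-1, which \<open>inverse_power_relation\<close>
      reaches.\<close>
    have "(\<Oplus>\<^bsub>Q.Q\<^esub>u\<in>?G. (?p u \<otimes>\<^bsub>Q.Q\<^esub> ?e a) \<otimes>\<^bsub>Q.Q\<^esub> (t [^]\<^bsub>Q.Q\<^esub> N \<otimes>\<^bsub>Q.Q\<^esub> ?q u)) = \<zero>\<^bsub>Q.Q\<^esub>" for N :: nat
    proof -
      have tN: "t [^]\<^bsub>Q.Q\<^esub> N \<in> carrier Q.Q" by (rule QQ.nat_pow_closed[OF tc(1)])
      let ?x = "?e a \<otimes>\<^bsub>Q.Q\<^esub> t [^]\<^bsub>Q.Q\<^esub> N"
      have "?x = ?e (a \<otimes>\<^bsub>C\<^esub> b [^]\<^bsub>C\<^esub> N)"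
        unfolding t_def using e(2)[of a "b [^]\<^bsub>C\<^esub> N"] b(1,3) alg_hom_pow[OF C.A.ring_axioms QQ.ring_axioms emb(1) b(1), of N] by simp
      then have xC: "?x \<in> ?e ` carrier C" using b(1,3) by blast
      have x: "?x \<in> carrier Q.Q" by (rule QQ.m_closed[OF ac tN])
      have "poly_value Q.Q g (z(m := ?x)) = \<zero>\<^bsub>Q.Q\<^esub>"
      proof (rule Suc(1))
        show "range (z(m := ?x)) \<subseteq> carrier Q.Q" using zc x by (auto simp del: Q.Q_simps)
        show "(z(m := ?x)) i \<in> ?e ` carrier C" if "i \<ge> m" for i using xC Suc(4)[of i] that by (cases "i = m") (auto simp del: Q.Q_simps)
      qed (use Suc(2) in simp)
      then show ?thesis unfolding val[OF x] assoc[OF tN] .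
    qed
    from inverse_power_relation[OF Q.Q_division t fin QQ.m_closed[OF pc ac] wc this]
    have "poly_value Q.Q g (z(m := ?e a \<otimes>\<^bsub>Q.Q\<^esub> inv\<^bsub>Q.Q\<^esub> t)) = \<zero>\<^bsub>Q.Q\<^esub>"
      unfolding val[OF QQ.m_closed[OF ac tc(2)]] assoc[OF tc(2)] .
    then show ?case unfolding zm[symmetric] by simp
  qed
  note claim = this
  have "poly_value Q.Q g z = \<zero>\<^bsub>Q.Q\<^esub>" if z: "range z \<subseteq> carrier Q.Q" for z
  proof -
    \<comment> \<open>The claim for m = d wants values from C at all indices from d on. The words
      contain only letters below d, so the image of 1 may be substituted there.\<close>
    let ?z = "\<lambda>i. if i < d then z i else ?e \<one>\<^bsub>C\<^esub>"
    have rz: "range ?z \<subseteq> carrier Q.Q" using z e(1)[of "\<one>\<^bsub>C\<^esub>"] by (auto simp del: Q.Q_simps)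
    have "poly_value Q.Q g z = poly_value Q.Q g ?z"
      unfolding poly_value_def
    proof (rule QQ.finsum_cong')
      fix u assume "u \<in> ?G"
      then have "set u = {..<d}" using g(2) by blast
      then show "[g u] \<cdot>\<^bsub>Q.Q\<^esub> word_value Q.Q z u = [g u] \<cdot>\<^bsub>Q.Q\<^esub> word_value Q.Q ?z u"
        by (intro arg_cong[of _ _ "add_pow Q.Q (g u)"] word_value_cong) auto
    qed (auto intro!: QQ.int_add_pow_closed QQ.word_value_closed rz simp del: Q.Q_simps)
    also have "\<dots> = \<zero>\<^bsub>Q.Q\<^esub>" by (rule claim[of d]) (use rz in \<open>auto simp del: Q.Q_simps\<close>)
    finally show ?thesis .
  qed
  then show ?thesis using g(1) unfolding monic_identity_iff by blast
qed

theorem identity_degrees: "(\<exists>f. monic_identity C d f) \<longleftrightarrow> (\<exists>f. monic_identity Q.Q d f)"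
  using identity_restrict identity_extend by blast

end

theorem theorem4p6:
  fixes K :: "'k ring"
    and A :: "('k, 'a) module"
    and S :: "nat \<Rightarrow> 'a set" and R :: "'a set"
    and n :: nat
    and x :: "nat \<Rightarrow> 'a"
    and \<tau> \<delta> :: "nat \<Rightarrow> 'a \<Rightarrow> 'a"
    and lam :: "nat \<Rightarrow> nat \<Rightarrow> 'k"
    and q :: "nat \<Rightarrow> 'k"
  assumes K: "field K"
    and A: "iterated_skew_polynomial_ring K A S n x \<tau> \<delta>"
    and R: "R = S 0"
    and R_noetherian: "nc_noetherian (A\<lparr>carrier := R\<rparr>)"
    and R_domain: "nc_domain (A\<lparr>carrier := R\<rparr>)"
    and tau_R: "\<forall>i\<in>{1..n}. \<tau> i ` R \<subseteq> R"
    and lam: "\<forall>i\<in>{1..n}. \<forall>j\<in>{1..<i}. lam i j \<in> carrier K - {\<zero>\<^bsub>K\<^esub>}"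
    and tau_x: "\<forall>i\<in>{1..n}. \<forall>j\<in>{1..<i}. \<tau> i (x j) = lam i j \<odot>\<^bsub>A\<^esub> x j"
    and q: "\<forall>i\<in>{1..n}. q i \<in> carrier K - {\<zero>\<^bsub>K\<^esub>} \<and> q i \<noteq> \<one>\<^bsub>K\<^esub>"
    and q_skew: "\<forall>i\<in>{1..n}. \<forall>s\<in>S (i - 1). \<delta> i (\<tau> i s) = q i \<odot>\<^bsub>A\<^esub> \<tau> i (\<delta> i s)"
    and higher: "\<forall>i\<in>{1..n}. \<exists>d.
          higher_skew_derivation K (A\<lparr>carrier := S (i - 1)\<rparr>) (q i) (\<tau> i) d \<and>
          (\<forall>s\<in>S (i - 1). d 1 s = \<delta> i s) \<and>
          locally_nilpotent (A\<lparr>carrier := S (i - 1)\<rparr>) d \<and>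
          iterative K (A\<lparr>carrier := S (i - 1)\<rparr>) (q i) d"
  shows "\<exists>(L :: ('k, (nat \<Rightarrow> int) \<Rightarrow> 'a) module) U \<iota> y \<tau>'.
      iterated_skew_laurent_ring K L U n y \<tau>' \<and>
      \<iota> \<in> alg_iso K (A\<lparr>carrier := R\<rparr>) (L\<lparr>carrier := U 0\<rparr>) \<and>
      (\<forall>i\<in>{1..n}. \<forall>r\<in>R. \<tau>' i (\<iota> r) = \<iota> (\<tau> i r)) \<and>
      (\<forall>i\<in>{1..n}. \<forall>j\<in>{1..<i}. \<tau>' i (y j) = lam i j \<odot>\<^bsub>L\<^esub> y j) \<and>
      (\<exists>T t (B :: ('k, ('a \<times> 'a) set) module) \<phi> h.
          t ` {1..n} \<subseteq> carrier A \<and> T = mult_set_generated A (t ` {1..n}) \<and> ore_set A T \<and>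
          right_localization K A T B \<phi> \<and> h \<in> alg_iso K B L) \<and>
      (\<exists>V P. P = L\<lparr>carrier := V n\<rparr> \<and> V 0 = U 0 \<and>
          iterated_skew_polynomial_ring K P V n y \<tau>' (\<lambda>i s. \<zero>\<^bsub>L\<^esub>) \<and>
          PI_degree_parity A P \<and>
          (\<exists>(Q\<^sub>A :: ('k, ('a \<times> 'a) set) module) \<phi>\<^sub>A
             (Q\<^sub>P :: ('k, (((nat \<Rightarrow> int) \<Rightarrow> 'a) \<times> ((nat \<Rightarrow> int) \<Rightarrow> 'a)) set) module) \<phi>\<^sub>P g.
             division_ring_of_fractions K A Q\<^sub>A \<phi>\<^sub>A \<and>
             division_ring_of_fractions K P Q\<^sub>P \<phi>\<^sub>P \<and>
             g \<in> alg_iso K Q\<^sub>A Q\<^sub>P))"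
proof -
  obtain d where d: "\<forall>i\<in>{1..n}. higher_skew_derivation K (A\<lparr>carrier := S (i - 1)\<rparr>) (q i) (\<tau> i) (d i) \<and>
      (\<forall>s\<in>S (i - 1). d i 1 s = \<delta> i s) \<and> locally_nilpotent (A\<lparr>carrier := S (i - 1)\<rparr>) (d i) \<and>
      iterative K (A\<lparr>carrier := S (i - 1)\<rparr>) (q i) (d i)"
    using bchoice[OF higher] by blast
  interpret tower K A S n x \<tau> \<delta> lam q d
    by (rule tower.intro) (use A R_domain tau_R lam tau_x q d R in auto)
  have An: "A\<lparr>carrier := S n\<rparr> = A" by (simp add: Sn)
  \<comment> \<open>The Noetherian hypothesis enters through the Ore conditions that it gives for R;
    these climb the tower by leading coefficients.\<close>
  have R_ore: "left_ore (A\<lparr>carrier := S 0\<rparr>)" "right_ore (A\<lparr>carrier := S 0\<rparr>)"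
    using noetherian_left_ore noetherian_right_ore R_domain R_noetherian R by auto
  have A_ore: "nc_domain A" "left_ore A" "right_ore A"
    using iterated_skew_polynomial_ore[OF A _ R_ore] R_domain R unfolding An by auto
  obtain L U V y \<tau>' \<theta> \<iota> t where st: "stage n L U V y \<tau>' \<theta> \<iota> t" using stage_exists[of n] by blast
  note st' = st[unfolded stage_def An Sn]
  note s1 = conjunct1[OF st'] and s2 = conjunct1[OF conjunct2[OF st']]
    and s3 = conjunct1[OF conjunct2[OF conjunct2[OF st']]]
    and s4 = conjunct1[OF conjunct2[OF conjunct2[OF conjunct2[OF st']]]]
  have L: "nc_algebra K L" "U n = carrier L" "V 0 = U 0" using s1 by auto
  have subU: "subalg K L (U j)" and subV: "subalg K L (V j)" if "j \<le> n" for j using s1 that by auto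
  interpret LA: nc_algebra K L by (rule L)
  interpret AA: nc_algebra K A by (rule algA)
  let ?T = "mult_set_generated A (t ` {1..n})"
  have \<theta>: "\<theta> \<in> alg_hom K A L" "inj_on \<theta> (carrier A)" "t ` {1..n} \<subseteq> carrier A"
    and T: "\<And>s. s \<in> ?T ==> \<theta> s \<in> Units L" "\<And>l. l \<in> carrier L ==> \<exists>s\<in>?T. \<theta> s \<otimes>\<^bsub>L\<^esub> l \<in> \<theta> ` carrier A"
      "\<And>l. l \<in> carrier L ==> \<exists>s\<in>?T. l \<otimes>\<^bsub>L\<^esub> \<theta> s \<in> \<theta> ` carrier A" using s3 by auto
  have Tsub: "submonoid ?T A" by (rule mult_set_generated_submonoid[OF AA.A.monoid_axioms \<theta>(3)])
  then have TA: "?T \<subseteq> carrier A" by (rule submonoid.subset)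
  have domL: "nc_domain L"
  proof (rule domain_of_fractions[OF A_ore(1) LA.A.ring_axioms \<theta>(1,2)])
    show "\<exists>s\<in>carrier A. \<theta> s \<in> Units L \<and> \<theta> s \<otimes>\<^bsub>L\<^esub> l \<in> \<theta> ` carrier A" if "l \<in> carrier L" for l
      using T(1) T(2)[OF that] TA by blast
    show "\<exists>s\<in>carrier A. \<theta> s \<in> Units L \<and> l \<otimes>\<^bsub>L\<^esub> \<theta> s \<in> \<theta> ` carrier A" if "l \<in> carrier L" for l
      using T(1) T(3)[OF that] TA by blast
  qed
  note LD = nc_domainD(2,3)[OF domL]
  have zero_unit: "\<zero>\<^bsub>L\<^esub> \<notin> Units L" using LA.A.Units_l_inv[of "\<zero>\<^bsub>L\<^esub>"] LA.A.Units_inv_closed[of "\<zero>\<^bsub>L\<^esub>"] LD(1) by auto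
  have "\<theta> \<zero>\<^bsub>A\<^esub> = \<zero>\<^bsub>L\<^esub>" by (rule alg_hom_zero[OF AA.A.ring_axioms LA.A.ring_axioms \<theta>(1)])
  then have T0: "s ~= \<zero>\<^bsub>A\<^esub>" if "s \<in> ?T" for s using T(1)[OF that] zero_unit by auto
  interpret FA: fractions_over K A L \<theta>
    by (rule fractions_over.intro[OF algA A_ore L(1) domL \<theta>(1,2)]) (use T(3) T0 TA in blast)

  define P where "P = L\<lparr>carrier := V n\<rparr>"
  have Pj: "P\<lparr>carrier := V j\<rparr> = L\<lparr>carrier := V j\<rparr>" for j by (simp add: P_def)
  have P: "nc_algebra K P" unfolding P_def by (rule subalg_nc_algebra[OF L(1) subV]) simp
  interpret PA: nc_algebra K P by (rule P)
  have Vj: "\<forall>j\<in>{1..n}. skew_polynomial_ring K (L\<lparr>carrier := V j\<rparr>) (V (j - 1)) (y j) (\<tau>' j) (\<lambda>_. \<zero>\<^bsub>L\<^esub>)" using s1 by blast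
  have "V 0 \<subseteq> V j" if "j \<le> n" for j
    using that
  proof (induct j)
    case (Suc j)
    have "skew_polynomial_ring K (L\<lparr>carrier := V (Suc j)\<rparr>) (V j) (y (Suc j)) (\<tau>' (Suc j)) (\<lambda>_. \<zero>\<^bsub>L\<^esub>)"
      using bspec[OF Vj, of "Suc j"] Suc(2) by simp
    then have "V j \<subseteq> V (Suc j)" using subalgD(3) unfolding skew_polynomial_ring_def by fastforce
    then show ?case using Suc by auto
  qed simp
  then have P0: "subalg K P (V 0)" unfolding P_def using subalg_sub[OF L(1) subV[of n]] subV[of 0] by simp
  have Pit: "iterated_skew_polynomial_ring K P V n y \<tau>' (\<lambda>i s. \<zero>\<^bsub>L\<^esub>)"
    unfolding iterated_skew_polynomial_ring_def Pj using P P0 Vj by (simp add: P_def)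
  have U0: "P\<lparr>carrier := V 0\<rparr> = L\<lparr>carrier := U 0\<rparr>" by (simp add: P_def L(3))
  have "nc_algebra K (L\<lparr>carrier := U 0\<rparr>)" by (rule subalg_nc_algebra[OF L(1) subU]) simp
  note tr = ore_transfer[OF algS[of 0] this conjunct1[OF s2], folded U0, simplified]
  have Pn: "P\<lparr>carrier := V n\<rparr> = P" by (simp add: P_def)
  have P_ore: "nc_domain P" "left_ore P" "right_ore P"
    using iterated_skew_polynomial_ore[OF Pit tr(1)[OF R_domain[unfolded R]] tr(2)[OF R_ore(1)] tr(3)[OF R_ore(2)]]
    unfolding Pn by auto
  have inc: "v \<in> carrier L" if "v \<in> V n" for v using subalgD(3)[OF subV[of n]] that by auto
  \<comment> \<open>The stage supplies left fractions: p and p l lie in the polynomial ring. The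
    right Ore condition there gives (p l)u = p w, and cancelling p in the domain L turns this into l
    u = w.\<close>
  have P_right: "\<exists>s\<in>carrier P. s ~= \<zero>\<^bsub>P\<^esub> \<and> l \<otimes>\<^bsub>L\<^esub> s \<in> (\<lambda>v. v) ` carrier P" if l: "l \<in> carrier L" for l
  proof -
    obtain p where p: "p \<in> V n" "p ~= \<zero>\<^bsub>L\<^esub>" "p \<otimes>\<^bsub>L\<^esub> l \<in> V n" using s4 l by blast
    show ?thesis
    proof (cases "l = \<zero>\<^bsub>L\<^esub>")
      case True
      then show ?thesis using p(1,2) inc[OF p(1)] subalgD(4)[OF subV[of n]] by (intro bexI[of _ p]) (auto simp: P_def)
    next
      case False
      then have pl: "p \<otimes>\<^bsub>L\<^esub> l ~= \<zero>\<^bsub>L\<^esub>" using LD(2)[of p l] p inc l by auto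
      have "\<exists>u\<in>carrier P. \<exists>w\<in>carrier P. (p \<otimes>\<^bsub>L\<^esub> l) \<otimes>\<^bsub>P\<^esub> u = p \<otimes>\<^bsub>P\<^esub> w \<and> (p \<otimes>\<^bsub>L\<^esub> l) \<otimes>\<^bsub>P\<^esub> u ~= \<zero>\<^bsub>P\<^esub>"
        by (rule right_oreD[OF P_ore(3)]) (use p pl in \<open>simp_all add: P_def\<close>)
      then obtain u w where u: "u \<in> V n" "w \<in> V n" "(p \<otimes>\<^bsub>L\<^esub> l) \<otimes>\<^bsub>L\<^esub> u = p \<otimes>\<^bsub>L\<^esub> w" "(p \<otimes>\<^bsub>L\<^esub> l) \<otimes>\<^bsub>L\<^esub> u ~= \<zero>\<^bsub>L\<^esub>"
        by (auto simp: P_def)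
      note c = inc[OF p(1)] inc[OF u(1)] inc[OF u(2)]
      have "p \<otimes>\<^bsub>L\<^esub> (l \<otimes>\<^bsub>L\<^esub> u \<ominus>\<^bsub>L\<^esub> w) = \<zero>\<^bsub>L\<^esub>"
        using u(3) c l by (simp add: a_minus_def LA.A.r_distr LA.A.r_minus LA.A.r_neg flip: LA.A.m_assoc)
      then have "l \<otimes>\<^bsub>L\<^esub> u \<ominus>\<^bsub>L\<^esub> w = \<zero>\<^bsub>L\<^esub>" using LD(2)[of p "l \<otimes>\<^bsub>L\<^esub> u \<ominus>\<^bsub>L\<^esub> w"] p(2) c l by simp
      then have "l \<otimes>\<^bsub>L\<^esub> u = w" using c l by simp
      moreover have "u ~= \<zero>\<^bsub>L\<^esub>" using u(4) c l by auto
      ultimately show ?thesis using u by (intro bexI[of _ u]) (auto simp: P_def)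
    qed
  qed
  have P_inc: "(\<lambda>v. v) \<in> alg_hom K P L" by (rule alg_homI) (auto simp: P_def inc)
  interpret FP: fractions_over K P L "\<lambda>v. v"
    by (rule fractions_over.intro[OF P P_ore L(1) domL P_inc _ P_right]) simp

  obtain B :: "('k, ('a \<times> 'a) set) module" and \<phi> h where B: "right_localization K A ?T B \<phi>" "h \<in> alg_iso K B L"
    using right_localization_exists[OF algA L(1) \<theta>(1,2) TA T(1,3)] by blast
  obtain QA :: "('k, ('a \<times> 'a) set) module" and \<phi>A hA
    where QA: "division_ring_of_fractions K A QA \<phi>A" "hA \<in> alg_iso K QA FA.Q.Q" using FA.fraction_ring_exists by blast
  \<comment> \<open>Both interpretations of \<open>fractions_over\<close> share K and L, so
    \<open>FA.Q.Q\<close> is also the ring built for the polynomial ring, and the two rings of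
    fractions can be compared through it.\<close>
  obtain QP :: "('k, (((nat => int) => 'a) \<times> ((nat => int) => 'a)) set) module" and \<phi>P hP
    where QP: "division_ring_of_fractions K P QP \<phi>P" "hP \<in> alg_iso K QP FA.Q.Q" using FP.fraction_ring_exists by blast
  have QP_alg: "nc_algebra K QP"
    using QP(1) unfolding division_ring_of_fractions_def right_localization_def by blast
  have g: "(\<lambda>z. inv_into (carrier QP) hP (hA z)) \<in> alg_iso K QA QP"
    by (rule alg_iso_comp[OF QA(2) alg_iso_inv[OF QP_alg QP(2)]])
  \<comment> \<open>\<open>identity_degrees\<close> replaces either ring by the same division ring,
    so that the sets of degrees of monic identities coincide.\<close>
  have parity: "PI_degree_parity A P"
    unfolding PI_degree_parity_def PI_ring_def PI_degree_def FA.identity_degrees FP.identity_degrees by simp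
  have ore: "ore_set A ?T" by (rule unit_fractions_ore[OF algA L(1) \<theta>(1,2) Tsub T])
  have Lit: "iterated_skew_laurent_ring K L U n y \<tau>'"
    unfolding iterated_skew_laurent_ring_def using L subU[of 0] s1 by auto
  have loc: "\<exists>T t (B :: ('k, ('a \<times> 'a) set) module) \<phi> h. t ` {1..n} \<subseteq> carrier A \<and>
      T = mult_set_generated A (t ` {1..n}) \<and> ore_set A T \<and> right_localization K A T B \<phi> \<and> h \<in> alg_iso K B L"
    by (rule exI[of _ ?T], rule exI[of _ t], rule exI[of _ B], rule exI[of _ \<phi>], rule exI[of _ h])
      (intro conjI \<theta>(3) refl ore B)
  have poly: "\<exists>V P. P = L\<lparr>carrier := V n\<rparr> \<and> V 0 = U 0 \<and> iterated_skew_polynomial_ring K P V n y \<tau>' (\<lambda>i s. \<zero>\<^bsub>L\<^esub>) \<and>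
      PI_degree_parity A P \<and>
      (\<exists>(Q\<^sub>A :: ('k, ('a \<times> 'a) set) module) \<phi>\<^sub>A
        (Q\<^sub>P :: ('k, (((nat => int) => 'a) \<times> ((nat => int) => 'a)) set) module) \<phi>\<^sub>P g.
        division_ring_of_fractions K A Q\<^sub>A \<phi>\<^sub>A \<and> division_ring_of_fractions K P Q\<^sub>P \<phi>\<^sub>P \<and> g \<in> alg_iso K Q\<^sub>A Q\<^sub>P)"
    by (rule exI[of _ V], rule exI[of _ P], intro conjI P_def L(3) Pit parity, rule exI[of _ QA], rule exI[of _ \<phi>A],
        rule exI[of _ QP], rule exI[of _ \<phi>P],
        rule exI[of _ "\<lambda>z. inv_into (carrier QP) hP (hA z)"]) (intro conjI QA(1) QP(1) g)
  show ?thesis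
    by (rule exI[of _ L], rule exI[of _ U], rule exI[of _ \<iota>], rule exI[of _ y], rule exI[of _ \<tau>'])
      (unfold R, intro conjI Lit conjunct1[OF s2] conjunct1[OF conjunct2[OF s2]] conjunct2[OF conjunct2[OF s2]] loc poly)
qed

end
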